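(* Consider the contaminated AR($p$) model, the local alternative $H_{1n}(\rho)$ and the symmetrized Pearson statistic $\hat\chi_n^2$ described in the context. Assume that (i) a random variable with distribution function $H$ has zero mean and finite variance, (ii) $H$ is twice differentiable with bounded second derivative, and (iii) $H$ is symmetric about zero, i.e. $H(-x)=1-H(x)$. Let $0<\alpha<1$ and let $\chi_{m-2}(1-\alpha)$ be the $(1-\alpha)$-quantile of the (central) chi-square distribution with $m-2$ degrees of freedom. Let $W_n(\rho,\gamma,\Pi)=P(\hat\chi_n^2>\chi_{m-2}(1-\alpha))$ be the power, under $H_{1n}(\rho)$, of the test that rejects normality of the innovations when $\hat\chi_n^2>\chi_{m-2}(1-\alpha)$. Then for any finite $R,\Gamma\ge0$, as $n\to\infty$, $W_n(\rho,\gamma,\Pi)$ converges, uniformly in $0\le\rho\le R$, $0\le\gamma\le\Gamma$, to the asymptotic power $$W(\rho,\gamma,\Pi)=1-F_{m-2}\big(\chi_{m-2}(1-\alpha),\hat\lambda^2(\rho,\gamma,\Pi)\big),\qquad W(0,0,\Pi)=\alpha,$$ where $F_{m-2}(\cdot,\lambda^2)$ is the distribution function of the noncentral chi-square distribution with $m-2$ degrees of freedom and noncentrality parameter $\lambda^2$, and $$\hat\lambda^2(\rho,\gamma,\Pi)=\big|(E_m-\alpha_0\alpha_0^T)P_0^{-1/2}[\rho(p_H-p_0)+\gamma\,\delta(\Pi)]\big|^2.$$ Moreover, the test is asymptotically qualitatively robust in the sense that $$\sup_{\Pi,\;\rho\ge0}|W(\rho,\gamma,\Pi)-W(\rho,0,\Pi)|\le\gamma\sqrt{2/\pi}\;\big|(E_m-\alpha_0\alpha_0^T)P_0^{-1/2}\big|\;\sup_{\Pi}|\delta(\Pi)|\to0,\quad\gamma\to0,$$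 where the suprema over $\Pi$ are over all probability distributions on $\mathbb{R}$.
   Context: Model. $\{v_t\}_{t\in\mathbb{Z}}$ is the stationary solution of $v_t=\beta_1v_{t-1}+\dots+\beta_pv_{t-p}+\nu+\varepsilon_t$, $t\in\mathbb{Z}$, where $\{\varepsilon_t\}$ are i.i.d. with distribution function $G$, $E\varepsilon_1=0$, $0<E\varepsilon_1^2<\infty$; $\boldsymbol\beta=(\beta_1,\dots,\beta_p)^T\in\mathbb{R}^p$ is such that all roots of the characteristic equation $z^p=\beta_1z^{p-1}+\dots+\beta_p$ are less than one in modulus; $\nu\in\mathbb{R}$. The constant $\mu$ is defined by $\nu=(1-\beta_1-\dots-\beta_p)\mu$. The parameters $\boldsymbol\beta,\nu$ are unknown. Observations. One observes $y_t=v_t+z_t^{\gamma_n}\xi_t$, $t=1-p,\dots,n$, where $\{z_t^{\gamma_n}\}$ are i.i.d. Bernoulli variables (values $0,1$) with $P(z_t^{\gamma_n}=1)=\gamma_n=\min(1,\gamma n^{-1/2})$, $\gamma\ge0$, and $\{\xi_t\}$ are i.i.d. with an arbitrary distribution $\Pi$ on $\mathbb{R}$. The sequences $\{\varepsilon_t\}$, $\{z_t^{\gamma_n}\}$, $\{\xi_t\}$ are mutually independent. Hypothesis and local alternative. $\Phi$ is the standard normal distribution function. The hypothesis of normality is $G\in\{\Phi(x/\theta):\theta>0\}$. Here $\theta_0>0$ is fixed, $H$ is a distribution function, and $\rho\ge0$. $H_{1n}(\rho)$ is the assumption that for sample size $n$ the innovation distribution function is $G(x)=A_n(x):=(1-\rho_n)\Phi(x/\theta_0)+\rho_nH(x)$,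 $\rho_n=\min(1,\rho n^{-1/2})$. The quantities $\boldsymbol\beta,\nu,\theta_0,H,\Pi$ do not depend on $n$. Residuals. $\hat\mu_n$ and $\hat{\boldsymbol\beta}_n=(\hat\beta_{1n},\dots,\hat\beta_{pn})^T$ are any estimator sequences such that, under $H_{1n}(\rho)$, for all finite $\Gamma,R\ge0$, $n^{1/2}(\hat\mu_n-\mu)=O_P(1)$ and $n^{1/2}(\hat{\boldsymbol\beta}_n-\boldsymbol\beta)=O_P(1)$ uniformly in $\rho\le R$, $\gamma\le\Gamma$. Put $\hat u_t=y_t-\hat\mu_n$, $t=1-p,\dots,n$, and $\hat\varepsilon_t=\hat u_t-\hat\beta_{1n}\hat u_{t-1}-\dots-\hat\beta_{pn}\hat u_{t-p}$, $t=1,\dots,n$. ($X_n=O_P(1)$ uniformly in $\rho\le R$, $\gamma\le\Gamma$ means $\lim_{K\to\infty}\limsup_{n\to\infty}\sup_{0\le\rho\le R,0\le\gamma\le\Gamma}P(|X_n|>K)=0$.) Statistic. Fix $m>2$ and $0=x_0<x_1<\dots<x_m=\infty$. Let $B_j^+=(x_{j-1},x_j]$, $B_j^-=(-x_j,-x_{j-1}]$, and $p_j(\theta)=2[\Phi(x_j/\theta)-\Phi(x_{j-1}/\theta)]$, $j=1,\dots,m$, $\theta>0$. Let $\hat\nu_j$ be the number of residuals among $\hat\varepsilon_1,\dots,\hat\varepsilon_n$ lying in $B_j^+\cup B_j^-$. Let $\hat\theta_n$ be an $n^{1/2}$-consistent solution of the equation $\sum_{j=1}^m\frac{\hat\nu_j}{p_j(\theta)}p_j'(\theta)=0$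 (prime denotes $d/d\theta$), meaning that under $H_{1n}(\rho)$, uniformly in $\rho\le R$, $\gamma\le\Gamma$, it solves the equation with probability tending to one and $n^{1/2}(\hat\theta_n-\theta_0)=O_P(1)$. The symmetrized Pearson statistic is $$\hat\chi_n^2=\sum_{j=1}^m\frac{(\hat\nu_j-np_j(\hat\theta_n))^2}{np_j(\hat\theta_n)}.$$ Notation in the noncentrality parameter. $|\cdot|$ is the Euclidean norm of a vector or matrix; $E_m$ is the $m\times m$ identity matrix; $P_0=\mathrm{diag}\{p_1(\theta_0),\dots,p_m(\theta_0)\}$; $p_0=(p_1(\theta_0),\dots,p_m(\theta_0))^T$; $p_0'=(p_1'(\theta_0),\dots,p_m'(\theta_0))^T$; $b_0=P_0^{-1/2}p_0'$; $\alpha_0=b_0/|b_0|$ (a vector, not to be confused with the level $\alpha$); $p_H=(p_1^H,\dots,p_m^H)^T$ with $p_j^H=2(H(x_j)-H(x_{j-1}))$; $\delta(\Pi)=(\delta_1(\Pi),\dots,\delta_m(\Pi))^T$ with $\delta_j(\Pi)=2[\Delta_S(x_j,\Pi)-\Delta_S(x_{j-1},\Pi)]$, where $\Delta_S(x,\Pi)=\frac12[\Delta_0(x,\Pi)-\Delta_0(-x,\Pi)]$, $\Delta_0(x,\Pi)=\sum_{j=0}^p[E\,G_0(x+\beta_j\xi_1)-G_0(x)]$, $\beta_0=-1$, $G_0(x)=\Phi(x/\theta_0)$; values at $x_m=\infty$ are understood as limits (so $\Delta_S(\infty,\Pi)=0$). The noncentral chi-square distribution with $k$ degrees of freedom and noncentrality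 $\lambda^2$ is the law of $|Z|^2$ where $Z$ is Gaussian in $\mathbb{R}^k$ with identity covariance and mean of Euclidean norm $\lambda$. *)

theory Defs
  imports "HOL-Probability.Probability"
begin

subsection \<open>The contaminated autoregressive model\<close>

definition strictly_stationary :: "'a measure \<Rightarrow> (int \<Rightarrow> 'a \<Rightarrow> real) \<Rightarrow> bool" where
  "strictly_stationary M v \<longleftrightarrow>
     (\<forall>t. v t \<in> borel_measurable M) \<and>
     (\<forall>h. distr M (\<Pi>\<^sub>M t\<in>UNIV. borel) (\<lambda>\<omega> t. v (t + h) \<omega>)
        = distr M (\<Pi>\<^sub>M t\<in>UNIV. borel) (\<lambda>\<omega> t. v t \<omega>))"

text \<open>Here \<open>G\<close> is the distribution function of the innovations \<open>eps\<close>, \<open>g\<close> the contamination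
  probability and \<open>Q\<close> the law of the outliers \<open>xi\<close>. Coefficient families
  \<open>\<beta> :: nat \<Rightarrow> real\<close> are only read at \<open>1, \<dots>, p\<close>.\<close>

locale contaminated_ar = prob_space M
  for M :: "'a measure" and p :: nat and \<beta> :: "nat \<Rightarrow> real" and \<nu> :: real
    and G :: "real \<Rightarrow> real" and g :: real and Q :: "real measure"
    and eps z xi v :: "int \<Rightarrow> 'a \<Rightarrow> real" +
  assumes eps_indep: "indep_vars (\<lambda>_. borel) eps UNIV"
    and eps_cdf: "\<And>t. cdf (distr M borel (eps t)) = G"
    and eps_mean: "expectation (eps 1) = 0"
    and eps_square_integrable: "integrable M (\<lambda>\<omega>. (eps 1 \<omega>)\<^sup>2)"
    and eps_variance_pos: "0 < expectation (\<lambda>\<omega>. (eps 1 \<omega>)\<^sup>2)"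
    and z_indep: "indep_vars (\<lambda>_. borel) z UNIV"
    and z_range: "\<And>t. AE \<omega> in M. z t \<omega> \<in> {0, 1}"
    and z_prob: "\<And>t. prob {\<omega> \<in> space M. z t \<omega> = 1} = g"
    and xi_indep: "indep_vars (\<lambda>_. borel) xi UNIV"
    and xi_law: "\<And>t. distr M borel (xi t) = Q"
    and sequences_indep:
      "indep_vars (\<lambda>_. \<Pi>\<^sub>M t\<in>UNIV. borel) (\<lambda>k \<omega> t. ([eps, z, xi] ! k) t \<omega>) {..<3}"
    and v_stationary: "strictly_stationary M v"
    and v_equation:
      "AE \<omega> in M. \<forall>t. v t \<omega> = (\<Sum>i = 1..p. \<beta> i * v (t - int i) \<omega>) + \<nu> + eps t \<omega>"

definition observations ::
  "nat \<Rightarrow> nat \<Rightarrow> (int \<Rightarrow> 'a \<Rightarrow> real) \<Rightarrow> (int \<Rightarrow> 'a \<Rightarrow> real) \<Rightarrow> (int \<Rightarrow> 'a \<Rightarrow> real) \<Rightarrow> 'a \<Rightarrow> int \<Rightarrow> real" where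
  "observations p n v z xi \<omega> = (\<lambda>t\<in>{1 - int p..int n}. v t \<omega> + z t \<omega> * xi t \<omega>)"

definition Phi :: "real \<Rightarrow> real" where
  "Phi = cdf std_normal_distribution"

definition local_weight :: "nat \<Rightarrow> real \<Rightarrow> real" where
  "local_weight n r = min 1 (r / sqrt (real n))"

definition alt_cdf :: "real \<Rightarrow> real measure \<Rightarrow> nat \<Rightarrow> real \<Rightarrow> real \<Rightarrow> real" where
  "alt_cdf \<theta>\<^sub>0 H n \<rho> x =
     (1 - local_weight n \<rho>) * Phi (x / \<theta>\<^sub>0) + local_weight n \<rho> * cdf H x"

text \<open>In a family of laws \<open>M n \<rho> \<gamma>\<close>, \<open>n\<close> is the sample size and \<open>\<rho>\<close>, \<open>\<gamma>\<close> are the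
  parameters of the local alternative and of the contamination.\<close>

definition uniformly_bounded_in_prob ::
  "(nat \<Rightarrow> real \<Rightarrow> real \<Rightarrow> 'a measure) \<Rightarrow> (nat \<Rightarrow> real \<Rightarrow> real \<Rightarrow> 'a \<Rightarrow> real) \<Rightarrow> bool" where
  "uniformly_bounded_in_prob M X \<longleftrightarrow>
     (\<forall>R\<ge>0. \<forall>\<Gamma>\<ge>0.
        ((\<lambda>K. limsup (\<lambda>n. SUP (\<rho>, \<gamma>) \<in> {0..R} \<times> {0..\<Gamma>}.
            ereal (measure (M n \<rho> \<gamma>) {\<omega> \<in> space (M n \<rho> \<gamma>). \<bar>X n \<rho> \<gamma> \<omega>\<bar> > K})))
         \<longlongrightarrow> 0) at_top)"

definition uniformly_prob_to_one ::
  "(nat \<Rightarrow> real \<Rightarrow> real \<Rightarrow> 'a measure) \<Rightarrow> (nat \<Rightarrow> real \<Rightarrow> real \<Rightarrow> 'a \<Rightarrow> bool) \<Rightarrow> bool" where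
  "uniformly_prob_to_one M E \<longleftrightarrow>
     (\<forall>R\<ge>0. \<forall>\<Gamma>\<ge>0.
        uniform_limit ({0..R} \<times> {0..\<Gamma>})
          (\<lambda>n (\<rho>, \<gamma>). measure (M n \<rho> \<gamma>) {\<omega> \<in> space (M n \<rho> \<gamma>). E n \<rho> \<gamma> \<omega>})
          (\<lambda>_. 1) sequentially)"

subsection \<open>The symmetrized Pearson statistic\<close>

text \<open>A partition is given by \<open>x :: nat \<Rightarrow> ereal\<close> with \<open>x 0 = 0\<close> and \<open>x m = \<infinity>\<close>; a function
  value at the point \<open>\<infinity>\<close> is the limit at \<open>\<infinity>\<close>.\<close>

definition value_at :: "(real \<Rightarrow> real) \<Rightarrow> ereal \<Rightarrow> real" where
  "value_at F x = (if x = \<infinity> then Lim at_top F else F (real_of_ereal x))"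

definition cell_increment :: "(real \<Rightarrow> real) \<Rightarrow> (nat \<Rightarrow> ereal) \<Rightarrow> nat \<Rightarrow> real" where
  "cell_increment F x j = 2 * (value_at F (x j) - value_at F (x (j - 1)))"

definition cell_prob :: "(nat \<Rightarrow> ereal) \<Rightarrow> nat \<Rightarrow> real \<Rightarrow> real" where
  "cell_prob x j \<theta> = cell_increment (\<lambda>u. Phi (u / \<theta>)) x j"

definition sym_cell :: "(nat \<Rightarrow> ereal) \<Rightarrow> nat \<Rightarrow> real set" where
  "sym_cell x j = {u. x (j - 1) < ereal u \<and> ereal u \<le> x j}
                \<union> {u. - x j < ereal u \<and> ereal u \<le> - x (j - 1)}"

definition residual ::
  "nat \<Rightarrow> real \<Rightarrow> (nat \<Rightarrow> real) \<Rightarrow> (int \<Rightarrow> real) \<Rightarrow> int \<Rightarrow> real" where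
  "residual p mh bh y t = (y t - mh) - (\<Sum>i = 1..p. bh i * (y (t - int i) - mh))"

definition cell_count ::
  "(nat \<Rightarrow> ereal) \<Rightarrow> nat \<Rightarrow> nat \<Rightarrow> real \<Rightarrow> (nat \<Rightarrow> real) \<Rightarrow> (int \<Rightarrow> real) \<Rightarrow> nat \<Rightarrow> nat" where
  "cell_count x p n mh bh y j = card {t \<in> {1..int n}. residual p mh bh y t \<in> sym_cell x j}"

definition solves_scale_equation ::
  "(nat \<Rightarrow> ereal) \<Rightarrow> nat \<Rightarrow> (nat \<Rightarrow> nat) \<Rightarrow> real \<Rightarrow> bool" where
  "solves_scale_equation x m c \<theta> \<longleftrightarrow>
     0 < \<theta> \<and> (\<Sum>j = 1..m. real (c j) / cell_prob x j \<theta> * deriv (cell_prob x j) \<theta>) = 0"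

definition pearson_statistic ::
  "(nat \<Rightarrow> ereal) \<Rightarrow> nat \<Rightarrow> nat \<Rightarrow> (nat \<Rightarrow> nat) \<Rightarrow> real \<Rightarrow> real" where
  "pearson_statistic x m n c \<theta> =
     (\<Sum>j = 1..m. (real (c j) - real n * cell_prob x j \<theta>)\<^sup>2 / (real n * cell_prob x j \<theta>))"

subsection \<open>The asymptotic power\<close>

text \<open>The law of \<open>|Z|\<^sup>2\<close> for \<open>Z\<close> Gaussian in \<open>\<real>\<^sup>k\<close>, \<open>k > 0\<close>, with identity covariance
  depends on the mean only through its norm; the mean is taken to be
  \<open>(sqrt l2, 0, \<dots>, 0)\<close>.\<close>

definition noncentral_chi_square :: "nat \<Rightarrow> real \<Rightarrow> real measure" where
  "noncentral_chi_square k l2 =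
     distr (\<Pi>\<^sub>M i\<in>{..<k}. density lborel (normal_density (if i = 0 then sqrt l2 else 0) 1))
       borel (\<lambda>Z. \<Sum>i<k. (Z i)\<^sup>2)"

definition chi_square_quantile :: "nat \<Rightarrow> real \<Rightarrow> real" where
  "chi_square_quantile k q = Inf {c. q \<le> cdf (noncentral_chi_square k 0) c}"

definition Delta_0 :: "nat \<Rightarrow> (nat \<Rightarrow> real) \<Rightarrow> real \<Rightarrow> real measure \<Rightarrow> real \<Rightarrow> real" where
  "Delta_0 p \<beta> \<theta>\<^sub>0 Q x =
     (\<Sum>j = 0..p. ((\<integral>s. Phi ((x + (if j = 0 then -1 else \<beta> j) * s) / \<theta>\<^sub>0) \<partial>Q) - Phi (x / \<theta>\<^sub>0)))"

definition Delta_S :: "nat \<Rightarrow> (nat \<Rightarrow> real) \<Rightarrow> real \<Rightarrow> real measure \<Rightarrow> real \<Rightarrow> real" where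
  "Delta_S p \<beta> \<theta>\<^sub>0 Q x = (Delta_0 p \<beta> \<theta>\<^sub>0 Q x - Delta_0 p \<beta> \<theta>\<^sub>0 Q (- x)) / 2"

definition outlier_shift ::
  "nat \<Rightarrow> (nat \<Rightarrow> real) \<Rightarrow> real \<Rightarrow> (nat \<Rightarrow> ereal) \<Rightarrow> real measure \<Rightarrow> nat \<Rightarrow> real" where
  "outlier_shift p \<beta> \<theta>\<^sub>0 x Q = cell_increment (Delta_S p \<beta> \<theta>\<^sub>0 Q) x"

definition score_direction :: "(nat \<Rightarrow> ereal) \<Rightarrow> nat \<Rightarrow> real \<Rightarrow> nat \<Rightarrow> real" where
  "score_direction x m \<theta>\<^sub>0 =
     (let b = (\<lambda>j. deriv (cell_prob x j) \<theta>\<^sub>0 / sqrt (cell_prob x j \<theta>\<^sub>0))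
      in (\<lambda>j. b j / L2_set b {1..m}))"

text \<open>Entry \<open>(i, j)\<close> of \<open>(E\<^sub>m - \<alpha>\<^sub>0 \<alpha>\<^sub>0\<^sup>T) P\<^sub>0\<^sup>-\<^sup>1\<^sup>/\<^sup>2\<close>, for \<open>i, j \<in> {1..m}\<close>.\<close>

definition projection_matrix :: "(nat \<Rightarrow> ereal) \<Rightarrow> nat \<Rightarrow> real \<Rightarrow> nat \<Rightarrow> nat \<Rightarrow> real" where
  "projection_matrix x m \<theta>\<^sub>0 i j =
     ((if i = j then 1 else 0) - score_direction x m \<theta>\<^sub>0 i * score_direction x m \<theta>\<^sub>0 j)
       / sqrt (cell_prob x j \<theta>\<^sub>0)"

definition noncentrality ::
  "nat \<Rightarrow> (nat \<Rightarrow> real) \<Rightarrow> real \<Rightarrow> (nat \<Rightarrow> ereal) \<Rightarrow> nat \<Rightarrow> real measure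
    \<Rightarrow> real \<Rightarrow> real \<Rightarrow> real measure \<Rightarrow> real" where
  "noncentrality p \<beta> \<theta>\<^sub>0 x m H \<rho> \<gamma> Q =
     (L2_set (\<lambda>i. \<Sum>j = 1..m. projection_matrix x m \<theta>\<^sub>0 i j *
        (\<rho> * (cell_increment (cdf H) x j - cell_prob x j \<theta>\<^sub>0)
         + \<gamma> * outlier_shift p \<beta> \<theta>\<^sub>0 x Q j)) {1..m})\<^sup>2"

definition asymptotic_power ::
  "nat \<Rightarrow> (nat \<Rightarrow> real) \<Rightarrow> real \<Rightarrow> (nat \<Rightarrow> ereal) \<Rightarrow> nat \<Rightarrow> real measure \<Rightarrow> real
    \<Rightarrow> real \<Rightarrow> real \<Rightarrow> real measure \<Rightarrow> real" where
  "asymptotic_power p \<beta> \<theta>\<^sub>0 x m H \<alpha> \<rho> \<gamma> Q =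
     1 - cdf (noncentral_chi_square (m - 2) (noncentrality p \<beta> \<theta>\<^sub>0 x m H \<rho> \<gamma> Q))
           (chi_square_quantile (m - 2) (1 - \<alpha>))"

text \<open>The Euclidean (Frobenius) norm of the matrix is used. The supremum is taken in the
  extended reals, so it is meaningful without a prior boundedness proof.\<close>

definition robustness_bound ::
  "nat \<Rightarrow> (nat \<Rightarrow> real) \<Rightarrow> real \<Rightarrow> (nat \<Rightarrow> ereal) \<Rightarrow> nat \<Rightarrow> real \<Rightarrow> ereal" where
  "robustness_bound p \<beta> \<theta>\<^sub>0 x m \<gamma> =
     ereal (\<gamma> * sqrt (2 / pi)
       * L2_set (\<lambda>(i, j). projection_matrix x m \<theta>\<^sub>0 i j) ({1..m} \<times> {1..m}))
     * (SUP Q \<in> {Q. real_distribution Q}. ereal (L2_set (outlier_shift p \<beta> \<theta>\<^sub>0 x Q) {1..m}))"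

end

theory Submission
  imports Defs "HOL-Complex_Analysis.Complex_Analysis"
begin

text \<open>The residual differs from the innovation by a perturbation of order \<open>n\<^sup>-\<^sup>1\<^sup>/\<^sup>2\<close>, linear in the
  normalized estimation errors, plus the rare outliers. Conditionally on the past the jump
  indicators are Bernoulli, so the residual empirical process is the innovation process plus
  its compensator up to \<open>o\<^sub>P(1)\<close>; monotonicity in the perturbation makes this uniform over bounded
  estimation errors. The compensator consists of a term even in the level, which cancels in the
  symmetrized cells, and of the outlier shift. Estimating the scale projects the multinomial vector
  of cell counts onto the complement of the score direction, which leaves a Gaussian vector of
  dimension \<open>m - 2\<close> in the limit. Uniformity in the parameters follows from convergence along all
  convergent sequences of parameters, and robustness from the fact that the distribution function
  of \<open>|Z|\<^sup>2\<close> at a fixed point is Lipschitz with constant \<open>sqrt (2 / pi)\<close> in the norm of the mean.\<close>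

subsection \<open>The normal distribution function\<close>

text \<open>The outlier law is arbitrary, so no moment of \<open>xi\<close> is available and the
  compensator cannot be linearized in the outliers. Rarity replaces moments: a residual sees the p +
  1 times t - p, ..., t, and with contamination probability of order n^(-1/2) two outliers in that
  window have probability O(1/n), which is negligible after summing over t and dividing by sqrt n. A
  window with exactly one outlier contributes a bounded increment of the distribution function;
  summed over the lag of the outlier these increments give \<open>Delta_0\<close>. The estimation
  errors enter through averages of the regressors. The centred autoregression averages to
  O(n^(-1/2)), so of all the coefficients only the intercept, which carries the error of the
  estimated mean, survives; its factor is the normal density at the level, and this is why the
  surviving term is even. The constant sqrt (2 / pi) equals 2 / sqrt (2 pi): an interval has two end
  points, and at each of them the normal distribution function is Lipschitz with the maximum of its
  density as constant.\<close>

lemma Phi_diff_eq_integral: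
  assumes "a \<le> x"
  shows "Phi x - Phi a = integral {a..x} std_normal_density"
proof -
  interpret real_distribution std_normal_distribution by (rule real_dist_normal_dist)
  have cont: "continuous_on {a..x} std_normal_density"
    unfolding normal_density_def by (intro continuous_intros) auto
  have int: "set_integrable lborel {a..x} std_normal_density"
    using borel_integrable_atLeastAtMost'[OF cont] .
  have "Phi x - Phi a = measure std_normal_distribution {a<..x}"
    unfolding Phi_def using assms by (cases "a = x") (auto simp: cdf_diff_eq)
  also have "\<dots> = measure std_normal_distribution {a..x}"
  proof -
    have "emeasure std_normal_distribution {a..x} = emeasure std_normal_distribution {a<..x}"
    proof -
      have "AE y in lborel. y \<noteq> a" by (rule AE_lborel_singleton)
      thus ?thesis by (subst (1 2) emeasure_density) (auto intro!: nn_integral_cong_AE simp: indicator_def)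
    qed
    thus ?thesis by (simp add: measure_def)
  qed
  also have "\<dots> = (\<integral>y\<in>{a..x}. std_normal_density y \<partial>lborel)"
  proof -
    have "emeasure std_normal_distribution {a..x} = (\<integral>\<^sup>+ y. ennreal (indicator {a..x} y *\<^sub>R std_normal_density y) \<partial>lborel)"
      by (subst emeasure_density) (auto intro!: nn_integral_cong simp: indicator_def)
    also have "\<dots> = ennreal (\<integral>y. indicator {a..x} y *\<^sub>R std_normal_density y \<partial>lborel)"
      using int unfolding set_integrable_def by (intro nn_integral_eq_integral) auto
    finally show ?thesis unfolding measure_def set_lebesgue_integral_def
      by (simp add: integral_nonneg_AE)
  qed
  also have "\<dots> = integral {a..x} std_normal_density"
    by (rule set_borel_integral_eq_integral(2)[OF int])
  finally show ?thesis .
qed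

lemma Phi_has_derivative: "(Phi has_real_derivative std_normal_density x) (at x)"
proof -
  have cont: "continuous_on {x - 1..x + 1} std_normal_density"
    unfolding normal_density_def by (intro continuous_intros) auto
  have "((\<lambda>u. integral {x - 1..u} std_normal_density) has_real_derivative std_normal_density x) (at x within {x - 1..x + 1})"
    by (rule integral_has_real_derivative[OF cont]) auto
  hence "((\<lambda>u. integral {x - 1..u} std_normal_density + Phi (x - 1)) has_real_derivative std_normal_density x + 0) (at x within {x - 1..x + 1})"
    by (intro derivative_intros)
  hence "(Phi has_real_derivative std_normal_density x) (at x within {x - 1..x + 1})"
    unfolding add_0_right
    by (rule has_field_derivative_transform_within[where d = 1]) (auto simp: Phi_diff_eq_integral[symmetric])
  thus ?thesis by (simp add: at_within_Icc_at)
qed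

lemma Phi_has_derivative' [derivative_intros]:
  assumes "(f has_real_derivative D) (at x within S)"
  shows "((\<lambda>x. Phi (f x)) has_real_derivative std_normal_density (f x) * D) (at x within S)"
  using DERIV_chain2[OF Phi_has_derivative assms] .

lemma isCont_Phi: "isCont Phi x"
  using Phi_has_derivative DERIV_isCont by blast

lemma measurable_Phi [measurable]: "Phi \<in> borel_measurable borel"
  by (intro borel_measurable_continuous_onI continuous_at_imp_continuous_on ballI isCont_Phi)

lemma std_normal_density_le: "std_normal_density x \<le> 1 / sqrt (2 * pi)"
  unfolding normal_density_def by (simp add: divide_simps)

lemma Phi_lipschitz: "\<bar>Phi a - Phi b\<bar> \<le> \<bar>a - b\<bar> / sqrt (2 * pi)"
proof -
  have "norm (Phi a - Phi b) \<le> 1 / sqrt (2 * pi) * norm (a - b)"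
    by (rule field_differentiable_bound[of UNIV Phi std_normal_density])
       (auto intro: Phi_has_derivative std_normal_density_le simp: abs_of_nonneg)
  thus ?thesis by simp
qed

lemma Phi_bounds: "0 \<le> Phi x" "Phi x \<le> 1"
proof -
  interpret real_distribution std_normal_distribution by (rule real_dist_normal_dist)
  show "0 \<le> Phi x" "Phi x \<le> 1" unfolding Phi_def by (auto intro: cdf_nonneg cdf_bounded_prob)
qed

lemma Phi_strict_mono: "a < b \<Longrightarrow> Phi a < Phi b"
  by (rule DERIV_pos_imp_increasing[where f = Phi])
     (auto intro!: exI Phi_has_derivative normal_density_pos)

lemma Phi_at_top: "(Phi \<longlongrightarrow> 1) at_top"
proof -
  interpret real_distribution std_normal_distribution by (rule real_dist_normal_dist)
  show ?thesis unfolding Phi_def by (rule cdf_lim_at_top_prob)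
qed

lemma Phi_at_bot: "(Phi \<longlongrightarrow> 0) at_bot"
proof -
  interpret real_distribution std_normal_distribution by (rule real_dist_normal_dist)
  show ?thesis unfolding Phi_def by (rule cdf_lim_at_bot)
qed

lemma Phi_minus: "Phi (- x) = 1 - Phi x"
proof -
  have "((\<lambda>x. Phi (- x) + Phi x) has_real_derivative 0) (at x)" for x
    by (auto intro!: derivative_eq_intros simp: normal_density_def)
  hence c: "Phi (- x) + Phi x = Phi (- y) + Phi y" for x y
    using DERIV_isconst_all[of "\<lambda>x. Phi (- x) + Phi x"] by metis
  have "((\<lambda>y. Phi (- y) + Phi y) \<longlongrightarrow> 0 + 1) at_top"
    by (intro tendsto_intros Phi_at_top filterlim_compose[OF Phi_at_bot filterlim_uminus_at_bot_at_top])
  moreover have "((\<lambda>y. Phi (- y) + Phi y) \<longlongrightarrow> Phi (- x) + Phi x) at_top"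
    by (subst c[of _ x]) auto
  ultimately show ?thesis
    using tendsto_unique[of at_top "\<lambda>y. Phi (- y) + Phi y"] by force
qed

lemma Phi_0: "Phi 0 = 1 / 2"
  using Phi_minus[of 0] by simp

text \<open>The derivative is -u times the density, and |u| <= 1 + u^2/2 <= exp(u^2/2) bounds it by
  1. The constant is crude, but any constant gives a quadratic remainder for
  \<open>Phi\<close>.\<close>

lemma std_normal_density_lipschitz: "\<bar>std_normal_density a - std_normal_density b\<bar> \<le> \<bar>a - b\<bar>"
proof -
  have D: "(std_normal_density has_real_derivative - (u * std_normal_density u)) (at u)" for u
    unfolding normal_density_def by (auto intro!: derivative_eq_intros simp: field_simps power2_eq_square)
  have "\<bar>u * std_normal_density u\<bar> \<le> 1" for u :: real
  proof -
    have "\<bar>u\<bar> \<le> 1 + u\<^sup>2 / 2"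
      using zero_le_power2[of "\<bar>u\<bar> - 1"] by (simp add: power2_diff)
    also have "\<dots> \<le> exp (u\<^sup>2 / 2)" by (rule exp_ge_add_one_self)
    finally have 1: "\<bar>u\<bar> * exp (- (u\<^sup>2 / 2)) \<le> 1" by (simp add: exp_minus field_simps)
    have "1 \<le> sqrt (2 * pi)" using pi_gt3 by simp
    hence "1 / sqrt (2 * pi) \<le> 1" by simp
    hence "(1 / sqrt (2 * pi)) * (\<bar>u\<bar> * exp (- (u\<^sup>2 / 2))) \<le> 1 * 1"
      using 1 by (intro mult_mono) auto
    thus ?thesis by (simp add: normal_density_def abs_mult)
  qed
  hence "norm (std_normal_density a - std_normal_density b) \<le> 1 * norm (a - b)"
    by (intro field_differentiable_bound[of UNIV _ "\<lambda>u. - (u * std_normal_density u)"]) (use D in auto)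
  thus ?thesis by simp
qed

text \<open>Mean value inequality for the remainder as a function of the increment: on [-|u|, |u|]
  its derivative is a difference of two density values, hence at most |u|.\<close>

lemma Phi_second_order: "\<bar>Phi (x + u) - Phi x - std_normal_density x * u\<bar> \<le> u\<^sup>2"
proof -
  have "norm ((Phi (x + u) - std_normal_density x * u) - (Phi (x + 0) - std_normal_density x * 0)) \<le> \<bar>u\<bar> * norm (u - 0)"
  proof (rule field_differentiable_bound[of "{-\<bar>u\<bar>..\<bar>u\<bar>}" _ "\<lambda>s. std_normal_density (x + s) - std_normal_density x"])
    fix s assume "s \<in> {-\<bar>u\<bar>..\<bar>u\<bar>}"
    thus "norm (std_normal_density (x + s) - std_normal_density x) \<le> \<bar>u\<bar>"
      using std_normal_density_lipschitz[of "x + s" x] by auto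
  qed (auto intro!: derivative_eq_intros)
  thus ?thesis by (simp add: power2_eq_square abs_mult[symmetric])
qed

text \<open>Since \<open>F\<close> stays in [0, 1], every interval [s, s + 1] contains a point where
  |F'| <= 1; the bound on F'' carries this back to s. Hence F' is bounded.\<close>

lemma lipschitz_from_second_derivative:
  fixes F :: "real \<Rightarrow> real"
  assumes F: "\<And>x. 0 \<le> F x" "\<And>x. F x \<le> 1"
    and d: "F differentiable_on UNIV" "deriv F differentiable_on UNIV" "bounded (range (deriv (deriv F)))"
  obtains L where "0 \<le> L" "\<And>a b. \<bar>F a - F b\<bar> \<le> L * \<bar>a - b\<bar>"
proof -
  obtain B where B: "\<And>x. \<bar>deriv (deriv F) x\<bar> \<le> B" using d(3) unfolding bounded_iff by auto
  have D1: "(F has_real_derivative deriv F x) (at x)" for x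
    using d(1) by (simp add: DERIV_deriv_iff_real_differentiable differentiable_on_def)
  have D2: "(deriv F has_real_derivative deriv (deriv F) x) (at x)" for x
    using d(2) by (simp add: DERIV_deriv_iff_real_differentiable differentiable_on_def)
  have L: "\<bar>deriv F s\<bar> \<le> 1 + B" for s
  proof -
    obtain w where w: "s < w" "w < s + 1" "F (s + 1) - F s = (s + 1 - s) * deriv F w"
      using MVT2[of s "s + 1" F "deriv F"] D1 by auto
    have "norm (deriv F w - deriv F s) \<le> B * norm (w - s)"
      by (intro field_differentiable_bound[of UNIV _ "deriv (deriv F)"]) (use D2 B in auto)
    moreover have "B * norm (w - s) \<le> B * 1" using w B[of 0] by (intro mult_left_mono) auto
    moreover have "\<bar>deriv F w\<bar> \<le> 1" using w(3) F[of "s + 1"] F[of s] by auto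
    ultimately show ?thesis by auto
  qed
  show ?thesis
  proof (rule that[of "1 + B"])
    show "0 \<le> 1 + B" using B[of 0] by auto
    fix a b
    have "norm (F a - F b) \<le> (1 + B) * norm (a - b)"
      by (intro field_differentiable_bound[of UNIV _ "deriv F"]) (use D1 L in auto)
    thus "\<bar>F a - F b\<bar> \<le> (1 + B) * \<bar>a - b\<bar>" by simp
  qed
qed

subsection \<open>The causal impulse response\<close>

text \<open>The moving-average coefficients of the autoregression: the reciprocal of the polynomial
  1 - \<beta>_1 X - ... - \<beta>_p X^p as a formal power series. Formally they satisfy the
  recursion for any \<beta>; summability is what the root condition adds.\<close>

definition ar_coeff :: "nat \<Rightarrow> (nat \<Rightarrow> real) \<Rightarrow> nat \<Rightarrow> real" where
  "ar_coeff p \<beta> = fps_nth (inverse (Abs_fps (\<lambda>i. if i = 0 then 1 else if i \<le> p then - \<beta> i else 0)))"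

lemma ar_coeff_0: "ar_coeff p \<beta> 0 = 1"
  by (simp add: ar_coeff_def)

lemma ar_coeff_rec:
  assumes "0 < k"
  shows "ar_coeff p \<beta> k = (\<Sum>i = 1..p. if i \<le> k then \<beta> i * ar_coeff p \<beta> (k - i) else 0)"
proof -
  define B where "B = Abs_fps (\<lambda>i. if i = 0 then 1 else if i \<le> p then - \<beta> i else 0)"
  have "B * inverse B = 1" by (intro inverse_mult_eq_1') (simp add: B_def)
  hence "0 = fps_nth (B * inverse B) k" using assms by simp
  also have "\<dots> = (\<Sum>i = 0..k. fps_nth B i * ar_coeff p \<beta> (k - i))"
    unfolding fps_mult_nth by (simp add: ar_coeff_def B_def)
  also have "\<dots> = ar_coeff p \<beta> k + (\<Sum>i = 1..k. fps_nth B i * ar_coeff p \<beta> (k - i))"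
    using assms by (subst sum.atLeast_Suc_atMost) (auto simp: B_def)
  also have "(\<Sum>i = 1..k. fps_nth B i * ar_coeff p \<beta> (k - i)) = (\<Sum>i\<in>{1..k} \<inter> {1..p}. - \<beta> i * ar_coeff p \<beta> (k - i))"
    by (intro sum.mono_neutral_cong_right) (auto simp: B_def)
  also have "\<dots> = (\<Sum>i = 1..p. if i \<le> k then - \<beta> i * ar_coeff p \<beta> (k - i) else 0)"
    by (intro sum.mono_neutral_cong_left) auto
  also have "\<dots> = - (\<Sum>i = 1..p. if i \<le> k then \<beta> i * ar_coeff p \<beta> (k - i) else 0)"
    by (simp add: sum_negf[symmetric] if_distrib cong: if_cong)
  finally show ?thesis by simp
qed

text \<open>The zeros of the autoregressive polynomial are the reciprocals of the nonzero
  characteristic roots, so they all lie outside the closed unit disc. The reciprocal is therefore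
  analytic on a disc of radius larger than 1, and its Taylor series converges absolutely at
  1.\<close>

lemma ar_coeff_summable:
  assumes roots: "\<And>w :: complex. w ^ p = (\<Sum>i = 1..p. of_real (\<beta> i) * w ^ (p - i)) \<Longrightarrow> cmod w < 1"
  shows "summable (\<lambda>k. \<bar>ar_coeff p \<beta> k\<bar>)"
proof -
  define b :: "nat \<Rightarrow> real" where "b = (\<lambda>i. if i = 0 then 1 else if i \<le> p then - \<beta> i else 0)"
  define P :: "complex poly" where "P = (\<Sum>i\<le>p. monom (of_real (b i)) i)"
  define F where "F = fps_of_poly P"
  have cP: "coeff P i = of_real (b i)" for i
    unfolding P_def by (auto simp: coeff_sum b_def)
  have F_nth: "fps_nth F i = of_real (b i)" for i
    by (simp add: F_def cP)
  have P0: "P \<noteq> 0" using cP[of 0] by (auto simp: b_def)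
  have eval: "eval_fps F z = poly P z" for z by (simp add: F_def)
  have poly_P: "poly P z = (\<Sum>i\<le>p. of_real (b i) * z ^ i)" for z
    unfolding P_def by (simp add: poly_sum poly_monom)
  have no_root: "1 < cmod z" if z: "poly P z = 0" for z
  proof -
    have z0: "z \<noteq> 0" using z cP[of 0] by (auto simp: poly_0_coeff_0 b_def)
    have "0 = (\<Sum>i\<le>p. of_real (b i) * z ^ i)" using z poly_P by simp
    also have "\<dots> = of_real (b 0) + (\<Sum>i = 1..p. of_real (b i) * z ^ i)"
      by (simp add: atMost_atLeast0 sum.atLeast_Suc_atMost)
    also have "(\<Sum>i = 1..p. of_real (b i) * z ^ i) = - (\<Sum>i = 1..p. of_real (\<beta> i) * z ^ i)"
      by (simp add: sum_negf[symmetric] b_def)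
    finally have e: "(\<Sum>i = 1..p. of_real (\<beta> i) * z ^ i) = 1" by (simp add: b_def)
    \<comment> \<open>At a zero of \<open>P\<close> the sum in \<open>e\<close> equals 1;
      multiplying by (1/z)^p turns this into the characteristic equation for 1/z.\<close>
    have "(1 / z) ^ p = (1 / z) ^ p * (\<Sum>i = 1..p. of_real (\<beta> i) * z ^ i)" by (simp only: e mult_1_right)
    also have "\<dots> = (\<Sum>i = 1..p. of_real (\<beta> i) * (1 / z) ^ (p - i))"
      unfolding sum_distrib_left
    proof (rule sum.cong)
      fix i assume "i \<in> {1..p}"
      hence "(1 / z) ^ p = (1 / z) ^ (p - i) * (1 / z) ^ i" by (simp flip: power_add)
      thus "(1 / z) ^ p * (of_real (\<beta> i) * z ^ i) = of_real (\<beta> i) * (1 / z) ^ (p - i)"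
        using z0 by (simp add: power_divide)
    qed simp
    finally have "cmod (1 / z) < 1" by (rule roots)
    thus ?thesis using z0 by (simp add: norm_divide)
  qed
  have fin: "finite {z. poly P z = 0}" using poly_roots_finite[OF P0] .
  \<comment> \<open>There are finitely many zeros, so their moduli stay above 1 by a margin; the
    value 2 serves the case without zeros.\<close>
  obtain R where R: "1 < R" "\<And>z. poly P z = 0 \<Longrightarrow> R \<le> cmod z"
  proof (cases "{z. poly P z = 0} = {}")
    case True
    thus ?thesis by (intro that[of 2]) auto
  next
    case False
    show ?thesis
    proof (rule that)
      show "1 < Min (cmod ` {z. poly P z = 0})" using fin False no_root by (subst Min_gr_iff) auto
      show "Min (cmod ` {z. poly P z = 0}) \<le> cmod z" if "poly P z = 0" for z
        using fin that by (intro Min_le) auto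
    qed
  qed
  have "fps_conv_radius (inverse F) \<ge> min (ereal R) (fps_conv_radius F)"
    by (rule fps_conv_radius_inverse) (use R eval in force)
  also have "fps_conv_radius F = \<infinity>" by (simp add: F_def)
  finally have "ereal R \<le> fps_conv_radius (inverse F)" by simp
  hence "summable (\<lambda>n. norm (fps_nth (inverse F) n * 1 ^ n))"
    using R(1) unfolding fps_conv_radius_def
    by (intro abs_summable_in_conv_radius) (auto intro: less_le_trans[of _ "ereal R"] simp: one_ereal_def)
  \<comment> \<open>The radius of convergence was found for the complex series; both reciprocals
    obey the same recursion, which identifies their coefficients.\<close>
  moreover have "fps_nth (inverse F) n = of_real (ar_coeff p \<beta> n)" for n
  proof (induction n rule: less_induct)
    case (less n)
    show ?case
    proof (cases "n = 0")
      case True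
      thus ?thesis by (simp add: ar_coeff_0 F_nth b_def)
    next
      case False
      have "F * inverse F = 1" by (intro inverse_mult_eq_1') (simp add: F_nth b_def)
      hence "0 = fps_nth (F * inverse F) n" using False by simp
      also have "\<dots> = (\<Sum>i = 0..n. fps_nth F i * fps_nth (inverse F) (n - i))"
        by (rule fps_mult_nth)
      also have "\<dots> = fps_nth (inverse F) n + (\<Sum>i = 1..n. fps_nth F i * fps_nth (inverse F) (n - i))"
        using False by (subst sum.atLeast_Suc_atMost) (auto simp: F_nth b_def)
      also have "(\<Sum>i = 1..n. fps_nth F i * fps_nth (inverse F) (n - i))
          = (\<Sum>i = 1..n. of_real (b i * ar_coeff p \<beta> (n - i)))"
        using False by (intro sum.cong) (auto simp: F_nth less)
      finally have 1: "fps_nth (inverse F) n = - of_real (\<Sum>i = 1..n. b i * ar_coeff p \<beta> (n - i))"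
        by (simp add: eq_neg_iff_add_eq_0)
      define B where "B = Abs_fps b"
      have "B * inverse B = 1" by (intro inverse_mult_eq_1') (simp add: B_def b_def)
      hence "0 = fps_nth (B * inverse B) n" using False by simp
      also have "\<dots> = (\<Sum>i = 0..n. b i * ar_coeff p \<beta> (n - i))"
        unfolding fps_mult_nth by (simp add: ar_coeff_def B_def b_def)
      also have "\<dots> = ar_coeff p \<beta> n + (\<Sum>i = 1..n. b i * ar_coeff p \<beta> (n - i))"
        using False by (subst sum.atLeast_Suc_atMost) (auto simp: b_def)
      finally show ?thesis using 1 by (simp add: eq_neg_iff_add_eq_0[symmetric])
    qed
  qed
  ultimately show ?thesis by simp
qed

subsection \<open>Stochastic order along a sequence of probability spaces\<close>

text \<open>Exceptional sets are required to be measurable, the events themselves are not: this is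
  convergence in outer probability, so no measurability has to be checked when such statements
  are combined.\<close>

locale prob_seq =
  fixes M :: "nat \<Rightarrow> 'a measure"
  assumes prob_space_M: "\<And>n. 1 \<le> n \<Longrightarrow> prob_space (M n)"
begin

definition mostly :: "nat \<Rightarrow> real \<Rightarrow> ('a \<Rightarrow> bool) \<Rightarrow> bool" where
  "mostly n d P \<longleftrightarrow> (\<exists>A\<in>sets (M n). measure (M n) A < d \<and> (\<forall>\<omega>\<in>space (M n) - A. P \<omega>))"

definition whp :: "(nat \<Rightarrow> 'a \<Rightarrow> bool) \<Rightarrow> bool" where
  "whp P \<longleftrightarrow> (\<forall>d>0. \<forall>\<^sub>F n in sequentially. mostly n d (P n))"

definition oP :: "(nat \<Rightarrow> 'a \<Rightarrow> real) \<Rightarrow> bool" where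
  "oP X \<longleftrightarrow> (\<forall>e>0. whp (\<lambda>n \<omega>. \<bar>X n \<omega>\<bar> \<le> e))"

definition OP :: "(nat \<Rightarrow> 'a \<Rightarrow> real) \<Rightarrow> bool" where
  "OP X \<longleftrightarrow> (\<forall>d>0. \<exists>K. \<forall>\<^sub>F n in sequentially. mostly n d (\<lambda>\<omega>. \<bar>X n \<omega>\<bar> \<le> K))"

lemma mostly_mono:
  "mostly n d P \<Longrightarrow> d \<le> d' \<Longrightarrow> (\<And>\<omega>. \<omega> \<in> space (M n) \<Longrightarrow> P \<omega> \<Longrightarrow> Q \<omega>) \<Longrightarrow> mostly n d' Q"
  unfolding mostly_def by (meson DiffD1 order_less_le_trans)

lemma mostly_conj:
  assumes "1 \<le> n" "mostly n d P" "mostly n d' Q"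
  shows "mostly n (d + d') (\<lambda>\<omega>. P \<omega> \<and> Q \<omega>)"
proof -
  interpret prob_space "M n" using prob_space_M assms(1) .
  obtain A where A: "A \<in> sets (M n)" "measure (M n) A < d" "\<forall>\<omega>\<in>space (M n) - A. P \<omega>"
    using assms(2) unfolding mostly_def by auto
  obtain B where B: "B \<in> sets (M n)" "measure (M n) B < d'" "\<forall>\<omega>\<in>space (M n) - B. Q \<omega>"
    using assms(3) unfolding mostly_def by auto
  have "measure (M n) (A \<union> B) < d + d'"
    using measure_Un_le[OF A(1) B(1)] A(2) B(2) by simp
  thus ?thesis unfolding mostly_def using A B by (intro bexI[of _ "A \<union> B"]) auto
qed

lemma whp_mono:
  assumes "whp P" "\<forall>\<^sub>F n in sequentially. \<forall>\<omega>\<in>space (M n). P n \<omega> \<longrightarrow> Q n \<omega>"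
  shows "whp Q"
  unfolding whp_def
proof safe
  fix d :: real assume "0 < d"
  hence "\<forall>\<^sub>F n in sequentially. mostly n d (P n)" using assms(1) unfolding whp_def by auto
  with assms(2) show "\<forall>\<^sub>F n in sequentially. mostly n d (Q n)"
    by eventually_elim (erule mostly_mono; auto)
qed

lemma whp_conj:
  assumes "whp P" "whp Q"
  shows "whp (\<lambda>n \<omega>. P n \<omega> \<and> Q n \<omega>)"
  unfolding whp_def
proof safe
  fix d :: real assume "0 < d"
  hence "\<forall>\<^sub>F n in sequentially. mostly n (d / 2) (P n)" "\<forall>\<^sub>F n in sequentially. mostly n (d / 2) (Q n)"
    using assms unfolding whp_def by auto
  with eventually_ge_at_top[of 1] show "\<forall>\<^sub>F n in sequentially. mostly n d (\<lambda>\<omega>. P n \<omega> \<and> Q n \<omega>)"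
  proof eventually_elim
    case (elim n)
    thus ?case using mostly_conj[of n "d / 2" "P n" "d / 2" "Q n"] by simp
  qed
qed

lemma whp_all: "\<forall>\<^sub>F n in sequentially. \<forall>\<omega>\<in>space (M n). P n \<omega> \<Longrightarrow> whp P"
  unfolding whp_def mostly_def by (auto elim!: eventually_mono intro!: bexI[of _ "{}"])

lemma whp_finite_ball:
  assumes "finite I" "\<And>i. i \<in> I \<Longrightarrow> whp (P i)"
  shows "whp (\<lambda>n \<omega>. \<forall>i\<in>I. P i n \<omega>)"
  using assms
proof (induction I rule: finite_induct)
  case empty
  thus ?case by (intro whp_all) auto
next
  case (insert i I)
  have "whp (\<lambda>n \<omega>. P i n \<omega> \<and> (\<forall>i\<in>I. P i n \<omega>))" using insert by (intro whp_conj) auto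
  thus ?case by simp
qed

lemma whp_AE:
  assumes "\<forall>\<^sub>F n in sequentially. AE \<omega> in M n. P n \<omega>"
  shows "whp P"
  unfolding whp_def
proof safe
  fix d :: real assume d: "0 < d"
  from assms show "\<forall>\<^sub>F n in sequentially. mostly n d (P n)"
  proof eventually_elim
    case (elim n)
    then obtain N where "N \<in> null_sets (M n)" "{\<omega> \<in> space (M n). \<not> P n \<omega>} \<subseteq> N"
      by (auto elim!: AE_E simp: null_setsI)
    thus ?case unfolding mostly_def using d
      by (intro bexI[of _ N]) (auto simp: null_sets_def measure_def)
  qed
qed

lemma oPD: "oP X \<Longrightarrow> 0 < e \<Longrightarrow> whp (\<lambda>n \<omega>. \<bar>X n \<omega>\<bar> \<le> e)"
  unfolding oP_def by auto

lemma oP_mono: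
  assumes "oP X" "whp (\<lambda>n \<omega>. \<bar>Y n \<omega>\<bar> \<le> \<bar>X n \<omega>\<bar>)"
  shows "oP Y"
  unfolding oP_def
proof safe
  fix e :: real assume "0 < e"
  hence "whp (\<lambda>n \<omega>. \<bar>X n \<omega>\<bar> \<le> e)" using assms(1) unfolding oP_def by auto
  from whp_conj[OF this assms(2)] show "whp (\<lambda>n \<omega>. \<bar>Y n \<omega>\<bar> \<le> e)"
    by (rule whp_mono) auto
qed

lemma oP_add:
  assumes "oP X" "oP Y"
  shows "oP (\<lambda>n \<omega>. X n \<omega> + Y n \<omega>)"
  unfolding oP_def
proof safe
  fix e :: real assume "0 < e"
  hence "whp (\<lambda>n \<omega>. \<bar>X n \<omega>\<bar> \<le> e / 2)" "whp (\<lambda>n \<omega>. \<bar>Y n \<omega>\<bar> \<le> e / 2)"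
    using oPD[OF assms(1), of "e / 2"] oPD[OF assms(2), of "e / 2"] by simp_all
  from whp_conj[OF this] show "whp (\<lambda>n \<omega>. \<bar>X n \<omega> + Y n \<omega>\<bar> \<le> e)"
    by (rule whp_mono) (auto intro!: always_eventually)
qed

lemma oP_const: "a \<longlonglongrightarrow> 0 \<Longrightarrow> oP (\<lambda>n _. a n)"
  unfolding oP_def
proof safe
  fix e :: real assume "a \<longlonglongrightarrow> 0" "0 < e"
  hence "\<forall>\<^sub>F n in sequentially. \<bar>a n\<bar> < e" by (auto simp: tendsto_iff dist_real_def)
  thus "whp (\<lambda>n \<omega>. \<bar>a n\<bar> \<le> e)" by (intro whp_all) (auto elim!: eventually_mono)
qed

lemma oP_zero: "oP (\<lambda>n _. 0)"
  by (rule oP_const) auto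

lemma oP_sum: "(\<And>i. i \<in> I \<Longrightarrow> oP (X i)) \<Longrightarrow> oP (\<lambda>n \<omega>. \<Sum>i\<in>I. X i n \<omega>)"
  by (induction I rule: infinite_finite_induct) (auto intro: oP_zero oP_add)

lemma oP_OP_mult:
  assumes "oP X" "OP Y"
  shows "oP (\<lambda>n \<omega>. X n \<omega> * Y n \<omega>)"
  unfolding oP_def whp_def
proof safe
  fix e d :: real assume e: "0 < e" and d: "0 < d"
  obtain K where K: "\<forall>\<^sub>F n in sequentially. mostly n (d / 2) (\<lambda>\<omega>. \<bar>Y n \<omega>\<bar> \<le> K)"
    using assms(2) d unfolding OP_def by (meson half_gt_zero)
  have "whp (\<lambda>n \<omega>. \<bar>X n \<omega>\<bar> \<le> e / (\<bar>K\<bar> + 1))"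
    using assms(1) e unfolding oP_def by (auto intro: divide_pos_pos)
  hence "\<forall>\<^sub>F n in sequentially. mostly n (d / 2) (\<lambda>\<omega>. \<bar>X n \<omega>\<bar> \<le> e / (\<bar>K\<bar> + 1))"
    using d unfolding whp_def by auto
  with K eventually_ge_at_top[of 1]
  show "\<forall>\<^sub>F n in sequentially. mostly n d (\<lambda>\<omega>. \<bar>X n \<omega> * Y n \<omega>\<bar> \<le> e)"
  proof eventually_elim
    case (elim n)
    show ?case
    proof (rule mostly_mono[OF mostly_conj[OF elim(2,1,3)]])
      fix \<omega> assume *: "\<bar>Y n \<omega>\<bar> \<le> K \<and> \<bar>X n \<omega>\<bar> \<le> e / (\<bar>K\<bar> + 1)"
      hence "\<bar>X n \<omega>\<bar> * \<bar>Y n \<omega>\<bar> \<le> e / (\<bar>K\<bar> + 1) * (\<bar>K\<bar> + 1)"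
        using e by (intro mult_mono) auto
      thus "\<bar>X n \<omega> * Y n \<omega>\<bar> \<le> e" by (simp add: abs_mult)
    qed auto
  qed
qed

lemma OP_bounded:
  assumes "\<forall>\<^sub>F n in sequentially. \<bar>a n\<bar> \<le> K"
  shows "OP (\<lambda>n _. a n)"
  unfolding OP_def mostly_def
  by (intro allI impI exI[of _ K] eventually_mono[OF assms] bexI[of _ "{}"]) auto

lemma OP_const: "OP (\<lambda>n _. c)"
  by (rule OP_bounded[of _ "\<bar>c\<bar>"]) auto

lemma OP_convergent: "a \<longlonglongrightarrow> c \<Longrightarrow> OP (\<lambda>n _. a n)"
proof -
  assume "a \<longlonglongrightarrow> c"
  then obtain K where "\<And>n. norm (a n) \<le> K" using convergent_imp_Bseq[THEN BseqE, of a] by (auto simp: convergent_def)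
  thus ?thesis by (intro OP_bounded[of _ K]) auto
qed

lemma oP_cmult: "oP X \<Longrightarrow> oP (\<lambda>n \<omega>. c * X n \<omega>)"
  using oP_OP_mult[OF _ OP_const, of X c] by (simp add: mult.commute)

lemma oP_diff: "oP X \<Longrightarrow> oP Y \<Longrightarrow> oP (\<lambda>n \<omega>. X n \<omega> - Y n \<omega>)"
  using oP_add[of X "\<lambda>n \<omega>. (-1) * Y n \<omega>"] oP_cmult[of Y "-1"] by simp

lemma OP_add:
  assumes "OP X" "OP Y"
  shows "OP (\<lambda>n \<omega>. X n \<omega> + Y n \<omega>)"
  unfolding OP_def
proof safe
  fix d :: real assume d: "0 < d"
  obtain K L where *: "\<forall>\<^sub>F n in sequentially. mostly n (d / 2) (\<lambda>\<omega>. \<bar>X n \<omega>\<bar> \<le> K)"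
    "\<forall>\<^sub>F n in sequentially. mostly n (d / 2) (\<lambda>\<omega>. \<bar>Y n \<omega>\<bar> \<le> L)"
    using assms d unfolding OP_def by (meson half_gt_zero)
  show "\<exists>K. \<forall>\<^sub>F n in sequentially. mostly n d (\<lambda>\<omega>. \<bar>X n \<omega> + Y n \<omega>\<bar> \<le> K)"
    using eventually_ge_at_top[of 1] *
    by (intro exI[of _ "K + L"], eventually_elim) (erule (2) mostly_mono[OF mostly_conj], auto)
qed

lemma OP_mult:
  assumes "OP X" "OP Y"
  shows "OP (\<lambda>n \<omega>. X n \<omega> * Y n \<omega>)"
  unfolding OP_def
proof safe
  fix d :: real assume d: "0 < d"
  obtain K L where *: "\<forall>\<^sub>F n in sequentially. mostly n (d / 2) (\<lambda>\<omega>. \<bar>X n \<omega>\<bar> \<le> K)"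
    "\<forall>\<^sub>F n in sequentially. mostly n (d / 2) (\<lambda>\<omega>. \<bar>Y n \<omega>\<bar> \<le> L)"
    using assms d unfolding OP_def by (meson half_gt_zero)
  have "\<forall>\<^sub>F n in sequentially. mostly n d (\<lambda>\<omega>. \<bar>X n \<omega> * Y n \<omega>\<bar> \<le> K * L)"
    using eventually_ge_at_top[of 1] *
  proof eventually_elim
    case (elim n)
    show ?case
      by (rule mostly_mono[OF mostly_conj[OF elim]]) (auto simp: abs_mult intro!: mult_mono)
  qed
  thus "\<exists>K. \<forall>\<^sub>F n in sequentially. mostly n d (\<lambda>\<omega>. \<bar>X n \<omega> * Y n \<omega>\<bar> \<le> K)" by blast
qed

lemma OP_sum: "(\<And>i. i \<in> I \<Longrightarrow> OP (X i)) \<Longrightarrow> OP (\<lambda>n \<omega>. \<Sum>i\<in>I. X i n \<omega>)"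
  by (induction I rule: infinite_finite_induct) (auto intro: OP_const OP_add)

lemma oP_imp_OP: "oP X \<Longrightarrow> OP X"
  unfolding oP_def whp_def OP_def by (intro allI impI exI[of _ 1]) auto

lemma OP_mono:
  assumes "OP X" "whp (\<lambda>n \<omega>. \<bar>Y n \<omega>\<bar> \<le> \<bar>X n \<omega>\<bar>)"
  shows "OP Y"
  unfolding OP_def
proof safe
  fix d :: real assume d: "0 < d"
  obtain K where *: "\<forall>\<^sub>F n in sequentially. mostly n (d / 2) (\<lambda>\<omega>. \<bar>X n \<omega>\<bar> \<le> K)"
    using assms d unfolding OP_def by (meson half_gt_zero)
  have "\<forall>\<^sub>F n in sequentially. mostly n (d / 2) (\<lambda>\<omega>. \<bar>Y n \<omega>\<bar> \<le> \<bar>X n \<omega>\<bar>)"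
    using assms(2) d unfolding whp_def by auto
  with eventually_ge_at_top[of 1] *
  show "\<exists>K. \<forall>\<^sub>F n in sequentially. mostly n d (\<lambda>\<omega>. \<bar>Y n \<omega>\<bar> \<le> K)"
    by (intro exI[of _ K], eventually_elim) (erule (2) mostly_mono[OF mostly_conj], auto)
qed

lemma mostly_Markov:
  assumes n: "1 \<le> n" and X: "integrable (M n) X" and E: "(\<integral>\<omega>. \<bar>X \<omega>\<bar> \<partial>M n) < d * e" and e: "0 < e"
  shows "mostly n d (\<lambda>\<omega>. \<bar>X \<omega>\<bar> \<le> e)"
proof -
  interpret prob_space "M n" using prob_space_M n .
  have "measure (M n) {\<omega>\<in>space (M n). \<bar>X \<omega>\<bar> \<ge> e} \<le> (\<integral>\<omega>. \<bar>X \<omega>\<bar> \<partial>M n) / e"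
    using X e by (intro integral_Markov_inequality_measure[where A = "{}"]) auto
  also have "\<dots> < d" using E e by (simp add: field_simps)
  finally show ?thesis unfolding mostly_def
    using X by (intro bexI[of _ "{\<omega>\<in>space (M n). \<bar>X \<omega>\<bar> \<ge> e}"]) auto
qed

lemma oP_expectation:
  assumes "\<forall>\<^sub>F n in sequentially. integrable (M n) (X n) \<and> (\<integral>\<omega>. \<bar>X n \<omega>\<bar> \<partial>M n) \<le> b n" "b \<longlonglongrightarrow> 0"
  shows "oP X"
  unfolding oP_def whp_def
proof safe
  fix e d :: real assume e: "0 < e" and d: "0 < d"
  have "\<forall>\<^sub>F n in sequentially. b n < d * e"
    using assms(2) e d by (auto simp: order_tendsto_iff)
  with assms(1) eventually_ge_at_top[of 1]
  show "\<forall>\<^sub>F n in sequentially. mostly n d (\<lambda>\<omega>. \<bar>X n \<omega>\<bar> \<le> e)"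
    by eventually_elim (rule mostly_Markov, use e in auto)
qed

lemma OP_expectation:
  assumes "\<forall>\<^sub>F n in sequentially. integrable (M n) (X n) \<and> (\<integral>\<omega>. \<bar>X n \<omega>\<bar> \<partial>M n) \<le> C"
  shows "OP X"
  unfolding OP_def
proof safe
  fix d :: real assume d: "0 < d"
  have "C \<le> \<bar>C\<bar>" "0 < \<bar>C\<bar> + 1" by auto
  show "\<exists>K. \<forall>\<^sub>F n in sequentially. mostly n d (\<lambda>\<omega>. \<bar>X n \<omega>\<bar> \<le> K)"
    using assms eventually_ge_at_top[of 1]
    by (intro exI[of _ "(\<bar>C\<bar> + 1) / d"], eventually_elim) (rule mostly_Markov, use d in auto)
qed

lemma oP_square:
  assumes "oP (\<lambda>n \<omega>. (X n \<omega>)\<^sup>2)"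
  shows "oP X"
  unfolding oP_def
proof safe
  fix e :: real assume e: "0 < e"
  hence "whp (\<lambda>n \<omega>. \<bar>(X n \<omega>)\<^sup>2\<bar> \<le> e\<^sup>2)" using assms unfolding oP_def by auto
  thus "whp (\<lambda>n \<omega>. \<bar>X n \<omega>\<bar> \<le> e)"
    by (rule whp_mono) (use e in \<open>auto intro!: always_eventually simp: abs_le_square_iff[symmetric]\<close>)
qed

lemma OP_square:
  assumes "OP (\<lambda>n \<omega>. (X n \<omega>)\<^sup>2)"
  shows "OP X"
proof (rule OP_mono[OF OP_add[OF OP_const[of 1] assms]], rule whp_all, intro always_eventually allI ballI)
  fix n \<omega>
  have "0 \<le> (\<bar>X n \<omega>\<bar> - 1)\<^sup>2" by simp
  also have "\<dots> = (X n \<omega>)\<^sup>2 - 2 * \<bar>X n \<omega>\<bar> + 1" by (simp add: power2_diff)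
  finally have "2 * \<bar>X n \<omega>\<bar> \<le> 1 + (X n \<omega>)\<^sup>2" by simp
  thus "\<bar>X n \<omega>\<bar> \<le> \<bar>1 + (X n \<omega>)\<^sup>2\<bar>" by (smt (verit) zero_le_power2)
qed

lemma oP_isCont:
  assumes "oP (\<lambda>n \<omega>. X n \<omega> - a)" "isCont f a"
  shows "oP (\<lambda>n \<omega>. f (X n \<omega>) - f a)"
  unfolding oP_def
proof safe
  fix e :: real assume "0 < e"
  then obtain d where d: "0 < d" "\<And>x. \<bar>x - a\<bar> < d \<Longrightarrow> \<bar>f x - f a\<bar> < e"
    using assms(2) unfolding continuous_at_eps_delta dist_real_def by metis
  have "whp (\<lambda>n \<omega>. \<bar>X n \<omega> - a\<bar> \<le> d / 2)" using oPD[OF assms(1), of "d / 2"] d by simp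
  thus "whp (\<lambda>n \<omega>. \<bar>f (X n \<omega>) - f a\<bar> \<le> e)"
    by (rule whp_mono) (use d in \<open>auto intro!: always_eventually less_imp_le d(2)\<close>)
qed

text \<open>The event is not assumed measurable. A set outside the sigma-algebra has measure 0, so a
  positive value of the measure already forces measurability; this is why the lower bound in the
  proof is kept nonnegative by \<open>max 0 (1 - d)\<close>.\<close>

lemma whp_prob_to_one:
  assumes "(\<lambda>n. measure (M n) {\<omega>\<in>space (M n). P n \<omega>}) \<longlonglongrightarrow> 1"
  shows "whp P"
  unfolding whp_def
proof safe
  fix d :: real assume d: "0 < d"
  have "\<forall>\<^sub>F n in sequentially. max 0 (1 - d) < measure (M n) {\<omega>\<in>space (M n). P n \<omega>}"
    using order_tendstoD(1)[OF assms, of "max 0 (1 - d)"] d by simp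
  with eventually_ge_at_top[of 1] show "\<forall>\<^sub>F n in sequentially. mostly n d (P n)"
  proof eventually_elim
    case (elim n)
    interpret prob_space "M n" using prob_space_M elim(1) .
    let ?A = "{\<omega>\<in>space (M n). P n \<omega>}"
    have A: "?A \<in> sets (M n)"
      using elim(2) measure_notin_sets[of ?A "M n"] by (cases "?A \<in> sets (M n)") auto
    have "measure (M n) (space (M n) - ?A) < d" using prob_compl[OF A] elim(2) by auto
    thus ?case unfolding mostly_def using A by (intro bexI[of _ "space (M n) - ?A"]) auto
  qed
qed

end

subsection \<open>The causal representation\<close>

text \<open>Stated as a functional of a whole sequence, so that it applies both to the innovations
  and to a truncated past: only the entries up to time t are read.\<close>

definition causal :: "(nat \<Rightarrow> real) \<Rightarrow> int \<Rightarrow> (int \<Rightarrow> real) \<Rightarrow> real" where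
  "causal c t e = (\<Sum>k. c k * e (t - int k))"

lemma abs_le_1_plus_square: "\<bar>x\<bar> \<le> 1 + x\<^sup>2" for x :: real
proof -
  have "0 \<le> (\<bar>x\<bar> - 1)\<^sup>2" by simp
  also have "\<dots> = x\<^sup>2 - 2 * \<bar>x\<bar> + 1" by (simp add: power2_diff)
  finally have "2 * \<bar>x\<bar> \<le> 1 + x\<^sup>2" by simp
  thus ?thesis by (smt (verit) zero_le_power2)
qed

lemma (in prob_space) integrable_bounded:
  fixes f :: "'a \<Rightarrow> 'b :: {banach, second_countable_topology}"
  assumes "f \<in> borel_measurable M" "\<And>\<omega>. norm (f \<omega>) \<le> B"
  shows "integrable M f"
  using assms by (intro integrable_const_bound[of _ B]) auto

lemma (in prob_space) integrable_if_square_integrable: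
  fixes f :: "'a \<Rightarrow> real"
  assumes [measurable]: "f \<in> borel_measurable M" and "integrable M (\<lambda>\<omega>. (f \<omega>)\<^sup>2)"
  shows "integrable M f"
proof (rule Bochner_Integration.integrable_bound)
  show "integrable M (\<lambda>\<omega>. 1 + (f \<omega>)\<^sup>2)" using assms by auto
  show "AE \<omega> in M. norm (f \<omega>) \<le> norm (1 + (f \<omega>)\<^sup>2)"
    by (intro AE_I2) (metis abs_ge_self abs_le_1_plus_square order_trans real_norm_def)
qed simp

lemma distr_eq_expectation:
  fixes f :: "'b \<Rightarrow> 'c :: {banach, second_countable_topology}"
  assumes "distr M N X = distr M N Y" "X \<in> measurable M N" "Y \<in> measurable M N" "f \<in> borel_measurable N"
  shows "(\<integral>\<omega>. f (X \<omega>) \<partial>M) = (\<integral>\<omega>. f (Y \<omega>) \<partial>M)" "integrable M (\<lambda>\<omega>. f (X \<omega>)) = integrable M (\<lambda>\<omega>. f (Y \<omega>))"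
  using integral_distr[OF assms(2,4)] integral_distr[OF assms(3,4)]
    integrable_distr_eq[OF assms(2,4)] integrable_distr_eq[OF assms(3,4)] assms(1) by simp_all

section \<open>Innovations and marginal laws of a single model\<close>

context contaminated_ar
begin

lemma eps_measurable [measurable]: "eps t \<in> borel_measurable M"
  using eps_indep unfolding indep_vars_def by auto

lemma z_measurable [measurable]: "z t \<in> borel_measurable M"
  using z_indep unfolding indep_vars_def by auto

lemma xi_measurable [measurable]: "xi t \<in> borel_measurable M"
  using xi_indep unfolding indep_vars_def by auto

lemma v_measurable [measurable]: "v t \<in> borel_measurable M"
  using v_stationary unfolding strictly_stationary_def by auto

lemma distr_eps: "distr M borel (eps t) = distr M borel (eps s)"
proof (rule cdf_unique)
  show "real_distribution (distr M borel (eps t))" "real_distribution (distr M borel (eps s))"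
    by (auto intro: real_distribution_distr)
qed (simp add: eps_cdf)

lemma eps_law: "real_distribution (distr M borel (eps t))"
  by (auto intro: real_distribution_distr)

lemma G_bounds: "0 \<le> G x" "G x \<le> 1"
proof -
  interpret A: real_distribution "distr M borel (eps 1)" by (rule eps_law)
  show "0 \<le> G x" "G x \<le> 1" using A.cdf_nonneg A.cdf_bounded_prob eps_cdf[of 1] by metis+
qed

lemma G_mono: "a \<le> b \<Longrightarrow> G a \<le> G b"
proof -
  interpret A: real_distribution "distr M borel (eps 1)" by (rule eps_law)
  show "a \<le> b \<Longrightarrow> G a \<le> G b" using A.cdf_nondecreasing eps_cdf[of 1] by metis
qed

lemma G_measurable [measurable]: "G \<in> borel_measurable borel"
  by (rule borel_measurable_mono) (auto intro: monoI G_mono)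

definition s2 :: real where "s2 = expectation (\<lambda>\<omega>. (eps 1 \<omega>)\<^sup>2)"

definition m1 :: real where "m1 = expectation (\<lambda>\<omega>. \<bar>eps 1 \<omega>\<bar>)"

lemma s2_pos: "0 < s2" using eps_variance_pos by (simp add: s2_def)

lemma eps_moments: "integrable M (\<lambda>\<omega>. (eps t \<omega>)\<^sup>2)" "expectation (\<lambda>\<omega>. (eps t \<omega>)\<^sup>2) = s2"
    "integrable M (eps t)" "expectation (eps t) = 0"
    "expectation (\<lambda>\<omega>. \<bar>eps t \<omega>\<bar>) = m1"
proof -
  note * = distr_eq_expectation[OF distr_eps[of t 1] eps_measurable eps_measurable]
  show sq: "integrable M (\<lambda>\<omega>. (eps t \<omega>)\<^sup>2)" using *(2)[of "\<lambda>x. x\<^sup>2"] eps_square_integrable by simp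
  show "expectation (\<lambda>\<omega>. (eps t \<omega>)\<^sup>2) = s2" using *(1)[of "\<lambda>x. x\<^sup>2"] by (simp add: s2_def)
  show "integrable M (eps t)" by (rule integrable_if_square_integrable[OF _ sq]) simp
  show "expectation (eps t) = 0" using *(1)[of "\<lambda>x. x"] eps_mean by simp
  show "expectation (\<lambda>\<omega>. \<bar>eps t \<omega>\<bar>) = m1" using *(1)[of "abs"] by (simp add: m1_def)
qed

lemma v_marginal: "distr M borel (v t) = distr M borel (v 0)"
proof -
  let ?P = "\<Pi>\<^sub>M t\<in>(UNIV :: int set). (borel :: real measure)"
  have e: "distr M ?P (\<lambda>\<omega> s. v (s + t) \<omega>) = distr M ?P (\<lambda>\<omega> s. v s \<omega>)"
    using v_stationary unfolding strictly_stationary_def by auto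
  have m: "(\<lambda>\<omega> s. v (s + t) \<omega>) \<in> measurable M ?P" "(\<lambda>\<omega> s. v s \<omega>) \<in> measurable M ?P"
    by (auto intro!: measurable_PiM_single')
  have "distr (distr M ?P (\<lambda>\<omega> s. v (s + t) \<omega>)) borel (\<lambda>f. f 0) = distr M borel (v t)"
    using m by (subst distr_distr) (auto simp: comp_def)
  moreover have "distr (distr M ?P (\<lambda>\<omega> s. v s \<omega>)) borel (\<lambda>f. f 0) = distr M borel (v 0)"
    using m by (subst distr_distr) (auto simp: comp_def)
  ultimately show ?thesis using e by simp
qed

end

locale ar_model = contaminated_ar M p \<beta> \<nu> G g Q eps z xi v
  for M :: "'a measure" and p :: nat and \<beta> :: "nat \<Rightarrow> real" and \<nu> :: real
    and G :: "real \<Rightarrow> real" and g :: real and Q :: "real measure"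
    and eps z xi v :: "int \<Rightarrow> 'a \<Rightarrow> real" +
  fixes \<mu> :: real
  assumes p_pos: "1 \<le> p"
    and roots: "\<And>w :: complex. w ^ p = (\<Sum>i = 1..p. of_real (\<beta> i) * w ^ (p - i)) \<Longrightarrow> cmod w < 1"
    and mu: "\<nu> = (1 - (\<Sum>i = 1..p. \<beta> i)) * \<mu>"
begin

abbreviation c :: "nat \<Rightarrow> real" where "c \<equiv> ar_coeff p \<beta>"

text \<open>The candidate for \<open>v t - \<mu>\<close>. Unlike \<open>v\<close>, which is given
  only as a stationary solution, it is visibly a function of the innovations up to time t; the
  conditioning arguments rest on this.\<close>

definition V :: "int \<Rightarrow> 'a \<Rightarrow> real" where "V t \<omega> = causal c t (\<lambda>s. eps s \<omega>)"

lemma V_measurable [measurable]: "V t \<in> borel_measurable M"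
  unfolding V_def causal_def
  by (intro borel_measurable_suminf borel_measurable_times borel_measurable_const eps_measurable)

lemma summable_c: "summable (\<lambda>k. \<bar>c k\<bar>)"
  by (rule ar_coeff_summable[OF roots])

definition cs :: real where "cs = (\<Sum>k. \<bar>c k\<bar>)"

lemma cs_nonneg: "0 \<le> cs" unfolding cs_def by (intro suminf_nonneg summable_c) auto

lemma causal_summable: "AE \<omega> in M. summable (\<lambda>k. c k * eps (t - int k) \<omega>)"
proof -
  have "(\<integral>\<^sup>+\<omega>. (\<Sum>k. ennreal (\<bar>c k\<bar> * \<bar>eps (t - int k) \<omega>\<bar>)) \<partial>M)
      = (\<Sum>k. \<integral>\<^sup>+\<omega>. ennreal (\<bar>c k\<bar> * \<bar>eps (t - int k) \<omega>\<bar>) \<partial>M)"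
    by (rule nn_integral_suminf) measurable
  also have "\<dots> = (\<Sum>k. ennreal (\<bar>c k\<bar> * m1))"
  proof (intro suminf_cong)
    fix k
    show "(\<integral>\<^sup>+\<omega>. ennreal (\<bar>c k\<bar> * \<bar>eps (t - int k) \<omega>\<bar>) \<partial>M) = ennreal (\<bar>c k\<bar> * m1)"
      using eps_moments(5)[of "t - int k"]
      by (subst nn_integral_eq_integral) (auto intro!: integrable_mult_right integrable_abs eps_moments(3))
  qed
  also have "\<dots> = ennreal (\<Sum>k. \<bar>c k\<bar> * m1)"
    by (intro suminf_ennreal2 summable_mult2 summable_c) (auto simp: m1_def)
  finally have "(\<integral>\<^sup>+\<omega>. (\<Sum>k. ennreal (\<bar>c k\<bar> * \<bar>eps (t - int k) \<omega>\<bar>)) \<partial>M) \<noteq> \<infinity>" by simp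
  hence "AE \<omega> in M. (\<Sum>k. ennreal (\<bar>c k\<bar> * \<bar>eps (t - int k) \<omega>\<bar>)) \<noteq> \<infinity>"
    by (rule nn_integral_PInf_AE[rotated]) measurable
  thus ?thesis
  proof eventually_elim
    case (elim \<omega>)
    hence "summable (\<lambda>k. \<bar>c k\<bar> * \<bar>eps (t - int k) \<omega>\<bar>)"
      by (intro summable_suminf_not_top) auto
    thus ?case by (intro summable_norm_cancel[of "\<lambda>k. c k * eps (t - int k) \<omega>"]) (simp add: abs_mult)
  qed
qed

text \<open>Cauchy-Schwarz with the weights sqrt |c k| bounds the squared partial sums by cs * (sum
  of |c k| * eps^2) pointwise; the limit of the partial sums then inherits the bound. The result
  depends on the innovation law only through \<open>s2\<close>, which later makes it uniform in
  n.\<close>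

lemma V_square: "integrable M (\<lambda>\<omega>. (V t \<omega>)\<^sup>2)" "expectation (\<lambda>\<omega>. (V t \<omega>)\<^sup>2) \<le> cs\<^sup>2 * s2"
proof -
  have "AE \<omega> in M. ennreal ((V t \<omega>)\<^sup>2) \<le> ennreal cs * (\<Sum>k. ennreal (\<bar>c k\<bar> * (eps (t - int k) \<omega>)\<^sup>2))"
    using causal_summable[of t]
  proof eventually_elim
    case (elim \<omega>)
    let ?S = "\<lambda>N. \<Sum>k<N. c k * eps (t - int k) \<omega>"
    have "?S \<longlonglongrightarrow> V t \<omega>" unfolding V_def causal_def using elim by (rule summable_LIMSEQ)
    hence lim: "(\<lambda>N. ennreal ((?S N)\<^sup>2)) \<longlonglongrightarrow> ennreal ((V t \<omega>)\<^sup>2)" by (intro tendsto_ennrealI tendsto_power)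
    have le: "ennreal ((?S N)\<^sup>2) \<le> ennreal cs * (\<Sum>k. ennreal (\<bar>c k\<bar> * (eps (t - int k) \<omega>)\<^sup>2))" for N
    proof -
      have sqrt_abs: "sqrt \<bar>a\<bar> * (sqrt \<bar>a\<bar> * y) = \<bar>a\<bar> * y" for a y :: real
        using real_sqrt_mult_self[of "\<bar>a\<bar>"] by (simp only: mult.assoc[symmetric] abs_idempotent)
      have "(?S N)\<^sup>2 \<le> (\<Sum>k<N. sqrt \<bar>c k\<bar> * (sqrt \<bar>c k\<bar> * \<bar>eps (t - int k) \<omega>\<bar>))\<^sup>2"
      proof -
        have "\<bar>?S N\<bar> \<le> (\<Sum>k<N. \<bar>c k * eps (t - int k) \<omega>\<bar>)" by (rule sum_abs)
        also have "\<dots> = (\<Sum>k<N. sqrt \<bar>c k\<bar> * (sqrt \<bar>c k\<bar> * \<bar>eps (t - int k) \<omega>\<bar>))"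
          by (intro sum.cong refl) (simp only: sqrt_abs abs_mult)
        also have "\<dots> \<le> \<bar>\<Sum>k<N. sqrt \<bar>c k\<bar> * (sqrt \<bar>c k\<bar> * \<bar>eps (t - int k) \<omega>\<bar>)\<bar>" by (rule abs_ge_self)
        finally show ?thesis by (simp only: abs_le_square_iff)
      qed
      also have "\<dots> \<le> (\<Sum>k<N. (sqrt \<bar>c k\<bar>)\<^sup>2) * (\<Sum>k<N. (sqrt \<bar>c k\<bar> * \<bar>eps (t - int k) \<omega>\<bar>)\<^sup>2)"
        by (rule Cauchy_Schwarz_ineq_sum)
      also have "\<dots> = (\<Sum>k<N. \<bar>c k\<bar>) * (\<Sum>k<N. \<bar>c k\<bar> * (eps (t - int k) \<omega>)\<^sup>2)"
        by (simp add: power_mult_distrib)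
      also have "\<dots> \<le> cs * (\<Sum>k<N. \<bar>c k\<bar> * (eps (t - int k) \<omega>)\<^sup>2)"
        unfolding cs_def by (intro mult_right_mono sum_le_suminf summable_c sum_nonneg) auto
      finally have "ennreal ((?S N)\<^sup>2) \<le> ennreal (cs * (\<Sum>k<N. \<bar>c k\<bar> * (eps (t - int k) \<omega>)\<^sup>2))"
        by (rule ennreal_leI)
      also have "\<dots> = ennreal cs * ennreal (\<Sum>k<N. \<bar>c k\<bar> * (eps (t - int k) \<omega>)\<^sup>2)"
        by (intro ennreal_mult cs_nonneg sum_nonneg mult_nonneg_nonneg abs_ge_zero zero_le_power2)
      also have "ennreal (\<Sum>k<N. \<bar>c k\<bar> * (eps (t - int k) \<omega>)\<^sup>2) = (\<Sum>k<N. ennreal (\<bar>c k\<bar> * (eps (t - int k) \<omega>)\<^sup>2))"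
        by (intro sum_ennreal[symmetric]) auto
      also have "\<dots> \<le> (\<Sum>k. ennreal (\<bar>c k\<bar> * (eps (t - int k) \<omega>)\<^sup>2))"
        by (intro sum_le_suminf summableI) auto
      finally show ?thesis by (metis mult_left_mono zero_le)
    qed
    show ?case
    proof (rule LIMSEQ_le_const2[OF lim], rule exI[of _ 0], rule allI, rule impI)
      fix n show "ennreal ((?S n)\<^sup>2) \<le> ennreal cs * (\<Sum>k. ennreal (\<bar>c k\<bar> * (eps (t - int k) \<omega>)\<^sup>2))" by (rule le)
    qed
  qed
  hence "(\<integral>\<^sup>+\<omega>. ennreal ((V t \<omega>)\<^sup>2) \<partial>M) \<le> (\<integral>\<^sup>+\<omega>. ennreal cs * (\<Sum>k. ennreal (\<bar>c k\<bar> * (eps (t - int k) \<omega>)\<^sup>2)) \<partial>M)"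
    by (rule nn_integral_mono_AE)
  also have "\<dots> = ennreal cs * (\<integral>\<^sup>+\<omega>. (\<Sum>k. ennreal (\<bar>c k\<bar> * (eps (t - int k) \<omega>)\<^sup>2)) \<partial>M)"
    by (rule nn_integral_cmult) measurable
  also have "(\<integral>\<^sup>+\<omega>. (\<Sum>k. ennreal (\<bar>c k\<bar> * (eps (t - int k) \<omega>)\<^sup>2)) \<partial>M)
      = (\<Sum>k. \<integral>\<^sup>+\<omega>. ennreal (\<bar>c k\<bar> * (eps (t - int k) \<omega>)\<^sup>2) \<partial>M)"
    by (rule nn_integral_suminf) measurable
  also have "\<dots> = (\<Sum>k. ennreal (\<bar>c k\<bar> * s2))"
  proof (intro suminf_cong)
    fix k
    show "(\<integral>\<^sup>+\<omega>. ennreal (\<bar>c k\<bar> * (eps (t - int k) \<omega>)\<^sup>2) \<partial>M) = ennreal (\<bar>c k\<bar> * s2)"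
      using eps_moments(2)[of "t - int k"]
      by (subst nn_integral_eq_integral) (auto intro!: integrable_mult_right eps_moments(1))
  qed
  also have "\<dots> = ennreal (\<Sum>k. \<bar>c k\<bar> * s2)"
    using s2_pos by (intro suminf_ennreal2 summable_mult2 summable_c) auto
  also have "(\<Sum>k. \<bar>c k\<bar> * s2) = cs * s2"
    unfolding cs_def by (intro suminf_mult2[symmetric] summable_c)
  also have "ennreal cs * ennreal (cs * s2) = ennreal (cs\<^sup>2 * s2)"
    unfolding power2_eq_square mult.assoc
    by (intro ennreal_mult[symmetric] cs_nonneg mult_nonneg_nonneg less_imp_le[OF s2_pos])
  finally have le: "(\<integral>\<^sup>+\<omega>. ennreal ((V t \<omega>)\<^sup>2) \<partial>M) \<le> ennreal (cs\<^sup>2 * s2)" .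
  show int: "integrable M (\<lambda>\<omega>. (V t \<omega>)\<^sup>2)"
  proof (rule integrableI_bounded)
    have "(\<integral>\<^sup>+\<omega>. ennreal (norm ((V t \<omega>)\<^sup>2)) \<partial>M) \<le> ennreal (cs\<^sup>2 * s2)"
      unfolding real_norm_def abs_power2 by (rule le)
    also have "\<dots> < \<infinity>" unfolding infinity_ennreal_def by (rule ennreal_less_top)
    finally show "(\<integral>\<^sup>+\<omega>. ennreal (norm ((V t \<omega>)\<^sup>2)) \<partial>M) < \<infinity>" .
  qed simp
  show "expectation (\<lambda>\<omega>. (V t \<omega>)\<^sup>2) \<le> cs\<^sup>2 * s2"
  proof -
    have "ennreal (expectation (\<lambda>\<omega>. (V t \<omega>)\<^sup>2)) = (\<integral>\<^sup>+\<omega>. ennreal ((V t \<omega>)\<^sup>2) \<partial>M)"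
      by (rule nn_integral_eq_integral[symmetric, OF int]) simp
    also note le
    finally show ?thesis
      by (subst (asm) ennreal_le_iff) (use s2_pos in auto)
  qed
qed

lemma V_integrable: "integrable M (V t)"
  by (rule integrable_if_square_integrable[OF _ V_square(1)]) simp

lemma V_abs: "expectation (\<lambda>\<omega>. \<bar>V t \<omega>\<bar>) \<le> 1 + cs\<^sup>2 * s2"
proof -
  have "expectation (\<lambda>\<omega>. \<bar>V t \<omega>\<bar>) \<le> expectation (\<lambda>\<omega>. 1 + (V t \<omega>)\<^sup>2)"
    by (intro integral_mono) (auto intro!: V_integrable V_square abs_le_1_plus_square)
  also have "\<dots> \<le> 1 + cs\<^sup>2 * s2" using V_square[of t] by (simp add: prob_space)
  finally show ?thesis .
qed

text \<open>The coefficients extended by 0 to negative indices, so that the recursion needs no case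
  distinction on i <= k.\<close>

definition cc :: "int \<Rightarrow> real" where "cc k = (if k < 0 then 0 else c (nat k))"

text \<open>The coefficient of u(t - N - j) that is left after the autoregressive equation has been
  substituted into itself N times.\<close>

definition rem_coeff :: "nat \<Rightarrow> nat \<Rightarrow> real" where
  "rem_coeff N j = (\<Sum>i = j + 1..p. \<beta> i * cc (int N + int j - int i))"

lemma cc_rec:
  assumes "0 < N"
  shows "cc (int N) = (\<Sum>i = 1..p. \<beta> i * cc (int N - int i))"
proof -
  have "cc (int N) = (\<Sum>i = 1..p. if i \<le> N then \<beta> i * c (N - i) else 0)"
    using ar_coeff_rec[OF assms, of p \<beta>] by (simp add: cc_def)
  also have "\<dots> = (\<Sum>i = 1..p. \<beta> i * cc (int N - int i))"
    by (intro sum.cong refl) (auto simp: cc_def nat_diff_distrib)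
  finally show ?thesis .
qed

lemma cc_tendsto: "(\<lambda>N. cc (int N + a)) \<longlonglongrightarrow> 0"
proof -
  have "(\<lambda>k. \<bar>c k\<bar>) \<longlonglongrightarrow> 0" by (rule summable_LIMSEQ_zero[OF summable_c])
  hence c0: "c \<longlonglongrightarrow> 0" by (simp add: tendsto_rabs_zero_iff)
  have "filterlim (\<lambda>N. nat (int N + a)) at_top sequentially"
    unfolding filterlim_at_top
  proof
    fix Z show "\<forall>\<^sub>F N in sequentially. Z \<le> nat (int N + a)"
      using eventually_ge_at_top[of "nat (int Z - a)"] by eventually_elim auto
  qed
  from filterlim_compose[OF c0 this] have "(\<lambda>N. c (nat (int N + a))) \<longlonglongrightarrow> 0" .
  thus ?thesis
  proof (rule Lim_transform_eventually)
    show "\<forall>\<^sub>F N in sequentially. c (nat (int N + a)) = cc (int N + a)"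
      using eventually_ge_at_top[of "nat (- a)"] by eventually_elim (auto simp: cc_def)
  qed
qed

lemma rem_coeff_tendsto: "(\<lambda>N. rem_coeff N j) \<longlonglongrightarrow> 0"
proof -
  have "(\<lambda>N. \<Sum>i = j + 1..p. \<beta> i * cc (int N + (int j - int i))) \<longlonglongrightarrow> (\<Sum>i = j + 1..p. \<beta> i * 0)"
    by (intro tendsto_intros cc_tendsto)
  thus ?thesis by (simp add: rem_coeff_def add_diff_eq)
qed

text \<open>Each step applies the equation to the most recent value in the remainder, u(t - N),
  whose coefficient is c N; this releases the innovation at t - N and spreads c N * \<beta> over the
  p values before it.\<close>

lemma ar_iterate:
  assumes eq: "\<And>t. u t = (\<Sum>i = 1..p. \<beta> i * u (t - int i)) + e t" and N: "1 \<le> N"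
  shows "u t = (\<Sum>k<N. c k * e (t - int k)) + (\<Sum>j<p. rem_coeff N j * u (t - int N - int j))"
  using N
proof (induction N rule: dec_induct)
  case base
  have "rem_coeff 1 j = \<beta> (j + 1)" if "j < p" for j
  proof -
    have "rem_coeff 1 j = \<beta> (j + 1) * cc 0 + (\<Sum>i = j + 2..p. \<beta> i * cc (int 1 + int j - int i))"
      unfolding rem_coeff_def using that by (subst sum.atLeast_Suc_atMost) auto
    also have "(\<Sum>i = j + 2..p. \<beta> i * cc (int 1 + int j - int i)) = 0"
      by (intro sum.neutral) (auto simp: cc_def)
    finally show ?thesis by (simp add: cc_def ar_coeff_0)
  qed
  hence "(\<Sum>j<p. rem_coeff 1 j * u (t - int 1 - int j)) = (\<Sum>j<p. \<beta> (Suc j) * u (t - int (Suc j)))"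
    by (intro sum.cong) (auto simp: algebra_simps)
  also have "\<dots> = (\<Sum>i = 1..p. \<beta> i * u (t - int i))"
    by (simp add: sum.atLeast1_atMost_eq)
  finally show ?case using eq[of t] by (simp add: ar_coeff_0)
next
  case (step N)
  define f where "f j = rem_coeff N j * u (t - int N - int j)" for j
  obtain q where q: "p = Suc q" using p_pos by (cases p) auto
  have r0: "rem_coeff N 0 = c N" using cc_rec[of N] step(1) by (simp add: rem_coeff_def cc_def)
  have rp: "rem_coeff N p = 0" by (simp add: rem_coeff_def)
  have rS: "rem_coeff (Suc N) j = rem_coeff N (Suc j) + c N * \<beta> (Suc j)" if "j < p" for j
  proof -
    have "rem_coeff (Suc N) j = \<beta> (j + 1) * cc (int N) + (\<Sum>i = Suc j + 1..p. \<beta> i * cc (int (Suc N) + int j - int i))"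
      unfolding rem_coeff_def using that by (subst sum.atLeast_Suc_atMost) auto
    thus ?thesis by (simp add: rem_coeff_def cc_def algebra_simps)
  qed
  \<comment> \<open>The term j = p is zero and is added so that, after j = 0 has been split off, p
    terms remain that align with the remainder for N + 1.\<close>
  have "(\<Sum>j<p. f j) = (\<Sum>j<Suc p. f j)" by (simp add: f_def rp)
  also have "\<dots> = f 0 + (\<Sum>j<p. f (Suc j))" by (rule sum.lessThan_Suc_shift)
  also have "f 0 = c N * e (t - int N) + (\<Sum>i = 1..p. c N * \<beta> i * u (t - int N - int i))"
    unfolding f_def r0 using arg_cong[OF eq[of "t - int N"], of "\<lambda>x. c N * x"]
    by (simp add: distrib_left sum_distrib_left mult.assoc)
  also have "(\<Sum>i = 1..p. c N * \<beta> i * u (t - int N - int i)) = (\<Sum>j<p. c N * \<beta> (Suc j) * u (t - int N - int (Suc j)))"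
    by (simp add: sum.atLeast1_atMost_eq)
  finally have "(\<Sum>j<p. f j) = c N * e (t - int N) + (\<Sum>j<p. (rem_coeff N (Suc j) + c N * \<beta> (Suc j)) * u (t - int N - int (Suc j)))"
    by (simp add: f_def algebra_simps sum.distrib)
  also have "(\<Sum>j<p. (rem_coeff N (Suc j) + c N * \<beta> (Suc j)) * u (t - int N - int (Suc j)))
      = (\<Sum>j<p. rem_coeff (Suc N) j * u (t - int (Suc N) - int j))"
    by (intro sum.cong) (auto simp: rS algebra_simps)
  finally show ?case using step.IH by (simp add: f_def)
qed

lemma v_recursion: "AE \<omega> in M. \<forall>t. v t \<omega> - \<mu> = (\<Sum>i = 1..p. \<beta> i * (v (t - int i) \<omega> - \<mu>)) + eps t \<omega>"
  using v_equation
proof eventually_elim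
  case (elim \<omega>)
  show ?case
  proof
    fix t
    have "v t \<omega> = (\<Sum>i = 1..p. \<beta> i * v (t - int i) \<omega>) + \<nu> + eps t \<omega>" using elim by blast
    thus "v t \<omega> - \<mu> = (\<Sum>i = 1..p. \<beta> i * (v (t - int i) \<omega> - \<mu>)) + eps t \<omega>"
      by (simp add: mu right_diff_distrib sum_subtractf sum_distrib_right left_diff_distrib)
  qed
qed

text \<open>No moment of \<open>v\<close> is assumed, so the remainder of the iterated equation
  cannot be controlled in mean. Stationarity does it instead: the remainder consists of p terms,
  each a coefficient tending to 0 times a variable of one fixed law, and so vanishes in the bounded
  metric E min(1, |.|). Almost surely it also converges to v - \<mu> - V, which must therefore be
  0.\<close>

lemma v_eq_V: "AE \<omega> in M. v t \<omega> - \<mu> = V t \<omega>"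
proof -
  define R where "R N \<omega> = (\<Sum>j<p. rem_coeff N j * (v (t - int N - int j) \<omega> - \<mu>))" for N \<omega>
  have [measurable]: "R N \<in> borel_measurable M" for N unfolding R_def by measurable
  have conv: "AE \<omega> in M. (\<lambda>N. R N \<omega>) \<longlonglongrightarrow> v t \<omega> - \<mu> - V t \<omega>"
    using v_recursion causal_summable[of t]
  proof eventually_elim
    case (elim \<omega>)
    note rec = elim(1)[rule_format]
    have "(\<lambda>N. v t \<omega> - \<mu> - (\<Sum>k<N. c k * eps (t - int k) \<omega>)) \<longlonglongrightarrow> v t \<omega> - \<mu> - V t \<omega>"
      unfolding V_def causal_def by (intro tendsto_intros summable_LIMSEQ elim(2))
    thus ?case
    proof (rule Lim_transform_eventually)
      show "\<forall>\<^sub>F N in sequentially. v t \<omega> - \<mu> - (\<Sum>k<N. c k * eps (t - int k) \<omega>) = R N \<omega>"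
        using eventually_ge_at_top[of 1]
      proof (rule eventually_mono)
        fix N :: nat assume N: "1 \<le> N"
        have "v t \<omega> - \<mu> = (\<Sum>k<N. c k * eps (t - int k) \<omega>) + R N \<omega>"
          unfolding R_def by (rule ar_iterate[OF rec N])
        thus "v t \<omega> - \<mu> - (\<Sum>k<N. c k * eps (t - int k) \<omega>) = R N \<omega>" by linarith
      qed
    qed
  qed
  have lim1: "(\<lambda>N. expectation (\<lambda>\<omega>. min 1 \<bar>R N \<omega>\<bar>)) \<longlonglongrightarrow> expectation (\<lambda>\<omega>. min 1 \<bar>v t \<omega> - \<mu> - V t \<omega>\<bar>)"
  proof (rule integral_dominated_convergence[where w = "\<lambda>_. 1"])
    show "AE \<omega> in M. (\<lambda>N. min 1 \<bar>R N \<omega>\<bar>) \<longlonglongrightarrow> min 1 \<bar>v t \<omega> - \<mu> - V t \<omega>\<bar>"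
      using conv by eventually_elim (intro tendsto_intros)
  qed auto
  have bound: "expectation (\<lambda>\<omega>. min 1 \<bar>R N \<omega>\<bar>) \<le> (\<Sum>j<p. expectation (\<lambda>\<omega>. min 1 (\<bar>rem_coeff N j\<bar> * \<bar>v 0 \<omega> - \<mu>\<bar>)))" for N
  proof -
    have min_sum: "min 1 \<bar>\<Sum>j<k. f j\<bar> \<le> (\<Sum>j<k. min 1 \<bar>f j\<bar>)" for k and f :: "nat \<Rightarrow> real"
      by (induction k) auto
    have "expectation (\<lambda>\<omega>. min 1 \<bar>R N \<omega>\<bar>) \<le> expectation (\<lambda>\<omega>. \<Sum>j<p. min 1 \<bar>rem_coeff N j * (v (t - int N - int j) \<omega> - \<mu>)\<bar>)"
      unfolding R_def
      by (intro integral_mono min_sum Bochner_Integration.integrable_sum integrable_bounded[where B = 1]) auto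
    also have "\<dots> = (\<Sum>j<p. expectation (\<lambda>\<omega>. min 1 \<bar>rem_coeff N j * (v (t - int N - int j) \<omega> - \<mu>)\<bar>))"
      by (intro Bochner_Integration.integral_sum integrable_bounded[where B = 1]) auto
    also have "\<dots> = (\<Sum>j<p. expectation (\<lambda>\<omega>. min 1 (\<bar>rem_coeff N j\<bar> * \<bar>v 0 \<omega> - \<mu>\<bar>)))"
    proof (intro sum.cong refl)
      fix j
      show "expectation (\<lambda>\<omega>. min 1 \<bar>rem_coeff N j * (v (t - int N - int j) \<omega> - \<mu>)\<bar>)
          = expectation (\<lambda>\<omega>. min 1 (\<bar>rem_coeff N j\<bar> * \<bar>v 0 \<omega> - \<mu>\<bar>))"
        using distr_eq_expectation(1)[OF v_marginal v_measurable v_measurable,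
            of "\<lambda>x. min 1 \<bar>rem_coeff N j * (x - \<mu>)\<bar>" "t - int N - int j"]
        by (simp add: abs_mult)
    qed
    finally show ?thesis .
  qed
  have lim2: "(\<lambda>N. \<Sum>j<p. expectation (\<lambda>\<omega>. min 1 (\<bar>rem_coeff N j\<bar> * \<bar>v 0 \<omega> - \<mu>\<bar>))) \<longlonglongrightarrow> (\<Sum>j<p. expectation (\<lambda>\<omega>. min 1 (0 * \<bar>v 0 \<omega> - \<mu>\<bar>)))"
  proof (intro tendsto_sum integral_dominated_convergence[where w = "\<lambda>_. 1"])
    fix j
    show "AE \<omega> in M. (\<lambda>N. min 1 (\<bar>rem_coeff N j\<bar> * \<bar>v 0 \<omega> - \<mu>\<bar>)) \<longlonglongrightarrow> min 1 (0 * \<bar>v 0 \<omega> - \<mu>\<bar>)"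
      by (intro AE_I2 tendsto_intros tendsto_rabs_zero rem_coeff_tendsto)
  qed auto
  have "expectation (\<lambda>\<omega>. min 1 \<bar>v t \<omega> - \<mu> - V t \<omega>\<bar>) \<le> 0"
    using LIMSEQ_le[OF lim1 lim2] bound by auto
  moreover have "expectation (\<lambda>\<omega>. min 1 \<bar>v t \<omega> - \<mu> - V t \<omega>\<bar>) \<ge> 0" by (intro integral_nonneg_AE) auto
  ultimately have "expectation (\<lambda>\<omega>. min 1 \<bar>v t \<omega> - \<mu> - V t \<omega>\<bar>) = 0" by simp
  hence "AE \<omega> in M. min 1 \<bar>v t \<omega> - \<mu> - V t \<omega>\<bar> = 0"
    by (subst (asm) integral_nonneg_eq_0_iff_AE) (auto intro!: integrable_bounded[where B = 1])
  thus ?thesis by eventually_elim (auto simp: min_def split: if_splits)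
qed

lemma V_recursion: "AE \<omega> in M. V t \<omega> = (\<Sum>i = 1..p. \<beta> i * V (t - int i) \<omega>) + eps t \<omega>"
proof -
  have "AE \<omega> in M. \<forall>s. v s \<omega> - \<mu> = V s \<omega>" by (simp add: AE_all_countable v_eq_V)
  with v_recursion show ?thesis
  proof eventually_elim
    case (elim \<omega>)
    have "v t \<omega> - \<mu> = (\<Sum>i = 1..p. \<beta> i * (v (t - int i) \<omega> - \<mu>)) + eps t \<omega>" using elim(1) by blast
    thus ?case using elim(2) by simp
  qed
qed

end

subsection \<open>Conditioning on the past\<close>

abbreviation seq_borel :: "(int \<Rightarrow> real) measure" where "seq_borel \<equiv> \<Pi>\<^sub>M t\<in>UNIV. borel"

text \<open>Unlike \<open>indep_var\<close>, the two variables may have different types.\<close>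

definition (in prob_space) indep_pair ::
  "'b measure \<Rightarrow> ('a \<Rightarrow> 'b) \<Rightarrow> 'c measure \<Rightarrow> ('a \<Rightarrow> 'c) \<Rightarrow> bool" where
  "indep_pair S X T Y \<longleftrightarrow> X \<in> measurable M S \<and> Y \<in> measurable M T \<and>
     distr M S X \<Otimes>\<^sub>M distr M T Y = distr M (S \<Otimes>\<^sub>M T) (\<lambda>\<omega>. (X \<omega>, Y \<omega>))"

lemma (in prob_space) indep_pair_compose:
  assumes "indep_pair S X T Y" and F[measurable]: "F \<in> measurable S S'" and H[measurable]: "H \<in> measurable T T'"
  shows "indep_pair S' (\<lambda>\<omega>. F (X \<omega>)) T' (\<lambda>\<omega>. H (Y \<omega>))"
proof -
  have X[measurable]: "X \<in> measurable M S" and Y[measurable]: "Y \<in> measurable M T"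
    and eq: "distr M S X \<Otimes>\<^sub>M distr M T Y = distr M (S \<Otimes>\<^sub>M T) (\<lambda>\<omega>. (X \<omega>, Y \<omega>))"
    using assms(1) unfolding indep_pair_def by auto
  have "prob_space (distr (distr M T Y) T' H)" by (intro prob_space.prob_space_distr prob_space_distr) auto
  hence sf: "sigma_finite_measure (distr (distr M T Y) T' H)"
    by (rule prob_space_imp_sigma_finite)
  have "distr M S' (\<lambda>\<omega>. F (X \<omega>)) \<Otimes>\<^sub>M distr M T' (\<lambda>\<omega>. H (Y \<omega>))
      = distr (distr M S X) S' F \<Otimes>\<^sub>M distr (distr M T Y) T' H"
    by (simp add: distr_distr comp_def)
  also have "\<dots> = distr (distr M S X \<Otimes>\<^sub>M distr M T Y) (S' \<Otimes>\<^sub>M T') (\<lambda>(x, y). (F x, H y))"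
    by (rule pair_measure_distr[OF _ _ sf]) auto
  also have "\<dots> = distr M (S' \<Otimes>\<^sub>M T') (\<lambda>\<omega>. (F (X \<omega>), H (Y \<omega>)))"
    unfolding eq by (subst distr_distr) (auto simp: comp_def)
  finally show ?thesis unfolding indep_pair_def by auto
qed

lemma (in prob_space) indep_pair_if_indep_var: "indep_var S X T Y \<Longrightarrow> indep_pair S X T Y"
  unfolding indep_pair_def indep_var_distribution_eq by auto

text \<open>Fubini for the product law in its two orders: the first form freezes the second
  variable, the second integrates the first variable out and keeps the second random. The
  conditioning step uses one form for the outliers and the other for the innovation.\<close>

lemma (in prob_space) indep_pair_expectation:
  fixes f :: "'b \<Rightarrow> 'c \<Rightarrow> real"
  assumes ind: "indep_pair S X T Y" and f[measurable]: "case_prod f \<in> borel_measurable (S \<Otimes>\<^sub>M T)"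
    and B: "\<And>x y. \<bar>f x y\<bar> \<le> B"
  shows "expectation (\<lambda>\<omega>. f (X \<omega>) (Y \<omega>)) = (\<integral>y. expectation (\<lambda>\<omega>. f (X \<omega>) y) \<partial>distr M T Y)"
    and "expectation (\<lambda>\<omega>. f (X \<omega>) (Y \<omega>)) = expectation (\<lambda>\<omega>. \<integral>x. f x (Y \<omega>) \<partial>distr M S X)"
proof -
  have X[measurable]: "X \<in> measurable M S" and Y[measurable]: "Y \<in> measurable M T"
    using ind unfolding indep_pair_def by auto
  interpret X: prob_space "distr M S X" by (rule prob_space_distr) simp
  interpret Y: prob_space "distr M T Y" by (rule prob_space_distr) simp
  interpret XY: pair_prob_space "distr M S X" "distr M T Y" ..
  have eq: "distr M (S \<Otimes>\<^sub>M T) (\<lambda>\<omega>. (X \<omega>, Y \<omega>)) = distr M S X \<Otimes>\<^sub>M distr M T Y"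
    using ind unfolding indep_pair_def by auto
  have int: "integrable (distr M S X \<Otimes>\<^sub>M distr M T Y) (case_prod f)"
  proof (rule XY.integrable_const_bound[of _ B])
    show "AE z in distr M S X \<Otimes>\<^sub>M distr M T Y. norm (case_prod f z) \<le> B"
      by (intro AE_I2) (auto simp: B split: prod.split)
    show "case_prod f \<in> borel_measurable (distr M S X \<Otimes>\<^sub>M distr M T Y)"
      using f by (simp cong: measurable_cong_sets sets_pair_measure_cong)
  qed
  have "expectation (\<lambda>\<omega>. f (X \<omega>) (Y \<omega>)) = (\<integral>z. case_prod f z \<partial>distr M (S \<Otimes>\<^sub>M T) (\<lambda>\<omega>. (X \<omega>, Y \<omega>)))"
    by (subst integral_distr) auto
  also have "\<dots> = (\<integral>y. (\<integral>x. f x y \<partial>distr M S X) \<partial>distr M T Y)"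
    unfolding eq by (rule XY.integral_snd[OF int, symmetric])
  finally have 1: "expectation (\<lambda>\<omega>. f (X \<omega>) (Y \<omega>)) = (\<integral>y. (\<integral>x. f x y \<partial>distr M S X) \<partial>distr M T Y)" .
  also have "\<dots> = (\<integral>y. expectation (\<lambda>\<omega>. f (X \<omega>) y) \<partial>distr M T Y)"
  proof (rule Bochner_Integration.integral_cong[OF refl])
    fix y assume "y \<in> space (distr M T Y)"
    hence "(\<lambda>x. f x y) \<in> borel_measurable S"
      using measurable_compose[OF measurable_Pair2'[of y T S] f] by simp
    thus "(\<integral>x. f x y \<partial>distr M S X) = expectation (\<lambda>\<omega>. f (X \<omega>) y)" by (subst integral_distr) auto
  qed
  finally show "expectation (\<lambda>\<omega>. f (X \<omega>) (Y \<omega>)) = (\<integral>y. expectation (\<lambda>\<omega>. f (X \<omega>) y) \<partial>distr M T Y)" .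
  have "(\<lambda>y. \<integral>x. f x y \<partial>distr M S X) \<in> borel_measurable T"
    by (rule X.borel_measurable_lebesgue_integral) measurable
  thus "expectation (\<lambda>\<omega>. f (X \<omega>) (Y \<omega>)) = expectation (\<lambda>\<omega>. \<integral>x. f x (Y \<omega>) \<partial>distr M S X)"
    unfolding 1 by (subst integral_distr) auto
qed

section \<open>The present innovation against past innovations and all outliers\<close>

context ar_model
begin

lemma seq_measurable [measurable]:
  "(\<lambda>\<omega> t. eps t \<omega>) \<in> measurable M seq_borel"
  "(\<lambda>\<omega> t. z t \<omega>) \<in> measurable M seq_borel"
  "(\<lambda>\<omega> t. xi t \<omega>) \<in> measurable M seq_borel"
  by (auto intro!: measurable_PiM_single')

lemma component_measurable [measurable]: "(\<lambda>e. e t) \<in> borel_measurable seq_borel"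
  by (rule measurable_component_singleton) simp

lemma indep_eps_zxi:
  "indep_pair seq_borel (\<lambda>\<omega> t. eps t \<omega>) (seq_borel \<Otimes>\<^sub>M seq_borel) (\<lambda>\<omega>. (\<lambda>t. z t \<omega>, \<lambda>t. xi t \<omega>))"
proof -
  let ?F = "\<lambda>k \<omega> t. ([eps, z, xi] ! k) t \<omega>"
  have "indep_var (PiM {0} (\<lambda>_. seq_borel)) (\<lambda>\<omega>. restrict (\<lambda>k. ?F k \<omega>) {0})
    (PiM {1, 2} (\<lambda>_. seq_borel)) (\<lambda>\<omega>. restrict (\<lambda>k. ?F k \<omega>) {1, 2})"
    by (rule indep_var_restrict[OF sequences_indep]) auto
  hence "indep_pair seq_borel (\<lambda>\<omega>. (restrict (\<lambda>k. ?F k \<omega>) {0}) 0) (seq_borel \<Otimes>\<^sub>M seq_borel)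
     (\<lambda>\<omega>. ((restrict (\<lambda>k. ?F k \<omega>) {1, 2}) 1, (restrict (\<lambda>k. ?F k \<omega>) {1, 2}) 2))"
    by (rule indep_pair_compose[OF indep_pair_if_indep_var, where F = "\<lambda>f. f 0" and H = "\<lambda>f. (f 1, f 2)"])
       (auto intro!: measurable_Pair measurable_component_singleton)
  thus ?thesis by (simp add: numeral_2_eq_2)
qed

lemma indep_z_xi: "indep_pair seq_borel (\<lambda>\<omega> t. z t \<omega>) seq_borel (\<lambda>\<omega> t. xi t \<omega>)"
proof -
  let ?F = "\<lambda>k \<omega> t. ([eps, z, xi] ! k) t \<omega>"
  have "indep_var (PiM {1} (\<lambda>_. seq_borel)) (\<lambda>\<omega>. restrict (\<lambda>k. ?F k \<omega>) {1})
    (PiM {2} (\<lambda>_. seq_borel)) (\<lambda>\<omega>. restrict (\<lambda>k. ?F k \<omega>) {2})"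
    by (rule indep_var_restrict[OF sequences_indep]) auto
  hence "indep_pair seq_borel (\<lambda>\<omega>. (restrict (\<lambda>k. ?F k \<omega>) {1}) 1) seq_borel (\<lambda>\<omega>. (restrict (\<lambda>k. ?F k \<omega>) {2}) 2)"
    by (rule indep_pair_compose[OF indep_pair_if_indep_var, where F = "\<lambda>f. f 1" and H = "\<lambda>f. f 2"])
       (auto intro!: measurable_component_singleton)
  thus ?thesis by (simp add: numeral_2_eq_2)
qed

abbreviation past_borel :: "int \<Rightarrow> (int \<Rightarrow> real) measure" where
  "past_borel t \<equiv> \<Pi>\<^sub>M s\<in>{..<t}. borel"

definition past :: "int \<Rightarrow> 'a \<Rightarrow> int \<Rightarrow> real" where
  "past t \<omega> = restrict (\<lambda>s. eps s \<omega>) {..<t}"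

text \<open>All outliers are included, not only the earlier ones: the outlier at time t itself
  enters the residual at time t, and the outlier sequences are independent of the innovations as a
  whole.\<close>

definition hist :: "int \<Rightarrow> 'a \<Rightarrow> (int \<Rightarrow> real) \<times> (int \<Rightarrow> real) \<times> (int \<Rightarrow> real)" where
  "hist t \<omega> = (past t \<omega>, \<lambda>t. z t \<omega>, \<lambda>t. xi t \<omega>)"

abbreviation hist_borel :: "int \<Rightarrow> ((int \<Rightarrow> real) \<times> (int \<Rightarrow> real) \<times> (int \<Rightarrow> real)) measure" where
  "hist_borel t \<equiv> past_borel t \<Otimes>\<^sub>M (seq_borel \<Otimes>\<^sub>M seq_borel)"

lemma past_measurable [measurable]: "past t \<in> measurable M (past_borel t)"
  unfolding past_def by (rule measurable_restrict) simp

lemma hist_measurable [measurable]: "hist t \<in> measurable M (hist_borel t)"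
  unfolding hist_def by measurable

lemma indep_eps_past: "indep_pair borel (eps t) (past_borel t) (past t)"
proof -
  have "indep_var (PiM {t} (\<lambda>_. borel)) (\<lambda>\<omega>. restrict (\<lambda>s. eps s \<omega>) {t})
     (past_borel t) (\<lambda>\<omega>. restrict (\<lambda>s. eps s \<omega>) {..<t})"
    by (rule indep_var_restrict[OF eps_indep]) auto
  hence "indep_pair borel (\<lambda>\<omega>. (restrict (\<lambda>s. eps s \<omega>) {t}) t) (past_borel t) (\<lambda>\<omega>. restrict (\<lambda>s. eps s \<omega>) {..<t})"
    by (rule indep_pair_compose[OF indep_pair_if_indep_var, where F = "\<lambda>f. f t" and H = "\<lambda>f. f"])
       (auto intro!: measurable_component_singleton)
  thus ?thesis by (simp add: past_def[abs_def])
qed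

lemma restrict_measurable [measurable]: "(\<lambda>e. restrict e {..<t}) \<in> measurable seq_borel (past_borel t)"
  by (rule measurable_restrict_subset) simp

lemma indep_eps_past_zxi:
  "indep_pair (borel \<Otimes>\<^sub>M past_borel t) (\<lambda>\<omega>. (eps t \<omega>, past t \<omega>)) (seq_borel \<Otimes>\<^sub>M seq_borel) (\<lambda>\<omega>. (\<lambda>t. z t \<omega>, \<lambda>t. xi t \<omega>))"
  using indep_pair_compose[OF indep_eps_zxi, of "\<lambda>e. (e t, restrict e {..<t})" "borel \<Otimes>\<^sub>M past_borel t" "\<lambda>q. q" "seq_borel \<Otimes>\<^sub>M seq_borel"]
  by (simp add: past_def)

lemma indep_past_zxi:
  "indep_pair (past_borel t) (past t) (seq_borel \<Otimes>\<^sub>M seq_borel) (\<lambda>\<omega>. (\<lambda>t. z t \<omega>, \<lambda>t. xi t \<omega>))"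
  using indep_pair_compose[OF indep_eps_zxi, of "\<lambda>e. restrict e {..<t}" "past_borel t" "\<lambda>q. q" "seq_borel \<Otimes>\<^sub>M seq_borel"]
  by (simp add: past_def[abs_def])

abbreviation A :: "real measure" where "A \<equiv> distr M borel (eps 1)"

text \<open>The tower property, stated without conditional expectations. With the outliers frozen,
  the innovation is integrated out against the past; afterwards the outliers are put back.\<close>

lemma expectation_innovation:
  fixes f :: "real \<Rightarrow> (int \<Rightarrow> real) \<times> (int \<Rightarrow> real) \<times> (int \<Rightarrow> real) \<Rightarrow> real"
  assumes f[measurable]: "case_prod f \<in> borel_measurable (borel \<Otimes>\<^sub>M hist_borel t)" and B: "\<And>e h. \<bar>f e h\<bar> \<le> B"
  shows "expectation (\<lambda>\<omega>. f (eps t \<omega>) (hist t \<omega>)) = expectation (\<lambda>\<omega>. \<integral>e. f e (hist t \<omega>) \<partial>A)"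
proof -
  have B0: "0 \<le> B" by (rule order_trans[OF abs_ge_zero B[of 0 "(\<lambda>_. 0, \<lambda>_. 0, \<lambda>_. 0)"]])
  define k where "k b q = (\<integral>e. f e (b, q) \<partial>A)" for b q
  interpret A: prob_space A by (rule prob_space_distr) simp
  have A: "distr M borel (eps t) = A" by (rule distr_eps)
  have km: "case_prod k \<in> borel_measurable (past_borel t \<Otimes>\<^sub>M (seq_borel \<Otimes>\<^sub>M seq_borel))"
  proof -
    have "(\<lambda>h. \<integral>e. f e h \<partial>A) \<in> borel_measurable (hist_borel t)"
      by (rule A.borel_measurable_lebesgue_integral) measurable
    moreover have "case_prod k = (\<lambda>h. \<integral>e. f e h \<partial>A)" by (auto simp: k_def fun_eq_iff)
    ultimately show ?thesis by simp
  qed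
  have kB: "\<bar>k b q\<bar> \<le> B" if "b \<in> space (past_borel t)" "q \<in> space (seq_borel \<Otimes>\<^sub>M seq_borel)" for b q
  proof -
    have [measurable]: "(\<lambda>e. f e (b, q)) \<in> borel_measurable borel"
      by (rule measurable_compose[OF _ f, of "\<lambda>e. (e, (b, q))", simplified]) (use that in measurable)
    have "\<bar>k b q\<bar> \<le> (\<integral>e. \<bar>f e (b, q)\<bar> \<partial>A)" unfolding k_def by (rule integral_abs_bound)
    also have "\<dots> \<le> (\<integral>e. B \<partial>A)"
      by (intro integral_mono A.integrable_bounded[where B = B]) (auto simp: B B0)
    finally show ?thesis using A.prob_space by simp
  qed
  \<comment> \<open>The bound on \<open>k\<close> is proved only for arguments in the underlying
    spaces, whereas Fubini is stated with a bound valid everywhere; hence the value 0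
    elsewhere.\<close>
  define k' where "k' b q = (if b \<in> space (past_borel t) then k b q else 0)" for b q
  have k': "\<bar>k' b q\<bar> \<le> B" for b q using kB[of b q] B0 by (auto simp: k'_def space_pair_measure space_PiM)
  have k'm: "case_prod k' \<in> borel_measurable (past_borel t \<Otimes>\<^sub>M (seq_borel \<Otimes>\<^sub>M seq_borel))"
    using km by (rule measurable_cong[THEN iffD1, rotated]) (auto simp: k'_def space_pair_measure)
  have "expectation (\<lambda>\<omega>. f (eps t \<omega>) (hist t \<omega>))
      = expectation (\<lambda>\<omega>. (\<lambda>(e, b) q. f e (b, q)) (eps t \<omega>, past t \<omega>) (\<lambda>t. z t \<omega>, \<lambda>t. xi t \<omega>))"
    by (simp add: hist_def)
  also have "\<dots> = (\<integral>q. expectation (\<lambda>\<omega>. (\<lambda>(e, b) q. f e (b, q)) (eps t \<omega>, past t \<omega>) q) \<partial>distr M (seq_borel \<Otimes>\<^sub>M seq_borel) (\<lambda>\<omega>. (\<lambda>t. z t \<omega>, \<lambda>t. xi t \<omega>)))"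
    by (rule indep_pair_expectation(1)[OF indep_eps_past_zxi, where B = B]) (auto simp: B split_beta' split: prod.split)
  also have "\<dots> = (\<integral>q. expectation (\<lambda>\<omega>. k' (past t \<omega>) q) \<partial>distr M (seq_borel \<Otimes>\<^sub>M seq_borel) (\<lambda>\<omega>. (\<lambda>t. z t \<omega>, \<lambda>t. xi t \<omega>)))"
  proof (rule Bochner_Integration.integral_cong[OF refl])
    fix q assume "q \<in> space (distr M (seq_borel \<Otimes>\<^sub>M seq_borel) (\<lambda>\<omega>. (\<lambda>t. z t \<omega>, \<lambda>t. xi t \<omega>)))"
    hence q: "q \<in> space (seq_borel \<Otimes>\<^sub>M seq_borel)" by simp
    have "expectation (\<lambda>\<omega>. f (eps t \<omega>) (past t \<omega>, q)) = expectation (\<lambda>\<omega>. \<integral>e. f e (past t \<omega>, q) \<partial>A)"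
      using indep_pair_expectation(2)[OF indep_eps_past[of t], of "\<lambda>e b. f e (b, q)" B] q
      by (simp add: B A split_beta')
    also have "\<dots> = expectation (\<lambda>\<omega>. k' (past t \<omega>) q)"
      by (intro Bochner_Integration.integral_cong refl)
         (auto simp: k'_def k_def dest: measurable_space[OF past_measurable])
    finally show "expectation (\<lambda>\<omega>. (\<lambda>(e, b) q. f e (b, q)) (eps t \<omega>, past t \<omega>) q) = expectation (\<lambda>\<omega>. k' (past t \<omega>) q)" by simp
  qed
  also have "\<dots> = expectation (\<lambda>\<omega>. k' (past t \<omega>) (\<lambda>t. z t \<omega>, \<lambda>t. xi t \<omega>))"
    by (rule indep_pair_expectation(1)[OF indep_past_zxi k'm k', symmetric])
  also have "\<dots> = expectation (\<lambda>\<omega>. \<integral>e. f e (hist t \<omega>) \<partial>A)"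
    by (intro Bochner_Integration.integral_cong refl)
       (auto simp: k'_def k_def hist_def dest: measurable_space[OF past_measurable])
  finally show ?thesis .
qed

text \<open>A residual is the innovation minus a perturbation u, so it lies below x exactly when the
  innovation lies below x + u. This is the resulting change of the indicator at level x.\<close>

definition jump :: "real \<Rightarrow> real \<Rightarrow> real \<Rightarrow> real" where
  "jump x u e = of_bool (e \<le> x + u) - of_bool (e \<le> x)"

lemma jump_measurable [measurable]: "(\<lambda>(u, e). jump x u e) \<in> borel_measurable (borel \<Otimes>\<^sub>M borel)"
  unfolding jump_def of_bool_def by measurable

lemma jump_measurable' [measurable (raw)]:
  fixes f h :: "'b \<Rightarrow> real"
  assumes [measurable]: "f \<in> borel_measurable N" "h \<in> borel_measurable N"
  shows "(\<lambda>\<omega>. jump x (f \<omega>) (h \<omega>)) \<in> borel_measurable N"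
  unfolding jump_def of_bool_def by measurable

lemma jump_bound: "\<bar>jump x u e\<bar> \<le> 1" "(jump x u e)\<^sup>2 = \<bar>jump x u e\<bar>"
  by (auto simp: jump_def)

lemma integral_jump: "(\<integral>e. jump x u e \<partial>A) = G (x + u) - G x" "(\<integral>e. \<bar>jump x u e\<bar> \<partial>A) = \<bar>G (x + u) - G x\<bar>"
proof -
  interpret A: real_distribution A by (rule eps_law)
  have G: "(\<integral>e. of_bool (e \<le> y) \<partial>A) = G y" for y
  proof -
    have "(\<integral>e. of_bool (e \<le> y) \<partial>A) = (\<integral>e. indicator {..y} e \<partial>A)"
      by (intro Bochner_Integration.integral_cong) (auto simp: indicator_def)
    also have "\<dots> = cdf A y" by (simp add: cdf_def)
    finally show ?thesis by (simp add: eps_cdf)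
  qed
  have int: "integrable A (\<lambda>e. of_bool (e \<le> y) :: real)" for y
    by (rule A.integrable_bounded[where B = 1]) (auto simp: of_bool_def)
  show 1: "(\<integral>e. jump x u e \<partial>A) = G (x + u) - G x"
    unfolding jump_def by (subst Bochner_Integration.integral_diff) (auto simp: G int)
  show "(\<integral>e. \<bar>jump x u e\<bar> \<partial>A) = \<bar>G (x + u) - G x\<bar>"
  proof (cases "0 \<le> u")
    case True
    hence "\<bar>jump x u e\<bar> = jump x u e" for e by (auto simp: jump_def)
    thus ?thesis using 1 G_mono[of x "x + u"] True by simp
  next
    case False
    hence "\<bar>jump x u e\<bar> = - jump x u e" for e by (auto simp: jump_def)
    thus ?thesis using 1 G_mono[of "x + u" x] False by simp
  qed
qed

text \<open>The compensated jump counts are orthogonal because \<open>W t\<close> is a function of the innovations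
  before \<open>t\<close> and of all outliers.\<close>

lemma compensated_jumps:
  fixes W :: "int \<Rightarrow> (int \<Rightarrow> real) \<times> (int \<Rightarrow> real) \<times> (int \<Rightarrow> real) \<Rightarrow> real" and x :: real
  assumes W[measurable]: "\<And>t. W t \<in> borel_measurable (hist_borel t)"
  defines "a \<equiv> \<lambda>t \<omega>. jump x (W t (hist t \<omega>)) (eps t \<omega>) - (G (x + W t (hist t \<omega>)) - G x)"
  shows "expectation (\<lambda>\<omega>. (\<Sum>t = 1..int n. a t \<omega>)\<^sup>2) \<le> 4 * (\<Sum>t = 1..int n. expectation (\<lambda>\<omega>. \<bar>G (x + W t (hist t \<omega>)) - G x\<bar>))"
proof -
  interpret A: real_distribution A by (rule eps_law)
  have am[measurable]: "a t \<in> borel_measurable M" for t unfolding a_def by measurable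
  have dG: "\<bar>G y - G y'\<bar> \<le> 1" for y y' using G_bounds[of y] G_bounds[of y'] by auto
  have aB: "\<bar>a t \<omega>\<bar> \<le> 2" for t \<omega>
    unfolding a_def using jump_bound(1)[of x "W t (hist t \<omega>)" "eps t \<omega>"] dG[of "x + W t (hist t \<omega>)" x] by linarith
  have int2: "integrable M (\<lambda>\<omega>. a s \<omega> * a t \<omega>)" for s t
    by (rule integrable_bounded[where B = "2 * 2"], measurable, unfold abs_mult real_norm_def, intro mult_mono aB) auto
  have orth: "expectation (\<lambda>\<omega>. a s \<omega> * a t \<omega>) = 0" if "s < t" for s t
  proof -
    \<comment> \<open>For s < t the factor at time s is rewritten as a function of
      \<open>hist t\<close>: the innovation at s and the past before s are both read off from the
      past before t. The remaining factor at time t integrates to 0 over the innovation.\<close>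
    define f where "f e h = (jump x (W t h) e - (G (x + W t h) - G x)) *
      (jump x (W s (restrict (fst h) {..<s}, snd h)) (fst h s) - (G (x + W s (restrict (fst h) {..<s}, snd h)) - G x))" for e h
    have [measurable]: "(\<lambda>e. restrict e {..<s}) \<in> measurable (past_borel t) (past_borel s)"
      by (rule measurable_restrict_subset) (use that in auto)
    have [measurable]: "(\<lambda>e. e s) \<in> borel_measurable (past_borel t)"
      by (rule measurable_component_singleton) (use that in auto)
    have fm: "case_prod f \<in> borel_measurable (borel \<Otimes>\<^sub>M hist_borel t)" unfolding f_def by measurable
    have fB: "\<bar>f e h\<bar> \<le> 2 * 2" for e h
    proof -
      have "\<bar>jump x u e - (G (x + u) - G x)\<bar> \<le> 2" for u e
        using jump_bound(1)[of x u e] dG[of "x + u" x] by linarith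
      thus ?thesis unfolding f_def abs_mult by (intro mult_mono) auto
    qed
    have 0: "(\<integral>e. f e h \<partial>A) = 0" for h
    proof -
      have "integrable A (\<lambda>e. jump x (W t h) e)"
        by (rule A.integrable_bounded[where B = 1]) (auto simp: jump_bound)
      hence "(\<integral>e. (jump x (W t h) e - (G (x + W t h) - G x)) \<partial>A) = 0"
        using A.prob_space by (subst Bochner_Integration.integral_diff) (auto simp: integral_jump)
      thus ?thesis unfolding f_def by simp
    qed
    have "past s \<omega> = restrict (past t \<omega>) {..<s}" for \<omega>
      using that by (auto simp: past_def fun_eq_iff restrict_def)
    hence "a s \<omega> * a t \<omega> = f (eps t \<omega>) (hist t \<omega>)" for \<omega>
      using that by (simp add: f_def a_def hist_def mult.commute past_def)
    hence "expectation (\<lambda>\<omega>. a s \<omega> * a t \<omega>) = expectation (\<lambda>\<omega>. f (eps t \<omega>) (hist t \<omega>))" by simp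
    also have "\<dots> = expectation (\<lambda>\<omega>. \<integral>e. f e (hist t \<omega>) \<partial>A)" by (rule expectation_innovation[OF fm fB])
    finally show ?thesis by (simp add: 0)
  qed
  have orth': "expectation (\<lambda>\<omega>. a s \<omega> * a t \<omega>) = 0" if "s \<noteq> t" for s t
  proof (cases "s < t")
    case False
    hence "t < s" using that by simp
    from orth[OF this] show ?thesis by (simp add: mult.commute)
  qed (rule orth)
  \<comment> \<open>With J the jump and D its compensator, (J - D)^2 <= 2 J^2 + 2 D^2 <= 2 |J| + 2
    |D|, because both are bounded by 1 and J^2 = |J|. As E |J| = E |D|, the factor is 4.\<close>
  have sq: "expectation (\<lambda>\<omega>. a t \<omega> * a t \<omega>) \<le> 4 * expectation (\<lambda>\<omega>. \<bar>G (x + W t (hist t \<omega>)) - G x\<bar>)" for t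
  proof -
    define D where "D \<omega> = G (x + W t (hist t \<omega>)) - G x" for \<omega>
    define J where "J \<omega> = jump x (W t (hist t \<omega>)) (eps t \<omega>)" for \<omega>
    have [measurable]: "D \<in> borel_measurable M" "J \<in> borel_measurable M" unfolding D_def J_def by measurable
    have DB: "\<bar>D \<omega>\<bar> \<le> 1" for \<omega> using dG by (simp add: D_def)
    have JB: "\<bar>J \<omega>\<bar> \<le> 1" "(J \<omega>)\<^sup>2 = \<bar>J \<omega>\<bar>" for \<omega> by (auto simp: J_def jump_bound)
    have int: "integrable M (\<lambda>\<omega>. \<bar>D \<omega>\<bar>)" "integrable M (\<lambda>\<omega>. \<bar>J \<omega>\<bar>)"
      by (auto intro!: integrable_bounded[where B = 1] simp: DB JB(1))
    have "a t \<omega> * a t \<omega> \<le> 2 * \<bar>J \<omega>\<bar> + 2 * \<bar>D \<omega>\<bar>" for \<omega>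
    proof -
      have "0 \<le> (J \<omega> + D \<omega>)\<^sup>2" by simp
      hence "(J \<omega> - D \<omega>)\<^sup>2 \<le> 2 * (J \<omega>)\<^sup>2 + 2 * (D \<omega>)\<^sup>2" by (simp add: power2_diff power2_sum)
      moreover have "(D \<omega>)\<^sup>2 \<le> \<bar>D \<omega>\<bar>"
        using mult_left_le[of "\<bar>D \<omega>\<bar>" "\<bar>D \<omega>\<bar>"] DB[of \<omega>] by (simp add: power2_eq_square)
      moreover have "a t \<omega> * a t \<omega> = (J \<omega> - D \<omega>)\<^sup>2" by (simp add: a_def J_def D_def power2_eq_square)
      ultimately show ?thesis using JB(2)[of \<omega>] by linarith
    qed
    hence "expectation (\<lambda>\<omega>. a t \<omega> * a t \<omega>) \<le> expectation (\<lambda>\<omega>. 2 * \<bar>J \<omega>\<bar> + 2 * \<bar>D \<omega>\<bar>)"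
      using int by (intro integral_mono int2) auto
    also have "\<dots> = 2 * expectation (\<lambda>\<omega>. \<bar>J \<omega>\<bar>) + 2 * expectation (\<lambda>\<omega>. \<bar>D \<omega>\<bar>)"
      using int by (subst Bochner_Integration.integral_add) auto
    also have "expectation (\<lambda>\<omega>. \<bar>J \<omega>\<bar>) = expectation (\<lambda>\<omega>. \<bar>D \<omega>\<bar>)"
    proof -
      have "expectation (\<lambda>\<omega>. \<bar>J \<omega>\<bar>) = expectation (\<lambda>\<omega>. \<integral>e. \<bar>jump x (W t (hist t \<omega>)) e\<bar> \<partial>A)"
        unfolding J_def
        by (rule expectation_innovation[of "\<lambda>e h. \<bar>jump x (W t h) e\<bar>" t 1]) (auto simp: jump_bound)
      thus ?thesis by (simp add: integral_jump D_def)
    qed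
    finally show ?thesis by (simp add: D_def)
  qed
  have "expectation (\<lambda>\<omega>. (\<Sum>t = 1..int n. a t \<omega>)\<^sup>2) = expectation (\<lambda>\<omega>. \<Sum>s = 1..int n. \<Sum>t = 1..int n. a s \<omega> * a t \<omega>)"
    by (simp add: power2_eq_square sum_product)
  also have "\<dots> = (\<Sum>s = 1..int n. \<Sum>t = 1..int n. expectation (\<lambda>\<omega>. a s \<omega> * a t \<omega>))"
    by (simp add: Bochner_Integration.integral_sum int2)
  also have "\<dots> = (\<Sum>s = 1..int n. \<Sum>t = 1..int n. if s = t then expectation (\<lambda>\<omega>. a t \<omega> * a t \<omega>) else 0)"
    by (intro sum.cong refl) (auto simp: orth')
  also have "\<dots> = (\<Sum>t = 1..int n. expectation (\<lambda>\<omega>. a t \<omega> * a t \<omega>))"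
    by (simp add: sum.delta)
  also have "\<dots> \<le> (\<Sum>t = 1..int n. 4 * expectation (\<lambda>\<omega>. \<bar>G (x + W t (hist t \<omega>)) - G x\<bar>))"
    by (intro sum_mono sq)
  finally show ?thesis by (simp add: sum_distrib_left)
qed

end

subsection \<open>Residuals as perturbed innovations\<close>

text \<open>Case distinction on the number of outliers in the window. Without outliers the identity
  is exact. With one, only its own jump remains and the small perturbation moves the argument of
  \<open>G\<close> a little. With two or more nothing is gained, and the trivial bound is charged to
  the pairs. The increments are kept as they are, since the outlier sizes may be arbitrarily
  large.\<close>

lemma single_outlier_expansion:
  fixes G :: "real \<Rightarrow> real" and \<zeta> \<eta> \<kappa> :: "nat \<Rightarrow> real"
  assumes G: "\<And>y. 0 \<le> G y" "\<And>y. G y \<le> 1" and L: "0 \<le> L" "\<And>y y'. \<bar>G y - G y'\<bar> \<le> L * \<bar>y - y'\<bar>"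
    and a: "0 \<le> a" and B: "0 \<le> B" and Y: "0 \<le> Y" and \<zeta>: "\<And>j. j \<le> p \<Longrightarrow> \<zeta> j \<in> {0, 1}"
    and h: "\<bar>h\<bar> \<le> 2 * B * (Y + (\<Sum>j\<le>p. \<zeta> j * \<bar>\<eta> j\<bar>))" and h0: "\<bar>h0\<bar> \<le> 2 * B * Y"
    and eq: "(\<And>j. j \<le> p \<Longrightarrow> \<zeta> j = 0) \<Longrightarrow> h = h0"
  shows "\<bar>(G (x + ((\<Sum>j\<le>p. \<kappa> j * (\<zeta> j * \<eta> j)) + a * h)) - G x) - (G (x + a * h0) - G x)
           - (\<Sum>j\<le>p. \<zeta> j * (G (x + \<kappa> j * \<eta> j) - G x))\<bar>
      \<le> (\<Sum>j\<le>p. \<zeta> j * (4 * L * a * B * Y + min 1 (2 * L * a * B * \<bar>\<eta> j\<bar>)))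
         + (real p + 3) * (\<Sum>i\<le>p. \<Sum>j\<in>{..p} - {i}. \<zeta> i * \<zeta> j)" (is "\<bar>?err\<bar> \<le> ?R1 + (real p + 3) * ?R2")
proof -
  have \<zeta>_nonneg: "0 \<le> \<zeta> j" if "j \<le> p" for j using \<zeta>[OF that] by auto
  have R1: "0 \<le> ?R1" using L(1) a B Y by (intro sum_nonneg mult_nonneg_nonneg \<zeta>_nonneg add_nonneg_nonneg) auto
  have R2: "0 \<le> ?R2" by (intro sum_nonneg mult_nonneg_nonneg \<zeta>_nonneg) auto
  have G1: "\<bar>G y - G y'\<bar> \<le> 1" for y y' using G[of y] G[of y'] by auto
  consider (none) "\<And>j. j \<le> p \<Longrightarrow> \<zeta> j = 0"
    | (two) i j where "i \<le> p" "j \<le> p" "i \<noteq> j" "\<zeta> i = 1" "\<zeta> j = 1"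
    | (one) k where "k \<le> p" "\<zeta> k = 1" "\<And>j. j \<le> p \<Longrightarrow> j \<noteq> k \<Longrightarrow> \<zeta> j = 0"
    using \<zeta> by (metis insertE singletonD)
  thus ?thesis
  proof cases
    case none
    thus ?thesis using eq R1 R2 by simp
  next
    case (two i j)
    have "1 = \<zeta> i * \<zeta> j" using two by simp
    also have "\<dots> \<le> (\<Sum>j\<in>{..p} - {i}. \<zeta> i * \<zeta> j)"
      by (rule member_le_sum) (use two in \<open>auto intro!: mult_nonneg_nonneg \<zeta>_nonneg\<close>)
    also have "\<dots> \<le> ?R2"
      by (rule member_le_sum[of i "{..p}" "\<lambda>i. \<Sum>j\<in>{..p} - {i}. \<zeta> i * \<zeta> j"])
         (use two in \<open>auto intro!: sum_nonneg mult_nonneg_nonneg \<zeta>_nonneg\<close>)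
    finally have "1 \<le> ?R2" .
    hence R: "real p + 3 \<le> (real p + 3) * ?R2" using mult_left_mono[of 1 ?R2 "real p + 3"] by simp
    \<comment> \<open>Origin of p + 3: the p + 1 summands and the two increments of \<open>G\<close>
      are each at most 1.\<close>
    have "\<bar>\<Sum>j\<le>p. \<zeta> j * (G (x + \<kappa> j * \<eta> j) - G x)\<bar> \<le> (\<Sum>j\<le>p. \<bar>\<zeta> j * (G (x + \<kappa> j * \<eta> j) - G x)\<bar>)"
      by (rule sum_abs)
    also have "\<dots> \<le> (\<Sum>j\<le>p. 1)"
    proof (rule sum_mono)
      fix j assume "j \<in> {..p}"
      thus "\<bar>\<zeta> j * (G (x + \<kappa> j * \<eta> j) - G x)\<bar> \<le> 1" using \<zeta>[of j] G1[of "x + \<kappa> j * \<eta> j" x] by auto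
    qed
    finally have "\<bar>\<Sum>j\<le>p. \<zeta> j * (G (x + \<kappa> j * \<eta> j) - G x)\<bar> \<le> real p + 1" by simp
    hence "\<bar>?err\<bar> \<le> real p + 3"
      using G1[of "x + ((\<Sum>j\<le>p. \<kappa> j * (\<zeta> j * \<eta> j)) + a * h)" x] G1[of "x + a * h0" x] by linarith
    thus ?thesis using R R1 by linarith
  next
    case (one k)
    have s: "(\<Sum>j\<le>p. f j * \<zeta> j) = f k" for f :: "nat \<Rightarrow> real"
    proof -
      have "(\<Sum>j\<le>p. f j * \<zeta> j) = (\<Sum>j\<in>{k}. f j * \<zeta> j)"
        using one by (intro sum.mono_neutral_right) auto
      thus ?thesis using one by simp
    qed
    have s1: "(\<Sum>j\<le>p. \<kappa> j * (\<zeta> j * \<eta> j)) = \<kappa> k * \<eta> k" using s[of "\<lambda>j. \<kappa> j * \<eta> j"] by (simp add: mult_ac)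
    have s2: "(\<Sum>j\<le>p. \<zeta> j * (G (x + \<kappa> j * \<eta> j) - G x)) = G (x + \<kappa> k * \<eta> k) - G x"
      using s[of "\<lambda>j. G (x + \<kappa> j * \<eta> j) - G x"] by (simp add: mult.commute)
    have s3: "?R1 = 4 * L * a * B * Y + min 1 (2 * L * a * B * \<bar>\<eta> k\<bar>)"
      using s[of "\<lambda>j. 4 * L * a * B * Y + min 1 (2 * L * a * B * \<bar>\<eta> j\<bar>)"] by (simp add: mult.commute)
    have s4: "(\<Sum>j\<le>p. \<zeta> j * \<bar>\<eta> j\<bar>) = \<bar>\<eta> k\<bar>"
      using s[of "\<lambda>j. \<bar>\<eta> j\<bar>"] by (simp add: mult.commute)
    \<comment> \<open>The perturbation contains the outlier through the lagged regressors, so the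
      Lipschitz bound is linear in |\<eta>|. Cutting that part off at 1, the maximal increment of
      \<open>G\<close>, keeps it integrable for every outlier law.\<close>
    have e1: "\<bar>G (x + (\<kappa> k * \<eta> k + a * h)) - G (x + \<kappa> k * \<eta> k)\<bar> \<le> 2 * L * a * B * Y + min 1 (2 * L * a * B * \<bar>\<eta> k\<bar>)"
    proof -
      have "\<bar>G (x + (\<kappa> k * \<eta> k + a * h)) - G (x + \<kappa> k * \<eta> k)\<bar> \<le> L * \<bar>a * h\<bar>"
        using L(2)[of "x + (\<kappa> k * \<eta> k + a * h)" "x + \<kappa> k * \<eta> k"] by simp
      also have "\<dots> \<le> L * (a * (2 * B * (Y + \<bar>\<eta> k\<bar>)))"
        using h s4 a L(1) by (auto simp: abs_mult intro!: mult_left_mono)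
      also have "\<dots> = 2 * L * a * B * Y + 2 * L * a * B * \<bar>\<eta> k\<bar>" by (simp add: algebra_simps)
      finally have "\<bar>G (x + (\<kappa> k * \<eta> k + a * h)) - G (x + \<kappa> k * \<eta> k)\<bar> \<le> 2 * L * a * B * Y + 2 * L * a * B * \<bar>\<eta> k\<bar>" .
      moreover have "0 \<le> 2 * L * a * B * Y" using L(1) a B Y by simp
      moreover note G1[of "x + (\<kappa> k * \<eta> k + a * h)" "x + \<kappa> k * \<eta> k"]
      ultimately show ?thesis by linarith
    qed
    have e2: "\<bar>G (x + a * h0) - G x\<bar> \<le> 2 * L * a * B * Y"
    proof -
      have "\<bar>G (x + a * h0) - G x\<bar> \<le> L * \<bar>a * h0\<bar>" using L(2)[of "x + a * h0" x] by simp
      also have "\<dots> \<le> L * (a * (2 * B * Y))"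
        using h0 a L(1) by (auto simp: abs_mult intro!: mult_left_mono)
      finally show ?thesis by (simp add: mult_ac)
    qed
    have "0 \<le> (real p + 3) * ?R2" using R2 by simp
    thus ?thesis unfolding s1 s2 s3 using e1 e2 by linarith
  qed
qed

section \<open>The perturbation of a residual as a function of the history\<close>

context ar_model
begin

text \<open>The weight with which an outlier at lag j enters the perturbation; the sign at lag 0 is
  negative because the perturbation is subtracted from the innovation.\<close>

definition kap :: "nat \<Rightarrow> real" where "kap j = (if j = 0 then -1 else \<beta> j)"

definition outl :: "int \<Rightarrow> 'a \<Rightarrow> real" where
  "outl t \<omega> = (\<Sum>j\<le>p. kap j * (z (t - int j) \<omega> * xi (t - int j) \<omega>))"

definition reg :: "int \<Rightarrow> nat \<Rightarrow> 'a \<Rightarrow> real" where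
  "reg t i \<omega> = (if i = 0 then 1 else V (t - int i) \<omega> + z (t - int i) \<omega> * xi (t - int i) \<omega>)"

definition reg0 :: "int \<Rightarrow> nat \<Rightarrow> 'a \<Rightarrow> real" where
  "reg0 t i \<omega> = (if i = 0 then 1 else V (t - int i) \<omega>)"

text \<open>For d = 0 this is a linear form in the regressors, with index 0 as the intercept. The
  term with d is a slack: with coefficient d or -d it bounds the linear form of every coefficient
  vector within distance d of b from above or below.\<close>

definition pert :: "(nat \<Rightarrow> real) \<Rightarrow> real \<Rightarrow> int \<Rightarrow> 'a \<Rightarrow> real" where
  "pert b d t \<omega> = (\<Sum>i\<le>p. b i * reg t i \<omega>) + d * (\<Sum>i\<le>p. \<bar>reg t i \<omega>\<bar>)"

definition pert0 :: "(nat \<Rightarrow> real) \<Rightarrow> real \<Rightarrow> int \<Rightarrow> 'a \<Rightarrow> real" where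
  "pert0 b d t \<omega> = (\<Sum>i\<le>p. b i * reg0 t i \<omega>) + d * (\<Sum>i\<le>p. \<bar>reg0 t i \<omega>\<bar>)"

definition absreg :: "int \<Rightarrow> 'a \<Rightarrow> real" where "absreg t \<omega> = (\<Sum>i\<le>p. \<bar>reg0 t i \<omega>\<bar>)"

lemma reg_measurable [measurable]: "reg t i \<in> borel_measurable M" "reg0 t i \<in> borel_measurable M"
  unfolding reg_def reg0_def by measurable

lemma pert_measurable [measurable]: "pert b d t \<in> borel_measurable M" "pert0 b d t \<in> borel_measurable M"
    "absreg t \<in> borel_measurable M" "outl t \<in> borel_measurable M"
  unfolding pert_def pert0_def absreg_def outl_def by measurable

lemma absreg_nonneg: "0 \<le> absreg t \<omega>" unfolding absreg_def by (intro sum_nonneg) auto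

lemma pert_bound:
  assumes b: "\<forall>i\<le>p. \<bar>b i\<bar> \<le> B" and d: "\<bar>d\<bar> \<le> B" and z: "\<forall>j\<le>p. z (t - int j) \<omega> \<in> {0, 1}"
  shows "\<bar>pert0 b d t \<omega>\<bar> \<le> 2 * B * absreg t \<omega>"
    "\<bar>pert b d t \<omega>\<bar> \<le> 2 * B * (absreg t \<omega> + (\<Sum>j\<le>p. z (t - int j) \<omega> * \<bar>xi (t - int j) \<omega>\<bar>))"
proof -
  have B: "0 \<le> B" using d by auto
  have gen: "\<bar>(\<Sum>i\<le>p. b i * r i) + d * (\<Sum>i\<le>p. \<bar>r i\<bar>)\<bar> \<le> 2 * B * (\<Sum>i\<le>p. \<bar>r i\<bar>)" for r :: "nat \<Rightarrow> real"
  proof -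
    have "\<bar>\<Sum>i\<le>p. b i * r i\<bar> \<le> (\<Sum>i\<le>p. \<bar>b i * r i\<bar>)" by (rule sum_abs)
    also have "\<dots> \<le> (\<Sum>i\<le>p. B * \<bar>r i\<bar>)" by (intro sum_mono) (auto simp: abs_mult intro!: mult_right_mono b[rule_format])
    also have "\<dots> = B * (\<Sum>i\<le>p. \<bar>r i\<bar>)" by (simp add: sum_distrib_left)
    finally have 1: "\<bar>\<Sum>i\<le>p. b i * r i\<bar> \<le> B * (\<Sum>i\<le>p. \<bar>r i\<bar>)" .
    have "0 \<le> (\<Sum>i\<le>p. \<bar>r i\<bar>)" by (intro sum_nonneg) auto
    hence 2: "\<bar>d * (\<Sum>i\<le>p. \<bar>r i\<bar>)\<bar> \<le> B * (\<Sum>i\<le>p. \<bar>r i\<bar>)" using d by (simp add: abs_mult mult_right_mono)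
    show ?thesis using 1 2 by linarith
  qed
  show "\<bar>pert0 b d t \<omega>\<bar> \<le> 2 * B * absreg t \<omega>" unfolding pert0_def absreg_def by (rule gen)
  have "\<bar>reg t i \<omega>\<bar> \<le> \<bar>reg0 t i \<omega>\<bar> + z (t - int i) \<omega> * \<bar>xi (t - int i) \<omega>\<bar>" if "i \<le> p" for i
    using z[rule_format, OF that] by (auto simp: reg_def reg0_def)
  hence "(\<Sum>i\<le>p. \<bar>reg t i \<omega>\<bar>) \<le> (\<Sum>i\<le>p. \<bar>reg0 t i \<omega>\<bar> + z (t - int i) \<omega> * \<bar>xi (t - int i) \<omega>\<bar>)"
    by (intro sum_mono) auto
  also have "\<dots> = absreg t \<omega> + (\<Sum>j\<le>p. z (t - int j) \<omega> * \<bar>xi (t - int j) \<omega>\<bar>)"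
    by (simp add: absreg_def sum.distrib)
  finally have "2 * B * (\<Sum>i\<le>p. \<bar>reg t i \<omega>\<bar>) \<le> 2 * B * (absreg t \<omega> + (\<Sum>j\<le>p. z (t - int j) \<omega> * \<bar>xi (t - int j) \<omega>\<bar>))"
    using B by (intro mult_left_mono) auto
  thus "\<bar>pert b d t \<omega>\<bar> \<le> 2 * B * (absreg t \<omega> + (\<Sum>j\<le>p. z (t - int j) \<omega> * \<bar>xi (t - int j) \<omega>\<bar>))"
    unfolding pert_def using gen[of "\<lambda>i. reg t i \<omega>"] by linarith
qed

text \<open>The whole perturbation written as an explicit function of the history, which makes it
  predictable: index 0 is the constant regressor, so the innovation sequence is read only at times
  before t.\<close>

definition Wt :: "real \<Rightarrow> (nat \<Rightarrow> real) \<Rightarrow> real \<Rightarrow> int \<Rightarrow> (int \<Rightarrow> real) \<times> (int \<Rightarrow> real) \<times> (int \<Rightarrow> real) \<Rightarrow> real" where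
  "Wt a b d t = (\<lambda>(e, zz, x).
     let r = (\<lambda>i. if i = 0 then 1 else causal c (t - int i) e + zz (t - int i) * x (t - int i))
     in (\<Sum>j\<le>p. kap j * (zz (t - int j) * x (t - int j)))
        + a * ((\<Sum>i\<le>p. b i * r i) + d * (\<Sum>i\<le>p. \<bar>r i\<bar>)))"

lemma Wt_measurable: "Wt a b d t \<in> borel_measurable (hist_borel t)"
proof -
  have [measurable]: "(\<lambda>e. causal c (t - int i) e) \<in> borel_measurable (past_borel t)" if "i \<noteq> 0" for i
    unfolding causal_def
    by (intro borel_measurable_suminf borel_measurable_times borel_measurable_const measurable_component_singleton)
       (use that in auto)
  have r: "(\<lambda>(e, zz, x). if i = 0 then 1 else causal c (t - int i) e + zz (t - int i) * x (t - int i)) \<in> borel_measurable (hist_borel t)" for i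
  proof (cases "i = 0")
    case False
    note this[measurable]
    show ?thesis using False by simp measurable
  qed simp
  have [measurable]: "(\<lambda>h. if i = 0 then 1 else causal c (t - int i) (fst h) + fst (snd h) (t - int i) * snd (snd h) (t - int i)) \<in> borel_measurable (hist_borel t)" for i
    using r[of i] by (simp add: split_beta' cong: if_cong)
  show ?thesis unfolding Wt_def Let_def split_beta' by measurable
qed

lemma Wt_hist: "Wt a b d t (hist t \<omega>) = outl t \<omega> + a * pert b d t \<omega>"
proof -
  have "causal c (t - int i) (past t \<omega>) = V (t - int i) \<omega>" if "i \<noteq> 0" for i
    unfolding V_def causal_def past_def using that by (intro suminf_cong) auto
  hence "(if i = 0 then 1 else causal c (t - int i) (past t \<omega>) + z (t - int i) \<omega> * xi (t - int i) \<omega>) = reg t i \<omega>" for i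
    by (simp add: reg_def)
  thus ?thesis by (simp add: Wt_def hist_def Let_def outl_def pert_def)
qed

end

lemma (in prob_space) indep_var_pair:
  assumes "indep_vars (\<lambda>_. borel) X UNIV" "s \<noteq> t"
  shows "indep_var borel (X s) borel (X t)"
proof -
  have "indep_var (PiM {s} (\<lambda>_. borel)) (\<lambda>\<omega>. restrict (\<lambda>s. X s \<omega>) {s}) (PiM {t} (\<lambda>_. borel)) (\<lambda>\<omega>. restrict (\<lambda>s. X s \<omega>) {t})"
    by (rule indep_var_restrict[OF assms(1)]) (use assms(2) in auto)
  hence "indep_pair borel (\<lambda>\<omega>. (restrict (\<lambda>s. X s \<omega>) {s}) s) borel (\<lambda>\<omega>. (restrict (\<lambda>s. X s \<omega>) {t}) t)"
    by (rule indep_pair_compose[OF indep_pair_if_indep_var, where F = "\<lambda>f. f s" and H = "\<lambda>f. f t"])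
       (auto intro!: measurable_component_singleton)
  thus ?thesis unfolding indep_pair_def indep_var_distribution_eq by simp
qed

section \<open>Moments of regressors, outliers and compensators\<close>

context ar_model
begin

lemma g_bounds: "0 \<le> g" "g \<le> 1"
  using z_prob[of 0, symmetric] by (simp_all add: measure_nonneg)

lemma z_nonneg: "AE \<omega> in M. 0 \<le> z t \<omega>"
  using z_range[of t] by eventually_elim auto

lemma z_integrable: "integrable M (z t)"
  by (rule integrable_const_bound[of _ 1]) (use z_range[of t] in \<open>auto elim!: eventually_mono\<close>)

lemma z_mean: "expectation (z t) = g"
proof -
  have "expectation (z t) = expectation (indicator {\<omega> \<in> space M. z t \<omega> = 1})"
    by (rule integral_cong_AE) (use z_range[of t] in \<open>auto elim!: eventually_mono simp: indicator_def\<close>)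
  thus ?thesis using z_prob[of t] by simp
qed

text \<open>\<open>Yb\<close> and \<open>Y2\<close> bound the first two moments of
  \<open>absreg\<close>. They are explicit in \<open>s2\<close>, so that a bound on the innovation
  variance makes them uniform along a sequence of models.\<close>

definition Yb :: real where "Yb = 1 + real p * (1 + cs\<^sup>2 * s2)"

definition Y2 :: real where "Y2 = (real p + 1) * (1 + real p * (cs\<^sup>2 * s2))"

lemma reg0_moments: "integrable M (\<lambda>\<omega>. (reg0 t i \<omega>)\<^sup>2)" "integrable M (\<lambda>\<omega>. \<bar>reg0 t i \<omega>\<bar>)"
    "expectation (\<lambda>\<omega>. (reg0 t i \<omega>)\<^sup>2) \<le> (if i = 0 then 1 else cs\<^sup>2 * s2)"
    "expectation (\<lambda>\<omega>. \<bar>reg0 t i \<omega>\<bar>) \<le> (if i = 0 then 1 else 1 + cs\<^sup>2 * s2)"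
  unfolding reg0_def
  by (cases "i = 0"; simp add: V_square V_integrable V_abs prob_space)+

lemma absreg_moments: "integrable M (absreg t)" "expectation (absreg t) \<le> Yb"
    "integrable M (\<lambda>\<omega>. (absreg t \<omega>)\<^sup>2)" "expectation (\<lambda>\<omega>. (absreg t \<omega>)\<^sup>2) \<le> Y2"
proof -
  show 1: "integrable M (absreg t)" unfolding absreg_def[abs_def]
    by (intro Bochner_Integration.integrable_sum reg0_moments)
  have "expectation (absreg t) = (\<Sum>i\<le>p. expectation (\<lambda>\<omega>. \<bar>reg0 t i \<omega>\<bar>))"
    unfolding absreg_def[abs_def] by (intro Bochner_Integration.integral_sum reg0_moments)
  also have "\<dots> \<le> (\<Sum>i\<le>p. if i = 0 then 1 else 1 + cs\<^sup>2 * s2)" by (intro sum_mono reg0_moments)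
  also have "\<dots> = Yb" by (simp add: Yb_def atMost_atLeast0 sum.atLeast_Suc_atMost)
  finally show "expectation (absreg t) \<le> Yb" .
  have le: "(absreg t \<omega>)\<^sup>2 \<le> (real p + 1) * (\<Sum>i\<le>p. (reg0 t i \<omega>)\<^sup>2)" for \<omega>
    using sum_squared_le_sum_of_squares[of "\<lambda>i. \<bar>reg0 t i \<omega>\<bar>" "{..p}"] by (simp add: absreg_def mult.commute add.commute)
  have int: "integrable M (\<lambda>\<omega>. (real p + 1) * (\<Sum>i\<le>p. (reg0 t i \<omega>)\<^sup>2))"
    by (intro integrable_mult_right Bochner_Integration.integrable_sum reg0_moments)
  show 3: "integrable M (\<lambda>\<omega>. (absreg t \<omega>)\<^sup>2)"
    by (rule Bochner_Integration.integrable_bound[OF int])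
       (auto intro!: AE_I2 order_trans[OF le abs_ge_self])
  have "expectation (\<lambda>\<omega>. (absreg t \<omega>)\<^sup>2) \<le> expectation (\<lambda>\<omega>. (real p + 1) * (\<Sum>i\<le>p. (reg0 t i \<omega>)\<^sup>2))"
    by (intro integral_mono 3 int le)
  also have "\<dots> = (real p + 1) * (\<Sum>i\<le>p. expectation (\<lambda>\<omega>. (reg0 t i \<omega>)\<^sup>2))"
    by (subst integral_mult_right_zero, subst Bochner_Integration.integral_sum) (auto intro: reg0_moments)
  also have "\<dots> \<le> (real p + 1) * (\<Sum>i\<le>p. if i = 0 then 1 else cs\<^sup>2 * s2)"
    by (intro mult_left_mono sum_mono reg0_moments) auto
  also have "\<dots> = Y2" by (simp add: Y2_def atMost_atLeast0 sum.atLeast_Suc_atMost)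
  finally show "expectation (\<lambda>\<omega>. (absreg t \<omega>)\<^sup>2) \<le> Y2" .
qed

text \<open>The clean regressors are functions of the innovations and hence independent of the
  contamination indicators, so the small factor g survives in the expectation.\<close>

lemma z_absreg: "integrable M (\<lambda>\<omega>. z s \<omega> * absreg t \<omega>)" "expectation (\<lambda>\<omega>. z s \<omega> * absreg t \<omega>) \<le> g * Yb"
proof -
  have [measurable]: "(\<lambda>e. causal c t e) \<in> borel_measurable seq_borel" for t
    unfolding causal_def by (intro borel_measurable_suminf borel_measurable_times borel_measurable_const component_measurable)
  have m: "(\<lambda>e. \<Sum>i\<le>p. \<bar>if i = 0 then 1 else causal c (t - int i) e\<bar>) \<in> borel_measurable seq_borel"
    by measurable
  have "indep_pair borel (\<lambda>\<omega>. \<Sum>i\<le>p. \<bar>if i = 0 then 1 else causal c (t - int i) (\<lambda>t. eps t \<omega>)\<bar>) borel (\<lambda>\<omega>. fst (\<lambda>t. z t \<omega>, \<lambda>t. xi t \<omega>) s)"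
    by (rule indep_pair_compose[OF indep_eps_zxi m]) measurable
  hence "indep_var borel (absreg t) borel (z s)"
    unfolding indep_pair_def indep_var_distribution_eq absreg_def[abs_def] reg0_def V_def by simp
  note * = indep_var_lebesgue_integral[OF this absreg_moments(1) z_integrable] indep_var_integrable[OF this absreg_moments(1) z_integrable]
  show "integrable M (\<lambda>\<omega>. z s \<omega> * absreg t \<omega>)" using *(2) by (simp add: mult.commute)
  show "expectation (\<lambda>\<omega>. z s \<omega> * absreg t \<omega>) \<le> g * Yb"
    using *(1) absreg_moments(2)[of t] g_bounds by (simp add: mult.commute z_mean mult_left_mono)
qed

lemma z_xi:
  fixes m :: "real \<Rightarrow> real"
  assumes [measurable]: "m \<in> borel_measurable borel" and K: "\<And>s. \<bar>m s\<bar> \<le> K"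
  shows "integrable M (\<lambda>\<omega>. z s \<omega> * m (xi s \<omega>))" "expectation (\<lambda>\<omega>. z s \<omega> * m (xi s \<omega>)) = g * (\<integral>y. m y \<partial>Q)"
proof -
  have "indep_pair borel (\<lambda>\<omega>. z s \<omega>) borel (\<lambda>\<omega>. m (xi s \<omega>))"
    by (rule indep_pair_compose[OF indep_z_xi, where F = "\<lambda>f. f s" and H = "\<lambda>f. m (f s)"]) measurable
  hence ind: "indep_var borel (z s) borel (\<lambda>\<omega>. m (xi s \<omega>))"
    unfolding indep_pair_def indep_var_distribution_eq by simp
  have "integrable M (\<lambda>\<omega>. m (xi s \<omega>))" by (rule integrable_bounded[where B = K]) (auto simp: K)
  note * = indep_var_lebesgue_integral[OF ind z_integrable this] indep_var_integrable[OF ind z_integrable this]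
  show "integrable M (\<lambda>\<omega>. z s \<omega> * m (xi s \<omega>))" by (rule *(2))
  have "expectation (\<lambda>\<omega>. m (xi s \<omega>)) = (\<integral>y. m y \<partial>Q)"
    unfolding xi_law[of s, symmetric] by (rule integral_distr[symmetric]) auto
  thus "expectation (\<lambda>\<omega>. z s \<omega> * m (xi s \<omega>)) = g * (\<integral>y. m y \<partial>Q)" using *(1) z_mean by simp
qed

lemma z_z: "s \<noteq> t \<Longrightarrow> integrable M (\<lambda>\<omega>. z s \<omega> * z t \<omega>)" "s \<noteq> t \<Longrightarrow> expectation (\<lambda>\<omega>. z s \<omega> * z t \<omega>) = g * g"
  using indep_var_lebesgue_integral[OF indep_var_pair[OF z_indep] z_integrable z_integrable]
    indep_var_integrable[OF indep_var_pair[OF z_indep] z_integrable z_integrable] by (auto simp: z_mean)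

text \<open>The compensator of a residual jump minus its approximation, which is the effect of the
  clean perturbation plus one separate increment for each outlier in the window.\<close>

definition err :: "real \<Rightarrow> (nat \<Rightarrow> real) \<Rightarrow> real \<Rightarrow> real \<Rightarrow> int \<Rightarrow> 'a \<Rightarrow> real" where
  "err a b d x t \<omega> = (G (x + (outl t \<omega> + a * pert b d t \<omega>)) - G x) - (G (x + a * pert0 b d t \<omega>) - G x)
      - (\<Sum>j\<le>p. z (t - int j) \<omega> * (G (x + kap j * xi (t - int j) \<omega>) - G x))"

text \<open>The first summand comes from windows with one outlier: a factor g times a quantity that
  vanishes with a. The second comes from pairs of outliers, at most (p + 1)^2 of them, each with
  probability g^2. For a and g of order n^(-1/2) both are o(n^(-1/2)).\<close>

definition errb :: "real \<Rightarrow> real \<Rightarrow> real \<Rightarrow> real" where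
  "errb L a B = (real p + 1) * g * (4 * L * a * B * Yb + (\<integral>s. min 1 (2 * L * a * B * \<bar>s\<bar>) \<partial>Q))
      + (real p + 3) * (real p + 1)\<^sup>2 * g\<^sup>2"

lemma err_expectation:
  assumes L: "0 \<le> L" "\<And>y y'. \<bar>G y - G y'\<bar> \<le> L * \<bar>y - y'\<bar>" and a: "0 \<le> a"
    and b: "\<forall>i\<le>p. \<bar>b i\<bar> \<le> B" and d: "\<bar>d\<bar> \<le> B"
  shows "integrable M (err a b d x t)" "expectation (\<lambda>\<omega>. \<bar>err a b d x t \<omega>\<bar>) \<le> errb L a B"
proof -
  have B: "0 \<le> B" using d by auto
  have [measurable]: "err a b d x t \<in> borel_measurable M" unfolding err_def by measurable
  define m where "m s = min 1 (2 * L * a * B * \<bar>s\<bar>)" for s :: real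
  have [measurable]: "m \<in> borel_measurable borel" unfolding m_def by measurable
  have m1: "\<bar>m s\<bar> \<le> 1" "0 \<le> m s" for s using L a B by (auto simp: m_def)
  define R where "R \<omega> = (\<Sum>j\<le>p. 4 * L * a * B * (z (t - int j) \<omega> * absreg t \<omega>) + z (t - int j) \<omega> * m (xi (t - int j) \<omega>))
      + (real p + 3) * (\<Sum>i\<le>p. \<Sum>j\<in>{..p} - {i}. z (t - int i) \<omega> * z (t - int j) \<omega>)" for \<omega>
  have int: "integrable M R" unfolding R_def
    by (intro Bochner_Integration.integrable_add Bochner_Integration.integrable_sum integrable_mult_right z_absreg z_xi(1)[where K = 1] z_z m1) auto
  have zz: "AE \<omega> in M. \<forall>j. z (t - int j) \<omega> \<in> {0, 1}" by (simp add: AE_all_countable z_range del: insert_iff)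
  have le: "AE \<omega> in M. \<bar>err a b d x t \<omega>\<bar> \<le> R \<omega>"
    using zz
  proof eventually_elim
    case (elim \<omega>)
    have zb: "z (t - int j) \<omega> \<in> {0, 1}" for j using elim by blast
    have same: "pert b d t \<omega> = pert0 b d t \<omega>" if "\<And>j. j \<le> p \<Longrightarrow> z (t - int j) \<omega> = 0"
    proof -
      have "reg t i \<omega> = reg0 t i \<omega>" if "i \<le> p" for i using \<open>\<And>j. j \<le> p \<Longrightarrow> z (t - int j) \<omega> = 0\<close>[OF that] by (simp add: reg_def reg0_def)
      thus ?thesis by (simp add: pert_def pert0_def)
    qed
    have "\<bar>err a b d x t \<omega>\<bar> \<le> (\<Sum>j\<le>p. z (t - int j) \<omega> * (4 * L * a * B * absreg t \<omega> + min 1 (2 * L * a * B * \<bar>xi (t - int j) \<omega>\<bar>)))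
         + (real p + 3) * (\<Sum>i\<le>p. \<Sum>j\<in>{..p} - {i}. z (t - int i) \<omega> * z (t - int j) \<omega>)"
      unfolding err_def outl_def
      by (rule single_outlier_expansion[OF G_bounds L a B absreg_nonneg zb]) (use pert_bound[OF b d] zb same in auto)
    also have "\<dots> = R \<omega>" unfolding R_def m_def by (simp add: algebra_simps)
    finally show ?case .
  qed
  show int_err: "integrable M (err a b d x t)"
    by (rule Bochner_Integration.integrable_bound[OF int]) (use le in \<open>auto elim!: eventually_mono\<close>)
  have "expectation (\<lambda>\<omega>. \<bar>err a b d x t \<omega>\<bar>) \<le> expectation R"
    by (intro integral_mono_AE integrable_abs int_err int le)
  also have "expectation R = (\<Sum>j\<le>p. 4 * L * a * B * expectation (\<lambda>\<omega>. z (t - int j) \<omega> * absreg t \<omega>) + g * (\<integral>y. m y \<partial>Q))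
      + (real p + 3) * (\<Sum>i\<le>p. \<Sum>j\<in>{..p} - {i}. g * g)"
  proof -
    have i1: "integrable M (\<lambda>\<omega>. 4 * L * a * B * (z (t - int j) \<omega> * absreg t \<omega>) + z (t - int j) \<omega> * m (xi (t - int j) \<omega>))" for j
      by (intro Bochner_Integration.integrable_add integrable_mult_right z_absreg z_xi(1)[where K = 1] m1) auto
    have i2: "integrable M (\<lambda>\<omega>. \<Sum>j\<in>{..p} - {i}. z (t - int i) \<omega> * z (t - int j) \<omega>)" for i
      by (intro Bochner_Integration.integrable_sum z_z) auto
    have zm: "integrable M (\<lambda>\<omega>. z s \<omega> * m (xi s \<omega>))" "expectation (\<lambda>\<omega>. z s \<omega> * m (xi s \<omega>)) = g * (\<integral>y. m y \<partial>Q)" for s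
      using z_xi[OF \<open>m \<in> borel_measurable borel\<close> m1(1)] by auto
    have e1: "expectation (\<lambda>\<omega>. 4 * L * a * B * (z (t - int j) \<omega> * absreg t \<omega>) + z (t - int j) \<omega> * m (xi (t - int j) \<omega>))
       = 4 * L * a * B * expectation (\<lambda>\<omega>. z (t - int j) \<omega> * absreg t \<omega>) + g * (\<integral>y. m y \<partial>Q)" for j
      using z_absreg(1)[of "t - int j" t] zm[of "t - int j"] by simp
    have e2: "expectation (\<lambda>\<omega>. \<Sum>j\<in>{..p} - {i}. z (t - int i) \<omega> * z (t - int j) \<omega>) = (\<Sum>j\<in>{..p} - {i}. g * g)" for i
    proof -
      have "expectation (\<lambda>\<omega>. \<Sum>j\<in>{..p} - {i}. z (t - int i) \<omega> * z (t - int j) \<omega>)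
          = (\<Sum>j\<in>{..p} - {i}. expectation (\<lambda>\<omega>. z (t - int i) \<omega> * z (t - int j) \<omega>))"
        by (rule Bochner_Integration.integral_sum) (auto intro!: z_z(1))
      also have "\<dots> = (\<Sum>j\<in>{..p} - {i}. g * g)" by (intro sum.cong refl z_z(2)) auto
      finally show ?thesis .
    qed
    have "expectation R = expectation (\<lambda>\<omega>. \<Sum>j\<le>p. 4 * L * a * B * (z (t - int j) \<omega> * absreg t \<omega>) + z (t - int j) \<omega> * m (xi (t - int j) \<omega>))
        + expectation (\<lambda>\<omega>. (real p + 3) * (\<Sum>i\<le>p. \<Sum>j\<in>{..p} - {i}. z (t - int i) \<omega> * z (t - int j) \<omega>))"
      unfolding R_def
      by (rule Bochner_Integration.integral_add) (intro Bochner_Integration.integrable_sum i1 i2 integrable_mult_right)+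
    thus ?thesis
      by (simp only: Bochner_Integration.integral_sum[OF i1] Bochner_Integration.integral_sum[OF i2] integral_mult_right_zero e1 e2)
  qed
  also have "\<dots> \<le> (\<Sum>j\<le>p. 4 * L * a * B * (g * Yb) + g * (\<integral>y. m y \<partial>Q)) + (real p + 3) * (\<Sum>i\<le>p. \<Sum>j\<le>p. g * g)"
    using L a B by (intro add_mono sum_mono mult_left_mono sum_mono2 z_absreg order_refl) auto
  also have "\<dots> = errb L a B"
    by (simp add: errb_def m_def algebra_simps power2_eq_square)
  finally show "expectation (\<lambda>\<omega>. \<bar>err a b d x t \<omega>\<bar>) \<le> errb L a B" .
qed

lemma sqrt_sum_expectation:
  assumes "1 \<le> n" "\<And>t. integrable M (X t)" "\<And>t. expectation (\<lambda>\<omega>. \<bar>X t \<omega>\<bar>) \<le> e"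
  shows "integrable M (\<lambda>\<omega>. (\<Sum>t = 1..int n. X t \<omega>) / sqrt (real n))"
    "expectation (\<lambda>\<omega>. \<bar>(\<Sum>t = 1..int n. X t \<omega>) / sqrt (real n)\<bar>) \<le> sqrt (real n) * e"
proof -
  show int: "integrable M (\<lambda>\<omega>. (\<Sum>t = 1..int n. X t \<omega>) / sqrt (real n))"
    by (intro integrable_divide Bochner_Integration.integrable_sum assms)
  have "expectation (\<lambda>\<omega>. \<bar>(\<Sum>t = 1..int n. X t \<omega>) / sqrt (real n)\<bar>) \<le> expectation (\<lambda>\<omega>. (\<Sum>t = 1..int n. \<bar>X t \<omega>\<bar>) / sqrt (real n))"
    by (intro integral_mono integrable_abs int integrable_divide Bochner_Integration.integrable_sum assms)
       (auto simp: abs_divide intro!: divide_right_mono)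
  also have "\<dots> = (\<Sum>t = 1..int n. expectation (\<lambda>\<omega>. \<bar>X t \<omega>\<bar>)) / sqrt (real n)"
    by (simp add: Bochner_Integration.integral_sum assms)
  also have "\<dots> \<le> (\<Sum>t = 1..int n. e) / sqrt (real n)" by (intro divide_right_mono sum_mono assms) auto
  also have "\<dots> = real n / sqrt (real n) * e" by simp
  also have "real n / sqrt (real n) = sqrt (real n)" by (simp add: real_div_sqrt)
  finally show "expectation (\<lambda>\<omega>. \<bar>(\<Sum>t = 1..int n. X t \<omega>) / sqrt (real n)\<bar>) \<le> sqrt (real n) * e" .
qed

lemma pert0_moments:
  assumes b: "\<forall>i\<le>p. \<bar>b i\<bar> \<le> B" and d: "\<bar>d\<bar> \<le> B"
  shows "integrable M (pert0 b d t)" "expectation (\<lambda>\<omega>. \<bar>pert0 b d t \<omega>\<bar>) \<le> 2 * B * Yb"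
    "integrable M (\<lambda>\<omega>. (pert0 b d t \<omega>)\<^sup>2)" "expectation (\<lambda>\<omega>. (pert0 b d t \<omega>)\<^sup>2) \<le> 4 * B\<^sup>2 * Y2"
proof -
  have B: "0 \<le> B" using d by auto
  have zz: "AE \<omega> in M. \<forall>j. z (t - int j) \<omega> \<in> {0, 1}" by (simp add: AE_all_countable z_range del: insert_iff)
  have le: "AE \<omega> in M. \<bar>pert0 b d t \<omega>\<bar> \<le> 2 * B * absreg t \<omega>"
    using zz
  proof eventually_elim
    case (elim \<omega>)
    show ?case by (rule pert_bound(1)[OF b d]) (use elim in blast)+
  qed
  have le2: "AE \<omega> in M. (pert0 b d t \<omega>)\<^sup>2 \<le> 4 * B\<^sup>2 * (absreg t \<omega>)\<^sup>2"
    using le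
  proof eventually_elim
    case (elim \<omega>)
    from power_mono[OF this, of 2] show ?case by (simp add: power_mult_distrib)
  qed
  note int = integrable_mult_right[OF absreg_moments(1)[of t], of "2 * B"]
    integrable_mult_right[OF absreg_moments(3)[of t], of "4 * B\<^sup>2"]
  show 1: "integrable M (pert0 b d t)"
    by (rule Bochner_Integration.integrable_bound[OF int(1)])
       (use le B in \<open>auto elim!: eventually_mono simp: abs_mult absreg_nonneg\<close>)
  show 2: "integrable M (\<lambda>\<omega>. (pert0 b d t \<omega>)\<^sup>2)"
    by (rule Bochner_Integration.integrable_bound[OF int(2)])
       (use le2 in \<open>auto elim!: eventually_mono\<close>)
  have "expectation (\<lambda>\<omega>. \<bar>pert0 b d t \<omega>\<bar>) \<le> expectation (\<lambda>\<omega>. 2 * B * absreg t \<omega>)"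
    by (intro integral_mono_AE integrable_abs 1 int le)
  also have "\<dots> \<le> 2 * B * Yb" using absreg_moments(2)[of t] B by (simp add: mult_left_mono)
  finally show "expectation (\<lambda>\<omega>. \<bar>pert0 b d t \<omega>\<bar>) \<le> 2 * B * Yb" .
  have "expectation (\<lambda>\<omega>. (pert0 b d t \<omega>)\<^sup>2) \<le> expectation (\<lambda>\<omega>. 4 * B\<^sup>2 * (absreg t \<omega>)\<^sup>2)"
    by (intro integral_mono_AE 2 int le2)
  also have "\<dots> \<le> 4 * B\<^sup>2 * Y2" using absreg_moments(4)[of t] B by (simp add: mult_left_mono)
  finally show "expectation (\<lambda>\<omega>. (pert0 b d t \<omega>)\<^sup>2) \<le> 4 * B\<^sup>2 * Y2" .
qed

definition compensated :: "nat \<Rightarrow> (nat \<Rightarrow> real) \<Rightarrow> real \<Rightarrow> real \<Rightarrow> 'a \<Rightarrow> real" where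
  "compensated n b d x \<omega> = (\<Sum>t = 1..int n. jump x (outl t \<omega> + pert b d t \<omega> / sqrt (real n)) (eps t \<omega>)
      - (G (x + (outl t \<omega> + pert b d t \<omega> / sqrt (real n))) - G x))"

text \<open>By orthogonality the second moment of the normalized sum is at most four times the
  average of E |D|. The increment D is small on average: up to \<open>err\<close> it consists of a
  Lipschitz term of order n^(-1/2) and of outlier increments, at most 1 each, whose expected number
  is (p + 1) g.\<close>

lemma compensated_bound:
  assumes L: "0 \<le> L" "\<And>y y'. \<bar>G y - G y'\<bar> \<le> L * \<bar>y - y'\<bar>" and n: "1 \<le> n"
    and b: "\<forall>i\<le>p. \<bar>b i\<bar> \<le> B" and d: "\<bar>d\<bar> \<le> B"
  shows "integrable M (\<lambda>\<omega>. (compensated n b d x \<omega> / sqrt (real n))\<^sup>2)"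
    "expectation (\<lambda>\<omega>. (compensated n b d x \<omega> / sqrt (real n))\<^sup>2)
      \<le> 4 * (errb L (1 / sqrt (real n)) B + L / sqrt (real n) * (2 * B * Yb) + (real p + 1) * g)"
proof -
  define a where "a = 1 / sqrt (real n)"
  have a: "0 \<le> a" by (simp add: a_def)
  have B: "0 \<le> B" using d by auto
  define D where "D t \<omega> = G (x + (outl t \<omega> + a * pert b d t \<omega>)) - G x" for t \<omega>
  have [measurable]: "D t \<in> borel_measurable M" for t unfolding D_def by measurable
  have dG: "\<bar>G y - G y'\<bar> \<le> 1" for y y' using G_bounds[of y] G_bounds[of y'] by auto
  have D1: "\<bar>D t \<omega>\<bar> \<le> 1" for t \<omega> by (simp add: D_def dG)
  have C: "compensated n b d x \<omega> = (\<Sum>t = 1..int n. jump x (Wt a b d t (hist t \<omega>)) (eps t \<omega>) - (G (x + Wt a b d t (hist t \<omega>)) - G x))" for \<omega>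
    by (simp add: compensated_def Wt_hist a_def)
  have [measurable]: "compensated n b d x \<in> borel_measurable M" unfolding compensated_def by measurable
  have "\<bar>compensated n b d x \<omega>\<bar> \<le> (\<Sum>t = 1..int n. 2)" for \<omega>
    unfolding compensated_def
  proof (rule order_trans[OF sum_abs], rule sum_mono)
    fix t
    show "\<bar>jump x (outl t \<omega> + pert b d t \<omega> / sqrt (real n)) (eps t \<omega>) - (G (x + (outl t \<omega> + pert b d t \<omega> / sqrt (real n))) - G x)\<bar> \<le> 2"
      using jump_bound(1)[of x "outl t \<omega> + pert b d t \<omega> / sqrt (real n)" "eps t \<omega>"]
        dG[of "x + (outl t \<omega> + pert b d t \<omega> / sqrt (real n))" x] by linarith
  qed
  hence cb: "\<bar>compensated n b d x \<omega>\<bar> \<le> 2 * real n" for \<omega> by (simp add: mult.commute)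
  show "integrable M (\<lambda>\<omega>. (compensated n b d x \<omega> / sqrt (real n))\<^sup>2)"
  proof (rule integrable_bounded[where B = "(2 * real n)\<^sup>2 / real n"])
    fix \<omega>
    have "(compensated n b d x \<omega>)\<^sup>2 \<le> (2 * real n)\<^sup>2" 
      using power_mono[OF cb[of \<omega>], of 2] by (simp only: power2_abs abs_ge_zero)
    thus "norm ((compensated n b d x \<omega> / sqrt (real n))\<^sup>2) \<le> (2 * real n)\<^sup>2 / real n"
      by (simp add: power_divide divide_right_mono)
  qed measurable
  have ED: "expectation (\<lambda>\<omega>. \<bar>D t \<omega>\<bar>) \<le> errb L a B + L * a * (2 * B * Yb) + (real p + 1) * g" for t
  proof -
    define S where "S \<omega> = (\<Sum>j\<le>p. z (t - int j) \<omega>)" for \<omega>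
    have intS: "integrable M S" unfolding S_def by (intro Bochner_Integration.integrable_sum z_integrable)
    have zn: "AE \<omega> in M. \<forall>j. 0 \<le> z (t - int j) \<omega>" by (simp add: AE_all_countable z_nonneg)
    have le: "AE \<omega> in M. \<bar>D t \<omega>\<bar> \<le> \<bar>err a b d x t \<omega>\<bar> + L * a * \<bar>pert0 b d t \<omega>\<bar> + S \<omega>"
      using zn
    proof eventually_elim
      case (elim \<omega>)
      have "\<bar>\<Sum>j\<le>p. z (t - int j) \<omega> * (G (x + kap j * xi (t - int j) \<omega>) - G x)\<bar> \<le> S \<omega>"
        unfolding S_def
      proof (rule order_trans[OF sum_abs], rule sum_mono)
        fix j
        have "0 \<le> z (t - int j) \<omega>" using elim by blast
        thus "\<bar>z (t - int j) \<omega> * (G (x + kap j * xi (t - int j) \<omega>) - G x)\<bar> \<le> z (t - int j) \<omega>"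
          using dG[of "x + kap j * xi (t - int j) \<omega>" x] by (simp add: abs_mult mult_left_le)
      qed
      moreover have "\<bar>G (x + a * pert0 b d t \<omega>) - G x\<bar> \<le> L * a * \<bar>pert0 b d t \<omega>\<bar>"
        using L(2)[of "x + a * pert0 b d t \<omega>" x] a by (simp add: abs_mult mult.assoc)
      ultimately show ?case unfolding D_def err_def by linarith
    qed
    have i1: "integrable M (\<lambda>\<omega>. \<bar>err a b d x t \<omega>\<bar>)" "integrable M (\<lambda>\<omega>. \<bar>pert0 b d t \<omega>\<bar>)"
      by (auto intro!: integrable_abs err_expectation(1)[OF L a b d] pert0_moments(1)[OF b d])
    have "expectation (\<lambda>\<omega>. \<bar>D t \<omega>\<bar>) \<le> expectation (\<lambda>\<omega>. \<bar>err a b d x t \<omega>\<bar> + L * a * \<bar>pert0 b d t \<omega>\<bar> + S \<omega>)"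
      by (intro integral_mono_AE le Bochner_Integration.integrable_add integrable_mult_right i1 intS integrable_bounded[where B = 1])
         (auto simp: D1)
    also have "\<dots> = expectation (\<lambda>\<omega>. \<bar>err a b d x t \<omega>\<bar>) + L * a * expectation (\<lambda>\<omega>. \<bar>pert0 b d t \<omega>\<bar>) + expectation S"
      using i1 intS by simp
    also have "expectation S = (real p + 1) * g"
      unfolding S_def by (subst Bochner_Integration.integral_sum) (auto simp: z_integrable z_mean)
    finally show ?thesis
      using err_expectation(2)[OF L a b d, of x t] mult_left_mono[OF pert0_moments(2)[OF b d, of t], of "L * a"] L a by simp
  qed
  have "expectation (\<lambda>\<omega>. (compensated n b d x \<omega> / sqrt (real n))\<^sup>2) = expectation (\<lambda>\<omega>. (compensated n b d x \<omega>)\<^sup>2) / real n"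
    by (simp add: power_divide)
  also have "\<dots> \<le> (4 * (\<Sum>t = 1..int n. expectation (\<lambda>\<omega>. \<bar>D t \<omega>\<bar>))) / real n"
    using compensated_jumps[of "Wt a b d" x n, OF Wt_measurable]
    by (intro divide_right_mono) (auto simp: C D_def Wt_hist)
  also have "\<dots> \<le> (4 * (\<Sum>t = 1..int n. errb L a B + L * a * (2 * B * Yb) + (real p + 1) * g)) / real n"
    by (intro divide_right_mono mult_left_mono sum_mono ED) auto
  also have "\<dots> = 4 * (errb L a B + L * a * (2 * B * Yb) + (real p + 1) * g)" using n by simp
  finally show "expectation (\<lambda>\<omega>. (compensated n b d x \<omega> / sqrt (real n))\<^sup>2)
      \<le> 4 * (errb L (1 / sqrt (real n)) B + L / sqrt (real n) * (2 * B * Yb) + (real p + 1) * g)"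
    by (simp add: a_def)
qed

text \<open>Two kinds of remainder are kept apart. The quadratic one gains a factor n^(-1/2) after
  summation. The linear one gains nothing, so its coefficient \<delta> has to be small by itself;
  under the local alternative it is proportional to the weight of \<open>H\<close>.\<close>

lemma first_order_bound:
  assumes e: "\<And>u. \<bar>G (x + u) - G x - f0 * u\<bar> \<le> \<delta> * \<bar>u\<bar> + C * u\<^sup>2" and n: "1 \<le> n"
    and \<delta>: "0 \<le> \<delta>" and C: "0 \<le> C"
    and b: "\<forall>i\<le>p. \<bar>b i\<bar> \<le> B" and d: "\<bar>d\<bar> \<le> B"
  defines "T \<equiv> \<lambda>\<omega>. (\<Sum>t = 1..int n. G (x + pert0 b d t \<omega> / sqrt (real n)) - G x - f0 * (pert0 b d t \<omega> / sqrt (real n))) / sqrt (real n)"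
  shows "integrable M T" "expectation (\<lambda>\<omega>. \<bar>T \<omega>\<bar>) \<le> \<delta> * (2 * B * Yb) + C * (4 * B\<^sup>2 * Y2) / sqrt (real n)"
proof -
  define X where "X t \<omega> = G (x + pert0 b d t \<omega> / sqrt (real n)) - G x - f0 * (pert0 b d t \<omega> / sqrt (real n))" for t \<omega>
  have dG: "\<bar>G y - G y'\<bar> \<le> 1" for y y' using G_bounds[of y] G_bounds[of y'] by auto
  have i: "integrable M (X t)" for t unfolding X_def
    by (intro Bochner_Integration.integrable_diff integrable_mult_right integrable_divide pert0_moments[OF b d] integrable_bounded[where B = 1])
       (auto simp: dG)
  have E: "expectation (\<lambda>\<omega>. \<bar>X t \<omega>\<bar>) \<le> \<delta> * (2 * B * Yb) / sqrt (real n) + C * (4 * B\<^sup>2 * Y2) / real n" for t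
  proof -
    have "expectation (\<lambda>\<omega>. \<bar>X t \<omega>\<bar>) \<le> expectation (\<lambda>\<omega>. \<delta> / sqrt (real n) * \<bar>pert0 b d t \<omega>\<bar> + C / real n * (pert0 b d t \<omega>)\<^sup>2)"
    proof (intro integral_mono integrable_abs i Bochner_Integration.integrable_add integrable_mult_right pert0_moments[OF b d])
      fix \<omega>
      show "\<bar>X t \<omega>\<bar> \<le> \<delta> / sqrt (real n) * \<bar>pert0 b d t \<omega>\<bar> + C / real n * (pert0 b d t \<omega>)\<^sup>2"
        using e[of "pert0 b d t \<omega> / sqrt (real n)"] by (simp add: X_def power_divide)
    qed
    also have "\<dots> = \<delta> / sqrt (real n) * expectation (\<lambda>\<omega>. \<bar>pert0 b d t \<omega>\<bar>) + C / real n * expectation (\<lambda>\<omega>. (pert0 b d t \<omega>)\<^sup>2)"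
      by (subst Bochner_Integration.integral_add)
         (auto intro!: integrable_divide integrable_mult_right integrable_abs pert0_moments[OF b d])
    also have "\<dots> \<le> \<delta> / sqrt (real n) * (2 * B * Yb) + C / real n * (4 * B\<^sup>2 * Y2)"
      using \<delta> C by (intro add_mono mult_left_mono pert0_moments[OF b d]) auto
    finally show ?thesis by simp
  qed
  have T: "T = (\<lambda>\<omega>. (\<Sum>t = 1..int n. X t \<omega>) / sqrt (real n))" by (simp add: T_def X_def)
  show "integrable M T" unfolding T by (rule sqrt_sum_expectation(1)[OF n i E])
  have "expectation (\<lambda>\<omega>. \<bar>T \<omega>\<bar>) \<le> sqrt (real n) * (\<delta> * (2 * B * Yb) / sqrt (real n) + C * (4 * B\<^sup>2 * Y2) / real n)"
    unfolding T by (rule sqrt_sum_expectation(2)[OF n i E])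
  also have "\<dots> = \<delta> * (2 * B * Yb) + C * (4 * B\<^sup>2 * Y2) / sqrt (real n)"
  proof -
    have "sqrt (real n) / real n = 1 / sqrt (real n)" by (simp add: sqrt_divide_self_eq inverse_eq_divide)
    thus ?thesis using n by (simp add: field_simps)
  qed
  finally show "expectation (\<lambda>\<omega>. \<bar>T \<omega>\<bar>) \<le> \<delta> * (2 * B * Yb) + C * (4 * B\<^sup>2 * Y2) / sqrt (real n)" .
qed

text \<open>The summands at different times are uncorrelated and each has variance at most g,
  because the indicator equals its own square. With g tending to 0 the normalized outlier sum may
  thus be replaced by its mean.\<close>

lemma outlier_sum_bound:
  fixes k :: "real \<Rightarrow> real" and j :: int
  assumes [measurable]: "k \<in> borel_measurable borel" and k: "\<And>s. \<bar>k s\<bar> \<le> (1 :: real)" and n: "1 \<le> n"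
  defines "T \<equiv> \<lambda>\<omega>. (\<Sum>t = 1..int n. z (t - j) \<omega> * k (xi (t - j) \<omega>)) / sqrt (real n) - sqrt (real n) * (g * (\<integral>s. k s \<partial>Q))"
  shows "integrable M (\<lambda>\<omega>. (T \<omega>)\<^sup>2)" "expectation (\<lambda>\<omega>. (T \<omega>)\<^sup>2) \<le> g"
proof -
  define \<kappa> where "\<kappa> = (\<integral>s. k s \<partial>Q)"
  define X where "X t \<omega> = z (t - j) \<omega> * k (xi (t - j) \<omega>)" for t \<omega>
  have [measurable]: "X t \<in> borel_measurable M" for t unfolding X_def by measurable
  have mean: "integrable M (X t)" "expectation (X t) = g * \<kappa>" for t
    unfolding X_def \<kappa>_def by (rule z_xi[where K = 1]; simp add: k)+
  have XX: "integrable M (\<lambda>\<omega>. X s \<omega> * X t \<omega>)" for s t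
  proof (rule integrable_const_bound[of _ 1])
    show "AE \<omega> in M. norm (X s \<omega> * X t \<omega>) \<le> 1" using z_range[of "s - j"] z_range[of "t - j"]
    proof eventually_elim
      case (elim \<omega>)
      hence "\<bar>X s \<omega>\<bar> \<le> 1" "\<bar>X t \<omega>\<bar> \<le> 1" using k by (auto simp: X_def)
      thus ?case by (simp add: abs_mult mult_le_one)
    qed
  qed measurable
  have sq: "expectation (\<lambda>\<omega>. X t \<omega> * X t \<omega>) \<le> g" for t
  proof -
    have "expectation (\<lambda>\<omega>. X t \<omega> * X t \<omega>) \<le> expectation (z (t - j))"
    proof (rule integral_mono_AE[OF XX z_integrable])
      show "AE \<omega> in M. X t \<omega> * X t \<omega> \<le> z (t - j) \<omega>" using z_range[of "t - j"]
      proof eventually_elim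
        case (elim \<omega>)
        have "k (xi (t - j) \<omega>) * k (xi (t - j) \<omega>) \<le> 1" using k[of "xi (t - j) \<omega>"]
          by (metis abs_mult_self_eq abs_ge_zero mult_le_one)
        thus ?case using elim by (auto simp: X_def)
      qed
    qed
    thus ?thesis by (simp add: z_mean)
  qed
  have cross: "expectation (\<lambda>\<omega>. X s \<omega> * X t \<omega>) = (g * \<kappa>) * (g * \<kappa>)" if "s \<noteq> t" for s t
  proof -
    have "indep_pair borel (\<lambda>\<omega>. z (s - j) \<omega> * z (t - j) \<omega>) borel (\<lambda>\<omega>. k (xi (s - j) \<omega>) * k (xi (t - j) \<omega>))"
      by (rule indep_pair_compose[OF indep_z_xi, where F = "\<lambda>f. f (s - j) * f (t - j)" and H = "\<lambda>f. k (f (s - j)) * k (f (t - j))"]) measurable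
    hence ind: "indep_var borel (\<lambda>\<omega>. z (s - j) \<omega> * z (t - j) \<omega>) borel (\<lambda>\<omega>. k (xi (s - j) \<omega>) * k (xi (t - j) \<omega>))"
      unfolding indep_pair_def indep_var_distribution_eq by simp
    have ne: "s - j \<noteq> t - j" using that by simp
    have ik: "integrable M (\<lambda>\<omega>. k (xi s \<omega>))" for s by (rule integrable_bounded[where B = 1]) (auto simp: k)
    have Ek: "expectation (\<lambda>\<omega>. k (xi s \<omega>)) = \<kappa>" for s
      unfolding \<kappa>_def xi_law[of s, symmetric] by (rule integral_distr[symmetric]) auto
    have "indep_pair borel (\<lambda>\<omega>. k (xi (s - j) \<omega>)) borel (\<lambda>\<omega>. k (xi (t - j) \<omega>))"
      by (rule indep_pair_compose[OF indep_pair_if_indep_var[OF indep_var_pair[OF xi_indep ne]], where F = k and H = k]) auto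
    hence indk: "indep_var borel (\<lambda>\<omega>. k (xi (s - j) \<omega>)) borel (\<lambda>\<omega>. k (xi (t - j) \<omega>))"
      unfolding indep_pair_def indep_var_distribution_eq by simp
    have "expectation (\<lambda>\<omega>. X s \<omega> * X t \<omega>) = expectation (\<lambda>\<omega>. (z (s - j) \<omega> * z (t - j) \<omega>) * (k (xi (s - j) \<omega>) * k (xi (t - j) \<omega>)))"
      by (simp add: X_def mult_ac)
    also have "\<dots> = (g * g) * (\<kappa> * \<kappa>)"
      using indep_var_lebesgue_integral[OF ind z_z(1)[OF ne] indep_var_integrable[OF indk ik ik]]
        indep_var_lebesgue_integral[OF indk ik ik] z_z(2)[OF ne] by (simp add: Ek)
    finally show ?thesis by (simp add: mult_ac)
  qed
  let ?c = "g * \<kappa>"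
  have i: "integrable M (\<lambda>\<omega>. (X s \<omega> - ?c) * (X t \<omega> - ?c))" for s t
    using XX[of s t] mean by (simp add: algebra_simps)
  have E: "expectation (\<lambda>\<omega>. (X s \<omega> - ?c) * (X t \<omega> - ?c)) = expectation (\<lambda>\<omega>. X s \<omega> * X t \<omega>) - ?c * ?c" for s t
    using XX[of s t] mean[of s] mean[of t] by (simp add: algebra_simps prob_space)
  have T: "T \<omega> = (\<Sum>t = 1..int n. X t \<omega> - ?c) / sqrt (real n)" for \<omega>
  proof -
    have "sqrt (real n) * (g * \<kappa>) = (real n / sqrt (real n)) * (g * \<kappa>)" by (simp only: real_div_sqrt of_nat_0_le_iff)
    thus ?thesis by (simp add: T_def X_def \<kappa>_def sum_subtractf diff_divide_distrib)
  qed
  have T2: "(T \<omega>)\<^sup>2 = (\<Sum>s = 1..int n. \<Sum>t = 1..int n. (X s \<omega> - ?c) * (X t \<omega> - ?c)) / real n" for \<omega>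
    unfolding T power_divide by (simp add: power2_eq_square sum_product)
  show "integrable M (\<lambda>\<omega>. (T \<omega>)\<^sup>2)" unfolding T2
    by (intro integrable_divide Bochner_Integration.integrable_sum i)
  have "expectation (\<lambda>\<omega>. (T \<omega>)\<^sup>2) = (\<Sum>s = 1..int n. \<Sum>t = 1..int n. expectation (\<lambda>\<omega>. X s \<omega> * X t \<omega>) - ?c * ?c) / real n"
    unfolding T2 by (simp add: Bochner_Integration.integral_sum i E)
  also have "\<dots> = (\<Sum>s = 1..int n. \<Sum>t = 1..int n. if s = t then expectation (\<lambda>\<omega>. X t \<omega> * X t \<omega>) - ?c * ?c else 0) / real n"
    by (intro arg_cong2[where f = "(/)"] sum.cong refl) (auto simp: cross)
  also have "\<dots> = (\<Sum>t = 1..int n. expectation (\<lambda>\<omega>. X t \<omega> * X t \<omega>) - ?c * ?c) / real n"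
    by (simp add: sum.delta)
  also have "\<dots> \<le> (\<Sum>t = 1..int n. g) / real n"
  proof (intro divide_right_mono sum_mono)
    fix t show "expectation (\<lambda>\<omega>. X t \<omega> * X t \<omega>) - ?c * ?c \<le> g"
      using sq[of t] zero_le_square[of ?c] by linarith
  qed auto
  also have "\<dots> = g" using n by simp
  finally show "expectation (\<lambda>\<omega>. (T \<omega>)\<^sup>2) \<le> g" .
qed

lemma sum_beta_neq_1: "(\<Sum>i = 1..p. \<beta> i) \<noteq> 1"
proof
  assume "(\<Sum>i = 1..p. \<beta> i) = 1"
  hence "(1 :: complex) ^ p = (\<Sum>i = 1..p. of_real (\<beta> i) * 1 ^ (p - i))" by (simp flip: of_real_sum)
  from roots[OF this] show False by simp
qed

text \<open>Uncorrelated innovations give the exact second moment n * s2; the inequality |S| <= sqrt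
  n + S^2 / sqrt n turns it into a first-moment bound of order sqrt n.\<close>

lemma eps_sum_abs: "expectation (\<lambda>\<omega>. \<bar>\<Sum>t = 1..int n. eps (t - i) \<omega>\<bar>) \<le> 1 + sqrt (real n) * (s2 + 1)"
proof (cases "n = 0")
  case False
  define S where "S \<omega> = (\<Sum>t = 1..int n. eps (t - i) \<omega>)" for \<omega>
  have [measurable]: "S \<in> borel_measurable M" unfolding S_def by measurable
  have ne: "s - i \<noteq> t - i" if "s \<noteq> t" for s t using that by simp
  have ie: "integrable M (\<lambda>\<omega>. eps (s - i) \<omega> * eps (t - i) \<omega>)" for s t
    by (cases "s = t") (use eps_moments(1) indep_var_integrable[OF indep_var_pair[OF eps_indep ne] eps_moments(3) eps_moments(3)] in \<open>auto simp: power2_eq_square\<close>)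
  have S2: "(S \<omega>)\<^sup>2 = (\<Sum>s = 1..int n. \<Sum>t = 1..int n. eps (s - i) \<omega> * eps (t - i) \<omega>)" for \<omega>
    unfolding S_def by (simp add: power2_eq_square sum_product)
  have int: "integrable M (\<lambda>\<omega>. (S \<omega>)\<^sup>2)" unfolding S2 by (intro Bochner_Integration.integrable_sum ie)
  have "expectation (\<lambda>\<omega>. (S \<omega>)\<^sup>2) = (\<Sum>s = 1..int n. \<Sum>t = 1..int n. expectation (\<lambda>\<omega>. eps (s - i) \<omega> * eps (t - i) \<omega>))"
    unfolding S2 by (simp add: Bochner_Integration.integral_sum ie)
  also have "\<dots> = (\<Sum>s = 1..int n. \<Sum>t = 1..int n. if s = t then s2 else 0)"
    by (intro sum.cong refl)
       (use eps_moments(2) indep_var_lebesgue_integral[OF indep_var_pair[OF eps_indep ne] eps_moments(3) eps_moments(3)] eps_moments(4) in \<open>auto simp: power2_eq_square\<close>)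
  also have "\<dots> = real n * s2" by (simp add: sum.delta)
  finally have E: "expectation (\<lambda>\<omega>. (S \<omega>)\<^sup>2) = real n * s2" .
  have n: "0 < sqrt (real n)" using False by simp
  have le: "\<bar>S \<omega>\<bar> \<le> sqrt (real n) + (S \<omega>)\<^sup>2 / sqrt (real n)" for \<omega>
  proof -
    have "\<bar>S \<omega> / sqrt (real n)\<bar> \<le> 1 + (S \<omega> / sqrt (real n))\<^sup>2" by (rule abs_le_1_plus_square)
    hence "\<bar>S \<omega>\<bar> / sqrt (real n) * sqrt (real n) \<le> (1 + (S \<omega>)\<^sup>2 / real n) * sqrt (real n)"
      using n by (intro mult_right_mono) (auto simp: power_divide abs_divide)
    moreover have "sqrt (real n) / real n = 1 / sqrt (real n)" by (simp add: sqrt_divide_self_eq inverse_eq_divide)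
    moreover have "(1 + (S \<omega>)\<^sup>2 / real n) * sqrt (real n) = sqrt (real n) + (S \<omega>)\<^sup>2 * (sqrt (real n) / real n)"
      by (simp add: algebra_simps)
    ultimately show ?thesis using n by simp
  qed
  have iS: "integrable M S" unfolding S_def by (intro Bochner_Integration.integrable_sum eps_moments)
  have "expectation (\<lambda>\<omega>. \<bar>S \<omega>\<bar>) \<le> expectation (\<lambda>\<omega>. sqrt (real n) + (S \<omega>)\<^sup>2 / sqrt (real n))"
    by (intro integral_mono integrable_abs iS Bochner_Integration.integrable_add integrable_divide int le) auto
  also have "\<dots> = sqrt (real n) + real n / sqrt (real n) * s2" using int by (simp add: E prob_space)
  also have "\<dots> = sqrt (real n) * (s2 + 1)" by (simp add: real_div_sqrt algebra_simps)
  finally show ?thesis by (simp add: S_def)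
qed simp

definition Vb :: real where
  "Vb = (1 + (\<Sum>k = 1..p. \<bar>\<beta> k\<bar> * (2 * real k * (1 + cs\<^sup>2 * s2)))) + (s2 + 1)"

text \<open>The covariances of the autoregression are avoided. Summing the equation over t gives (1
  - sum of \<beta>) times the sum of V as the sum of the innovations plus boundary terms, and the
  factor is nonzero because 1 is not a characteristic root.\<close>

lemma V_sum_bound:
  assumes n: "1 \<le> n"
  shows "integrable M (\<lambda>\<omega>. (\<Sum>t = 1..int n. V (t - i) \<omega>) / real n)"
    "expectation (\<lambda>\<omega>. \<bar>(\<Sum>t = 1..int n. V (t - i) \<omega>) / real n\<bar>) \<le> Vb / \<bar>1 - (\<Sum>i = 1..p. \<beta> i)\<bar> / sqrt (real n)"
proof -
  define S where "S k \<omega> = (\<Sum>t = 1..int n. V (t - i - int k) \<omega>)" for k \<omega>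
  let ?v = "1 + cs\<^sup>2 * s2"
  let ?b = "1 - (\<Sum>i = 1..p. \<beta> i)"
  have b0: "0 < \<bar>?b\<bar>" using sum_beta_neq_1 by auto
  have iS: "integrable M (S k)" for k unfolding S_def by (intro Bochner_Integration.integrable_sum V_integrable)
  show "integrable M (\<lambda>\<omega>. (\<Sum>t = 1..int n. V (t - i) \<omega>) / real n)"
    by (intro integrable_divide Bochner_Integration.integrable_sum V_integrable)
  \<comment> \<open>Moving the summation window back by one replaces one boundary value by another,
    so k shifts cost at most 2 k values of V, independently of n.\<close>
  have shift: "S (Suc k) \<omega> = S k \<omega> + (V (- i - int k) \<omega> - V (int n - i - int k) \<omega>)" for k \<omega>
  proof -
    have "S (Suc k) \<omega> = (\<Sum>t = 0..int n - 1. V (t - i - int k) \<omega>)"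
      unfolding S_def by (rule sum.reindex_bij_witness[of _ "\<lambda>t. t + 1" "\<lambda>t. t - 1"]) (auto simp: algebra_simps)
    also have "\<dots> = (\<Sum>t = 0..int n. V (t - i - int k) \<omega>) - V (int n - i - int k) \<omega>"
    proof -
      have "{0..int n} = insert (int n) {0..int n - 1}" by auto
      thus ?thesis by simp
    qed
    also have "{0..int n} = insert 0 {1..int n}" by auto
    finally show ?thesis by (simp add: S_def)
  qed
  have diff: "expectation (\<lambda>\<omega>. \<bar>S k \<omega> - S 0 \<omega>\<bar>) \<le> 2 * real k * ?v" for k
  proof (induction k)
    case (Suc k)
    have "expectation (\<lambda>\<omega>. \<bar>S (Suc k) \<omega> - S 0 \<omega>\<bar>) \<le> expectation (\<lambda>\<omega>. \<bar>S k \<omega> - S 0 \<omega>\<bar> + \<bar>V (- i - int k) \<omega>\<bar> + \<bar>V (int n - i - int k) \<omega>\<bar>)"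
      by (intro integral_mono integrable_abs Bochner_Integration.integrable_diff Bochner_Integration.integrable_add iS V_integrable)
         (auto simp: shift)
    also have "\<dots> = expectation (\<lambda>\<omega>. \<bar>S k \<omega> - S 0 \<omega>\<bar>) + expectation (\<lambda>\<omega>. \<bar>V (- i - int k) \<omega>\<bar>) + expectation (\<lambda>\<omega>. \<bar>V (int n - i - int k) \<omega>\<bar>)"
      using iS V_integrable by simp
    also have "\<dots> \<le> 2 * real k * ?v + ?v + ?v" by (intro add_mono Suc V_abs)
    finally show ?case by (simp add: algebra_simps)
  qed simp
  define Es where "Es \<omega> = (\<Sum>t = 1..int n. eps (t - i) \<omega>)" for \<omega>
  have iE: "integrable M Es" unfolding Es_def by (intro Bochner_Integration.integrable_sum eps_moments)
  have rec: "AE \<omega> in M. ?b * S 0 \<omega> = Es \<omega> + (\<Sum>k = 1..p. \<beta> k * (S k \<omega> - S 0 \<omega>))"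
  proof -
    have "AE \<omega> in M. \<forall>t. V t \<omega> = (\<Sum>i = 1..p. \<beta> i * V (t - int i) \<omega>) + eps t \<omega>"
      unfolding AE_all_countable using V_recursion by blast
    thus ?thesis
    proof eventually_elim
      case (elim \<omega>)
      have "S 0 \<omega> = (\<Sum>t = 1..int n. (\<Sum>k = 1..p. \<beta> k * V (t - i - int k) \<omega>) + eps (t - i) \<omega>)"
        unfolding S_def of_nat_0 diff_0_right by (intro sum.cong refl elim[rule_format])
      also have "\<dots> = (\<Sum>k = 1..p. \<beta> k * S k \<omega>) + Es \<omega>"
        unfolding sum.distrib S_def Es_def by (subst sum.swap) (simp add: sum_distrib_left)
      finally show ?case by (simp add: left_diff_distrib right_diff_distrib sum_subtractf sum_distrib_right)
    qed
  qed
  have "\<bar>?b\<bar> * expectation (\<lambda>\<omega>. \<bar>S 0 \<omega>\<bar>) = expectation (\<lambda>\<omega>. \<bar>?b * S 0 \<omega>\<bar>)" by (simp add: abs_mult)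
  also have "\<dots> \<le> expectation (\<lambda>\<omega>. \<bar>Es \<omega>\<bar> + (\<Sum>k = 1..p. \<bar>\<beta> k\<bar> * \<bar>S k \<omega> - S 0 \<omega>\<bar>))"
  proof (intro integral_mono_AE integrable_abs integrable_mult_right iS Bochner_Integration.integrable_add iE Bochner_Integration.integrable_sum Bochner_Integration.integrable_diff)
    show "AE \<omega> in M. \<bar>?b * S 0 \<omega>\<bar> \<le> \<bar>Es \<omega>\<bar> + (\<Sum>k = 1..p. \<bar>\<beta> k\<bar> * \<bar>S k \<omega> - S 0 \<omega>\<bar>)"
      using rec
    proof eventually_elim
      case (elim \<omega>)
      have "\<bar>\<Sum>k = 1..p. \<beta> k * (S k \<omega> - S 0 \<omega>)\<bar> \<le> (\<Sum>k = 1..p. \<bar>\<beta> k\<bar> * \<bar>S k \<omega> - S 0 \<omega>\<bar>)"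
        by (rule order_trans[OF sum_abs]) (simp add: abs_mult)
      thus ?case unfolding elim by linarith
    qed
  qed
  also have "\<dots> = expectation (\<lambda>\<omega>. \<bar>Es \<omega>\<bar>) + (\<Sum>k = 1..p. \<bar>\<beta> k\<bar> * expectation (\<lambda>\<omega>. \<bar>S k \<omega> - S 0 \<omega>\<bar>))"
    using iS iE by (simp add: Bochner_Integration.integral_sum)
  also have "\<dots> \<le> (1 + sqrt (real n) * (s2 + 1)) + (\<Sum>k = 1..p. \<bar>\<beta> k\<bar> * (2 * real k * ?v))"
    unfolding Es_def by (intro add_mono eps_sum_abs sum_mono mult_left_mono diff) auto
  also have "\<dots> \<le> sqrt (real n) * Vb"
  proof -
    let ?c = "\<Sum>k = 1..p. \<bar>\<beta> k\<bar> * (2 * real k * ?v)"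
    have "0 \<le> ?c" using s2_pos by (intro sum_nonneg mult_nonneg_nonneg add_nonneg_nonneg) auto
    hence "1 * (1 + ?c) \<le> sqrt (real n) * (1 + ?c)" using n by (intro mult_right_mono) auto
    thus ?thesis by (simp add: Vb_def algebra_simps)
  qed
  finally have "expectation (\<lambda>\<omega>. \<bar>S 0 \<omega>\<bar>) \<le> sqrt (real n) * Vb / \<bar>?b\<bar>" using b0 by (simp add: pos_le_divide_eq mult.commute)
  hence "expectation (\<lambda>\<omega>. \<bar>S 0 \<omega>\<bar>) / real n \<le> sqrt (real n) * Vb / \<bar>?b\<bar> / real n"
    by (rule divide_right_mono) simp
  also have "\<dots> = (sqrt (real n) / real n) * Vb / \<bar>?b\<bar>" by simp
  also have "sqrt (real n) / real n = 1 / sqrt (real n)" by (simp add: sqrt_divide_self_eq inverse_eq_divide)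
  finally show "expectation (\<lambda>\<omega>. \<bar>(\<Sum>t = 1..int n. V (t - i) \<omega>) / real n\<bar>) \<le> Vb / \<bar>?b\<bar> / sqrt (real n)"
    by (simp add: S_def mult.commute)
qed

end

subsection \<open>The innovation law under the local alternative\<close>

lemma local_weight_bounds: "0 \<le> r \<Longrightarrow> 0 \<le> local_weight n r" "local_weight n r \<le> 1"
  by (auto simp: local_weight_def)

lemma sqrt_local_weight:
  assumes r: "r \<longlonglongrightarrow> r0" "\<And>n. 0 \<le> r n"
  shows "(\<lambda>n. sqrt (real n) * local_weight n (r n)) \<longlonglongrightarrow> r0"
    and "(\<lambda>n. local_weight n (r n)) \<longlonglongrightarrow> 0"
proof -
  have s: "filterlim (\<lambda>n. sqrt (real n)) at_top sequentially"
    by (intro filterlim_compose[OF sqrt_at_top] filterlim_real_sequentially)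
  have 0: "(\<lambda>n. r n / sqrt (real n)) \<longlonglongrightarrow> 0"
    using r(1) s by (intro real_tendsto_divide_at_top)
  hence ev: "\<forall>\<^sub>F n in sequentially. r n / sqrt (real n) < 1"
    by (auto simp: order_tendsto_iff)
  have eq: "\<forall>\<^sub>F n in sequentially. r n / sqrt (real n) = local_weight n (r n)"
    using ev by eventually_elim (auto simp: local_weight_def)
  show "(\<lambda>n. local_weight n (r n)) \<longlonglongrightarrow> 0" by (rule Lim_transform_eventually[OF 0 eq])
  show "(\<lambda>n. sqrt (real n) * local_weight n (r n)) \<longlonglongrightarrow> r0"
    by (rule Lim_transform_eventually[OF r(1)])
       (use eventually_conj[OF eq eventually_gt_at_top[of 0]] in \<open>auto elim!: eventually_mono simp: field_simps\<close>)
qed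

text \<open>The distribution function determines the law, so the innovation law is the mixture of
  the normal law and \<open>H\<close>. Its second moment is a convex combination of the two, which
  gives a bound free of n and of the weight.\<close>

lemma alt_cdf_second_moment:
  assumes A: "real_distribution A" "cdf A = alt_cdf \<theta>\<^sub>0 H n r" and \<theta>: "0 < \<theta>\<^sub>0" and H: "real_distribution H"
    and H2: "integrable H (\<lambda>s. s\<^sup>2)" and r: "0 \<le> r"
  shows "(\<integral>s. s\<^sup>2 \<partial>A) \<le> \<theta>\<^sub>0\<^sup>2 + (\<integral>s. s\<^sup>2 \<partial>H)"
proof -
  interpret A: real_distribution A by fact
  interpret H: real_distribution H by fact
  interpret N: real_distribution std_normal_distribution by (rule real_dist_normal_dist)
  define w where "w = local_weight n r"
  have w: "0 \<le> w" "w \<le> 1" using local_weight_bounds r by (auto simp: w_def)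
  define N where "N = distr std_normal_distribution borel (\<lambda>x. \<theta>\<^sub>0 * x)"
  interpret N': real_distribution N unfolding N_def by (rule N.real_distribution_distr) simp
  define K where "K b = (if b then H else N)" for b
  have sK: "K \<in> measurable (measure_pmf (bernoulli_pmf w)) (subprob_algebra borel)"
    using prob_space_imp_subprob_space[OF H.prob_space_axioms] prob_space_imp_subprob_space[OF N'.prob_space_axioms]
    by (auto simp: measurable_pmf_measure1 space_subprob_algebra K_def)
  \<comment> \<open>The mixture realized as a measure: a Bernoulli variable with success probability
    w selects \<open>H\<close> or the scaled normal law.\<close>
  define B where "B = measure_pmf (bernoulli_pmf w) \<bind> K"
  have setsB: "sets B = sets borel" unfolding B_def
    using sK by (intro sets_bind) (auto simp: K_def N_def)
  have em: "emeasure B X = ennreal w * emeasure H X + ennreal (1 - w) * emeasure N X" if "X \<in> sets borel" for X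
    unfolding B_def using that w
    by (subst emeasure_bind[OF _ sK]) (auto simp: K_def mult.commute)
  have meas: "measure B X = w * measure H X + (1 - w) * measure N X" if "X \<in> sets borel" for X
    unfolding measure_def em[OF that] using w
    by (simp add: H.emeasure_eq_measure N'.emeasure_eq_measure ennreal_mult[symmetric] ennreal_plus[symmetric] measure_nonneg del: ennreal_plus)
  have "prob_space B"
  proof
    have "emeasure B (space B) = emeasure B UNIV" using sets_eq_imp_space_eq[OF setsB] by simp
    also have "\<dots> = ennreal w + ennreal (1 - w)" 
      using em[of UNIV] H.emeasure_space_1 N'.emeasure_space_1 by simp
    also have "\<dots> = 1" using w by (simp add: ennreal_plus[symmetric] del: ennreal_plus)
    finally show "emeasure B (space B) = 1" .
  qed
  hence B: "real_distribution B" using setsB by (intro real_distribution.intro real_distribution_axioms.intro)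
  have "cdf N y = Phi (y / \<theta>\<^sub>0)" for y
  proof -
    have "(\<lambda>x. \<theta>\<^sub>0 * x) -` {..y} \<inter> space std_normal_distribution = {..y / \<theta>\<^sub>0}"
      using \<theta> by (auto simp: field_simps)
    thus ?thesis unfolding cdf_def N_def Phi_def by (subst measure_distr) auto
  qed
  hence "cdf B = cdf A"
    unfolding A(2) by (auto simp: fun_eq_iff cdf_def meas alt_cdf_def w_def)
  hence AB: "A = B" using A(1) B by (intro cdf_unique) auto
  have iN: "integrable N (\<lambda>s. s\<^sup>2)" "(\<integral>s. s\<^sup>2 \<partial>N) = \<theta>\<^sub>0\<^sup>2"
  proof -
    have i: "integrable std_normal_distribution (\<lambda>x. x\<^sup>2)" by (rule integrable_std_normal_distribution_moment)
    have e: "(\<integral>x. x\<^sup>2 \<partial>std_normal_distribution) = 1"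
      using std_normal_distribution_even_moments[of 1] by (simp add: fact_numeral)
    show "integrable N (\<lambda>s. s\<^sup>2)" unfolding N_def
      using i by (subst integrable_distr_eq) (auto simp: power_mult_distrib)
    show "(\<integral>s. s\<^sup>2 \<partial>N) = \<theta>\<^sub>0\<^sup>2" unfolding N_def
      using i e by (subst integral_distr) (auto simp: power_mult_distrib)
  qed
  let ?h = "\<integral>s. s\<^sup>2 \<partial>H"
  have h0: "0 \<le> ?h" by (intro integral_nonneg_AE) auto
  have "(\<integral>\<^sup>+s. ennreal (s\<^sup>2) \<partial>A) = (\<integral>\<^sup>+b. \<integral>\<^sup>+s. ennreal (s\<^sup>2) \<partial>K b \<partial>measure_pmf (bernoulli_pmf w))"
    unfolding AB B_def by (rule nn_integral_bind[OF _ sK]) simp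
  also have "\<dots> = (\<integral>\<^sup>+s. ennreal (s\<^sup>2) \<partial>H) * ennreal w + (\<integral>\<^sup>+s. ennreal (s\<^sup>2) \<partial>N) * ennreal (1 - w)"
    using w by (simp add: K_def)
  also have "\<dots> = ennreal ?h * ennreal w + ennreal (\<theta>\<^sub>0\<^sup>2) * ennreal (1 - w)"
    using nn_integral_eq_integral[OF H2] nn_integral_eq_integral[OF iN(1)] iN(2) by simp
  also have "\<dots> \<le> ennreal ?h * 1 + ennreal (\<theta>\<^sub>0\<^sup>2) * 1"
    using w by (intro add_mono mult_left_mono) (auto simp: ennreal_le_1)
  also have "\<dots> = ennreal (\<theta>\<^sub>0\<^sup>2 + ?h)"
    using h0 by (simp add: ennreal_plus[symmetric] add.commute del: ennreal_plus)
  finally have le: "(\<integral>\<^sup>+s. ennreal (s\<^sup>2) \<partial>A) \<le> ennreal (\<theta>\<^sub>0\<^sup>2 + ?h)" .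
  have "(\<integral>s. s\<^sup>2 \<partial>A) = enn2real (\<integral>\<^sup>+s. ennreal (s\<^sup>2) \<partial>A)"
    by (rule integral_eq_nn_integral) auto
  also have "\<dots> \<le> \<theta>\<^sub>0\<^sup>2 + ?h" using le h0 by (intro enn2real_leI) auto
  finally show ?thesis .
qed

text \<open>The Lipschitz constant is free of n. The linear term of the second statement is always
  the limiting normal density, not the density of the innovation law itself; the discrepancy is a
  linear error carrying the weight of the alternative.\<close>

lemma alt_cdf_lipschitz:
  assumes LH: "0 \<le> LH" "\<And>a b. \<bar>cdf H a - cdf H b\<bar> \<le> LH * \<bar>a - b\<bar>" and \<theta>: "0 < \<theta>\<^sub>0" and r: "0 \<le> r"
  shows "\<bar>alt_cdf \<theta>\<^sub>0 H n r a - alt_cdf \<theta>\<^sub>0 H n r b\<bar> \<le> (1 / \<theta>\<^sub>0 + LH) * \<bar>a - b\<bar>"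
    and "\<bar>alt_cdf \<theta>\<^sub>0 H n r (x + u) - alt_cdf \<theta>\<^sub>0 H n r x - std_normal_density (x / \<theta>\<^sub>0) / \<theta>\<^sub>0 * u\<bar>
          \<le> local_weight n r * (1 / \<theta>\<^sub>0 + LH) * \<bar>u\<bar> + 1 / \<theta>\<^sub>0\<^sup>2 * u\<^sup>2"
proof -
  define w where "w = local_weight n r"
  have w: "0 \<le> w" "w \<le> 1" using local_weight_bounds r by (auto simp: w_def)
  have P: "\<bar>Phi (a / \<theta>\<^sub>0) - Phi (b / \<theta>\<^sub>0)\<bar> \<le> 1 / \<theta>\<^sub>0 * \<bar>a - b\<bar>" for a b
  proof -
    have "1 \<le> sqrt (2 * pi)" using pi_gt3 by simp
    hence "\<bar>a / \<theta>\<^sub>0 - b / \<theta>\<^sub>0\<bar> / sqrt (2 * pi) \<le> \<bar>a / \<theta>\<^sub>0 - b / \<theta>\<^sub>0\<bar> / 1" by (intro divide_left_mono) auto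
    also have "\<dots> = 1 / \<theta>\<^sub>0 * \<bar>a - b\<bar>" using \<theta> by (simp add: diff_divide_distrib[symmetric])
    finally show ?thesis using Phi_lipschitz[of "a / \<theta>\<^sub>0" "b / \<theta>\<^sub>0"] by linarith
  qed
  have P': "\<bar>w * (Phi (a / \<theta>\<^sub>0) - Phi (b / \<theta>\<^sub>0))\<bar> \<le> w * (1 / \<theta>\<^sub>0 * \<bar>a - b\<bar>)" for a b
    using mult_left_mono[OF P[of a b] w(1)] w by (simp add: abs_mult)
  have H': "\<bar>w * (cdf H a - cdf H b)\<bar> \<le> w * (LH * \<bar>a - b\<bar>)" for a b
    using mult_left_mono[OF LH(2)[of a b] w(1)] w by (simp add: abs_mult)
  show "\<bar>alt_cdf \<theta>\<^sub>0 H n r a - alt_cdf \<theta>\<^sub>0 H n r b\<bar> \<le> (1 / \<theta>\<^sub>0 + LH) * \<bar>a - b\<bar>"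
  proof -
    have "\<bar>(1 - w) * (Phi (a / \<theta>\<^sub>0) - Phi (b / \<theta>\<^sub>0))\<bar> \<le> 1 / \<theta>\<^sub>0 * \<bar>a - b\<bar>"
      using mult_mono[of "1 - w" 1 "\<bar>Phi (a / \<theta>\<^sub>0) - Phi (b / \<theta>\<^sub>0)\<bar>" "1 / \<theta>\<^sub>0 * \<bar>a - b\<bar>"] P[of a b] w by (simp add: abs_mult)
    moreover have "\<bar>w * (cdf H a - cdf H b)\<bar> \<le> LH * \<bar>a - b\<bar>"
      using mult_mono[of w 1 "\<bar>cdf H a - cdf H b\<bar>" "LH * \<bar>a - b\<bar>"] LH(2)[of a b] w by (simp add: abs_mult)
    moreover have "alt_cdf \<theta>\<^sub>0 H n r a - alt_cdf \<theta>\<^sub>0 H n r b = (1 - w) * (Phi (a / \<theta>\<^sub>0) - Phi (b / \<theta>\<^sub>0)) + w * (cdf H a - cdf H b)"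
      by (simp add: alt_cdf_def w_def algebra_simps)
    ultimately have "\<bar>alt_cdf \<theta>\<^sub>0 H n r a - alt_cdf \<theta>\<^sub>0 H n r b\<bar> \<le> 1 / \<theta>\<^sub>0 * \<bar>a - b\<bar> + LH * \<bar>a - b\<bar>" by linarith
    thus ?thesis by (simp add: distrib_right)
  qed
  show "\<bar>alt_cdf \<theta>\<^sub>0 H n r (x + u) - alt_cdf \<theta>\<^sub>0 H n r x - std_normal_density (x / \<theta>\<^sub>0) / \<theta>\<^sub>0 * u\<bar>
          \<le> local_weight n r * (1 / \<theta>\<^sub>0 + LH) * \<bar>u\<bar> + 1 / \<theta>\<^sub>0\<^sup>2 * u\<^sup>2"
  proof -
    have "\<bar>Phi (x / \<theta>\<^sub>0 + u / \<theta>\<^sub>0) - Phi (x / \<theta>\<^sub>0) - std_normal_density (x / \<theta>\<^sub>0) * (u / \<theta>\<^sub>0)\<bar> \<le> (u / \<theta>\<^sub>0)\<^sup>2"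
      by (rule Phi_second_order)
    hence 1: "\<bar>Phi ((x + u) / \<theta>\<^sub>0) - Phi (x / \<theta>\<^sub>0) - std_normal_density (x / \<theta>\<^sub>0) / \<theta>\<^sub>0 * u\<bar> \<le> 1 / \<theta>\<^sub>0\<^sup>2 * u\<^sup>2"
      by (simp add: add_divide_distrib power_divide)
    have "alt_cdf \<theta>\<^sub>0 H n r (x + u) - alt_cdf \<theta>\<^sub>0 H n r x - std_normal_density (x / \<theta>\<^sub>0) / \<theta>\<^sub>0 * u
       = (Phi ((x + u) / \<theta>\<^sub>0) - Phi (x / \<theta>\<^sub>0) - std_normal_density (x / \<theta>\<^sub>0) / \<theta>\<^sub>0 * u)
         - w * (Phi ((x + u) / \<theta>\<^sub>0) - Phi (x / \<theta>\<^sub>0)) + w * (cdf H (x + u) - cdf H x)"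
      by (simp add: alt_cdf_def w_def algebra_simps)
    hence "\<bar>alt_cdf \<theta>\<^sub>0 H n r (x + u) - alt_cdf \<theta>\<^sub>0 H n r x - std_normal_density (x / \<theta>\<^sub>0) / \<theta>\<^sub>0 * u\<bar>
      \<le> 1 / \<theta>\<^sub>0\<^sup>2 * u\<^sup>2 + w * (1 / \<theta>\<^sub>0 * \<bar>u\<bar>) + w * (LH * \<bar>u\<bar>)"
      using 1 P'[of "x + u" x] H'[of "x + u" x] by simp
    thus ?thesis by (simp add: w_def algebra_simps)
  qed
qed

text \<open>Dominated convergence with the constant 1 as majorant; it takes the place of a first
  moment of the outlier law.\<close>

lemma tendsto_integral_min:
  assumes Q: "real_distribution Q" and a: "a \<longlonglongrightarrow> 0" "\<And>n. 0 \<le> a n"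
  shows "(\<lambda>n. \<integral>s. min 1 (a n * \<bar>s\<bar>) \<partial>Q) \<longlonglongrightarrow> 0"
proof -
  interpret Q: real_distribution Q by fact
  have "(\<lambda>n. \<integral>s. min 1 (a n * \<bar>s\<bar>) \<partial>Q) \<longlonglongrightarrow> (\<integral>s. min 1 (0 * \<bar>s\<bar>) \<partial>Q)"
  proof (rule integral_dominated_convergence[where w = "\<lambda>_. 1"])
    show "AE s in Q. (\<lambda>n. min 1 (a n * \<bar>s\<bar>)) \<longlonglongrightarrow> min 1 (0 * \<bar>s\<bar>)"
      by (intro AE_I2 tendsto_min tendsto_const tendsto_mult a(1))
  qed (auto simp: a(2))
  thus ?thesis by simp
qed

subsection \<open>Sequences of models\<close>

locale ar_seq =
  fixes M :: "nat \<Rightarrow> 'a measure" and p :: nat and \<beta> :: "nat \<Rightarrow> real" and \<nu> \<mu> \<theta>\<^sub>0 :: real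
    and H Q :: "real measure" and eps z xi v :: "nat \<Rightarrow> int \<Rightarrow> 'a \<Rightarrow> real"
    and rho gam :: "nat \<Rightarrow> real" and \<rho> \<gamma> LH :: real
  assumes model: "\<And>n. 1 \<le> n \<Longrightarrow> contaminated_ar (M n) p \<beta> \<nu> (alt_cdf \<theta>\<^sub>0 H n (rho n)) (local_weight n (gam n)) Q (eps n) (z n) (xi n) (v n)"
    and p_pos: "1 \<le> p"
    and roots: "\<And>w :: complex. w ^ p = (\<Sum>i = 1..p. of_real (\<beta> i) * w ^ (p - i)) \<Longrightarrow> cmod w < 1"
    and mu: "\<nu> = (1 - (\<Sum>i = 1..p. \<beta> i)) * \<mu>"
    and theta_pos: "0 < \<theta>\<^sub>0"
    and Q: "real_distribution Q" and H: "real_distribution H" and H2: "integrable H (\<lambda>s. s\<^sup>2)"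
    and LH: "0 \<le> LH" "\<And>a b. \<bar>cdf H a - cdf H b\<bar> \<le> LH * \<bar>a - b\<bar>"
    and rho: "rho \<longlonglongrightarrow> \<rho>" "\<And>n. 0 \<le> rho n" and gam: "gam \<longlonglongrightarrow> \<gamma>" "\<And>n. 0 \<le> gam n"
begin

abbreviation Gn :: "nat \<Rightarrow> real \<Rightarrow> real" where "Gn n \<equiv> alt_cdf \<theta>\<^sub>0 H n (rho n)"
abbreviation gn :: "nat \<Rightarrow> real" where "gn n \<equiv> local_weight n (gam n)"
abbreviation rn :: "nat \<Rightarrow> real" where "rn n \<equiv> local_weight n (rho n)"

lemma model_n: "1 \<le> n \<Longrightarrow> ar_model (M n) p \<beta> \<nu> (Gn n) (gn n) Q (eps n) (z n) (xi n) (v n) \<mu>"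
  by (intro ar_model.intro ar_model_axioms.intro model p_pos roots mu)

sublocale prob_seq M
  by (rule prob_seq.intro) (rule contaminated_ar.axioms(1)[OF model])

abbreviation "jmp \<equiv> ar_model.jump"
abbreviation "kap \<equiv> ar_model.kap \<beta>"
abbreviation "outl n \<equiv> ar_model.outl p \<beta> (z n) (xi n)"
abbreviation "pert n \<equiv> ar_model.pert p \<beta> (eps n) (z n) (xi n)"
abbreviation "pert0 n \<equiv> ar_model.pert0 p \<beta> (eps n)"
abbreviation "absreg n \<equiv> ar_model.absreg p \<beta> (eps n)"
abbreviation "Vn n \<equiv> ar_model.V p \<beta> (eps n)"
abbreviation "errb n \<equiv> ar_model.errb (M n) p \<beta> (gn n) Q (eps n)"

definition L where "L = 1 / \<theta>\<^sub>0 + LH"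
definition f0 where "f0 x = std_normal_density (x / \<theta>\<^sub>0) / \<theta>\<^sub>0"
text \<open>\<open>Sb\<close> and the barred constants after it are versions of the moment bounds
  that are free of n, the variance of the innovations being replaced by its uniform bound.\<close>

definition Sb where "Sb = \<theta>\<^sub>0\<^sup>2 + (\<integral>s. s\<^sup>2 \<partial>H)"
definition Ybar where "Ybar = 1 + real p * (1 + (ar_model.cs p \<beta>)\<^sup>2 * Sb)"
definition Y2bar where "Y2bar = (real p + 1) * (1 + real p * ((ar_model.cs p \<beta>)\<^sup>2 * Sb))"
definition Vbar where "Vbar = (1 + (\<Sum>k = 1..p. \<bar>\<beta> k\<bar> * (2 * real k * (1 + (ar_model.cs p \<beta>)\<^sup>2 * Sb)))) + (Sb + 1)"

lemma L_nonneg: "0 \<le> L" using theta_pos LH(1) by (simp add: L_def)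

lemma f0_nonneg: "0 \<le> f0 x" using theta_pos by (simp add: f0_def)

lemma G_lipschitz: "\<bar>Gn n a - Gn n b\<bar> \<le> L * \<bar>a - b\<bar>"
  unfolding L_def by (rule alt_cdf_lipschitz(1)[OF LH theta_pos rho(2)])

lemma G_second_order: "\<bar>Gn n (x + u) - Gn n x - f0 x * u\<bar> \<le> rn n * L * \<bar>u\<bar> + 1 / \<theta>\<^sub>0\<^sup>2 * u\<^sup>2"
  unfolding L_def f0_def by (rule alt_cdf_lipschitz(2)[OF LH theta_pos rho(2)])

lemma s2_le:
  assumes "1 \<le> n"
  shows "contaminated_ar.s2 (M n) (eps n) \<le> Sb"
proof -
  interpret a: ar_model "M n" p \<beta> \<nu> "Gn n" "gn n" Q "eps n" "z n" "xi n" "v n" \<mu> by (rule model_n[OF assms])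
  have "a.s2 = (\<integral>s. s\<^sup>2 \<partial>a.A)" unfolding a.s2_def by (subst integral_distr) auto
  also have "\<dots> \<le> Sb" unfolding Sb_def
    by (rule alt_cdf_second_moment[OF a.eps_law _ theta_pos H H2 rho(2)]) (rule a.eps_cdf)
  finally show ?thesis .
qed

lemma moment_bounds:
  assumes n: "1 \<le> n"
  shows "ar_model.Yb (M n) p \<beta> (eps n) \<le> Ybar" "ar_model.Y2 (M n) p \<beta> (eps n) \<le> Y2bar" "ar_model.Vb (M n) p \<beta> (eps n) \<le> Vbar"
proof -
  interpret a: ar_model "M n" p \<beta> \<nu> "Gn n" "gn n" Q "eps n" "z n" "xi n" "v n" \<mu> by (rule model_n[OF n])
  note s2_le[OF n]
  show "a.Yb \<le> Ybar" unfolding a.Yb_def Ybar_def by (intro add_mono mult_left_mono s2_le n order_refl) auto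
  show "a.Y2 \<le> Y2bar" unfolding a.Y2_def Y2bar_def by (intro add_mono mult_left_mono s2_le n order_refl) auto
  show "a.Vb \<le> Vbar" unfolding a.Vb_def Vbar_def by (intro add_mono sum_mono mult_left_mono s2_le n order_refl) auto
qed

definition errbar where
  "errbar n B = (real p + 1) * gn n * (4 * L * (1 / sqrt (real n)) * B * Ybar + (\<integral>s. min 1 (2 * L * (1 / sqrt (real n)) * B * \<bar>s\<bar>) \<partial>Q))
      + (real p + 3) * (real p + 1)\<^sup>2 * (gn n)\<^sup>2"

lemma errb_le:
  assumes n: "1 \<le> n" and B: "0 \<le> B"
  shows "errb n L (1 / sqrt (real n)) B \<le> errbar n B"
proof -
  interpret a: ar_model "M n" p \<beta> \<nu> "Gn n" "gn n" Q "eps n" "z n" "xi n" "v n" \<mu> by (rule model_n[OF n])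
  show ?thesis unfolding a.errb_def errbar_def
    using local_weight_bounds(1)[OF gam(2)] L_nonneg B
    by (intro add_mono mult_left_mono moment_bounds n order_refl) auto
qed

lemma inv_sqrt_tendsto: "(\<lambda>n. 1 / sqrt (real n)) \<longlonglongrightarrow> 0"
  by (rule real_tendsto_divide_at_top[OF tendsto_const filterlim_compose[OF sqrt_at_top filterlim_real_sequentially]])

lemma gn_tendsto: "(\<lambda>n. sqrt (real n) * gn n) \<longlonglongrightarrow> \<gamma>" "gn \<longlonglongrightarrow> 0"
  using sqrt_local_weight[OF gam] by auto

lemma rn_tendsto: "(\<lambda>n. sqrt (real n) * rn n) \<longlonglongrightarrow> \<rho>" "rn \<longlonglongrightarrow> 0"
  using sqrt_local_weight[OF rho] by auto

text \<open>One factor sqrt n is absorbed by the contamination probability, since sqrt n * g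
  converges. What remains is the truncated single-outlier error in the first summand and a further
  factor g in the second, and both vanish.\<close>

lemma errbar_tendsto:
  assumes B: "0 \<le> B"
  shows "(\<lambda>n. sqrt (real n) * errbar n B) \<longlonglongrightarrow> 0" "(\<lambda>n. errbar n B) \<longlonglongrightarrow> 0"
proof -
  have m: "(\<lambda>n. \<integral>s. min 1 (2 * L * (1 / sqrt (real n)) * B * \<bar>s\<bar>) \<partial>Q) \<longlonglongrightarrow> 0"
  proof (rule tendsto_integral_min[OF Q])
    have "(\<lambda>n. 2 * L * (1 / sqrt (real n)) * B) \<longlonglongrightarrow> 2 * L * 0 * B" by (intro tendsto_intros inv_sqrt_tendsto)
    thus "(\<lambda>n. 2 * L * (1 / sqrt (real n)) * B) \<longlonglongrightarrow> 0" by simp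
  qed (use B L_nonneg in auto)
  have "(\<lambda>n. (real p + 1) * (sqrt (real n) * gn n) * (4 * L * (1 / sqrt (real n)) * B * Ybar + (\<integral>s. min 1 (2 * L * (1 / sqrt (real n)) * B * \<bar>s\<bar>) \<partial>Q))
      + (real p + 3) * (real p + 1)\<^sup>2 * ((sqrt (real n) * gn n) * gn n)) \<longlonglongrightarrow>
      (real p + 1) * \<gamma> * (4 * L * 0 * B * Ybar + 0) + (real p + 3) * (real p + 1)\<^sup>2 * (\<gamma> * 0)"
    by (intro tendsto_intros inv_sqrt_tendsto gn_tendsto m)
  thus "(\<lambda>n. sqrt (real n) * errbar n B) \<longlonglongrightarrow> 0"
    by (simp add: errbar_def algebra_simps power2_eq_square)
  have "(\<lambda>n. errbar n B) \<longlonglongrightarrow> (real p + 1) * 0 * (4 * L * 0 * B * Ybar + 0) + (real p + 3) * (real p + 1)\<^sup>2 * 0\<^sup>2"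
    unfolding errbar_def by (intro tendsto_intros inv_sqrt_tendsto gn_tendsto m)
  thus "(\<lambda>n. errbar n B) \<longlonglongrightarrow> 0" by simp
qed

text \<open>The difference between the normalized empirical processes of perturbed and unperturbed
  innovations at level x, for nonrandom coefficients b and slack d.\<close>

definition Dn :: "real \<Rightarrow> nat \<Rightarrow> (nat \<Rightarrow> real) \<Rightarrow> real \<Rightarrow> 'a \<Rightarrow> real" where
  "Dn x n b d \<omega> = (\<Sum>t = 1..int n. jmp x (outl n t \<omega> + pert n b d t \<omega> / sqrt (real n)) (eps n t \<omega>)) / sqrt (real n)"

definition kn :: "real \<Rightarrow> nat \<Rightarrow> nat \<Rightarrow> real \<Rightarrow> real" where
  "kn x n j s = Gn n (x + kap j * s) - Gn n x"

lemma kn_integral_tendsto: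
  "(\<lambda>n. \<integral>s. kn x n j s \<partial>Q) \<longlonglongrightarrow> (\<integral>s. Phi ((x + kap j * s) / \<theta>\<^sub>0) \<partial>Q) - Phi (x / \<theta>\<^sub>0)"
proof -
  interpret Q: real_distribution Q by (rule Q)
  interpret H: real_distribution H by (rule H)
  have [measurable]: "cdf H \<in> borel_measurable borel"
    by (rule borel_measurable_mono) (auto intro: monoI H.cdf_nondecreasing)
  have G: "(\<lambda>n. Gn n y) \<longlonglongrightarrow> Phi (y / \<theta>\<^sub>0)" for y
  proof -
    have "(\<lambda>n. (1 - rn n) * Phi (y / \<theta>\<^sub>0) + rn n * cdf H y) \<longlonglongrightarrow> (1 - 0) * Phi (y / \<theta>\<^sub>0) + 0 * cdf H y"
      by (intro tendsto_intros rn_tendsto)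
    thus ?thesis by (simp add: alt_cdf_def)
  qed
  have Gb: "\<bar>Gn n y\<bar> \<le> 1" for n y
  proof -
    have "0 \<le> rn n" "rn n \<le> 1" using local_weight_bounds rho(2) by auto
    moreover have "0 \<le> cdf H y" "cdf H y \<le> 1" by (rule H.cdf_nonneg, rule H.cdf_bounded_prob)
    moreover have "(1 - rn n) * Phi (y / \<theta>\<^sub>0) + rn n * cdf H y \<le> (1 - rn n) * 1 + rn n * 1"
      using calculation Phi_bounds[of "y / \<theta>\<^sub>0"] by (intro add_mono mult_left_mono) auto
    ultimately have "0 \<le> Gn n y" "Gn n y \<le> 1"
      unfolding alt_cdf_def using Phi_bounds[of "y / \<theta>\<^sub>0"] by auto
    thus ?thesis by simp
  qed
  have "(\<lambda>n. \<integral>s. kn x n j s \<partial>Q) \<longlonglongrightarrow> (\<integral>s. Phi ((x + kap j * s) / \<theta>\<^sub>0) - Phi (x / \<theta>\<^sub>0) \<partial>Q)"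
  proof (rule integral_dominated_convergence[where w = "\<lambda>_. 2"])
    show "AE s in Q. (\<lambda>n. kn x n j s) \<longlonglongrightarrow> Phi ((x + kap j * s) / \<theta>\<^sub>0) - Phi (x / \<theta>\<^sub>0)"
      unfolding kn_def by (intro AE_I2 tendsto_intros G)
    fix n
    show "kn x n j \<in> borel_measurable Q" unfolding kn_def alt_cdf_def by measurable
    show "AE s in Q. norm (kn x n j s) \<le> 2"
    proof (rule AE_I2)
      fix s show "norm (kn x n j s) \<le> 2" unfolding kn_def using Gb[of n "x + kap j * s"] Gb[of n x] by auto
    qed
  qed auto
  also have "(\<integral>s. Phi ((x + kap j * s) / \<theta>\<^sub>0) - Phi (x / \<theta>\<^sub>0) \<partial>Q) = (\<integral>s. Phi ((x + kap j * s) / \<theta>\<^sub>0) \<partial>Q) - Phi (x / \<theta>\<^sub>0)"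
    using Q.prob_space Phi_bounds
    by (subst Bochner_Integration.integral_diff) (auto intro!: Q.integrable_bounded[where B = 1])
  finally show ?thesis .
qed

lemma Delta_0_eq: "Delta_0 p \<beta> \<theta>\<^sub>0 Q x = (\<Sum>j\<le>p. (\<integral>s. Phi ((x + kap j * s) / \<theta>\<^sub>0) \<partial>Q) - Phi (x / \<theta>\<^sub>0))"
proof -
  interpret a: ar_model "M 1" p \<beta> \<nu> "Gn 1" "gn 1" Q "eps 1" "z 1" "xi 1" "v 1" \<mu> by (rule model_n) simp
  show ?thesis unfolding Delta_0_def atMost_atLeast0 a.kap_def by simp
qed

text \<open>An exact decomposition into pieces that vanish separately: \<open>C\<close> the
  compensated jumps, \<open>E\<close> the windows with interacting outliers, \<open>T\<close> the
  Taylor remainder at the clean perturbation, and \<open>Ot\<close> the fluctuation of the outlier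
  increments about their mean. The means themselves converge to the shift \<gamma> *
  \<open>Delta_0\<close>.\<close>

lemma Dn_fixed:
  "oP (\<lambda>n \<omega>. Dn x n b d \<omega> - f0 x * ((\<Sum>t = 1..int n. pert0 n b d t \<omega>) / real n) - \<gamma> * Delta_0 p \<beta> \<theta>\<^sub>0 Q x)"
proof -
  define B where "B = \<bar>d\<bar> + (\<Sum>i\<le>p. \<bar>b i\<bar>)"
  have b: "\<forall>i\<le>p. \<bar>b i\<bar> \<le> B"
  proof safe
    fix i assume "i \<le> p"
    hence "\<bar>b i\<bar> \<le> (\<Sum>i\<le>p. \<bar>b i\<bar>)" by (intro member_le_sum) auto
    thus "\<bar>b i\<bar> \<le> B" by (simp add: B_def)
  qed
  have d: "\<bar>d\<bar> \<le> B" unfolding B_def using sum_nonneg[of "{..p}" "\<lambda>i. \<bar>b i\<bar>"] by simp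
  have B: "0 \<le> B" using d by auto
  define C where "C n \<omega> = ar_model.compensated p \<beta> (Gn n) (eps n) (z n) (xi n) n b d x \<omega> / sqrt (real n)" for n \<omega>
  define E where "E n \<omega> = (\<Sum>t = 1..int n. ar_model.err p \<beta> (Gn n) (eps n) (z n) (xi n) (1 / sqrt (real n)) b d x t \<omega>) / sqrt (real n)" for n \<omega>
  define T where "T n \<omega> = (\<Sum>t = 1..int n. Gn n (x + pert0 n b d t \<omega> / sqrt (real n)) - Gn n x - f0 x * (pert0 n b d t \<omega> / sqrt (real n))) / sqrt (real n)" for n \<omega>
  define Ot where "Ot j n \<omega> = (\<Sum>t = 1..int n. z n (t - int j) \<omega> * kn x n j (xi n (t - int j) \<omega>)) / sqrt (real n) - sqrt (real n) * (gn n * (\<integral>s. kn x n j s \<partial>Q))" for j n \<omega>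
  have oC: "oP C"
  proof (rule oP_square, rule oP_expectation)
    let ?b = "\<lambda>n. 4 * (errbar n B + L * (1 / sqrt (real n)) * (2 * B * Ybar) + (real p + 1) * gn n)"
    show "\<forall>\<^sub>F n in sequentially. integrable (M n) (\<lambda>\<omega>. (C n \<omega>)\<^sup>2) \<and> (\<integral>\<omega>. \<bar>(C n \<omega>)\<^sup>2\<bar> \<partial>M n) \<le> ?b n"
      using eventually_ge_at_top[of 1]
    proof eventually_elim
      case (elim n)
      interpret a: ar_model "M n" p \<beta> \<nu> "Gn n" "gn n" Q "eps n" "z n" "xi n" "v n" \<mu> by (rule model_n[OF elim])
      note cb = a.compensated_bound[OF L_nonneg G_lipschitz elim b d, of x]
      have "4 * (errb n L (1 / sqrt (real n)) B + L / sqrt (real n) * (2 * B * a.Yb) + (real p + 1) * gn n) \<le> ?b n"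
        using L_nonneg B moment_bounds(1)[OF elim] errb_le[OF elim B]
        by (intro mult_left_mono add_mono order_refl) (auto intro!: divide_right_mono mult_left_mono)
      thus ?case using cb by (simp add: C_def)
    qed
    have "?b \<longlonglongrightarrow> 4 * (0 + L * 0 * (2 * B * Ybar) + (real p + 1) * 0)"
      by (intro tendsto_intros errbar_tendsto B inv_sqrt_tendsto gn_tendsto)
    thus "?b \<longlonglongrightarrow> 0" by simp
  qed
  have oE: "oP E"
  proof (rule oP_expectation)
    show "\<forall>\<^sub>F n in sequentially. integrable (M n) (E n) \<and> (\<integral>\<omega>. \<bar>E n \<omega>\<bar> \<partial>M n) \<le> sqrt (real n) * errbar n B"
      using eventually_ge_at_top[of 1]
    proof eventually_elim
      case (elim n)
      interpret a: ar_model "M n" p \<beta> \<nu> "Gn n" "gn n" Q "eps n" "z n" "xi n" "v n" \<mu> by (rule model_n[OF elim])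
      have "0 \<le> 1 / sqrt (real n)" by simp
      note e = a.err_expectation[OF L_nonneg G_lipschitz this b d]
      note s = a.sqrt_sum_expectation[OF elim e, of "\<lambda>_. x" "\<lambda>t. t"]
      have "sqrt (real n) * errb n L (1 / sqrt (real n)) B \<le> sqrt (real n) * errbar n B"
        by (intro mult_left_mono errb_le elim B) auto
      thus ?case using s unfolding E_def by auto
    qed
  qed (rule errbar_tendsto[OF B])
  have oT: "oP T"
  proof (rule oP_expectation)
    let ?b = "\<lambda>n. (rn n * L) * (2 * B * Ybar) + 1 / \<theta>\<^sub>0\<^sup>2 * (4 * B\<^sup>2 * Y2bar) * (1 / sqrt (real n))"
    show "\<forall>\<^sub>F n in sequentially. integrable (M n) (T n) \<and> (\<integral>\<omega>. \<bar>T n \<omega>\<bar> \<partial>M n) \<le> ?b n"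
      using eventually_ge_at_top[of 1]
    proof eventually_elim
      case (elim n)
      interpret a: ar_model "M n" p \<beta> \<nu> "Gn n" "gn n" Q "eps n" "z n" "xi n" "v n" \<mu> by (rule model_n[OF elim])
      have d0: "0 \<le> rn n * L" "0 \<le> 1 / \<theta>\<^sub>0\<^sup>2" using local_weight_bounds(1)[OF rho(2)] L_nonneg by auto
      note f = a.first_order_bound[OF G_second_order elim d0 b d, of x]
      have "rn n * L * (2 * B * a.Yb) + 1 / \<theta>\<^sub>0\<^sup>2 * (4 * B\<^sup>2 * a.Y2) / sqrt (real n) \<le> ?b n"
        using d0 B moment_bounds(1,2)[OF elim]
        by (intro add_mono mult_left_mono) (auto intro!: divide_right_mono mult_left_mono)
      thus ?case using f unfolding T_def by auto
    qed
    have "?b \<longlonglongrightarrow> (0 * L) * (2 * B * Ybar) + 1 / \<theta>\<^sub>0\<^sup>2 * (4 * B\<^sup>2 * Y2bar) * 0"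
      by (intro tendsto_intros inv_sqrt_tendsto rn_tendsto)
    thus "?b \<longlonglongrightarrow> 0" by simp
  qed
  have oO: "oP (Ot j)" for j
  proof (rule oP_square, rule oP_expectation)
    show "\<forall>\<^sub>F n in sequentially. integrable (M n) (\<lambda>\<omega>. (Ot j n \<omega>)\<^sup>2) \<and> (\<integral>\<omega>. \<bar>(Ot j n \<omega>)\<^sup>2\<bar> \<partial>M n) \<le> gn n"
      using eventually_ge_at_top[of 1]
    proof eventually_elim
      case (elim n)
      interpret a: ar_model "M n" p \<beta> \<nu> "Gn n" "gn n" Q "eps n" "z n" "xi n" "v n" \<mu> by (rule model_n[OF elim])
      have k: "kn x n j \<in> borel_measurable borel" unfolding kn_def using a.G_measurable by measurable
      have "\<bar>kn x n j s\<bar> \<le> 1" for s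
        unfolding kn_def using a.G_bounds[of "x + kap j * s"] a.G_bounds[of x] by auto
      note o = a.outlier_sum_bound[OF k this elim, of "int j"]
      thus ?case unfolding Ot_def by auto
    qed
  qed (rule gn_tendsto)
  have oK: "oP (\<lambda>n _. (\<Sum>j\<le>p. sqrt (real n) * (gn n * (\<integral>s. kn x n j s \<partial>Q))) - \<gamma> * Delta_0 p \<beta> \<theta>\<^sub>0 Q x)"
  proof (rule oP_const)
    have "(\<lambda>n. (\<Sum>j\<le>p. (sqrt (real n) * gn n) * (\<integral>s. kn x n j s \<partial>Q)) - \<gamma> * Delta_0 p \<beta> \<theta>\<^sub>0 Q x)
      \<longlonglongrightarrow> (\<Sum>j\<le>p. \<gamma> * ((\<integral>s. Phi ((x + kap j * s) / \<theta>\<^sub>0) \<partial>Q) - Phi (x / \<theta>\<^sub>0))) - \<gamma> * Delta_0 p \<beta> \<theta>\<^sub>0 Q x"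
      by (intro tendsto_intros gn_tendsto kn_integral_tendsto)
    thus "(\<lambda>n. (\<Sum>j\<le>p. sqrt (real n) * (gn n * (\<integral>s. kn x n j s \<partial>Q))) - \<gamma> * Delta_0 p \<beta> \<theta>\<^sub>0 Q x) \<longlonglongrightarrow> 0"
      by (simp add: Delta_0_eq sum_distrib_left mult.assoc)
  qed
  \<comment> \<open>The five errors add up to the asserted difference, because the two pieces of the
    compensator and the outlier means telescope.\<close>
  have all: "oP (\<lambda>n \<omega>. C n \<omega> + E n \<omega> + T n \<omega> + (\<Sum>j\<le>p. Ot j n \<omega>) + ((\<Sum>j\<le>p. sqrt (real n) * (gn n * (\<integral>s. kn x n j s \<partial>Q))) - \<gamma> * Delta_0 p \<beta> \<theta>\<^sub>0 Q x))"
    by (intro oP_add oP_sum oC oE oT oO oK)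
  show ?thesis
  proof (rule oP_mono[OF all], rule whp_all)
    show "\<forall>\<^sub>F n in sequentially. \<forall>\<omega>\<in>space (M n). \<bar>Dn x n b d \<omega> - f0 x * ((\<Sum>t = 1..int n. pert0 n b d t \<omega>) / real n) - \<gamma> * Delta_0 p \<beta> \<theta>\<^sub>0 Q x\<bar>
       \<le> \<bar>C n \<omega> + E n \<omega> + T n \<omega> + (\<Sum>j\<le>p. Ot j n \<omega>) + ((\<Sum>j\<le>p. sqrt (real n) * (gn n * (\<integral>s. kn x n j s \<partial>Q))) - \<gamma> * Delta_0 p \<beta> \<theta>\<^sub>0 Q x)\<bar>"
      using eventually_ge_at_top[of 1]
    proof eventually_elim
      case (elim n)
      interpret a: ar_model "M n" p \<beta> \<nu> "Gn n" "gn n" Q "eps n" "z n" "xi n" "v n" \<mu> by (rule model_n[OF elim])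
      let ?q = "sqrt (real n)"
      have q: "?q * ?q = real n" by simp
      show ?case
      proof
        fix \<omega>
        have Ot: "(\<Sum>j\<le>p. Ot j n \<omega>) + (\<Sum>j\<le>p. ?q * (gn n * (\<integral>s. kn x n j s \<partial>Q)))
            = (\<Sum>t = 1..int n. \<Sum>j\<le>p. z n (t - int j) \<omega> * (Gn n (x + kap j * xi n (t - int j) \<omega>) - Gn n x)) / ?q"
          unfolding Ot_def kn_def sum.distrib[symmetric] by (subst sum.swap) (simp add: sum_divide_distrib)
        have "f0 x * ((\<Sum>t = 1..int n. pert0 n b d t \<omega>) / real n) = (\<Sum>t = 1..int n. f0 x * (pert0 n b d t \<omega> / ?q)) / ?q"
          by (simp add: sum_distrib_left sum_divide_distrib q)
        moreover have "C n \<omega> + E n \<omega> + T n \<omega> + (\<Sum>t = 1..int n. \<Sum>j\<le>p. z n (t - int j) \<omega> * (Gn n (x + kap j * xi n (t - int j) \<omega>) - Gn n x)) / ?q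
            = Dn x n b d \<omega> - (\<Sum>t = 1..int n. f0 x * (pert0 n b d t \<omega> / ?q)) / ?q"
        proof -
          define J where "J t = jmp x (outl n t \<omega> + pert n b d t \<omega> / ?q) (eps n t \<omega>)" for t
          define W where "W t = Gn n (x + (outl n t \<omega> + pert n b d t \<omega> / ?q)) - Gn n x" for t
          define Er where "Er t = a.err (1 / ?q) b d x t \<omega>" for t
          define F where "F t = f0 x * (pert0 n b d t \<omega> / ?q)" for t
          define U where "U t = Gn n (x + pert0 n b d t \<omega> / ?q) - Gn n x" for t
          define R where "R t = (\<Sum>j\<le>p. z n (t - int j) \<omega> * (Gn n (x + kap j * xi n (t - int j) \<omega>) - Gn n x))" for t
          have Er: "Er t = W t - U t - R t" for t by (simp add: Er_def W_def U_def R_def a.err_def)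
          have "(\<Sum>t = 1..int n. J t - W t) + (\<Sum>t = 1..int n. Er t) + (\<Sum>t = 1..int n. U t - F t) + (\<Sum>t = 1..int n. R t)
              = (\<Sum>t = 1..int n. J t) - (\<Sum>t = 1..int n. F t)"
            by (simp add: Er sum_subtractf)
          hence "((\<Sum>t = 1..int n. J t - W t) + (\<Sum>t = 1..int n. Er t) + (\<Sum>t = 1..int n. U t - F t) + (\<Sum>t = 1..int n. R t)) / ?q
              = ((\<Sum>t = 1..int n. J t) - (\<Sum>t = 1..int n. F t)) / ?q" by (rule arg_cong)
          moreover have "C n \<omega> = (\<Sum>t = 1..int n. J t - W t) / ?q"
            by (simp add: C_def a.compensated_def J_def W_def)
          moreover have "E n \<omega> = (\<Sum>t = 1..int n. Er t) / ?q" by (simp add: E_def Er_def)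
          moreover have "T n \<omega> = (\<Sum>t = 1..int n. U t - F t) / ?q" by (simp add: T_def U_def F_def)
          moreover have "Dn x n b d \<omega> = (\<Sum>t = 1..int n. J t) / ?q" by (simp add: Dn_def J_def)
          ultimately show ?thesis unfolding F_def[symmetric] R_def[symmetric]
            by (simp only: add_divide_distrib diff_divide_distrib)
        qed
        ultimately have "C n \<omega> + E n \<omega> + T n \<omega> + ((\<Sum>j\<le>p. Ot j n \<omega>) + (\<Sum>j\<le>p. ?q * (gn n * (\<integral>s. kn x n j s \<partial>Q))))
            = Dn x n b d \<omega> - f0 x * ((\<Sum>t = 1..int n. pert0 n b d t \<omega>) / real n)"
          unfolding Ot by simp
        thus "\<bar>Dn x n b d \<omega> - f0 x * ((\<Sum>t = 1..int n. pert0 n b d t \<omega>) / real n) - \<gamma> * Delta_0 p \<beta> \<theta>\<^sub>0 Q x\<bar>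
           \<le> \<bar>C n \<omega> + E n \<omega> + T n \<omega> + (\<Sum>j\<le>p. Ot j n \<omega>) + ((\<Sum>j\<le>p. ?q * (gn n * (\<integral>s. kn x n j s \<partial>Q))) - \<gamma> * Delta_0 p \<beta> \<theta>\<^sub>0 Q x)\<bar>"
          by linarith
      qed
    qed
  qed
qed

end

text \<open>Multiples of d; the range is one step wider than the ratio |K| / d requires, since
  rounding down may leave it at the negative end.\<close>

lemma finite_grid:
  fixes K d :: real
  assumes "0 < d"
  obtains S where "finite S" "\<And>y. \<bar>y\<bar> \<le> K \<Longrightarrow> \<exists>s\<in>S. \<bar>y - s\<bar> \<le> d"
proof
  let ?N = "nat \<lceil>\<bar>K\<bar> / d\<rceil> + 1"
  show "finite ((\<lambda>k::int. of_int k * d) ` {- int ?N..int ?N})" by simp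
  fix y assume y: "\<bar>y\<bar> \<le> K"
  define k where "k = \<lfloor>y / d\<rfloor>"
  have 1: "of_int k \<le> y / d" "y / d < of_int k + 1" by (auto simp: k_def)
  have "\<bar>y / d\<bar> \<le> \<bar>K\<bar> / d" using y assms by (simp add: divide_right_mono abs_divide)
  also have "\<dots> \<le> real_of_int (int (nat \<lceil>\<bar>K\<bar> / d\<rceil>))" using assms by (simp add: le_of_int_ceiling)
  finally have "\<bar>y / d\<bar> \<le> real_of_int (int (nat \<lceil>\<bar>K\<bar> / d\<rceil>))" .
  hence "real_of_int k \<le> real_of_int (int (nat \<lceil>\<bar>K\<bar> / d\<rceil>))" "- real_of_int (int (nat \<lceil>\<bar>K\<bar> / d\<rceil>)) - 1 \<le> real_of_int k"
    using 1 by linarith+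
  hence k: "k \<in> {- int ?N..int ?N}" by (auto simp: field_simps)
  have "\<bar>y - of_int k * d\<bar> \<le> d"
  proof -
    have "of_int k * d \<le> y" "y < (of_int k + 1) * d" using 1 assms by (auto simp: field_simps)
    thus ?thesis by (auto simp: algebra_simps)
  qed
  thus "\<exists>s\<in>(\<lambda>k::int. of_int k * d) ` {- int ?N..int ?N}. \<bar>y - s\<bar> \<le> d" using k by blast
qed

section \<open>From nonrandom to estimated coefficients\<close>

context ar_seq
begin

definition absmean :: "nat \<Rightarrow> 'a \<Rightarrow> real" where
  "absmean n \<omega> = (\<Sum>t = 1..int n. absreg n t \<omega>) / real n"

lemma absmean_nonneg: "1 \<le> n \<Longrightarrow> 0 \<le> absmean n \<omega>"
proof -
  assume n: "1 \<le> n"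
  interpret a: ar_model "M n" p \<beta> \<nu> "Gn n" "gn n" Q "eps n" "z n" "xi n" "v n" \<mu> by (rule model_n[OF n])
  show ?thesis unfolding absmean_def by (intro divide_nonneg_nonneg sum_nonneg a.absreg_nonneg) auto
qed

lemma OP_absmean: "OP absmean"
proof (rule OP_expectation)
  show "\<forall>\<^sub>F n in sequentially. integrable (M n) (absmean n) \<and> (\<integral>\<omega>. \<bar>absmean n \<omega>\<bar> \<partial>M n) \<le> Ybar"
    using eventually_ge_at_top[of 1]
  proof eventually_elim
    case (elim n)
    interpret a: ar_model "M n" p \<beta> \<nu> "Gn n" "gn n" Q "eps n" "z n" "xi n" "v n" \<mu> by (rule model_n[OF elim])
    have i: "integrable (M n) (absmean n)" unfolding absmean_def[abs_def]
      by (intro integrable_divide Bochner_Integration.integrable_sum a.absreg_moments)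
    have "(\<integral>\<omega>. \<bar>absmean n \<omega>\<bar> \<partial>M n) = (\<integral>\<omega>. absmean n \<omega> \<partial>M n)"
      using absmean_nonneg[OF elim] by simp
    also have "\<dots> = (\<Sum>t = 1..int n. a.expectation (absreg n t)) / real n"
      unfolding absmean_def by (simp add: Bochner_Integration.integral_sum a.absreg_moments)
    also have "\<dots> \<le> (\<Sum>t = 1..int n. Ybar) / real n"
      by (intro divide_right_mono sum_mono order_trans[OF a.absreg_moments(2) moment_bounds(1)] elim) auto
    also have "\<dots> = Ybar" using elim by simp
    finally show ?case using i by simp
  qed
qed

lemma oP_V_mean: "oP (\<lambda>n \<omega>. (\<Sum>t = 1..int n. Vn n (t - int i) \<omega>) / real n)"
proof (rule oP_expectation)
  let ?b = "\<bar>1 - (\<Sum>i = 1..p. \<beta> i)\<bar>"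
  show "\<forall>\<^sub>F n in sequentially. integrable (M n) (\<lambda>\<omega>. (\<Sum>t = 1..int n. Vn n (t - int i) \<omega>) / real n) \<and>
      (\<integral>\<omega>. \<bar>(\<Sum>t = 1..int n. Vn n (t - int i) \<omega>) / real n\<bar> \<partial>M n) \<le> Vbar / ?b * (1 / sqrt (real n))"
    using eventually_ge_at_top[of 1]
  proof eventually_elim
    case (elim n)
    interpret a: ar_model "M n" p \<beta> \<nu> "Gn n" "gn n" Q "eps n" "z n" "xi n" "v n" \<mu> by (rule model_n[OF elim])
    have "a.Vb / ?b / sqrt (real n) \<le> Vbar / ?b / sqrt (real n)"
      by (intro divide_right_mono moment_bounds elim) auto
    thus ?case using a.V_sum_bound[OF elim, of "int i"] by auto
  qed
  have "(\<lambda>n. Vbar / ?b * (1 / sqrt (real n))) \<longlonglongrightarrow> Vbar / ?b * 0" by (intro tendsto_intros inv_sqrt_tendsto)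
  thus "(\<lambda>n. Vbar / ?b * (1 / sqrt (real n))) \<longlonglongrightarrow> 0" by simp
qed

text \<open>The lagged values of V average to 0, so only the intercept and the slack are left; for
  this reason the errors of the autoregressive coefficients have no first-order effect.\<close>

lemma pert0_mean:
  "oP (\<lambda>n \<omega>. (\<Sum>t = 1..int n. pert0 n b d t \<omega>) / real n - b 0 - d * absmean n \<omega>)"
proof -
  have "oP (\<lambda>n \<omega>. \<Sum>i = 1..p. b i * ((\<Sum>t = 1..int n. Vn n (t - int i) \<omega>) / real n))"
    by (intro oP_sum oP_cmult oP_V_mean)
  thus ?thesis
  proof (rule oP_mono, intro whp_all eventually_mono[OF eventually_ge_at_top[of 1]] ballI)
    fix n :: nat and \<omega> assume n: "1 \<le> n"
    interpret a: ar_model "M n" p \<beta> \<nu> "Gn n" "gn n" Q "eps n" "z n" "xi n" "v n" \<mu> by (rule model_n[OF n])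
    have "(\<Sum>i\<le>p. b i * a.reg0 t i \<omega>) = b 0 + (\<Sum>i = 1..p. b i * Vn n (t - int i) \<omega>)" for t
      by (simp add: atMost_atLeast0 sum.atLeast_Suc_atMost a.reg0_def)
    hence "(\<Sum>t = 1..int n. pert0 n b d t \<omega>) = (\<Sum>t = 1..int n. b 0 + (\<Sum>i = 1..p. b i * Vn n (t - int i) \<omega>) + d * absreg n t \<omega>)"
      unfolding a.pert0_def a.absreg_def by simp
    also have "\<dots> = real n * b 0 + (\<Sum>i = 1..p. b i * (\<Sum>t = 1..int n. Vn n (t - int i) \<omega>)) + d * (\<Sum>t = 1..int n. absreg n t \<omega>)"
      unfolding sum.distrib by (subst sum.swap) (simp add: sum_distrib_left)
    finally have e: "(\<Sum>t = 1..int n. pert0 n b d t \<omega>) = \<dots>" .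
    have "(\<Sum>i = 1..p. b i * (\<Sum>t = 1..int n. Vn n (t - int i) \<omega>)) / real n
        = (\<Sum>i = 1..p. b i * ((\<Sum>t = 1..int n. Vn n (t - int i) \<omega>) / real n))"
      by (subst sum_divide_distrib) simp
    hence "(\<Sum>t = 1..int n. pert0 n b d t \<omega>) / real n - b 0 - d * absmean n \<omega>
        = (\<Sum>i = 1..p. b i * ((\<Sum>t = 1..int n. Vn n (t - int i) \<omega>) / real n))"
      unfolding e using n by (simp add: absmean_def add_divide_distrib)
    thus "\<bar>(\<Sum>t = 1..int n. pert0 n b d t \<omega>) / real n - b 0 - d * absmean n \<omega>\<bar>
        \<le> \<bar>\<Sum>i = 1..p. b i * ((\<Sum>t = 1..int n. Vn n (t - int i) \<omega>) / real n)\<bar>" by simp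
  qed
qed

lemma Dn_expansion:
  "oP (\<lambda>n \<omega>. Dn x n b d \<omega> - f0 x * (b 0 + d * absmean n \<omega>) - \<gamma> * Delta_0 p \<beta> \<theta>\<^sub>0 Q x)"
proof -
  have "oP (\<lambda>n \<omega>. (Dn x n b d \<omega> - f0 x * ((\<Sum>t = 1..int n. pert0 n b d t \<omega>) / real n) - \<gamma> * Delta_0 p \<beta> \<theta>\<^sub>0 Q x)
     + f0 x * ((\<Sum>t = 1..int n. pert0 n b d t \<omega>) / real n - b 0 - d * absmean n \<omega>))"
    by (intro oP_add oP_cmult Dn_fixed pert0_mean)
  thus ?thesis by (simp add: algebra_simps)
qed

text \<open>Moving every coefficient by at most d changes the linear form by at most d times the sum
  of the absolute regressors, which is exactly the slack of \<open>pert\<close>; and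
  \<open>jump\<close> is monotone in the perturbation.\<close>

lemma Dn_mono:
  assumes n: "1 \<le> n" and d: "\<forall>i\<le>p. \<bar>b i - b' i\<bar> \<le> d"
  shows "Dn x n b' (- d) \<omega> \<le> Dn x n b 0 \<omega>" "Dn x n b 0 \<omega> \<le> Dn x n b' d \<omega>"
proof -
  interpret a: ar_model "M n" p \<beta> \<nu> "Gn n" "gn n" Q "eps n" "z n" "xi n" "v n" \<mu> by (rule model_n[OF n])
  have jump_mono: "u \<le> u' \<Longrightarrow> jmp x u e \<le> jmp x u' e" for u u' e by (auto simp: a.jump_def)
  have b: "\<bar>a.pert b 0 t \<omega> - a.pert b' 0 t \<omega>\<bar> \<le> d * (\<Sum>i\<le>p. \<bar>a.reg t i \<omega>\<bar>)" for t
  proof -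
    have "\<bar>a.pert b 0 t \<omega> - a.pert b' 0 t \<omega>\<bar> = \<bar>\<Sum>i\<le>p. (b i - b' i) * a.reg t i \<omega>\<bar>"
      by (simp add: a.pert_def left_diff_distrib sum_subtractf)
    also have "\<dots> \<le> (\<Sum>i\<le>p. \<bar>(b i - b' i) * a.reg t i \<omega>\<bar>)" by (rule sum_abs)
    also have "\<dots> \<le> (\<Sum>i\<le>p. d * \<bar>a.reg t i \<omega>\<bar>)"
      unfolding abs_mult by (intro sum_mono mult_right_mono) (use d in auto)
    finally show ?thesis by (simp add: sum_distrib_left)
  qed
  have s: "a.pert b' s t \<omega> = a.pert b' 0 t \<omega> + s * (\<Sum>i\<le>p. \<bar>a.reg t i \<omega>\<bar>)" for s t
    by (simp add: a.pert_def)
  have "a.pert b' (- d) t \<omega> \<le> a.pert b 0 t \<omega>" "a.pert b 0 t \<omega> \<le> a.pert b' d t \<omega>" for t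
    using b[of t] s[of "-d" t] s[of d t] by linarith+
  thus "Dn x n b' (- d) \<omega> \<le> Dn x n b 0 \<omega>" "Dn x n b 0 \<omega> \<le> Dn x n b' d \<omega>"
    unfolding Dn_def by (intro divide_right_mono sum_mono jump_mono add_left_mono; simp)+
qed

text \<open>Uniformity in the estimated parameters: the counts are monotone in the perturbation, so a
  finite grid of deterministic parameters suffices.\<close>

lemma Dn_estimated:
  assumes bh: "\<And>i. i \<le> p \<Longrightarrow> OP (\<lambda>n \<omega>. bh n \<omega> i)"
  shows "oP (\<lambda>n \<omega>. Dn x n (bh n \<omega>) 0 \<omega> - f0 x * bh n \<omega> 0 - \<gamma> * Delta_0 p \<beta> \<theta>\<^sub>0 Q x)"
  unfolding oP_def whp_def
proof safe
  fix e \<delta> :: real assume e: "0 < e" and \<delta>: "0 < \<delta>"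
  let ?c = "\<gamma> * Delta_0 p \<beta> \<theta>\<^sub>0 Q x"
  have abs_OP: "OP (\<lambda>n \<omega>. \<bar>X n \<omega>\<bar>)" if "OP X" for X :: "nat \<Rightarrow> 'a \<Rightarrow> real"
    using that unfolding OP_def by simp
  have "OP (\<lambda>n \<omega>. \<Sum>i\<le>p. \<bar>bh n \<omega> i\<bar>)" by (intro OP_sum abs_OP bh) auto
  then obtain K where K: "\<forall>\<^sub>F n in sequentially. mostly n (\<delta> / 4) (\<lambda>\<omega>. \<bar>\<Sum>i\<le>p. \<bar>bh n \<omega> i\<bar>\<bar> \<le> K)"
    using \<delta> unfolding OP_def by (meson zero_less_divide_iff zero_less_numeral)
  obtain L' where L': "\<forall>\<^sub>F n in sequentially. mostly n (\<delta> / 4) (\<lambda>\<omega>. \<bar>absmean n \<omega>\<bar> \<le> L')"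
    using OP_absmean \<delta> unfolding OP_def by (meson zero_less_divide_iff zero_less_numeral)
  \<comment> \<open>The error budget is e/2 for the expansion at the grid points and e/2 for the
    discretization. The latter is at most f0(x) * d * (1 + L'), from the intercept and from the
    slack; adding 1 in the denominators avoids division by 0.\<close>
  define d where "d = e / (2 * (1 + f0 x) * (1 + \<bar>L'\<bar>))"
  have d: "0 < d" unfolding d_def using e f0_nonneg[of x] by (intro divide_pos_pos mult_pos_pos) auto
  have d2: "f0 x * (d * (1 + \<bar>L'\<bar>)) \<le> e / 2"
  proof -
    have "1 + \<bar>L'\<bar> \<noteq> 0" by (metis abs_ge_zero add_nonneg_eq_0_iff zero_le_one zero_neq_one)
    hence "d * (1 + \<bar>L'\<bar>) = e / (2 * (1 + f0 x))" unfolding d_def by simp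
    hence "f0 x * (d * (1 + \<bar>L'\<bar>)) = (f0 x / (1 + f0 x)) * (e / 2)" by simp
    also have "\<dots> \<le> 1 * (e / 2)"
      using e f0_nonneg[of x] by (intro mult_right_mono) (auto simp: divide_le_eq_1)
    finally show ?thesis by simp
  qed
  obtain S where S: "finite S" "\<And>y. \<bar>y\<bar> \<le> K \<Longrightarrow> \<exists>s\<in>S. \<bar>y - s\<bar> \<le> d" using finite_grid[OF d] by blast
  \<comment> \<open>A grid point is a coefficient vector together with a sign of the slack, so that
    both brackets of the monotonicity argument are available.\<close>
  define Gr where "Gr = PiE {..p} (\<lambda>_. S) \<times> {- d, d}"
  have finG: "finite Gr" unfolding Gr_def using S(1) by (intro finite_cartesian_product finite_PiE) auto
  have "whp (\<lambda>n \<omega>. \<forall>q\<in>Gr. \<bar>Dn x n (fst q) (snd q) \<omega> - f0 x * (fst q 0 + snd q * absmean n \<omega>) - ?c\<bar> \<le> e / 2)"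
    using e by (intro whp_finite_ball finG oPD[OF Dn_expansion]) auto
  hence "\<forall>\<^sub>F n in sequentially. mostly n (\<delta> / 4) (\<lambda>\<omega>. \<forall>q\<in>Gr. \<bar>Dn x n (fst q) (snd q) \<omega> - f0 x * (fst q 0 + snd q * absmean n \<omega>) - ?c\<bar> \<le> e / 2)"
    using \<delta> unfolding whp_def by auto
  with K L' eventually_ge_at_top[of 1]
  show "\<forall>\<^sub>F n in sequentially. mostly n \<delta> (\<lambda>\<omega>. \<bar>Dn x n (bh n \<omega>) 0 \<omega> - f0 x * bh n \<omega> 0 - ?c\<bar> \<le> e)"
  proof eventually_elim
    case (elim n)
    show ?case
    proof (rule mostly_mono[OF mostly_conj[OF elim(3) elim(1) mostly_conj[OF elim(3) elim(2) elim(4)]]])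
      show "\<delta> / 4 + (\<delta> / 4 + \<delta> / 4) \<le> \<delta>" using \<delta> by simp
      fix \<omega>
      assume *: "\<bar>\<Sum>i\<le>p. \<bar>bh n \<omega> i\<bar>\<bar> \<le> K \<and> \<bar>absmean n \<omega>\<bar> \<le> L' \<and>
        (\<forall>q\<in>Gr. \<bar>Dn x n (fst q) (snd q) \<omega> - f0 x * (fst q 0 + snd q * absmean n \<omega>) - ?c\<bar> \<le> e / 2)"
      have "\<bar>bh n \<omega> i\<bar> \<le> K" if "i \<le> p" for i
      proof -
        have "\<bar>bh n \<omega> i\<bar> \<le> (\<Sum>i\<le>p. \<bar>bh n \<omega> i\<bar>)" using that by (intro member_le_sum) auto
        thus ?thesis using * by linarith
      qed
      hence "\<forall>i\<in>{..p}. \<exists>s. s \<in> S \<and> \<bar>bh n \<omega> i - s\<bar> \<le> d" using S(2) by blast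
      then obtain s where s: "\<And>i. i \<le> p \<Longrightarrow> s i \<in> S \<and> \<bar>bh n \<omega> i - s i\<bar> \<le> d" by (metis atMost_iff)
      define b' where "b' = restrict s {..p}"
      have b': "b' \<in> PiE {..p} (\<lambda>_. S)" "\<forall>i\<le>p. \<bar>bh n \<omega> i - b' i\<bar> \<le> d" using s by (auto simp: b'_def)
      have m: "Dn x n b' (- d) \<omega> \<le> Dn x n (bh n \<omega>) 0 \<omega>" "Dn x n (bh n \<omega>) 0 \<omega> \<le> Dn x n b' d \<omega>"
        by (rule Dn_mono[OF elim(3) b'(2)])+
      have "(b', - d) \<in> Gr" "(b', d) \<in> Gr" using b' by (auto simp: Gr_def)
      hence g: "\<bar>Dn x n b' (- d) \<omega> - f0 x * (b' 0 + (- d) * absmean n \<omega>) - ?c\<bar> \<le> e / 2"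
        "\<bar>Dn x n b' d \<omega> - f0 x * (b' 0 + d * absmean n \<omega>) - ?c\<bar> \<le> e / 2"
        using * by fastforce+
      have "\<bar>f0 x * (b' 0 + r * absmean n \<omega>) - f0 x * bh n \<omega> 0\<bar> \<le> e / 2" if "\<bar>r\<bar> = d" for r
      proof -
        have "f0 x * (b' 0 + r * absmean n \<omega>) - f0 x * bh n \<omega> 0 = f0 x * ((b' 0 - bh n \<omega> 0) + r * absmean n \<omega>)"
          by (simp add: algebra_simps)
        hence "\<bar>f0 x * (b' 0 + r * absmean n \<omega>) - f0 x * bh n \<omega> 0\<bar> = f0 x * \<bar>(b' 0 - bh n \<omega> 0) + r * absmean n \<omega>\<bar>"
          using f0_nonneg[of x] by (simp only: abs_mult abs_of_nonneg)
        also have "\<dots> \<le> f0 x * (d * (1 + \<bar>L'\<bar>))"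
        proof (intro mult_left_mono f0_nonneg)
          have "\<bar>b' 0 - bh n \<omega> 0\<bar> \<le> d" using b'(2) by (metis abs_minus_commute le0)
          moreover have "\<bar>r * absmean n \<omega>\<bar> \<le> d * \<bar>L'\<bar>"
            unfolding abs_mult that using * d by (intro mult_left_mono) auto
          ultimately show "\<bar>(b' 0 - bh n \<omega> 0) + r * absmean n \<omega>\<bar> \<le> d * (1 + \<bar>L'\<bar>)"
            by (simp add: distrib_left)
        qed
        finally show ?thesis using d2 by linarith
      qed
      from this[of "- d"] this[of d] show "\<bar>Dn x n (bh n \<omega>) 0 \<omega> - f0 x * bh n \<omega> 0 - ?c\<bar> \<le> e"
        using g m d by (simp only: abs_minus_cancel abs_of_pos) linarith
    qed
  qed
qed

end

subsection \<open>Noncentral chi-square distributions\<close>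

lemma (in prob_space) integrable_indicator_event:
  "E \<in> sets M \<Longrightarrow> integrable M (indicator E :: 'a \<Rightarrow> real)"
  by (rule integrable_bounded[where B = 1]) (auto simp: indicator_def)

abbreviation unit_normal :: "real \<Rightarrow> real measure" where
  "unit_normal m \<equiv> density lborel (normal_density m 1)"

lemma prob_space_unit_normal: "prob_space (unit_normal m)"
  by (rule prob_space_normal_density) simp

lemma unit_normal_shift: "distr (unit_normal m) borel (\<lambda>y. y - m) = std_normal_distribution"
proof -
  interpret prob_space "unit_normal m" by (rule prob_space_unit_normal)
  have "distributed (unit_normal m) lborel (\<lambda>x. x) (normal_density m 1)"
    unfolding distributed_def by (auto simp: distr_id2)
  hence "distributed (unit_normal m) lborel (\<lambda>x. (x - m) / 1) std_normal_density"
    by (subst (asm) normal_standard_normal_convert) auto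
  hence "distr (unit_normal m) lborel (\<lambda>x. x - m) = std_normal_distribution" by (simp add: distributed_def)
  thus ?thesis by (simp cong: distr_cong)
qed

lemma unit_normal_char: "(\<integral>y. iexp (t * y) \<partial>unit_normal m) = iexp (t * m) * of_real (exp (- (t\<^sup>2) / 2))"
proof -
  have "(\<integral>y. iexp (t * y) \<partial>unit_normal m) = (\<integral>y. iexp (t * m) * iexp (t * (y - m)) \<partial>unit_normal m)"
    by (intro Bochner_Integration.integral_cong refl) (simp add: exp_add[symmetric] algebra_simps)
  also have "\<dots> = iexp (t * m) * (\<integral>y. iexp (t * (y - m)) \<partial>unit_normal m)" by simp
  also have "(\<integral>y. iexp (t * (y - m)) \<partial>unit_normal m) = (\<integral>y. iexp (t * y) \<partial>distr (unit_normal m) borel (\<lambda>y. y - m))"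
    by (subst integral_distr) auto
  also have "\<dots> = char std_normal_distribution t" unfolding unit_normal_shift char_def by simp
  also have "\<dots> = of_real (exp (- (t\<^sup>2) / 2))" by (simp add: char_std_normal_distribution)
  finally show ?thesis .
qed

lemma unit_normal_square_le:
  "measure (unit_normal m) {y. y\<^sup>2 \<le> s} = (if s < 0 then 0 else Phi (sqrt s - m) - Phi (- sqrt s - m))"
proof (cases "s < 0")
  case True
  hence "{y. y\<^sup>2 \<le> s} = {}" using zero_le_power2 by (auto simp: not_le intro: less_le_trans)
  thus ?thesis using True by simp
next
  case False
  interpret N: real_distribution std_normal_distribution by (rule real_dist_normal_dist)
  have e: "{y. y\<^sup>2 \<le> s} = {- sqrt s..sqrt s}"
  proof (rule set_eqI)
    fix y
    have iff: "y\<^sup>2 \<le> s \<longleftrightarrow> \<bar>y\<bar> \<le> sqrt s" by (metis real_sqrt_abs real_sqrt_le_iff)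
    show "y \<in> {y. y\<^sup>2 \<le> s} \<longleftrightarrow> y \<in> {- sqrt s..sqrt s}"
      unfolding mem_Collect_eq atLeastAtMost_iff iff by linarith
  qed
  define a where "a = - sqrt s - m"
  define b where "b = sqrt s - m"
  have le: "a \<le> b" using False by (simp add: a_def b_def)
  have v: "(\<lambda>y. y - m) -` {a..b} \<inter> space (unit_normal m) = {- sqrt s..sqrt s}"
    by (auto simp: a_def b_def)
  have "measure (unit_normal m) {y. y\<^sup>2 \<le> s} = measure (distr (unit_normal m) borel (\<lambda>y. y - m)) {a..b}"
    using measure_distr[of "\<lambda>y. y - m" "unit_normal m" borel "{a..b}"] unfolding e v by simp
  also have "\<dots> = Phi b - Phi a"
  proof -
    have 0: "N.prob {a} = 0"
      using N.isCont_cdf[of a] isCont_Phi[of a] by (simp add: Phi_def)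
    have ab: "{a..b} = {a} \<union> {a<..b}" using le by auto
    have "N.prob {a..b} = N.prob {a} + N.prob {a<..b}"
      unfolding ab by (rule N.finite_measure_Union) auto
    also have "N.prob {a<..b} = Phi b - Phi a"
    proof (cases "a = b")
      case False
      hence "a < b" using le by simp
      thus ?thesis unfolding Phi_def by (rule N.cdf_diff_eq[symmetric])
    qed simp
    finally show ?thesis unfolding unit_normal_shift using 0 by simp
  qed
  finally show ?thesis using False by (simp add: a_def b_def)
qed

text \<open>The event is the interval from -sqrt s to sqrt s; moving the mean moves two end points
  relative to the standard normal law, each at rate at most 1 / sqrt (2 pi).\<close>

lemma unit_normal_square_lipschitz:
  "\<bar>measure (unit_normal m) {y. y\<^sup>2 \<le> s} - measure (unit_normal m') {y. y\<^sup>2 \<le> s}\<bar> \<le> sqrt (2 / pi) * \<bar>m - m'\<bar>"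
proof (cases "s < 0")
  case False
  have c: "2 / sqrt (2 * pi) = sqrt (2 / pi)"
    by (simp add: real_sqrt_divide real_sqrt_mult field_simps)
  have "\<bar>Phi (sqrt s - m) - Phi (sqrt s - m')\<bar> \<le> \<bar>m - m'\<bar> / sqrt (2 * pi)"
    using Phi_lipschitz[of "sqrt s - m" "sqrt s - m'"] by (simp add: abs_minus_commute)
  moreover have "\<bar>Phi (- sqrt s - m) - Phi (- sqrt s - m')\<bar> \<le> \<bar>m - m'\<bar> / sqrt (2 * pi)"
    using Phi_lipschitz[of "- sqrt s - m" "- sqrt s - m'"] by (simp add: abs_minus_commute)
  ultimately have "\<bar>(Phi (sqrt s - m) - Phi (- sqrt s - m)) - (Phi (sqrt s - m') - Phi (- sqrt s - m'))\<bar> \<le> 2 / sqrt (2 * pi) * \<bar>m - m'\<bar>"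
    by simp
  thus ?thesis unfolding c using False by (simp add: unit_normal_square_le)
qed (simp add: unit_normal_square_le)

definition ncp_space :: "nat \<Rightarrow> real \<Rightarrow> (nat \<Rightarrow> real) measure" where
  "ncp_space k l2 = (\<Pi>\<^sub>M i\<in>{..<k}. unit_normal (if i = 0 then sqrt l2 else 0))"

lemma noncentral_chi_square_alt: "noncentral_chi_square k l2 = distr (ncp_space k l2) borel (\<lambda>Z. \<Sum>i<k. (Z i)\<^sup>2)"
  by (simp add: noncentral_chi_square_def ncp_space_def)

lemma product_prob_space_normal: "product_prob_space (\<lambda>i. unit_normal (m i))"
  by (intro product_prob_spaceI prob_space_unit_normal)

lemma prob_space_ncp: "prob_space (ncp_space k l2)"
  unfolding ncp_space_def by (intro prob_space_PiM prob_space_unit_normal)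

lemma ncp_component [measurable]: "i < k \<Longrightarrow> (\<lambda>Z. Z i) \<in> borel_measurable (ncp_space k l2)"
  unfolding ncp_space_def using measurable_component_singleton[of i "{..<k}" "\<lambda>i. unit_normal (if i = 0 then sqrt l2 else 0)"] by simp

lemma ncp_sum_measurable [measurable]: "(\<lambda>Z. \<Sum>i<k. (Z i)\<^sup>2) \<in> borel_measurable (ncp_space k l2)"
  by (intro borel_measurable_sum borel_measurable_power ncp_component) auto

lemma real_distribution_ncc: "real_distribution (noncentral_chi_square k l2)"
  unfolding noncentral_chi_square_alt
  by (rule prob_space.real_distribution_distr[OF prob_space_ncp]) measurable

lemma ncp_char:
  assumes k: "1 \<le> k"
  shows "(\<integral>Z. iexp (\<Sum>i<k. t i * Z i) \<partial>ncp_space k l2) = iexp (t 0 * sqrt l2) * of_real (exp (- (\<Sum>i<k. (t i)\<^sup>2) / 2))"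
proof -
  let ?m = "\<lambda>i::nat. if i = 0 then sqrt l2 else 0"
  interpret P: product_prob_space "\<lambda>i. unit_normal (?m i)" by (rule product_prob_space_normal)
  have "(\<integral>Z. iexp (\<Sum>i<k. t i * Z i) \<partial>ncp_space k l2) = (\<integral>Z. (\<Prod>i<k. iexp (t i * Z i)) \<partial>(\<Pi>\<^sub>M i\<in>{..<k}. unit_normal (?m i)))"
    unfolding ncp_space_def by (simp add: exp_sum[symmetric] sum_distrib_left of_real_sum)
  also have "\<dots> = (\<Prod>i<k. \<integral>y. iexp (t i * y) \<partial>unit_normal (?m i))"
  proof (rule P.product_integral_prod)
    fix i
    show "integrable (unit_normal (?m i)) (\<lambda>y. iexp (t i * y))"
      by (rule prob_space.integrable_bounded[OF prob_space_unit_normal, where B = 1]) auto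
  qed auto
  also have "\<dots> = (\<Prod>i<k. iexp (t i * ?m i) * of_real (exp (- ((t i)\<^sup>2) / 2)))"
    by (intro prod.cong refl unit_normal_char)
  also have "\<dots> = (\<Prod>i<k. iexp (t i * ?m i)) * of_real (\<Prod>i<k. exp (- ((t i)\<^sup>2) / 2))"
    by (simp add: prod.distrib)
  also have "(\<Prod>i<k. exp (- ((t i)\<^sup>2) / 2)) = exp (- (\<Sum>i<k. (t i)\<^sup>2) / 2)"
    by (simp add: exp_sum[symmetric] sum_divide_distrib[symmetric] sum_negf)
  also have "(\<Prod>i<k. iexp (t i * ?m i)) = (\<Prod>i\<in>{0}. iexp (t i * ?m i))"
    by (rule prod.mono_neutral_right) (use k in auto)
  finally show ?thesis by simp
qed

definition rest_space :: "nat \<Rightarrow> (nat \<Rightarrow> real) measure" where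
  "rest_space k = (\<Pi>\<^sub>M i\<in>{1..<k}. unit_normal 0)"

lemma prob_space_rest: "prob_space (rest_space k)"
  unfolding rest_space_def by (intro prob_space_PiM prob_space_unit_normal)

text \<open>Only the first coordinate carries a mean. Conditioning on the others reduces questions
  about the noncentral law to a single normal variable: half-lines give the distribution function, a
  single point gives its continuity.\<close>

lemma ncp_split:
  fixes A :: "real set"
  assumes k: "1 \<le> k" and [measurable]: "A \<in> sets borel"
  shows "measure (noncentral_chi_square k l2) A
     = (\<integral>x. measure (unit_normal (sqrt l2)) {y. y\<^sup>2 + (\<Sum>i\<in>{1..<k}. (x i)\<^sup>2) \<in> A} \<partial>rest_space k)"
proof -
  let ?m = "\<lambda>i::nat. if i = 0 then sqrt l2 else 0"
  interpret P: product_prob_space "\<lambda>i. unit_normal (?m i)" by (rule product_prob_space_normal)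
  interpret N: prob_space "unit_normal (sqrt l2)" by (rule prob_space_unit_normal)
  interpret Z: prob_space "ncp_space k l2" by (rule prob_space_ncp)
  have ins: "{..<k} = insert 0 {1..<k}" using k by auto
  define f where "f Z = (indicator A (\<Sum>i<k. (Z i)\<^sup>2) :: real)" for Z :: "nat \<Rightarrow> real"
  have fm[measurable]: "f \<in> borel_measurable (ncp_space k l2)" unfolding f_def by measurable
  have "measure (noncentral_chi_square k l2) A = (\<integral>Z. f Z \<partial>ncp_space k l2)"
  proof -
    interpret D: real_distribution "noncentral_chi_square k l2" by (rule real_distribution_ncc)
    have "measure (noncentral_chi_square k l2) A = (\<integral>r. indicator A r \<partial>noncentral_chi_square k l2)" by simp
    also have "\<dots> = (\<integral>Z. f Z \<partial>ncp_space k l2)"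
      unfolding noncentral_chi_square_alt f_def by (rule integral_distr) auto
    finally show ?thesis .
  qed
  also have "\<dots> = (\<integral>x. (\<integral>y. f (x(0 := y)) \<partial>unit_normal (?m 0)) \<partial>(\<Pi>\<^sub>M i\<in>{1..<k}. unit_normal (?m i)))"
    unfolding ncp_space_def ins
  proof (rule P.product_integral_insert)
    show "integrable (\<Pi>\<^sub>M i\<in>insert 0 {1..<k}. unit_normal (?m i)) f"
      using Z.integrable_bounded[OF fm, of 1] unfolding ncp_space_def ins by (simp add: f_def)
  qed auto
  also have "(\<Pi>\<^sub>M i\<in>{1..<k}. unit_normal (?m i)) = rest_space k"
    unfolding rest_space_def by (rule PiM_cong) auto
  also have "(\<integral>x. (\<integral>y. f (x(0 := y)) \<partial>unit_normal (?m 0)) \<partial>rest_space k)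
     = (\<integral>x. measure (unit_normal (sqrt l2)) {y. y\<^sup>2 + (\<Sum>i\<in>{1..<k}. (x i)\<^sup>2) \<in> A} \<partial>rest_space k)"
  proof (intro Bochner_Integration.integral_cong refl)
    fix x :: "nat \<Rightarrow> real"
    have "f (x(0 := y)) = indicator {y. y\<^sup>2 + (\<Sum>i\<in>{1..<k}. (x i)\<^sup>2) \<in> A} y" for y
      unfolding f_def ins by (auto simp: indicator_def intro!: sum.cong)
    thus "(\<integral>y. f (x(0 := y)) \<partial>unit_normal (?m 0)) = measure (unit_normal (sqrt l2)) {y. y\<^sup>2 + (\<Sum>i\<in>{1..<k}. (x i)\<^sup>2) \<in> A}"
      by simp
  qed
  finally show ?thesis .
qed

lemma ncc_cdf_eq:
  assumes k: "1 \<le> k"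
  shows "cdf (noncentral_chi_square k l2) c
     = (\<integral>x. measure (unit_normal (sqrt l2)) {y. y\<^sup>2 \<le> c - (\<Sum>i\<in>{1..<k}. (x i)\<^sup>2)} \<partial>rest_space k)"
  unfolding cdf_def by (subst ncp_split[OF k]) (auto simp: le_diff_eq)

text \<open>Given the other coordinates, a fixed value of the sum of squares leaves at most two
  values for the first coordinate, which is a null set for a law with a density.\<close>

lemma ncc_isCont:
  assumes k: "1 \<le> k"
  shows "isCont (cdf (noncentral_chi_square k l2)) c"
proof -
  interpret real_distribution "noncentral_chi_square k l2" by (rule real_distribution_ncc)
  have "measure (unit_normal (sqrt l2)) {y. y\<^sup>2 + r \<in> {c}} = 0" for r
  proof -
    have "{y. y\<^sup>2 + r \<in> {c}} \<subseteq> {sqrt (c - r), - sqrt (c - r)}"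
    proof
      fix y assume "y \<in> {y. y\<^sup>2 + r \<in> {c}}"
      hence "c - r = y\<^sup>2" by simp
      hence "sqrt (c - r) = \<bar>y\<bar>" by simp
      thus "y \<in> {sqrt (c - r), - sqrt (c - r)}" by auto
    qed
    hence "finite {y. y\<^sup>2 + r \<in> {c}}" by (rule finite_subset) simp
    hence "{y. y\<^sup>2 + r \<in> {c}} \<in> null_sets lborel" by (rule finite_imp_null_set_lborel)
    hence "emeasure (unit_normal (sqrt l2)) {y. y\<^sup>2 + r \<in> {c}} = 0"
      by (subst emeasure_density) (auto simp: null_sets_def intro!: nn_integral_null_set[where M = lborel, unfolded null_sets_def])
    thus ?thesis by (simp add: measure_def)
  qed
  hence "measure (noncentral_chi_square k l2) {c} = 0" by (subst ncp_split[OF k]) auto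
  thus ?thesis by (simp add: isCont_cdf)
qed

text \<open>The one-dimensional bound holds for every threshold with the same constant, so it
  survives averaging over the central coordinates. It is linear in the norm of the mean, not in the
  noncentrality parameter, its square.\<close>

lemma ncc_lipschitz:
  assumes k: "1 \<le> k" and l: "0 \<le> l" "0 \<le> l'"
  shows "\<bar>cdf (noncentral_chi_square k (l\<^sup>2)) c - cdf (noncentral_chi_square k (l'\<^sup>2)) c\<bar> \<le> sqrt (2 / pi) * \<bar>l - l'\<bar>"
proof -
  interpret R: prob_space "rest_space k" by (rule prob_space_rest)
  let ?q = "\<lambda>l x. measure (unit_normal l) {y. y\<^sup>2 \<le> c - (\<Sum>i\<in>{1..<k}. (x i)\<^sup>2)}"
  have [measurable]: "(\<lambda>x. \<Sum>i\<in>{1..<k}. (x i)\<^sup>2) \<in> borel_measurable (rest_space k)"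
    unfolding rest_space_def
    by (intro borel_measurable_sum borel_measurable_power)
       (use measurable_component_singleton[of _ "{1..<k}" "\<lambda>_. unit_normal 0"] in auto)
  have m: "?q l \<in> borel_measurable (rest_space k)" for l
    unfolding unit_normal_square_le by measurable
  have i: "integrable (rest_space k) (?q l)" for l
  proof (rule R.integrable_bounded[OF m, where B = 1])
    fix x
    interpret N: prob_space "unit_normal l" by (rule prob_space_unit_normal)
    show "norm (?q l x) \<le> 1" by (simp add: N.prob_le_1 measure_nonneg)
  qed
  have "\<bar>cdf (noncentral_chi_square k (l\<^sup>2)) c - cdf (noncentral_chi_square k (l'\<^sup>2)) c\<bar> = \<bar>\<integral>x. ?q l x - ?q l' x \<partial>rest_space k\<bar>"
    unfolding ncc_cdf_eq[OF k] using l i by simp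
  also have "\<dots> \<le> (\<integral>x. \<bar>?q l x - ?q l' x\<bar> \<partial>rest_space k)" by (rule integral_abs_bound)
  also have "\<dots> \<le> (\<integral>x. sqrt (2 / pi) * \<bar>l - l'\<bar> \<partial>rest_space k)"
    by (intro integral_mono integrable_abs Bochner_Integration.integrable_diff i unit_normal_square_lipschitz) auto
  also have "\<dots> = sqrt (2 / pi) * \<bar>l - l'\<bar>" using R.prob_space by simp
  finally show ?thesis .
qed

text \<open>Continuity makes the defining set closed, so its infimum belongs to it and the value
  there is at least q; points to the left lie outside the set, and the left limit gives the
  converse.\<close>

lemma chi_square_quantile_cdf:
  assumes k: "1 \<le> k" and q: "0 < q" "q < 1"
  shows "cdf (noncentral_chi_square k 0) (chi_square_quantile k q) = q"
proof -
  interpret real_distribution "noncentral_chi_square k 0" by (rule real_distribution_ncc)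
  let ?F = "cdf (noncentral_chi_square k 0)"
  define S where "S = {c. q \<le> ?F c}"
  have neg: "?F c = 0" if "c < 0" for c
  proof -
    have "measure (unit_normal (sqrt 0)) {y. y\<^sup>2 \<le> c - (\<Sum>i\<in>{1..<k}. (x i)\<^sup>2)} = 0" for x :: "nat \<Rightarrow> real"
      using that sum_nonneg[of "{1..<k}" "\<lambda>i. (x i)\<^sup>2"] by (subst unit_normal_square_le) auto
    thus ?thesis by (simp add: ncc_cdf_eq[OF k])
  qed
  have "\<forall>\<^sub>F c in at_top. q < ?F c" using cdf_lim_at_top_prob q(2) by (auto simp: order_tendsto_iff)
  hence ne: "S \<noteq> {}" unfolding S_def eventually_at_top_linorder by (force intro: less_imp_le)
  have bdd: "bdd_below S" by (rule bdd_belowI[of _ 0]) (use neg q(1) in \<open>force simp: S_def not_less[symmetric]\<close>)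
  have "closed S" unfolding S_def
    by (intro closed_Collect_le continuous_intros continuous_at_imp_continuous_on ballI ncc_isCont[OF k])
  hence "Inf S \<in> S" using ne bdd by (intro closed_contains_Inf)
  hence ge: "q \<le> ?F (Inf S)" by (simp add: S_def)
  have le: "?F (Inf S) \<le> q"
  proof -
    have "(?F \<longlongrightarrow> ?F (Inf S)) (at_left (Inf S))"
      by (rule tendsto_within_subset[OF ncc_isCont[OF k, unfolded isCont_def]]) simp
    moreover have "\<forall>\<^sub>F c in at_left (Inf S). ?F c \<le> q"
    proof (rule eventually_at_leftI[of "Inf S - 1"])
      fix c assume "c \<in> {Inf S - 1<..<Inf S}"
      hence "c \<notin> S" using cInf_lower[OF _ bdd] by force
      thus "?F c \<le> q" by (simp add: S_def)
    qed simp
    ultimately show ?thesis by (intro tendsto_upperbound) (auto simp: trivial_limit_at_left_real)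
  qed
  show ?thesis using ge le unfolding chi_square_quantile_def S_def by simp
qed

subsection \<open>Weak convergence of squared norms\<close>

text \<open>The Laplace transform of a squared norm is a Gaussian average of the characteristic function.\<close>

lemma laplace_square_norm:
  fixes X :: "nat \<Rightarrow> 'a \<Rightarrow> real"
  assumes N: "prob_space N" and X: "\<And>k. k < K \<Longrightarrow> X k \<in> borel_measurable N"
  shows "complex_of_real (\<integral>\<omega>. exp (- (s\<^sup>2) / 2 * (\<Sum>k<K. (X k \<omega>)\<^sup>2)) \<partial>N)
     = (\<integral>g. (\<integral>\<omega>. iexp (\<Sum>k<K. (s * g k) * X k \<omega>) \<partial>N) \<partial>(\<Pi>\<^sub>M k\<in>{..<K}. std_normal_distribution))"
    and "(\<lambda>g. \<integral>\<omega>. iexp (\<Sum>k<K. (s * g k) * X k \<omega>) \<partial>N) \<in> borel_measurable (\<Pi>\<^sub>M k\<in>{..<K}. std_normal_distribution)"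
proof -
  interpret N: prob_space N by fact
  interpret S: real_distribution std_normal_distribution by (rule real_dist_normal_dist)
  let ?P = "\<Pi>\<^sub>M k\<in>{..<K}. std_normal_distribution"
  interpret P: product_prob_space "\<lambda>_::nat. std_normal_distribution"
    by (intro product_prob_spaceI S.prob_space_axioms)
  interpret PP: prob_space ?P by (intro prob_space_PiM S.prob_space_axioms)
  interpret NP: pair_prob_space N ?P ..
  define f where "f \<omega> g = iexp (\<Sum>k<K. (s * g k) * X k \<omega>)" for \<omega> and g :: "nat \<Rightarrow> real"
  have [measurable]: "X k \<in> borel_measurable N" if "k \<in> {..<K}" for k using X that by auto
  have [measurable]: "(\<lambda>g. g k) \<in> borel_measurable ?P" if "k \<in> {..<K}" for k
    using measurable_component_singleton[of k "{..<K}" "\<lambda>_. std_normal_distribution"] that by simp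
  have inner: "(\<lambda>(\<omega>, g). \<Sum>k<K. (s * g k) * X k \<omega>) \<in> borel_measurable (N \<Otimes>\<^sub>M ?P)"
    unfolding split_beta'
    by (intro borel_measurable_sum borel_measurable_times borel_measurable_const
          measurable_compose[OF measurable_snd] measurable_compose[OF measurable_fst]) auto
  have fm: "case_prod f \<in> borel_measurable (N \<Otimes>\<^sub>M ?P)"
  proof -
    have "(\<lambda>z. iexp ((\<lambda>(\<omega>, g). \<Sum>k<K. (s * g k) * X k \<omega>) z)) \<in> borel_measurable (N \<Otimes>\<^sub>M ?P)"
      using inner by measurable
    thus ?thesis by (simp add: f_def split_beta')
  qed
  have int: "integrable (N \<Otimes>\<^sub>M ?P) (case_prod f)"
    by (rule NP.integrable_const_bound[OF _ fm, of 1]) (auto simp: f_def split: prod.split)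
  \<comment> \<open>The characteristic function of a standard normal variable at s X is exp(-s^2 X^2
    / 2); the product over the coordinates is one Gaussian integral.\<close>
  have eq: "complex_of_real (exp (- (s\<^sup>2) / 2 * (\<Sum>k<K. (X k \<omega>)\<^sup>2))) = (\<integral>g. f \<omega> g \<partial>?P)" for \<omega>
  proof -
    have "complex_of_real (exp (- (s\<^sup>2) / 2 * (\<Sum>k<K. (X k \<omega>)\<^sup>2))) = (\<Prod>k<K. of_real (exp (- ((s * X k \<omega>)\<^sup>2) / 2)))"
      by (simp add: of_real_prod[symmetric] exp_sum[symmetric] sum_distrib_left power_mult_distrib del: of_real_prod)
    also have "\<dots> = (\<Prod>k<K. char std_normal_distribution (s * X k \<omega>))"
      by (simp add: char_std_normal_distribution)
    also have "\<dots> = (\<Prod>k<K. \<integral>y. iexp (s * X k \<omega> * y) \<partial>std_normal_distribution)" by (simp add: char_def)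
    also have "\<dots> = (\<integral>g. (\<Prod>k<K. iexp (s * X k \<omega> * g k)) \<partial>?P)"
      by (rule P.product_integral_prod[symmetric]) (auto intro!: S.integrable_const_bound[of _ 1])
    also have "\<dots> = (\<integral>g. f \<omega> g \<partial>?P)"
      by (simp add: f_def exp_sum[symmetric] sum_distrib_left of_real_sum mult_ac)
    finally show ?thesis .
  qed
  have "complex_of_real (\<integral>\<omega>. exp (- (s\<^sup>2) / 2 * (\<Sum>k<K. (X k \<omega>)\<^sup>2)) \<partial>N) = (\<integral>\<omega>. (\<integral>g. f \<omega> g \<partial>?P) \<partial>N)"
    unfolding eq[symmetric] by (rule integral_complex_of_real[symmetric])
  also have "\<dots> = (\<integral>g. (\<integral>\<omega>. f \<omega> g \<partial>N) \<partial>?P)" by (rule NP.Fubini_integral[OF int, symmetric])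
  finally show "complex_of_real (\<integral>\<omega>. exp (- (s\<^sup>2) / 2 * (\<Sum>k<K. (X k \<omega>)\<^sup>2)) \<partial>N)
     = (\<integral>g. (\<integral>\<omega>. iexp (\<Sum>k<K. (s * g k) * X k \<omega>) \<partial>N) \<partial>?P)" by (simp add: f_def)
  have "(\<lambda>(g, \<omega>). f \<omega> g) \<in> borel_measurable (?P \<Otimes>\<^sub>M N)"
    using measurable_compose[OF measurable_pair_swap' fm] by (simp add: split_beta')
  from N.borel_measurable_lebesgue_integral[OF this]
  show "(\<lambda>g. \<integral>\<omega>. iexp (\<Sum>k<K. (s * g k) * X k \<omega>) \<partial>N) \<in> borel_measurable ?P" by (simp add: f_def)
qed

text \<open>The characteristic functions are averaged over a fixed Gaussian law and bounded by 1, so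
  pointwise convergence passes through the average by dominated convergence. Neither tightness nor a
  multivariate continuity theorem is involved.\<close>

lemma laplace_tendsto:
  fixes X :: "nat \<Rightarrow> nat \<Rightarrow> 'a \<Rightarrow> real" and Z :: "nat \<Rightarrow> 'b \<Rightarrow> real"
  assumes N: "\<And>n. prob_space (N n)" and X: "\<And>n k. k < K \<Longrightarrow> X n k \<in> borel_measurable (N n)"
    and N': "prob_space N'" and Z: "\<And>k. k < K \<Longrightarrow> Z k \<in> borel_measurable N'"
    and cf: "\<And>t. (\<lambda>n. \<integral>\<omega>. iexp (\<Sum>k<K. t k * X n k \<omega>) \<partial>N n) \<longlonglongrightarrow> (\<integral>\<omega>. iexp (\<Sum>k<K. t k * Z k \<omega>) \<partial>N')"
  shows "(\<lambda>n. \<integral>\<omega>. exp (- (s\<^sup>2) / 2 * (\<Sum>k<K. (X n k \<omega>)\<^sup>2)) \<partial>N n) \<longlonglongrightarrow> (\<integral>\<omega>. exp (- (s\<^sup>2) / 2 * (\<Sum>k<K. (Z k \<omega>)\<^sup>2)) \<partial>N')"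
proof -
  let ?P = "\<Pi>\<^sub>M k\<in>{..<K}. std_normal_distribution"
  interpret S: real_distribution std_normal_distribution by (rule real_dist_normal_dist)
  interpret PP: prob_space ?P by (intro prob_space_PiM S.prob_space_axioms)
  have e1: "complex_of_real (\<integral>\<omega>. exp (- (s\<^sup>2) / 2 * (\<Sum>k<K. (X n k \<omega>)\<^sup>2)) \<partial>N n)
     = (\<integral>g. (\<integral>\<omega>. iexp (\<Sum>k<K. (s * g k) * X n k \<omega>) \<partial>N n) \<partial>?P)" for n
    by (rule laplace_square_norm(1)[OF N]) (rule X)
  have e2: "complex_of_real (\<integral>\<omega>. exp (- (s\<^sup>2) / 2 * (\<Sum>k<K. (Z k \<omega>)\<^sup>2)) \<partial>N')
     = (\<integral>g. (\<integral>\<omega>. iexp (\<Sum>k<K. (s * g k) * Z k \<omega>) \<partial>N') \<partial>?P)"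
    by (rule laplace_square_norm(1)[OF N']) (rule Z)
  have "(\<lambda>n. complex_of_real (\<integral>\<omega>. exp (- (s\<^sup>2) / 2 * (\<Sum>k<K. (X n k \<omega>)\<^sup>2)) \<partial>N n))
      \<longlonglongrightarrow> complex_of_real (\<integral>\<omega>. exp (- (s\<^sup>2) / 2 * (\<Sum>k<K. (Z k \<omega>)\<^sup>2)) \<partial>N')"
    unfolding e1 e2
  proof (rule integral_dominated_convergence[where w = "\<lambda>_. 1"])
    show "AE g in ?P. (\<lambda>n. \<integral>\<omega>. iexp (\<Sum>k<K. (s * g k) * X n k \<omega>) \<partial>N n) \<longlonglongrightarrow> (\<integral>\<omega>. iexp (\<Sum>k<K. (s * g k) * Z k \<omega>) \<partial>N')"
      by (intro AE_I2 cf)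
    fix n
    interpret N: prob_space "N n" by (rule N)
    show "AE g in ?P. norm (\<integral>\<omega>. iexp (\<Sum>k<K. (s * g k) * X n k \<omega>) \<partial>N n) \<le> 1"
    proof (rule AE_I2)
      fix g
      have "norm (\<integral>\<omega>. iexp (\<Sum>k<K. (s * g k) * X n k \<omega>) \<partial>N n) \<le> (\<integral>\<omega>. norm (iexp (\<Sum>k<K. (s * g k) * X n k \<omega>)) \<partial>N n)"
        by (rule integral_norm_bound)
      also have "\<dots> = 1" using N.prob_space by (simp del: of_real_sum of_real_mult)
      finally show "norm (\<integral>\<omega>. iexp (\<Sum>k<K. (s * g k) * X n k \<omega>) \<partial>N n) \<le> 1" .
    qed
    show "(\<lambda>g. \<integral>\<omega>. iexp (\<Sum>k<K. (s * g k) * X n k \<omega>) \<partial>N n) \<in> borel_measurable ?P"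
      by (rule laplace_square_norm(2)[OF N]) (rule X)
  next
    show "(\<lambda>g. \<integral>\<omega>. iexp (\<Sum>k<K. (s * g k) * Z k \<omega>) \<partial>N') \<in> borel_measurable ?P"
      by (rule laplace_square_norm(2)[OF N']) (rule Z)
  qed auto
  thus ?thesis by (simp only: tendsto_of_real_iff)
qed

text \<open>Moments of the \<open>[0, 1]\<close>-valued variable \<open>exp (- |X|\<^sup>2 / 2)\<close> are Laplace transforms, so the
  Weierstrass theorem gives convergence of all continuous functions of it.\<close>

lemma polynomial_approximation_integral:
  fixes h :: "real \<Rightarrow> real"
  assumes h: "continuous_on UNIV h" and ak: "\<And>x. x \<in> {0..1} \<Longrightarrow> \<bar>h x - (\<Sum>i\<le>k. a i * x ^ i)\<bar> < e"
    and L: "prob_space L" and W[measurable]: "W \<in> borel_measurable L" and W01: "\<And>\<omega>. W \<omega> \<in> {0..1}"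
  shows "\<bar>(\<integral>\<omega>. h (W \<omega>) \<partial>L) - (\<Sum>i\<le>k. a i * (\<integral>\<omega>. W \<omega> ^ i \<partial>L))\<bar> \<le> e"
proof -
  interpret L: prob_space L by fact
  have hm[measurable]: "h \<in> borel_measurable borel" using h by (rule borel_measurable_continuous_onI)
  have "compact (h ` {0..1})" by (intro compact_continuous_image continuous_on_subset[OF h]) auto
  hence "bounded (h ` {0..1})" by (rule compact_imp_bounded)
  then obtain B where B: "\<And>x. x \<in> {0..1} \<Longrightarrow> \<bar>h x\<bar> \<le> B"
    unfolding bounded_iff by (metis imageI real_norm_def)
  have ih: "integrable L (\<lambda>\<omega>. h (W \<omega>))"
    by (rule L.integrable_bounded[where B = B]) (use B W01 in auto)
  have ip: "integrable L (\<lambda>\<omega>. W \<omega> ^ i)" for i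
  proof (rule L.integrable_bounded[where B = 1])
    fix \<omega> show "norm (W \<omega> ^ i) \<le> 1" using W01[of \<omega>] by (simp add: power_le_one)
  qed measurable
  have iq: "integrable L (\<lambda>\<omega>. \<Sum>i\<le>k. a i * W \<omega> ^ i)"
    by (intro Bochner_Integration.integrable_sum integrable_mult_right ip)
  have "\<bar>(\<integral>\<omega>. h (W \<omega>) \<partial>L) - (\<Sum>i\<le>k. a i * (\<integral>\<omega>. W \<omega> ^ i \<partial>L))\<bar> = \<bar>(\<integral>\<omega>. h (W \<omega>) \<partial>L) - (\<integral>\<omega>. (\<Sum>i\<le>k. a i * W \<omega> ^ i) \<partial>L)\<bar>"
    by (simp add: Bochner_Integration.integral_sum ip)
  also have "\<dots> = \<bar>\<integral>\<omega>. h (W \<omega>) - (\<Sum>i\<le>k. a i * W \<omega> ^ i) \<partial>L\<bar>"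
    by (subst Bochner_Integration.integral_diff[OF ih iq]) simp
  also have "\<dots> \<le> (\<integral>\<omega>. \<bar>h (W \<omega>) - (\<Sum>i\<le>k. a i * W \<omega> ^ i)\<bar> \<partial>L)" by (rule integral_abs_bound)
  also have "\<dots> \<le> (\<integral>\<omega>. e \<partial>L)"
    by (intro integral_mono integrable_abs Bochner_Integration.integrable_diff ih iq less_imp_le[OF ak[OF W01]]) auto
  also have "\<dots> = e" using L.prob_space by simp
  finally show ?thesis .
qed

lemma continuous_functional_tendsto:
  fixes U :: "nat \<Rightarrow> 'a \<Rightarrow> real" and U' :: "'b \<Rightarrow> real" and h :: "real \<Rightarrow> real"
  assumes N: "\<And>n. prob_space (N n)" and U: "\<And>n. U n \<in> borel_measurable (N n)" "\<And>n \<omega>. U n \<omega> \<in> {0..1}"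
    and N': "prob_space N'" and U': "U' \<in> borel_measurable N'" "\<And>\<omega>. U' \<omega> \<in> {0..1}"
    and mom: "\<And>j. (\<lambda>n. \<integral>\<omega>. U n \<omega> ^ j \<partial>N n) \<longlonglongrightarrow> (\<integral>\<omega>. U' \<omega> ^ j \<partial>N')"
    and h: "continuous_on UNIV h"
  shows "(\<lambda>n. \<integral>\<omega>. h (U n \<omega>) \<partial>N n) \<longlonglongrightarrow> (\<integral>\<omega>. h (U' \<omega>) \<partial>N')"
proof (rule LIMSEQ_I)
  fix e :: real assume e: "0 < e"
  obtain q where q: "real_polynomial_function q" "\<And>x. x \<in> {0..1::real} \<Longrightarrow> \<bar>h x - q x\<bar> < e / 3"
    using Stone_Weierstrass_real_polynomial_function[of "{0..1}" h "e / 3"] continuous_on_subset[OF h] e by auto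
  obtain a k where ak: "q = (\<lambda>x. \<Sum>i\<le>k. a i * x ^ i)" using q(1) unfolding real_polynomial_function_iff_sum by auto
  note q' = q(2)[unfolded ak]
  note 1 = polynomial_approximation_integral[OF h q' N U]
  note 2 = polynomial_approximation_integral[OF h q' N' U']
  have "(\<lambda>n. \<Sum>i\<le>k. a i * (\<integral>\<omega>. U n \<omega> ^ i \<partial>N n)) \<longlonglongrightarrow> (\<Sum>i\<le>k. a i * (\<integral>\<omega>. U' \<omega> ^ i \<partial>N'))"
    by (intro tendsto_intros mom)
  then obtain n0 where n0: "\<And>n. n0 \<le> n \<Longrightarrow> \<bar>(\<Sum>i\<le>k. a i * (\<integral>\<omega>. U n \<omega> ^ i \<partial>N n)) - (\<Sum>i\<le>k. a i * (\<integral>\<omega>. U' \<omega> ^ i \<partial>N'))\<bar> < e / 3"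
    using e LIMSEQ_D[of "\<lambda>n. \<Sum>i\<le>k. a i * (\<integral>\<omega>. U n \<omega> ^ i \<partial>N n)" _ "e / 3"] unfolding real_norm_def by force
  show "\<exists>n0. \<forall>n\<ge>n0. norm ((\<integral>\<omega>. h (U n \<omega>) \<partial>N n) - (\<integral>\<omega>. h (U' \<omega>) \<partial>N')) < e"
  proof (intro exI[of _ n0] allI impI)
    fix n assume "n0 \<le> n"
    thus "norm ((\<integral>\<omega>. h (U n \<omega>) \<partial>N n) - (\<integral>\<omega>. h (U' \<omega>) \<partial>N')) < e"
      using n0[of n] 1[of n] 2 unfolding real_norm_def by linarith
  qed
qed

lemma square_norm_functional_tendsto:
  fixes X :: "nat \<Rightarrow> nat \<Rightarrow> 'a \<Rightarrow> real" and Z :: "nat \<Rightarrow> 'b \<Rightarrow> real" and h :: "real \<Rightarrow> real"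
  assumes N: "\<And>n. prob_space (N n)" and X: "\<And>n k. k < K \<Longrightarrow> X n k \<in> borel_measurable (N n)"
    and N': "prob_space N'" and Z: "\<And>k. k < K \<Longrightarrow> Z k \<in> borel_measurable N'"
    and cf: "\<And>t. (\<lambda>n. \<integral>\<omega>. iexp (\<Sum>k<K. t k * X n k \<omega>) \<partial>N n) \<longlonglongrightarrow> (\<integral>\<omega>. iexp (\<Sum>k<K. t k * Z k \<omega>) \<partial>N')"
    and h: "continuous_on UNIV h"
  shows "(\<lambda>n. \<integral>\<omega>. h (exp (- (\<Sum>k<K. (X n k \<omega>)\<^sup>2) / 2)) \<partial>N n) \<longlonglongrightarrow> (\<integral>\<omega>. h (exp (- (\<Sum>k<K. (Z k \<omega>)\<^sup>2) / 2)) \<partial>N')"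
proof (rule continuous_functional_tendsto[OF N _ _ N' _ _ _ h])
  have [measurable]: "(\<lambda>\<omega>. \<Sum>k<K. (X n k \<omega>)\<^sup>2) \<in> borel_measurable (N n)" for n
    by (intro borel_measurable_sum borel_measurable_power X) auto
  have [measurable]: "(\<lambda>\<omega>. \<Sum>k<K. (Z k \<omega>)\<^sup>2) \<in> borel_measurable N'"
    by (intro borel_measurable_sum borel_measurable_power Z) auto
  show "(\<lambda>\<omega>. exp (- (\<Sum>k<K. (X n k \<omega>)\<^sup>2) / 2)) \<in> borel_measurable (N n)" for n by measurable
  show "(\<lambda>\<omega>. exp (- (\<Sum>k<K. (Z k \<omega>)\<^sup>2) / 2)) \<in> borel_measurable N'" by measurable
  show "exp (- (\<Sum>k<K. (X n k \<omega>)\<^sup>2) / 2) \<in> {0..1}" for n \<omega> by (simp add: sum_nonneg)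
  show "exp (- (\<Sum>k<K. (Z k \<omega>)\<^sup>2) / 2) \<in> {0..1}" for \<omega> by (simp add: sum_nonneg)
  fix j :: nat
  \<comment> \<open>The j-th power of exp(-r/2) is the Laplace kernel at s = sqrt j, so moments of
    this variable and Laplace transforms of the squared norm are the same thing.\<close>
  have e: "exp (- r / 2) ^ j = exp (- ((sqrt (real j))\<^sup>2) / 2 * r)" for r :: real
    by (simp add: exp_of_nat_mult[symmetric])
  show "(\<lambda>n. \<integral>\<omega>. exp (- (\<Sum>k<K. (X n k \<omega>)\<^sup>2) / 2) ^ j \<partial>N n) \<longlonglongrightarrow> (\<integral>\<omega>. exp (- (\<Sum>k<K. (Z k \<omega>)\<^sup>2) / 2) ^ j \<partial>N')"
    unfolding e by (rule laplace_tendsto[OF N _ N' _ cf]) (auto intro: X Z)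
qed

text \<open>The tail indicator is squeezed between two continuous functions of exp(-S/2), for which
  convergence is known. They are placed at distance \<delta> on either side of c, which leaves room
  for replacing the squared norm S by the statistic T; the continuity of F at c closes the
  gap.\<close>

lemma (in prob_seq) square_norm_tail_tendsto:
  fixes X :: "nat \<Rightarrow> nat \<Rightarrow> 'a \<Rightarrow> real" and Z :: "nat \<Rightarrow> 'b \<Rightarrow> real"
  assumes X: "\<And>n k. 1 \<le> n \<Longrightarrow> k < K \<Longrightarrow> X n k \<in> borel_measurable (M n)"
    and N': "prob_space N'" and Z: "\<And>k. k < K \<Longrightarrow> Z k \<in> borel_measurable N'"
    and cf: "\<And>t. (\<lambda>n. \<integral>\<omega>. iexp (\<Sum>k<K. t k * X n k \<omega>) \<partial>M n) \<longlonglongrightarrow> (\<integral>\<omega>. iexp (\<Sum>k<K. t k * Z k \<omega>) \<partial>N')"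
    and T: "\<And>n. 1 \<le> n \<Longrightarrow> T n \<in> borel_measurable (M n)"
    and close: "oP (\<lambda>n \<omega>. T n \<omega> - (\<Sum>k<K. (X n k \<omega>)\<^sup>2))"
    and F: "F = cdf (distr N' borel (\<lambda>\<omega>. \<Sum>k<K. (Z k \<omega>)\<^sup>2))" and c: "isCont F c"
  shows "(\<lambda>n. measure (M n) {\<omega> \<in> space (M n). T n \<omega> > c}) \<longlonglongrightarrow> 1 - F c"
proof (rule LIMSEQ_I)
  fix e :: real assume e: "0 < e"
  interpret N': prob_space N' by fact
  define S where "S n \<omega> = (\<Sum>k<K. (X n k \<omega>)\<^sup>2)" for n \<omega>
  define R where "R \<omega> = (\<Sum>k<K. (Z k \<omega>)\<^sup>2)" for \<omega>
  have Rm[measurable]: "R \<in> borel_measurable N'" unfolding R_def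
    by (intro borel_measurable_sum borel_measurable_power Z) auto
  have Fm: "F r = N'.prob {\<omega>\<in>space N'. R \<omega> \<le> r}" for r
    unfolding F cdf_def R_def[symmetric, abs_def] by (subst measure_distr) (auto intro!: arg_cong[where f = N'.prob])
  obtain d where d: "0 < d" "\<And>r. \<bar>r - c\<bar> < d \<Longrightarrow> \<bar>F r - F c\<bar> < e / 3"
    using c e unfolding continuous_at_eps_delta dist_real_def by (metis zero_less_divide_iff zero_less_numeral)
  \<comment> \<open>Both ramps live between c - 2 \<delta> and c + 2 \<delta>, that is within d/2 of
    c, where F differs from F c by less than e/3.\<close>
  define \<delta> where "\<delta> = d / 4"
  have \<delta>: "0 < \<delta>" using d by (simp add: \<delta>_def)
  \<comment> \<open>As a function of r this rises from 0 at a to 1 at b; it is expressed in the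
    variable u = exp(-r/2), in which the continuous functionals are formulated.\<close>
  define ramp where "ramp a b u = max 0 (min 1 ((exp (- a / 2) - u) / (exp (- a / 2) - exp (- b / 2))))" for a b u :: real
  have ramp: "ramp a b (exp (- r / 2)) \<le> of_bool (a < r)" "of_bool (b \<le> r) \<le> ramp a b (exp (- r / 2))"
    "0 \<le> ramp a b u" "ramp a b u \<le> 1" if "a < b" for a b r u :: real
  proof -
    have pos: "0 < exp (- a / 2) - exp (- b / 2)" using that by simp
    show "ramp a b (exp (- r / 2)) \<le> of_bool (a < r)"
    proof (cases "a < r")
      case False
      hence "(exp (- a / 2) - exp (- r / 2)) / (exp (- a / 2) - exp (- b / 2)) \<le> 0"
        using pos by (intro divide_nonpos_pos) auto
      thus ?thesis using False by (simp add: ramp_def)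
    qed (simp add: ramp_def)
    show "of_bool (b \<le> r) \<le> ramp a b (exp (- r / 2))"
    proof (cases "b \<le> r")
      case True
      hence "1 \<le> (exp (- a / 2) - exp (- r / 2)) / (exp (- a / 2) - exp (- b / 2))"
        using pos by (simp add: le_divide_eq)
      thus ?thesis using True by (simp add: ramp_def)
    qed (simp add: ramp_def)
    show "0 \<le> ramp a b u" "ramp a b u \<le> 1" by (auto simp: ramp_def)
  qed
  have ramp_cont: "continuous_on UNIV (ramp a b)" if "a < b" for a b
    unfolding ramp_def using that by (intro continuous_intros) auto
  have ramp_m[measurable]: "ramp a b \<in> borel_measurable borel" if "a < b" for a b
    by (rule borel_measurable_continuous_onI[OF ramp_cont[OF that]])
  have lim: "(\<lambda>n. \<integral>\<omega>. ramp a b (exp (- S n \<omega> / 2)) \<partial>M n) \<longlonglongrightarrow> (\<integral>\<omega>. ramp a b (exp (- R \<omega> / 2)) \<partial>N')" if "a < b" for a b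
  proof -
    \<comment> \<open>The spaces \<open>M n\<close> are controlled only for n >= 1, whereas the
      convergence result speaks of every index; hence the shift by one.\<close>
    have "(\<lambda>n. \<integral>\<omega>. ramp a b (exp (- S (Suc n) \<omega> / 2)) \<partial>M (Suc n)) \<longlonglongrightarrow> (\<integral>\<omega>. ramp a b (exp (- R \<omega> / 2)) \<partial>N')"
      unfolding S_def R_def
    proof (rule square_norm_functional_tendsto[OF _ _ N' Z _ ramp_cont[OF that]])
      show "prob_space (M (Suc n))" for n by (rule prob_space_M) simp
      show "X (Suc n) k \<in> borel_measurable (M (Suc n))" if "k < K" for n k using X[of "Suc n" k] that by simp
      show "(\<lambda>n. \<integral>\<omega>. iexp (\<Sum>k<K. t k * X (Suc n) k \<omega>) \<partial>M (Suc n)) \<longlonglongrightarrow> (\<integral>\<omega>. iexp (\<Sum>k<K. t k * Z k \<omega>) \<partial>N')" for t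
        by (rule LIMSEQ_Suc[OF cf])
    qed
    thus ?thesis by (rule LIMSEQ_imp_Suc)
  qed
  have up: "(\<integral>\<omega>. ramp (c - 2 * \<delta>) (c - \<delta>) (exp (- R \<omega> / 2)) \<partial>N') \<le> 1 - F c + e / 3"
  proof -
    have "(\<integral>\<omega>. ramp (c - 2 * \<delta>) (c - \<delta>) (exp (- R \<omega> / 2)) \<partial>N') \<le> (\<integral>\<omega>. indicator {\<omega>\<in>space N'. c - 2 * \<delta> < R \<omega>} \<omega> \<partial>N')"
    proof (rule integral_mono)
      show "integrable N' (\<lambda>\<omega>. ramp (c - 2 * \<delta>) (c - \<delta>) (exp (- R \<omega> / 2)))"
        using \<delta> ramp(3,4) by (intro N'.integrable_bounded[where B = 1] measurable_compose[OF _ ramp_m]) auto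
      show "ramp (c - 2 * \<delta>) (c - \<delta>) (exp (- R \<omega> / 2)) \<le> indicator {\<omega>\<in>space N'. c - 2 * \<delta> < R \<omega>} \<omega>" if "\<omega> \<in> space N'" for \<omega>
        using ramp(1)[of "c - 2 * \<delta>" "c - \<delta>" "R \<omega>"] \<delta> that by (auto simp: indicator_def)
      show "integrable N' (indicator {\<omega>\<in>space N'. c - 2 * \<delta> < R \<omega>} :: 'b \<Rightarrow> real)"
        by (rule N'.integrable_indicator_event) measurable
    qed
    also have "\<dots> = N'.prob {\<omega>\<in>space N'. \<not> R \<omega> \<le> c - 2 * \<delta>}" by (simp add: not_le)
    also have "\<dots> = 1 - F (c - 2 * \<delta>)" unfolding Fm by (rule N'.prob_neg) measurable
    finally have "(\<integral>\<omega>. ramp (c - 2 * \<delta>) (c - \<delta>) (exp (- R \<omega> / 2)) \<partial>N') \<le> 1 - F (c - 2 * \<delta>)" .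
    moreover have "\<bar>F (c - 2 * \<delta>) - F c\<bar> < e / 3" by (rule d(2)) (use d(1) in \<open>simp add: \<delta>_def\<close>)
    ultimately show ?thesis by linarith
  qed
  have down: "1 - F c - e / 3 \<le> (\<integral>\<omega>. ramp (c + \<delta>) (c + 2 * \<delta>) (exp (- R \<omega> / 2)) \<partial>N')"
  proof -
    have "1 - F (c + 2 * \<delta>) = N'.prob {\<omega>\<in>space N'. \<not> R \<omega> \<le> c + 2 * \<delta>}"
      unfolding Fm by (rule N'.prob_neg[symmetric]) measurable
    also have "\<dots> = (\<integral>\<omega>. indicator {\<omega>\<in>space N'. \<not> R \<omega> \<le> c + 2 * \<delta>} \<omega> \<partial>N')" by simp
    also have "\<dots> \<le> (\<integral>\<omega>. ramp (c + \<delta>) (c + 2 * \<delta>) (exp (- R \<omega> / 2)) \<partial>N')"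
    proof (rule integral_mono)
      show "integrable N' (\<lambda>\<omega>. ramp (c + \<delta>) (c + 2 * \<delta>) (exp (- R \<omega> / 2)))"
        using \<delta> ramp(3,4) by (intro N'.integrable_bounded[where B = 1] measurable_compose[OF _ ramp_m]) auto
      show "indicator {\<omega>\<in>space N'. \<not> R \<omega> \<le> c + 2 * \<delta>} \<omega> \<le> ramp (c + \<delta>) (c + 2 * \<delta>) (exp (- R \<omega> / 2))" if "\<omega> \<in> space N'" for \<omega>
        using ramp(2)[of "c + \<delta>" "c + 2 * \<delta>" "R \<omega>"] ramp(3)[of "c + \<delta>" "c + 2 * \<delta>" "exp (- R \<omega> / 2)"] \<delta> that
        by (auto simp: indicator_def split: if_splits)
      show "integrable N' (indicator {\<omega>\<in>space N'. \<not> R \<omega> \<le> c + 2 * \<delta>} :: 'b \<Rightarrow> real)"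
        by (rule N'.integrable_indicator_event) measurable
    qed
    finally have "1 - F (c + 2 * \<delta>) \<le> (\<integral>\<omega>. ramp (c + \<delta>) (c + 2 * \<delta>) (exp (- R \<omega> / 2)) \<partial>N')" .
    moreover have "\<bar>F (c + 2 * \<delta>) - F c\<bar> < e / 3" by (rule d(2)) (use d(1) in \<open>simp add: \<delta>_def\<close>)
    ultimately show ?thesis by linarith
  qed
  have ev1: "\<forall>\<^sub>F n in sequentially. (\<integral>\<omega>. ramp (c - 2 * \<delta>) (c - \<delta>) (exp (- S n \<omega> / 2)) \<partial>M n) < 1 - F c + e / 3 + e / 3"
    using up e by (intro order_tendstoD(2)[OF lim]) (use \<delta> in auto)
  have ev2: "\<forall>\<^sub>F n in sequentially. 1 - F c - e / 3 - e / 3 < (\<integral>\<omega>. ramp (c + \<delta>) (c + 2 * \<delta>) (exp (- S n \<omega> / 2)) \<partial>M n)"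
    using down e by (intro order_tendstoD(1)[OF lim]) (use \<delta> in auto)
  have "whp (\<lambda>n \<omega>. \<bar>T n \<omega> - S n \<omega>\<bar> \<le> \<delta> / 2)" using oPD[OF close, of "\<delta> / 2"] \<delta> by (simp add: S_def)
  hence ev3: "\<forall>\<^sub>F n in sequentially. mostly n (e / 3) (\<lambda>\<omega>. \<bar>T n \<omega> - S n \<omega>\<bar> \<le> \<delta> / 2)"
    using e unfolding whp_def by auto
  have "\<forall>\<^sub>F n in sequentially. norm (measure (M n) {\<omega> \<in> space (M n). T n \<omega> > c} - (1 - F c)) < e"
    using ev1 ev2 ev3 eventually_ge_at_top[of 1]
  proof eventually_elim
    case (elim n)
    interpret Mn: prob_space "M n" by (rule prob_space_M[OF elim(4)])
    have Tm[measurable]: "T n \<in> borel_measurable (M n)" by (rule T[OF elim(4)])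
    have Sm[measurable]: "S n \<in> borel_measurable (M n)" unfolding S_def
      by (intro borel_measurable_sum borel_measurable_power X elim) auto
    obtain A where A: "A \<in> sets (M n)" "Mn.prob A < e / 3" "\<forall>\<omega>\<in>space (M n) - A. \<bar>T n \<omega> - S n \<omega>\<bar> \<le> \<delta> / 2"
      using elim(3) unfolding mostly_def by auto
    have ri: "integrable (M n) (\<lambda>\<omega>. ramp a b (exp (- S n \<omega> / 2)))" if "a < b" for a b
      using that ramp(3,4) by (intro Mn.integrable_bounded[where B = 1] measurable_compose[OF _ ramp_m]) auto
    have iA: "integrable (M n) (indicator A :: 'a \<Rightarrow> real)" by (rule Mn.integrable_indicator_event[OF A(1)])
    have iT: "integrable (M n) (indicator {\<omega> \<in> space (M n). T n \<omega> > c} :: 'a \<Rightarrow> real)"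
      by (rule Mn.integrable_indicator_event) measurable
    have E: "Mn.prob {\<omega> \<in> space (M n). T n \<omega> > c} = (\<integral>\<omega>. indicator {\<omega> \<in> space (M n). T n \<omega> > c} \<omega> \<partial>M n)"
      by simp
    have EA: "(\<integral>\<omega>. indicator A \<omega> \<partial>M n) = Mn.prob A" using A(1) by simp
    have l1: "c - 2 * \<delta> < c - \<delta>" "c + \<delta> < c + 2 * \<delta>" using \<delta> by auto
    have "Mn.prob {\<omega> \<in> space (M n). T n \<omega> > c} \<le> (\<integral>\<omega>. ramp (c - 2 * \<delta>) (c - \<delta>) (exp (- S n \<omega> / 2)) + indicator A \<omega> \<partial>M n)"
      unfolding E
    proof (rule integral_mono)
      fix \<omega> assume w: "\<omega> \<in> space (M n)"
      have "of_bool (c - \<delta> \<le> S n \<omega>) \<le> ramp (c - 2 * \<delta>) (c - \<delta>) (exp (- S n \<omega> / 2))"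
        "0 \<le> ramp (c - 2 * \<delta>) (c - \<delta>) (exp (- S n \<omega> / 2))" by (rule ramp[OF l1(1)])+
      thus "indicator {\<omega> \<in> space (M n). T n \<omega> > c} \<omega> \<le> ramp (c - 2 * \<delta>) (c - \<delta>) (exp (- S n \<omega> / 2)) + indicator A \<omega>"
        using A(3) w \<delta> by (cases "\<omega> \<in> A"; cases "T n \<omega> > c"; cases "c - \<delta> \<le> S n \<omega>") (auto simp: abs_le_iff, force)
    qed (rule iT, rule Bochner_Integration.integrable_add[OF ri[OF l1(1)] iA])
    also have "\<dots> = (\<integral>\<omega>. ramp (c - 2 * \<delta>) (c - \<delta>) (exp (- S n \<omega> / 2)) \<partial>M n) + Mn.prob A"
      by (subst Bochner_Integration.integral_add[OF ri[OF l1(1)] iA]) (simp only: EA)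
    finally have u: "Mn.prob {\<omega> \<in> space (M n). T n \<omega> > c} < 1 - F c + e" using elim(1) A(2) by linarith
    have "(\<integral>\<omega>. ramp (c + \<delta>) (c + 2 * \<delta>) (exp (- S n \<omega> / 2)) \<partial>M n) \<le> (\<integral>\<omega>. indicator {\<omega> \<in> space (M n). T n \<omega> > c} \<omega> + indicator A \<omega> \<partial>M n)"
    proof (rule integral_mono)
      fix \<omega> assume w: "\<omega> \<in> space (M n)"
      have "ramp (c + \<delta>) (c + 2 * \<delta>) (exp (- S n \<omega> / 2)) \<le> of_bool (c + \<delta> < S n \<omega>)" by (rule ramp[OF l1(2)])
      thus "ramp (c + \<delta>) (c + 2 * \<delta>) (exp (- S n \<omega> / 2)) \<le> indicator {\<omega> \<in> space (M n). T n \<omega> > c} \<omega> + indicator A \<omega>"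
        using A(3) w \<delta> by (cases "\<omega> \<in> A"; cases "T n \<omega> > c"; cases "c + \<delta> < S n \<omega>") (auto simp: abs_le_iff, force)
    qed (rule ri[OF l1(2)], rule Bochner_Integration.integrable_add[OF iT iA])
    also have "\<dots> = Mn.prob {\<omega> \<in> space (M n). T n \<omega> > c} + Mn.prob A"
      by (subst Bochner_Integration.integral_add[OF iT iA]) (simp only: EA E)
    finally have "1 - F c - e < Mn.prob {\<omega> \<in> space (M n). T n \<omega> > c}" using elim(2) A(2) by linarith
    thus ?case using u by (simp add: abs_less_iff)
  qed
  thus "\<exists>n0. \<forall>n\<ge>n0. norm (measure (M n) {\<omega> \<in> space (M n). T n \<omega> > c} - (1 - F c)) < e"
    by (simp add: eventually_sequentially)
qed

subsection \<open>Orthonormal bases of \<open>\<real>\<^sup>I\<close>\<close>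

definition dotp :: "'i set \<Rightarrow> ('i \<Rightarrow> real) \<Rightarrow> ('i \<Rightarrow> real) \<Rightarrow> real" where
  "dotp I a b = (\<Sum>i\<in>I. a i * b i)"

definition orthonormal :: "'i set \<Rightarrow> (nat \<Rightarrow> 'i \<Rightarrow> real) \<Rightarrow> nat \<Rightarrow> bool" where
  "orthonormal I e r \<longleftrightarrow> (\<forall>k<r. \<forall>l<r. dotp I (e k) (e l) = (if k = l then 1 else 0))"

lemma dotp_commute: "dotp I a b = dotp I b a"
  by (simp add: dotp_def mult.commute)

lemma dotp_self_nonneg: "0 \<le> dotp I a a"
  by (simp add: dotp_def sum_nonneg)

text \<open>Here u is what remains of the j-th unit vector after its projection onto the span of e
  0, ..., e (r - 1). It measures whether that span already contains the unit vector.\<close>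

lemma coordinate_residual:
  assumes I: "finite I" "j \<in> I" and e: "orthonormal I e r"
  defines "u \<equiv> \<lambda>i. (if i = j then 1 else 0) - (\<Sum>k<r. e k j * e k i)"
  shows "l < r \<Longrightarrow> dotp I (e l) u = 0" "dotp I u u = 1 - (\<Sum>k<r. (e k j)\<^sup>2)"
proof -
  have expand: "dotp I a u = a j - (\<Sum>k<r. e k j * dotp I a (e k))" for a
  proof -
    have "dotp I a u = (\<Sum>i\<in>I. a i * (if i = j then 1 else 0)) - (\<Sum>i\<in>I. \<Sum>k<r. e k j * (a i * e k i))"
      by (simp add: dotp_def u_def right_diff_distrib sum_subtractf sum_distrib_left mult_ac)
    also have "(\<Sum>i\<in>I. a i * (if i = j then 1 else 0)) = (\<Sum>i\<in>I. if i = j then a i else 0)"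
      by (intro sum.cong) auto
    also have "\<dots> = a j" using I by simp
    also have "(\<Sum>i\<in>I. \<Sum>k<r. e k j * (a i * e k i)) = (\<Sum>k<r. e k j * dotp I a (e k))"
      by (subst sum.swap) (simp add: dotp_def sum_distrib_left)
    finally show ?thesis .
  qed
  show 0: "dotp I (e l) u = 0" if "l < r" for l
  proof -
    have "(\<Sum>k<r. e k j * dotp I (e l) (e k)) = (\<Sum>k<r. if k = l then e k j else 0)"
      using e that by (intro sum.cong) (auto simp: orthonormal_def)
    thus ?thesis using that by (simp add: expand sum.delta)
  qed
  have "dotp I u u = u j - (\<Sum>k<r. e k j * dotp I u (e k))" by (rule expand)
  also have "(\<Sum>k<r. e k j * dotp I u (e k)) = 0"
    by (intro sum.neutral) (simp add: 0 dotp_commute[of I u])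
  finally show "dotp I u u = 1 - (\<Sum>k<r. (e k j)\<^sup>2)" by (simp add: u_def power2_eq_square)
qed

text \<open>The trace of the projection onto the span. Below full dimension it forces some unit
  vector to stick out of the span; in full dimension it forces none to.\<close>

lemma orthonormal_sum_squares:
  assumes "orthonormal I e r"
  shows "(\<Sum>j\<in>I. \<Sum>k<r. (e k j)\<^sup>2) = real r"
proof -
  have "(\<Sum>j\<in>I. \<Sum>k<r. (e k j)\<^sup>2) = (\<Sum>k<r. dotp I (e k) (e k))"
    by (subst sum.swap) (simp add: dotp_def power2_eq_square)
  also have "\<dots> = (\<Sum>k<r. 1)" using assms by (intro sum.cong) (auto simp: orthonormal_def)
  finally show ?thesis by simp
qed

text \<open>The trace r is less than the number of coordinates, so some unit vector has a residual
  of positive norm; normalizing it gives the new vector.\<close>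

lemma orthonormal_extend:
  assumes I: "finite I" and r: "r < card I" and e: "orthonormal I e r"
  shows "\<exists>w. orthonormal I (e(r := w)) (Suc r)"
proof -
  have "\<exists>j\<in>I. (\<Sum>k<r. (e k j)\<^sup>2) < 1"
  proof (rule ccontr)
    assume "\<not> (\<exists>j\<in>I. (\<Sum>k<r. (e k j)\<^sup>2) < 1)"
    hence "(\<Sum>j\<in>I. 1) \<le> (\<Sum>j\<in>I. \<Sum>k<r. (e k j)\<^sup>2)" by (intro sum_mono) (auto simp: not_less)
    thus False using orthonormal_sum_squares[OF e] r by simp
  qed
  then obtain j where j: "j \<in> I" "(\<Sum>k<r. (e k j)\<^sup>2) < 1" by blast
  define u where "u i = (if i = j then 1 else 0) - (\<Sum>k<r. e k j * e k i)" for i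
  have u: "dotp I (e l) u = 0" if "l < r" for l
    using coordinate_residual(1)[OF I j(1) e that] by (simp add: u_def[abs_def])
  have uu: "0 < dotp I u u" using coordinate_residual(2)[OF I j(1) e] j(2) by (simp add: u_def[abs_def])
  define w where "w i = u i / sqrt (dotp I u u)" for i
  have s: "dotp I a w = dotp I a u / sqrt (dotp I u u)" for a
    by (simp add: dotp_def w_def sum_divide_distrib)
  have "dotp I w w = dotp I u u / (sqrt (dotp I u u) * sqrt (dotp I u u))"
    using s[of w] s[of u] dotp_commute[of I w u] by simp
  hence "dotp I w w = 1" using uu by simp
  moreover have "dotp I (e l) w = 0" "dotp I w (e l) = 0" if "l < r" for l
    using u[OF that] s[of "e l"] dotp_commute[of I w "e l"] by simp_all
  ultimately have "orthonormal I (e(r := w)) (Suc r)"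
    using e unfolding orthonormal_def by (auto simp: less_Suc_eq)
  thus ?thesis by blast
qed

lemma orthonormal_complete:
  assumes I: "finite I" and r: "r \<le> card I" and e: "orthonormal I e r"
  shows "\<exists>e'. orthonormal I e' (card I) \<and> (\<forall>k<r. e' k = e k)"
  using r e
proof (induction "card I - r" arbitrary: r e)
  case 0
  thus ?case by (intro exI[of _ e]) auto
next
  case (Suc d)
  hence "r < card I" by simp
  then obtain w where w: "orthonormal I (e(r := w)) (Suc r)" using orthonormal_extend[OF I _ Suc.prems(2)] by auto
  have "\<exists>e'. orthonormal I e' (card I) \<and> (\<forall>k<Suc r. e' k = (e(r := w)) k)"
    using Suc.hyps(2) Suc.prems by (intro Suc.hyps(1) w) auto
  thus ?case by (auto simp: less_Suc_eq) 
qed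

text \<open>In full dimension the squared norms of all coordinate residuals are nonnegative and add
  up to 0, so each residual vanishes. This is the expansion of every unit vector in the basis, and
  hence of x.\<close>

lemma orthonormal_Parseval:
  assumes I: "finite I" and e: "orthonormal I e (card I)"
  shows "dotp I x x = (\<Sum>k<card I. (dotp I (e k) x)\<^sup>2)"
proof -
  let ?m = "card I"
  define u where "u j i = (if i = j then 1 else 0) - (\<Sum>k<?m. e k j * e k i)" for i j
  have uu: "dotp I (u j) (u j) = 1 - (\<Sum>k<?m. (e k j)\<^sup>2)" if "j \<in> I" for j
    using coordinate_residual(2)[OF I that e] by (simp add: u_def[abs_def])
  have "(\<Sum>j\<in>I. dotp I (u j) (u j)) = 0"
    using orthonormal_sum_squares[OF e] by (simp add: uu sum_subtractf)
  hence "\<forall>j\<in>I. dotp I (u j) (u j) = 0" using I by (subst (asm) sum_nonneg_eq_0_iff) (auto intro: dotp_self_nonneg)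
  hence u0: "u j i = 0" if "i \<in> I" "j \<in> I" for i j
    using that I by (auto simp: dotp_def sum_nonneg_eq_0_iff)
  have x: "x i = (\<Sum>k<?m. e k i * dotp I (e k) x)" if i: "i \<in> I" for i
  proof -
    have "x i = (\<Sum>j\<in>I. (if i = j then 1 else 0) * x j)" using I i by (simp add: if_distrib[of "\<lambda>c. c * _"] sum.delta' cong: if_cong)
    also have "\<dots> = (\<Sum>j\<in>I. (\<Sum>k<?m. e k j * e k i) * x j)"
    proof (intro sum.cong refl)
      fix j assume "j \<in> I"
      from u0[OF i this] show "(if i = j then 1 else 0) * x j = (\<Sum>k<?m. e k j * e k i) * x j" by (simp add: u_def)
    qed
    also have "\<dots> = (\<Sum>k<?m. e k i * dotp I (e k) x)"
      by (simp add: sum_distrib_right dotp_def sum_distrib_left) (subst sum.swap, simp add: mult_ac)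
    finally show ?thesis .
  qed
  have "dotp I x x = (\<Sum>i\<in>I. (\<Sum>k<?m. e k i * dotp I (e k) x) * x i)"
    unfolding dotp_def[of I x x] using x by (intro sum.cong refl) auto
  also have "\<dots> = (\<Sum>k<?m. dotp I (e k) x * dotp I (e k) x)"
    by (simp add: sum_distrib_right dotp_def[of I "e _"] sum_distrib_left) (subst sum.swap, simp add: mult_ac)
  finally show ?thesis by (simp add: power2_eq_square)
qed

subsection \<open>Characteristic functions of local multinomial arrays\<close>

text \<open>Comparison with exp(a/n)^n through |z^n - w^n| <= n |z - w| for z and w in the unit
  disc; Re a <= 0 puts exp(a/n) there, and complex logarithms are avoided.\<close>

lemma complex_power_tendsto_exp:
  fixes z :: "nat \<Rightarrow> complex"
  assumes z: "\<And>n. norm (z n) \<le> 1" and lim: "(\<lambda>n. of_nat n * (z n - 1)) \<longlonglongrightarrow> a" and a: "Re a \<le> 0"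
  shows "(\<lambda>n. z n ^ n) \<longlonglongrightarrow> exp a"
proof -
  have "((\<lambda>h. exp (a * h)) has_field_derivative a * exp (a * 0)) (at 0)"
    by (auto intro!: derivative_eq_intros)
  hence D: "((\<lambda>h. (exp (a * h) - 1) / h) \<longlongrightarrow> a) (at 0)" by (simp add: DERIV_def)
  have "filterlim (\<lambda>n. 1 / of_nat (Suc n) :: complex) (at 0) sequentially"
    unfolding filterlim_at
    by (auto intro!: LIMSEQ_Suc[OF lim_1_over_n] always_eventually simp del: of_nat_Suc)
  from filterlim_compose[OF D this]
  have "(\<lambda>n. (exp (a * (1 / of_nat (Suc n))) - 1) / (1 / of_nat (Suc n))) \<longlonglongrightarrow> a" .
  hence "(\<lambda>n. of_nat (Suc n) * (exp (a / of_nat (Suc n)) - 1)) \<longlonglongrightarrow> a" by (simp add: mult.commute del: of_nat_Suc)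
  hence ex: "(\<lambda>n. of_nat n * (exp (a / of_nat n) - 1)) \<longlonglongrightarrow> a" by (rule LIMSEQ_imp_Suc)
  have d: "(\<lambda>n. norm (of_nat n * (z n - 1) - of_nat n * (exp (a / of_nat n) - 1))) \<longlonglongrightarrow> 0"
    using tendsto_norm[OF tendsto_diff[OF lim ex]] by simp
  have "(\<lambda>n. z n ^ n - exp (a / of_nat n) ^ n) \<longlonglongrightarrow> 0"
  proof (rule Lim_null_comparison[OF always_eventually d], rule allI)
    fix n
    have "norm (exp (a / of_nat n)) \<le> 1" using a by (simp add: divide_nonpos_nonneg)
    hence "norm (z n ^ n - exp (a / of_nat n) ^ n) \<le> real n * norm (z n - exp (a / of_nat n))"
      by (intro norm_power_diff z)
    also have "\<dots> = norm (of_nat n * (z n - 1) - of_nat n * (exp (a / of_nat n) - 1))"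
      by (simp add: right_diff_distrib[symmetric] norm_mult)
    finally show "norm (z n ^ n - exp (a / of_nat n) ^ n) \<le> norm (of_nat n * (z n - 1) - of_nat n * (exp (a / of_nat n) - 1))" .
  qed
  moreover have "(\<lambda>n. exp (a / of_nat n) ^ n) \<longlonglongrightarrow> exp a"
  proof (rule tendsto_eventually, rule eventually_mono[OF eventually_gt_at_top[of 0]])
    fix n :: nat assume "0 < n"
    thus "exp (a / of_nat n) ^ n = exp a" by (simp add: exp_of_nat_mult[symmetric])
  qed
  ultimately have "(\<lambda>n. (z n ^ n - exp (a / of_nat n) ^ n) + exp (a / of_nat n) ^ n) \<longlonglongrightarrow> 0 + exp a"
    by (rule tendsto_add)
  thus ?thesis by simp
qed

text \<open>Expansion of the characteristic function of one observation to order 1/n. Since w is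
  centred under the null probabilities, the term of order n^(-1/2) drops out; at order 1/n the
  variance term meets the product of the local shift, of order n^(-1/2), with the first-order phase,
  of the same order.\<close>

lemma local_multinomial_char:
  fixes w \<pi>0 q :: "'j \<Rightarrow> real" and r :: "nat \<Rightarrow> real"
  assumes J: "finite J" and mean: "(\<Sum>j\<in>J. \<pi>0 j * w j) = 0" and pos: "\<And>j. j \<in> J \<Longrightarrow> 0 \<le> \<pi>0 j"
    and prob: "\<And>n j. 1 \<le> n \<Longrightarrow> j \<in> J \<Longrightarrow> 0 \<le> \<pi>0 j + r n * q j" "\<And>n. 1 \<le> n \<Longrightarrow> (\<Sum>j\<in>J. \<pi>0 j + r n * q j) = 1"
    and r: "(\<lambda>n. sqrt (real n) * r n) \<longlonglongrightarrow> \<rho>"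
  shows "(\<lambda>n. (\<Sum>j\<in>J. of_real (\<pi>0 j + r n * q j) * iexp (w j / sqrt (real n))) ^ n)
     \<longlonglongrightarrow> exp (\<i> * of_real (\<rho> * (\<Sum>j\<in>J. q j * w j)) - of_real ((\<Sum>j\<in>J. \<pi>0 j * (w j)\<^sup>2) / 2))"
proof -
  define h where "h n = 1 / sqrt (real n)" for n
  have h: "h \<longlonglongrightarrow> 0" unfolding h_def
    by (rule real_tendsto_divide_at_top[OF tendsto_const filterlim_compose[OF sqrt_at_top filterlim_real_sequentially]])
  have hh: "real n * (h n)\<^sup>2 = 1" "sqrt (real n) * h n = 1" if "1 \<le> n" for n
    using that by (auto simp: h_def power_divide)
  define z where "z n = (\<Sum>j\<in>J. of_real (\<pi>0 j + r n * q j) * iexp (h n * w j))" for n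
  define a where "a = \<i> * of_real (\<rho> * (\<Sum>j\<in>J. q j * w j)) - of_real ((\<Sum>j\<in>J. \<pi>0 j * (w j)\<^sup>2) / 2)"
  have second: "(\<lambda>n. of_nat n * (iexp (h n * y) - 1 - \<i> * of_real (h n * y))) \<longlonglongrightarrow> - of_real (y\<^sup>2 / 2)" for y
  proof (rule Lim_transform_eventually)
    have "(\<lambda>n. h n * (\<bar>y\<bar> ^ 3 / 6)) \<longlonglongrightarrow> 0" by (rule tendsto_mult_left_zero[OF h])
    hence "(\<lambda>n. of_nat n * (iexp (h n * y) - (1 + \<i> * of_real (h n * y) - of_real ((h n * y)\<^sup>2 / 2)))) \<longlonglongrightarrow> 0"
    proof (rule Lim_null_comparison[rotated], intro eventually_mono[OF eventually_ge_at_top[of 1]])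
      fix n :: nat assume n: "1 \<le> n"
      have e: "(\<Sum>k\<le>2. (\<i> * of_real x) ^ k / fact k) = 1 + \<i> * of_real x - of_real (x\<^sup>2 / 2)" for x :: real
        by (simp add: numeral_2_eq_2 power2_eq_square fact_numeral) (simp add: field_simps power2_eq_square)
      have "cmod (iexp (h n * y) - (1 + \<i> * of_real (h n * y) - of_real ((h n * y)\<^sup>2 / 2))) \<le> \<bar>h n * y\<bar> ^ 3 / 6"
        using iexp_approx1[of "h n * y" 2] unfolding e by (simp add: numeral_3_eq_3 fact_numeral)
      hence "real n * cmod (iexp (h n * y) - (1 + \<i> * of_real (h n * y) - of_real ((h n * y)\<^sup>2 / 2))) \<le> real n * (\<bar>h n * y\<bar> ^ 3 / 6)"
        by (intro mult_left_mono) auto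
      hence "cmod (of_nat n * (iexp (h n * y) - (1 + \<i> * of_real (h n * y) - of_real ((h n * y)\<^sup>2 / 2)))) \<le> real n * (\<bar>h n * y\<bar> ^ 3 / 6)"
        unfolding norm_mult norm_of_nat .
      also have "\<dots> = (real n * (h n)\<^sup>2) * (h n * (\<bar>y\<bar> ^ 3 / 6))"
        by (simp add: abs_mult power_mult_distrib h_def power3_eq_cube power2_eq_square)
      finally show "cmod (of_nat n * (iexp (h n * y) - (1 + \<i> * of_real (h n * y) - of_real ((h n * y)\<^sup>2 / 2)))) \<le> h n * (\<bar>y\<bar> ^ 3 / 6)"
        using hh[OF n] by simp
    qed
    from tendsto_diff[OF this tendsto_const[of "of_real (y\<^sup>2 / 2)"]]
    show "(\<lambda>n. of_nat n * (iexp (h n * y) - (1 + \<i> * of_real (h n * y) - of_real ((h n * y)\<^sup>2 / 2))) - of_real (y\<^sup>2 / 2)) \<longlonglongrightarrow> - of_real (y\<^sup>2 / 2)"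
      by simp
    show "\<forall>\<^sub>F n in sequentially. of_nat n * (iexp (h n * y) - (1 + \<i> * of_real (h n * y) - of_real ((h n * y)\<^sup>2 / 2))) - of_real (y\<^sup>2 / 2)
       = of_nat n * (iexp (h n * y) - 1 - \<i> * of_real (h n * y))"
    proof (intro eventually_mono[OF eventually_ge_at_top[of 1]])
      fix n :: nat assume n: "1 \<le> n"
      have "of_nat n * of_real ((h n * y)\<^sup>2 / 2) = (of_real (real n * (h n)\<^sup>2 * (y\<^sup>2 / 2)) :: complex)"
        by (simp add: power_mult_distrib)
      also have "\<dots> = of_real (y\<^sup>2 / 2)" using hh(1)[OF n] by simp
      finally have "of_nat n * of_real ((h n * y)\<^sup>2 / 2) = (of_real (y\<^sup>2 / 2) :: complex)" .
      thus "of_nat n * (iexp (h n * y) - (1 + \<i> * of_real (h n * y) - of_real ((h n * y)\<^sup>2 / 2))) - of_real (y\<^sup>2 / 2)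
       = of_nat n * (iexp (h n * y) - 1 - \<i> * of_real (h n * y))"
        by (simp only: right_diff_distrib distrib_left) (simp add: algebra_simps)
    qed
  qed
  have first: "(\<lambda>n. of_real (sqrt (real n)) * (iexp (h n * y) - 1)) \<longlonglongrightarrow> \<i> * of_real y" for y
  proof -
    have "(\<lambda>n. h n * (y\<^sup>2 / 2)) \<longlonglongrightarrow> 0" by (rule tendsto_mult_left_zero[OF h])
    hence "(\<lambda>n. of_real (sqrt (real n)) * (iexp (h n * y) - 1) - \<i> * of_real y) \<longlonglongrightarrow> 0"
    proof (rule Lim_null_comparison[rotated], intro eventually_mono[OF eventually_ge_at_top[of 1]])
      fix n :: nat assume n: "1 \<le> n"
      have e: "(\<Sum>k\<le>1. (\<i> * of_real x) ^ k / fact k) = 1 + \<i> * of_real x" for x :: real by simp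
      have b: "cmod (iexp (h n * y) - (1 + \<i> * of_real (h n * y))) \<le> \<bar>h n * y\<bar>\<^sup>2 / 2"
        using iexp_approx1[of "h n * y" 1] unfolding e by (simp add: numeral_2_eq_2)
      have "of_real (sqrt (real n)) * (\<i> * of_real (h n * y)) = \<i> * (of_real (sqrt (real n) * h n) * of_real y)" by simp
      also have "\<dots> = \<i> * of_real y" using hh(2)[OF n] by simp
      finally have s: "of_real (sqrt (real n)) * (\<i> * of_real (h n * y)) = \<i> * of_real y" .
      have "of_real (sqrt (real n)) * (iexp (h n * y) - 1) - \<i> * of_real y
          = of_real (sqrt (real n)) * (iexp (h n * y) - (1 + \<i> * of_real (h n * y)))"
        unfolding right_diff_distrib distrib_left s by simp
      moreover have "sqrt (real n) * cmod (iexp (h n * y) - (1 + \<i> * of_real (h n * y))) \<le> sqrt (real n) * (\<bar>h n * y\<bar>\<^sup>2 / 2)"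
        using b by (intro mult_left_mono) auto
      ultimately have "cmod (of_real (sqrt (real n)) * (iexp (h n * y) - 1) - \<i> * of_real y) \<le> sqrt (real n) * (\<bar>h n * y\<bar>\<^sup>2 / 2)"
        by (simp only: norm_mult norm_of_real abs_of_nonneg[OF real_sqrt_ge_zero[OF of_nat_0_le_iff]])
      also have "\<dots> = (sqrt (real n) * h n) * (h n * (y\<^sup>2 / 2))"
        by (simp add: power_mult_distrib power2_eq_square)
      finally show "cmod (of_real (sqrt (real n)) * (iexp (h n * y) - 1) - \<i> * of_real y) \<le> h n * (y\<^sup>2 / 2)"
        using hh(2)[OF n] by simp
    qed
    thus ?thesis by (simp add: LIM_zero_iff)
  qed
  have lim: "(\<lambda>n. of_nat n * (z n - 1)) \<longlonglongrightarrow> a"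
  proof (rule Lim_transform_eventually)
    have "(\<lambda>n. (\<Sum>j\<in>J. of_real (\<pi>0 j) * (of_nat n * (iexp (h n * w j) - 1 - \<i> * of_real (h n * w j))))
         + of_real (sqrt (real n) * r n) * (\<Sum>j\<in>J. of_real (q j) * (of_real (sqrt (real n)) * (iexp (h n * w j) - 1))))
       \<longlonglongrightarrow> (\<Sum>j\<in>J. of_real (\<pi>0 j) * (- of_real ((w j)\<^sup>2 / 2))) + of_real \<rho> * (\<Sum>j\<in>J. of_real (q j) * (\<i> * of_real (w j)))"
      by (intro tendsto_intros second first r)
    also have "(\<Sum>j\<in>J. of_real (\<pi>0 j) * (- of_real ((w j)\<^sup>2 / 2))) + of_real \<rho> * (\<Sum>j\<in>J. of_real (q j) * (\<i> * of_real (w j))) = a"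
      by (simp add: a_def sum_distrib_left sum_negf sum_divide_distrib mult_ac)
    finally show "(\<lambda>n. (\<Sum>j\<in>J. of_real (\<pi>0 j) * (of_nat n * (iexp (h n * w j) - 1 - \<i> * of_real (h n * w j))))
         + of_real (sqrt (real n) * r n) * (\<Sum>j\<in>J. of_real (q j) * (of_real (sqrt (real n)) * (iexp (h n * w j) - 1)))) \<longlonglongrightarrow> a" .
    show "\<forall>\<^sub>F n in sequentially. (\<Sum>j\<in>J. of_real (\<pi>0 j) * (of_nat n * (iexp (h n * w j) - 1 - \<i> * of_real (h n * w j))))
         + of_real (sqrt (real n) * r n) * (\<Sum>j\<in>J. of_real (q j) * (of_real (sqrt (real n)) * (iexp (h n * w j) - 1)))
       = of_nat n * (z n - 1)"
    proof (intro eventually_mono[OF eventually_ge_at_top[of 1]])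
      fix n :: nat assume n: "1 \<le> n"
      let ?E = "\<lambda>j. iexp (h n * w j) - 1"
      have m0: "(\<Sum>j\<in>J. of_real (\<pi>0 j) * (\<i> * of_real (h n * w j))) = 0"
      proof -
        have "(\<Sum>j\<in>J. of_real (\<pi>0 j) * (\<i> * of_real (h n * w j))) = \<i> * of_real (h n * (\<Sum>j\<in>J. \<pi>0 j * w j))"
          by (simp add: sum_distrib_left mult_ac)
        thus ?thesis by (simp add: mean)
      qed
      have "(\<Sum>j\<in>J. of_real (\<pi>0 j) * (of_nat n * (?E j - \<i> * of_real (h n * w j))))
          = of_nat n * ((\<Sum>j\<in>J. of_real (\<pi>0 j) * ?E j) - (\<Sum>j\<in>J. of_real (\<pi>0 j) * (\<i> * of_real (h n * w j))))"
        by (simp only: right_diff_distrib sum_subtractf sum_distrib_left mult.left_commute[of "of_nat n"])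
      hence A: "(\<Sum>j\<in>J. of_real (\<pi>0 j) * (of_nat n * (?E j - \<i> * of_real (h n * w j)))) = of_nat n * (\<Sum>j\<in>J. of_real (\<pi>0 j) * ?E j)"
        by (simp only: m0 diff_zero)
      have sq: "of_real (sqrt (real n)) * of_real (sqrt (real n)) = (of_nat n :: complex)"
        by (simp flip: of_real_mult)
      have B: "of_real (sqrt (real n) * r n) * (\<Sum>j\<in>J. of_real (q j) * (of_real (sqrt (real n)) * ?E j))
         = of_nat n * (\<Sum>j\<in>J. of_real (r n * q j) * ?E j)"
        unfolding sum_distrib_left
      proof (intro sum.cong refl)
        fix j
        show "of_real (sqrt (real n) * r n) * (of_real (q j) * (of_real (sqrt (real n)) * ?E j)) = of_nat n * (of_real (r n * q j) * ?E j)"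
          unfolding of_real_mult sq[symmetric] by (simp only: mult_ac)
      qed
      have "of_nat n * (\<Sum>j\<in>J. of_real (\<pi>0 j) * ?E j) + of_nat n * (\<Sum>j\<in>J. of_real (r n * q j) * ?E j)
          = of_nat n * (\<Sum>j\<in>J. of_real (\<pi>0 j + r n * q j) * ?E j)"
        by (simp add: distrib_left[symmetric] sum.distrib[symmetric] distrib_right)
      also have "(\<Sum>j\<in>J. of_real (\<pi>0 j + r n * q j) * ?E j) = z n - of_real (\<Sum>j\<in>J. \<pi>0 j + r n * q j)"
        unfolding z_def by (simp only: right_diff_distrib sum_subtractf mult_1_right of_real_sum)
      also have "\<dots> = z n - 1" using prob(2)[OF n] by simp
      finally show "(\<Sum>j\<in>J. of_real (\<pi>0 j) * (of_nat n * (iexp (h n * w j) - 1 - \<i> * of_real (h n * w j))))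
         + of_real (sqrt (real n) * r n) * (\<Sum>j\<in>J. of_real (q j) * (of_real (sqrt (real n)) * (iexp (h n * w j) - 1)))
       = of_nat n * (z n - 1)" unfolding A B .
    qed
  qed
  \<comment> \<open>The cells form a probability vector only for n >= 1; at n = 0 the value 1 keeps
    the sequence in the unit disc.\<close>
  define z' where "z' n = (if n = 0 then 1 else z n)" for n
  have "norm (z' n) \<le> 1" for n
  proof (cases "n = 0")
    case False
    hence n: "1 \<le> n" by simp
    have "norm (z n) \<le> (\<Sum>j\<in>J. norm (of_real (\<pi>0 j + r n * q j) * iexp (h n * w j)))" unfolding z_def by (rule norm_sum)
    also have "\<dots> = (\<Sum>j\<in>J. \<pi>0 j + r n * q j)"
      using prob(1)[OF n] by (intro sum.cong refl) (simp add: norm_mult del: of_real_add of_real_mult)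
    finally show ?thesis using prob(2)[OF n] False by (simp add: z'_def)
  qed (simp add: z'_def)
  moreover have "(\<lambda>n. of_nat n * (z' n - 1)) \<longlonglongrightarrow> a"
    by (rule Lim_transform_eventually[OF lim]) (auto simp: z'_def intro!: eventually_mono[OF eventually_ge_at_top[of 1]])
  moreover have "Re a \<le> 0" unfolding a_def using pos by (simp add: sum_nonneg)
  ultimately have "(\<lambda>n. z' n ^ n) \<longlonglongrightarrow> exp a" by (rule complex_power_tendsto_exp)
  hence "(\<lambda>n. z n ^ n) \<longlonglongrightarrow> exp a"
    by (rule Lim_transform_eventually) (auto simp: z'_def intro!: eventually_mono[OF eventually_ge_at_top[of 1]])
  thus ?thesis by (simp add: z_def h_def a_def)
qed

subsection \<open>Cells and cell probabilities\<close>

locale partition =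
  fixes m :: nat and x :: "nat \<Rightarrow> ereal"
  assumes m2: "2 < m" and x0: "x 0 = 0" and xm: "x m = \<infinity>" and x_mono: "strict_mono_on {0..m} x"
begin

text \<open>At the infinite boundary, index m, this is the default value 0; formulas that use it
  treat j = m separately.\<close>

definition xr :: "nat \<Rightarrow> real" where "xr j = real_of_ereal (x j)"

lemma x_less: "i < j \<Longrightarrow> j \<le> m \<Longrightarrow> x i < x j"
  using x_mono by (auto simp: strict_mono_on_def)

lemma x_finite: "j < m \<Longrightarrow> x j = ereal (xr j)" "j < m \<Longrightarrow> 0 \<le> xr j"
proof -
  assume j: "j < m"
  have "0 \<le> x j" using x_less[of 0 j] x0 j by (cases "j = 0") auto
  moreover have "x j < \<infinity>" using x_less[of j m] xm j by auto
  ultimately show "x j = ereal (xr j)" "0 \<le> xr j" unfolding xr_def by (cases "x j"; simp)+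
qed

lemma xr_less: "i < j \<Longrightarrow> j < m \<Longrightarrow> xr i < xr j"
  using x_less[of i j] x_finite(1)[of i] x_finite(1)[of j] by simp

lemma xr_0: "xr 0 = 0" by (simp add: xr_def x0)

lemma telescope: "(\<Sum>j = 1..m. f j - f (j - 1)) = f m - f 0" for f :: "nat \<Rightarrow> real"
proof -
  have "(\<Sum>j = 1..k. f j - f (j - 1)) = f k - f 0" for k by (induction k) auto
  thus ?thesis .
qed

text \<open>The level is an extended real so that the unbounded cells are handled like the others:
  at the two infinities the indicator is constant and no residual can cross it.\<close>

definition le_ind :: "ereal \<Rightarrow> real \<Rightarrow> real" where "le_ind y u = of_bool (ereal u \<le> y)"

lemma le_ind_simps [simp]: "le_ind (ereal r) u = of_bool (u \<le> r)" "le_ind \<infinity> u = 1" "le_ind (- \<infinity>) u = 0"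
  by (auto simp: le_ind_def)

text \<open>The boundaries are nonnegative and both halves are open on the left, so the two halves
  are disjoint and the indicator of the union is the sum.\<close>

lemma cell_indicator:
  assumes j: "j \<in> {1..m}"
  shows "indicator (sym_cell x j) u = (le_ind (x j) u - le_ind (x (j - 1)) u) + (le_ind (- x (j - 1)) u - le_ind (- x j) u)"
proof -
  have "x (j - 1) < x j" using j by (intro x_less) auto
  moreover have "0 \<le> x (j - 1)" using x_finite[of "j - 1"] j by auto
  moreover have f: "x (j - 1) = ereal (xr (j - 1))" using x_finite[of "j - 1"] j by auto
  ultimately show ?thesis
    unfolding sym_cell_def le_ind_def f by (cases "x j") (auto simp: indicator_def)
qed

lemma cell_borel [measurable]: "sym_cell x j \<in> sets borel"
  unfolding sym_cell_def by measurable

lemma cells_partition: "(\<Sum>j = 1..m. indicator (sym_cell x j) u) = (1 :: real)"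
proof -
  have "(\<Sum>j = 1..m. indicator (sym_cell x j) u) = (\<Sum>j = 1..m. (le_ind (x j) u - le_ind (x (j - 1)) u) - (le_ind (- x j) u - le_ind (- x (j - 1)) u))"
    by (intro sum.cong refl) (simp add: cell_indicator)
  also have "\<dots> = (le_ind (x m) u - le_ind (x 0) u) - (le_ind (- x m) u - le_ind (- x 0) u)"
    using telescope[of "\<lambda>j. le_ind (x j) u"] telescope[of "\<lambda>j. le_ind (- x j) u"] by (simp only: sum_subtractf)
  also have "\<dots> = 1" by (simp add: x0 xm)
  finally show ?thesis .
qed

lemma value_at_finite: "j < m \<Longrightarrow> value_at F (x j) = F (xr j)"
  using x_finite(1)[of j] by (simp add: value_at_def)

lemma value_at_m: "(F \<longlongrightarrow> l) at_top \<Longrightarrow> value_at F (x m) = l"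
  by (simp add: value_at_def xm tendsto_Lim)

lemma cell_increment_eq:
  assumes "(F \<longlongrightarrow> l) at_top" "j \<in> {1..m}"
  shows "cell_increment F x j = 2 * ((if j = m then l else F (xr j)) - F (xr (j - 1)))"
proof -
  have "value_at F (x (j - 1)) = F (xr (j - 1))" using assms(2) by (intro value_at_finite) auto
  moreover have "value_at F (x j) = (if j = m then l else F (xr j))"
    using assms value_at_m[OF assms(1)] value_at_finite[of j F] by auto
  ultimately show ?thesis by (simp add: cell_increment_def)
qed

lemma cell_increment_sum:
  assumes "(F \<longlongrightarrow> l) at_top"
  shows "(\<Sum>j = 1..m. cell_increment F x j) = 2 * (l - F 0)"
proof -
  have "(\<Sum>j = 1..m. cell_increment F x j) = (\<Sum>j = 1..m. 2 * value_at F (x j) - 2 * value_at F (x (j - 1)))"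
    by (simp add: cell_increment_def right_diff_distrib)
  also have "\<dots> = 2 * value_at F (x m) - 2 * value_at F (x 0)" by (rule telescope)
  also have "\<dots> = 2 * (l - F 0)" using value_at_m[OF assms] value_at_finite[of 0 F] m2 by (simp add: xr_0)
  finally show ?thesis .
qed

text \<open>The mirrored half is again open on the left, so the symmetry in the form cdf(-s) = 1 -
  cdf(s) gives it exactly the mass of the positive half; possible atoms need no separate treatment.
  The factor 2 in \<open>cell_increment\<close> is these two halves.\<close>

lemma measure_cell:
  assumes A: "real_distribution A" and sym: "\<And>s. cdf A (- s) = 1 - cdf A s" and j: "j \<in> {1..m}"
  shows "measure A (sym_cell x j) = cell_increment (cdf A) x j"
proof -
  interpret A: real_distribution A by fact
  have le: "integrable A (le_ind y)" "(\<integral>u. le_ind y u \<partial>A) = (if y = \<infinity> then 1 else if y = - \<infinity> then 0 else cdf A (real_of_ereal y))" for y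
  proof -
    have [measurable]: "le_ind y \<in> borel_measurable borel" unfolding le_ind_def of_bool_def by measurable
    show "integrable A (le_ind y)" by (rule A.integrable_bounded[where B = 1]) (auto simp: le_ind_def)
    have "(\<integral>u. (of_bool (u \<le> r) :: real) \<partial>A) = cdf A r" for r
    proof -
      have "(\<integral>u. (of_bool (u \<le> r) :: real) \<partial>A) = (\<integral>u. indicator {..r} u \<partial>A)"
        by (intro Bochner_Integration.integral_cong refl) (simp add: indicator_def)
      thus ?thesis by (simp add: cdf_def)
    qed
    thus "(\<integral>u. le_ind y u \<partial>A) = (if y = \<infinity> then 1 else if y = - \<infinity> then 0 else cdf A (real_of_ereal y))"
      using A.prob_space by (cases y) auto
  qed
  have xj: "x (j - 1) = ereal (xr (j - 1))" using j by (intro x_finite) auto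
  have "measure A (sym_cell x j) = (\<integral>u. indicator (sym_cell x j) u \<partial>A)" by simp
  also have "\<dots> = (\<integral>u. (le_ind (x j) u - le_ind (x (j - 1)) u) + (le_ind (- x (j - 1)) u - le_ind (- x j) u) \<partial>A)"
    by (simp only: cell_indicator[OF j])
  also have "\<dots> = ((\<integral>u. le_ind (x j) u \<partial>A) - (\<integral>u. le_ind (x (j - 1)) u \<partial>A)) + ((\<integral>u. le_ind (- x (j - 1)) u \<partial>A) - (\<integral>u. le_ind (- x j) u \<partial>A))"
    using le(1) by (simp only: Bochner_Integration.integral_add Bochner_Integration.integral_diff Bochner_Integration.integrable_diff)
  also have "\<dots> = cell_increment (cdf A) x j"
  proof (cases "j = m")
    case True
    thus ?thesis unfolding le(2) cell_increment_eq[OF A.cdf_lim_at_top_prob j] xj using sym[of "xr (j - 1)"] by (simp add: xm)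
  next
    case False
    hence "x j = ereal (xr j)" using j by (intro x_finite) auto
    thus ?thesis unfolding le(2) cell_increment_eq[OF A.cdf_lim_at_top_prob j] xj using False sym[of "xr (j - 1)"] sym[of "xr j"]
      by simp
  qed
  finally show ?thesis .
qed

definition Acdf :: "nat \<Rightarrow> real \<Rightarrow> real" where "Acdf j \<theta> = (if j = m then 1 else Phi (xr j / \<theta>))"

definition Ader :: "nat \<Rightarrow> real \<Rightarrow> real" where
  "Ader j \<theta> = (if j = m then 0 else - (std_normal_density (xr j / \<theta>) * (xr j / \<theta>\<^sup>2)))"

lemma Phi_scaled_limit: "0 < \<theta> \<Longrightarrow> ((\<lambda>u. Phi (u / \<theta>)) \<longlongrightarrow> 1) at_top"
  by (rule filterlim_compose[OF Phi_at_top], rule filterlim_tendsto_pos_mult_at_top[OF tendsto_const _ filterlim_ident, of "1 / \<theta>", simplified])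

lemma cell_prob_eq: "0 < \<theta> \<Longrightarrow> j \<in> {1..m} \<Longrightarrow> cell_prob x j \<theta> = 2 * (Acdf j \<theta> - Acdf (j - 1) \<theta>)"
  unfolding cell_prob_def by (subst cell_increment_eq[OF Phi_scaled_limit]) (auto simp: Acdf_def)

lemma cell_prob_sum: "0 < \<theta> \<Longrightarrow> (\<Sum>j = 1..m. cell_prob x j \<theta>) = 1"
  unfolding cell_prob_def by (subst cell_increment_sum[OF Phi_scaled_limit]) (auto simp: Phi_0)

lemma cell_prob_pos: "0 < \<theta> \<Longrightarrow> j \<in> {1..m} \<Longrightarrow> 0 < cell_prob x j \<theta>"
proof -
  assume \<theta>: "0 < \<theta>" and j: "j \<in> {1..m}"
  have "Phi (xr (j - 1) / \<theta>) < Acdf j \<theta>"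
  proof (cases "j = m")
    case True
    have "Phi (xr (j - 1) / \<theta>) < Phi (xr (j - 1) / \<theta> + 1)" by (rule Phi_strict_mono) simp
    thus ?thesis using Phi_bounds(2)[of "xr (j - 1) / \<theta> + 1"] True by (simp add: Acdf_def)
  next
    case False
    hence "xr (j - 1) < xr j" using j by (intro xr_less) auto
    thus ?thesis using False \<theta> by (auto simp: Acdf_def intro!: Phi_strict_mono divide_strict_right_mono)
  qed
  thus ?thesis using j by (auto simp: cell_prob_eq[OF \<theta> j] Acdf_def)
qed

lemma cell_prob_has_derivative:
  assumes \<theta>: "0 < \<theta>" and j: "j \<in> {1..m}"
  shows "(cell_prob x j has_real_derivative 2 * (Ader j \<theta> - Ader (j - 1) \<theta>)) (at \<theta>)"
proof -
  have A: "(Acdf i has_real_derivative Ader i \<theta>) (at \<theta>)" for i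
    unfolding Acdf_def[abs_def] Ader_def using \<theta>
    by (cases "i = m") (auto intro!: derivative_eq_intros simp: power2_eq_square)
  have "((\<lambda>\<theta>. 2 * (Acdf j \<theta> - Acdf (j - 1) \<theta>)) has_real_derivative 2 * (Ader j \<theta> - Ader (j - 1) \<theta>)) (at \<theta>)"
    by (intro derivative_intros A DERIV_cmult)
  moreover have "\<forall>\<^sub>F t in nhds \<theta>. 0 < t" using eventually_nhds_in_open[of "{0<..}" \<theta>] \<theta> by auto
  hence "\<forall>\<^sub>F t in nhds \<theta>. 2 * (Acdf j t - Acdf (j - 1) t) = cell_prob x j t"
    by eventually_elim (simp add: cell_prob_eq[OF _ j])
  ultimately show ?thesis by (subst (asm) DERIV_cong_ev[OF refl _ refl]) auto
qed

lemma deriv_cell_prob: "0 < \<theta> \<Longrightarrow> j \<in> {1..m} \<Longrightarrow> deriv (cell_prob x j) \<theta> = 2 * (Ader j \<theta> - Ader (j - 1) \<theta>)"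
  by (rule DERIV_imp_deriv[OF cell_prob_has_derivative])

lemma deriv_cell_prob_isCont:
  assumes \<theta>: "0 < \<theta>" and j: "j \<in> {1..m}"
  shows "isCont (deriv (cell_prob x j)) \<theta>"
proof -
  have A: "isCont (Ader i) \<theta>" for i
    unfolding Ader_def[abs_def] normal_density_def using \<theta>
    by (cases "i = m") (auto intro!: continuous_intros)
  have "isCont (\<lambda>\<theta>. 2 * (Ader j \<theta> - Ader (j - 1) \<theta>)) \<theta>" by (intro continuous_intros A)
  moreover have "\<forall>\<^sub>F t in nhds \<theta>. 0 < t" using eventually_nhds_in_open[of "{0<..}" \<theta>] \<theta> by auto
  hence "\<forall>\<^sub>F t in nhds \<theta>. 2 * (Ader j t - Ader (j - 1) t) = deriv (cell_prob x j) t"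
    by eventually_elim (simp add: deriv_cell_prob[OF _ j])
  ultimately show ?thesis by (subst (asm) isCont_cong) auto
qed

lemma deriv_cell_prob_sum:
  assumes "0 < \<theta>"
  shows "(\<Sum>j = 1..m. deriv (cell_prob x j) \<theta>) = 0"
proof -
  have "(\<Sum>j = 1..m. deriv (cell_prob x j) \<theta>) = (\<Sum>j = 1..m. 2 * Ader j \<theta> - 2 * Ader (j - 1) \<theta>)"
    by (intro sum.cong refl) (simp add: deriv_cell_prob[OF assms] right_diff_distrib)
  also have "\<dots> = 2 * Ader m \<theta> - 2 * Ader 0 \<theta>" by (rule telescope)
  also have "\<dots> = 0" by (simp add: Ader_def xr_0)
  finally show ?thesis .
qed

text \<open>One nonvanishing component of the score suffices to make its norm positive, so that the
  score direction is a unit vector. In the first cell the inner boundary is 0 and contributes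
  nothing, so nothing can cancel.\<close>

lemma deriv_cell_prob_1_neq_0:
  assumes "0 < \<theta>"
  shows "deriv (cell_prob x 1) \<theta> \<noteq> 0"
proof -
  have "0 < xr 1" using xr_less[of 0 1] m2 by (simp add: xr_0)
  moreover have "0 < std_normal_density (xr 1 / \<theta>)" by (rule normal_density_pos) simp
  ultimately show ?thesis using m2 assms by (simp add: deriv_cell_prob[OF assms] Ader_def xr_0)
qed

text \<open>Outside the event where it solves its equation the estimated scale may take any real
  value, so measurability is needed on the whole line. The limit at infinity is therefore computed
  for each sign of the scale, with 0 as a separate case.\<close>

lemma cell_prob_measurable [measurable]: "cell_prob x j \<in> borel_measurable borel"
proof -
  have L: "Lim at_top (\<lambda>u. Phi (u / \<theta>)) = (if 0 < \<theta> then 1 else if \<theta> = 0 then Phi 0 else 0)" for \<theta>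
  proof -
    have "((\<lambda>u. Phi (u / \<theta>)) \<longlongrightarrow> 0) at_top" if "\<theta> < 0"
    proof -
      have "filterlim (\<lambda>u. u / \<theta>) at_bot at_top"
        using filterlim_tendsto_neg_mult_at_bot[OF tendsto_const _ filterlim_ident, of "1 / \<theta>"] that by simp
      from filterlim_compose[OF Phi_at_bot this] show ?thesis .
    qed
    thus ?thesis using Phi_scaled_limit[of \<theta>] by (auto intro!: tendsto_Lim)
  qed
  have "(\<lambda>\<theta>. value_at (\<lambda>u. Phi (u / \<theta>)) y) \<in> borel_measurable borel" for y
    by (cases "y = \<infinity>") (simp_all add: value_at_def L)
  thus ?thesis unfolding cell_prob_def[abs_def] cell_increment_def by measurable
qed

end

subsection \<open>The Pearson statistic at an estimated scale\<close>

locale scaled_partition = partition m x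
  for m :: nat and x :: "nat \<Rightarrow> ereal" +
  fixes \<theta>\<^sub>0 :: real
  assumes theta0: "0 < \<theta>\<^sub>0"
begin

definition p0 :: "nat \<Rightarrow> real" where "p0 j = cell_prob x j \<theta>\<^sub>0"
definition dp :: "nat \<Rightarrow> real" where "dp j = deriv (cell_prob x j) \<theta>\<^sub>0"
text \<open>The squared norm of the score vector b_0, which is also the Fisher information for the
  scale in one grouped observation.\<close>

definition Bv :: real where "Bv = (\<Sum>j = 1..m. (dp j)\<^sup>2 / p0 j)"

lemma p0_pos: "j \<in> {1..m} \<Longrightarrow> 0 < p0 j" using cell_prob_pos[OF theta0] by (simp add: p0_def)

lemma Bv_pos: "0 < Bv"
proof -
  have "0 < (dp 1)\<^sup>2 / p0 1" using deriv_cell_prob_1_neq_0[OF theta0] p0_pos[of 1] m2 by (simp add: dp_def)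
  also have "\<dots> \<le> Bv" unfolding Bv_def
    by (rule member_le_sum) (use m2 p0_pos in \<open>auto intro!: divide_nonneg_pos\<close>)
  finally show ?thesis .
qed

end

locale pearson_seq = prob_seq M + scaled_partition m x \<theta>\<^sub>0
  for M :: "nat \<Rightarrow> 'a measure" and m :: nat and x :: "nat \<Rightarrow> ereal" and \<theta>\<^sub>0 :: real +
  fixes \<theta> :: "nat \<Rightarrow> 'a \<Rightarrow> real" and c :: "nat \<Rightarrow> 'a \<Rightarrow> nat \<Rightarrow> nat"
  assumes solves: "whp (\<lambda>n \<omega>. solves_scale_equation x m (c n \<omega>) (\<theta> n \<omega>))"
    and root_n: "OP (\<lambda>n \<omega>. sqrt (real n) * (\<theta> n \<omega> - \<theta>\<^sub>0))"
    and total: "\<And>n \<omega>. 1 \<le> n \<Longrightarrow> (\<Sum>j = 1..m. real (c n \<omega> j)) = real n"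
    and tight: "\<And>j. j \<in> {1..m} \<Longrightarrow> OP (\<lambda>n \<omega>. (real (c n \<omega> j) - real n * cell_prob x j \<theta>\<^sub>0) / sqrt (real n))"
begin

definition qv :: "nat \<Rightarrow> nat \<Rightarrow> 'a \<Rightarrow> real" where "qv j n \<omega> = (real (c n \<omega> j) - real n * p0 j) / sqrt (real n)"
definition Dv :: "nat \<Rightarrow> 'a \<Rightarrow> real" where "Dv n \<omega> = sqrt (real n) * (\<theta> n \<omega> - \<theta>\<^sub>0)"

lemma theta_consistent: "oP (\<lambda>n \<omega>. \<theta> n \<omega> - \<theta>\<^sub>0)"
proof -
  have "(\<lambda>n. 1 / sqrt (real n)) \<longlonglongrightarrow> 0"
    by (rule real_tendsto_divide_at_top[OF tendsto_const filterlim_compose[OF sqrt_at_top filterlim_real_sequentially]])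
  from oP_OP_mult[OF oP_const[OF this] root_n]
  show ?thesis
    by (rule oP_mono) (intro whp_all eventually_mono[OF eventually_ge_at_top[of 1]] ballI, simp)
qed

text \<open>Linearization of the estimating equation: it determines the normalized scale error up to
  oP(1) as a linear function of the count deviations, which is then inserted into the statistic.
  Caratheodory slopes make the first-order expansion of the cell probabilities exact, so no
  remainder has to be carried along.\<close>

lemma pearson_expansion_aux:
  "oP (\<lambda>n \<omega>. pearson_statistic x m n (c n \<omega>) (\<theta> n \<omega>)
     - (\<Sum>j = 1..m. (qv j n \<omega> - dp j * ((\<Sum>i = 1..m. qv i n \<omega> * (dp i / p0 i)) / Bv))\<^sup>2 / p0 j))"
proof -
  define psi where "psi j t = deriv (cell_prob x j) t / cell_prob x j t" for j and t :: real
  \<comment> \<open>Differentiability in Caratheodory form: the difference quotient extends to a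
    function that is continuous at the true scale, where it equals the derivative.\<close>
  have "\<exists>s. \<forall>j\<in>{1..m}. (\<forall>t. cell_prob x j t - p0 j = s j t * (t - \<theta>\<^sub>0)) \<and> isCont (s j) \<theta>\<^sub>0 \<and> s j \<theta>\<^sub>0 = dp j"
  proof -
    have "\<exists>s. (\<forall>t. cell_prob x j t - p0 j = s t * (t - \<theta>\<^sub>0)) \<and> isCont s \<theta>\<^sub>0 \<and> s \<theta>\<^sub>0 = dp j" if "j \<in> {1..m}" for j
      using cell_prob_has_derivative[OF theta0 that] unfolding CARAT_DERIV p0_def dp_def deriv_cell_prob[OF theta0 that] .
    thus ?thesis by metis
  qed
  then obtain s where s: "\<And>j t. j \<in> {1..m} \<Longrightarrow> cell_prob x j t - p0 j = s j t * (t - \<theta>\<^sub>0)"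
    "\<And>j. j \<in> {1..m} \<Longrightarrow> isCont (s j) \<theta>\<^sub>0" "\<And>j. j \<in> {1..m} \<Longrightarrow> s j \<theta>\<^sub>0 = dp j" by blast
  define qt where "qt j n \<omega> = qv j n \<omega> - s j (\<theta> n \<omega>) * Dv n \<omega>" for j n \<omega>
  define qs where "qs j n \<omega> = qv j n \<omega> - dp j * ((\<Sum>i = 1..m. qv i n \<omega> * (dp i / p0 i)) / Bv)" for j n \<omega>
  have D: "OP Dv" using root_n unfolding Dv_def .
  have Q: "OP (qv j)" if "j \<in> {1..m}" for j using tight[OF that] unfolding qv_def p0_def .
  have S: "oP (\<lambda>n \<omega>. s j (\<theta> n \<omega>) - dp j)" if "j \<in> {1..m}" for j
    using oP_isCont[OF theta_consistent s(2)[OF that]] s(3)[OF that] by simp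
  have cP: "isCont (cell_prob x j) \<theta>\<^sub>0" if "j \<in> {1..m}" for j
    using cell_prob_has_derivative[OF theta0 that] by (rule DERIV_isCont)
  have ne: "cell_prob x j \<theta>\<^sub>0 \<noteq> 0" if "j \<in> {1..m}" for j using p0_pos[OF that] by (simp add: p0_def)
  have Psi: "oP (\<lambda>n \<omega>. psi j (\<theta> n \<omega>) - dp j / p0 j)" if "j \<in> {1..m}" for j
  proof -
    have "isCont (psi j) \<theta>\<^sub>0" unfolding psi_def
      by (intro continuous_intros deriv_cell_prob_isCont[OF theta0 that] cP that ne)
    from oP_isCont[OF theta_consistent this] show ?thesis by (simp add: psi_def dp_def p0_def)
  qed
  have Inv: "oP (\<lambda>n \<omega>. 1 / cell_prob x j (\<theta> n \<omega>) - 1 / p0 j)" if "j \<in> {1..m}" for j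
  proof -
    have "isCont (\<lambda>t. 1 / cell_prob x j t) \<theta>\<^sub>0" by (intro continuous_intros cP that ne)
    from oP_isCont[OF theta_consistent this] show ?thesis by (simp add: p0_def)
  qed
  have SD: "oP (\<lambda>n \<omega>. (s j (\<theta> n \<omega>) - dp j) * Dv n \<omega>)" if "j \<in> {1..m}" for j by (rule oP_OP_mult[OF S[OF that] D])
  have QT: "OP (qt j)" if "j \<in> {1..m}" for j
  proof -
    have "OP (\<lambda>n \<omega>. qv j n \<omega> + ((-1) * ((s j (\<theta> n \<omega>) - dp j) * Dv n \<omega>) + (- dp j) * Dv n \<omega>))"
      by (intro OP_add Q that OP_mult[OF OP_const] oP_imp_OP[OF SD] D)
    thus ?thesis unfolding qt_def by (simp add: algebra_simps)
  qed
  have qt_eq: "sqrt (real n) * qt j n \<omega> = real (c n \<omega> j) - real n * cell_prob x j (\<theta> n \<omega>)"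
    if n: "1 \<le> n" and j: "j \<in> {1..m}" for n j \<omega>
  proof -
    let ?r = "sqrt (real n)" and ?t = "\<theta> n \<omega>"
    have r: "?r \<noteq> 0" "?r * ?r = real n" using n by auto
    have "?r * qv j n \<omega> = real (c n \<omega> j) - real n * p0 j" using r(1) by (simp add: qv_def)
    moreover have "?r * (s j ?t * Dv n \<omega>) = (?r * ?r) * (s j ?t * (?t - \<theta>\<^sub>0))" by (simp add: Dv_def)
    hence "?r * (s j ?t * Dv n \<omega>) = real n * (cell_prob x j ?t - p0 j)" using s(1)[OF j, of ?t] r(2) by simp
    ultimately show ?thesis by (simp add: qt_def right_diff_distrib)
  qed
  have score: "whp (\<lambda>n \<omega>. (\<Sum>j = 1..m. qt j n \<omega> * psi j (\<theta> n \<omega>)) = 0)"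
  proof (rule whp_mono[OF solves], intro eventually_mono[OF eventually_ge_at_top[of 1]] ballI impI)
    fix n :: nat and \<omega> assume n: "1 \<le> n" and sol: "solves_scale_equation x m (c n \<omega>) (\<theta> n \<omega>)"
    let ?t = "\<theta> n \<omega>" and ?r = "sqrt (real n)"
    have t: "0 < ?t" and eq: "(\<Sum>j = 1..m. real (c n \<omega> j) / cell_prob x j ?t * deriv (cell_prob x j) ?t) = 0"
      using sol by (auto simp: solves_scale_equation_def)
    have r: "0 < ?r" "?r * ?r = real n" using n by auto
    \<comment> \<open>Centring the counts at the fitted expectations changes the estimating equation
      by n times the sum of the derivatives, which is 0 because the cell probabilities add up to
      1.\<close>
    have "?r * (\<Sum>j = 1..m. qt j n \<omega> * psi j ?t) = (\<Sum>j = 1..m. real (c n \<omega> j) / cell_prob x j ?t * deriv (cell_prob x j) ?t - real n * deriv (cell_prob x j) ?t)"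
      unfolding sum_distrib_left
    proof (rule sum.cong[OF refl])
      fix j assume j: "j \<in> {1..m}"
      have P: "cell_prob x j ?t \<noteq> 0" using cell_prob_pos[OF t j] by simp
      have "?r * qt j n \<omega> = real (c n \<omega> j) - real n * cell_prob x j ?t" by (rule qt_eq[OF n j])
      hence "?r * (qt j n \<omega> * psi j ?t) = (real (c n \<omega> j) - real n * cell_prob x j ?t) * psi j ?t"
        by (simp add: mult.assoc[symmetric])
      thus "?r * (qt j n \<omega> * psi j ?t) = real (c n \<omega> j) / cell_prob x j ?t * deriv (cell_prob x j) ?t - real n * deriv (cell_prob x j) ?t"
        using P by (simp add: psi_def field_simps)
    qed
    also have "\<dots> = 0" using eq deriv_cell_prob_sum[OF t] by (simp add: sum_subtractf sum_distrib_left[symmetric])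
    finally show "(\<Sum>j = 1..m. qt j n \<omega> * psi j ?t) = 0" using r(1) by simp
  qed
  have "oP (\<lambda>n \<omega>. (\<Sum>j = 1..m. (psi j (\<theta> n \<omega>) - dp j / p0 j) * qt j n \<omega>))"
    by (intro oP_sum oP_OP_mult Psi QT) auto
  moreover have "oP (\<lambda>n \<omega>. \<Sum>j = 1..m. (dp j / p0 j) * ((s j (\<theta> n \<omega>) - dp j) * Dv n \<omega>))"
    by (intro oP_sum oP_cmult SD) auto
  ultimately have "oP (\<lambda>n \<omega>. (\<Sum>j = 1..m. (psi j (\<theta> n \<omega>) - dp j / p0 j) * qt j n \<omega>) - (\<Sum>j = 1..m. (dp j / p0 j) * ((s j (\<theta> n \<omega>) - dp j) * Dv n \<omega>)))"
    by (rule oP_diff)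
  hence "oP (\<lambda>n \<omega>. (1 / Bv) * ((\<Sum>j = 1..m. (psi j (\<theta> n \<omega>) - dp j / p0 j) * qt j n \<omega>) - (\<Sum>j = 1..m. (dp j / p0 j) * ((s j (\<theta> n \<omega>) - dp j) * Dv n \<omega>))))"
    by (rule oP_cmult)
  \<comment> \<open>In the score equation the random weights and slopes are replaced by their values
    at the true scale. What is left is Bv times the scale error minus the weighted count deviations,
    so the scale error is obtained by dividing by Bv.\<close>
  hence Dexp: "oP (\<lambda>n \<omega>. Dv n \<omega> - (\<Sum>i = 1..m. qv i n \<omega> * (dp i / p0 i)) / Bv)"
  proof (rule oP_mono, intro whp_mono[OF score] always_eventually allI ballI impI)
    fix n \<omega> assume z: "(\<Sum>j = 1..m. qt j n \<omega> * psi j (\<theta> n \<omega>)) = 0"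
    have "(\<Sum>j = 1..m. (psi j (\<theta> n \<omega>) - dp j / p0 j) * qt j n \<omega>) - (\<Sum>j = 1..m. (dp j / p0 j) * ((s j (\<theta> n \<omega>) - dp j) * Dv n \<omega>))
        = (\<Sum>j = 1..m. qt j n \<omega> * psi j (\<theta> n \<omega>)) + (\<Sum>j = 1..m. (dp j)\<^sup>2 / p0 j * Dv n \<omega> - qv j n \<omega> * (dp j / p0 j))"
      unfolding sum_subtractf[symmetric] sum.distrib[symmetric]
      by (intro sum.cong refl) (simp add: qt_def algebra_simps power2_eq_square)
    also have "\<dots> = Bv * Dv n \<omega> - (\<Sum>i = 1..m. qv i n \<omega> * (dp i / p0 i))"
      unfolding z by (simp add: Bv_def sum_subtractf sum_distrib_right)
    finally show "\<bar>Dv n \<omega> - (\<Sum>i = 1..m. qv i n \<omega> * (dp i / p0 i)) / Bv\<bar>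
      \<le> \<bar>(1 / Bv) * ((\<Sum>j = 1..m. (psi j (\<theta> n \<omega>) - dp j / p0 j) * qt j n \<omega>) - (\<Sum>j = 1..m. (dp j / p0 j) * ((s j (\<theta> n \<omega>) - dp j) * Dv n \<omega>)))\<bar>"
      using Bv_pos by (simp add: diff_divide_distrib)
  qed
  have QS: "OP (qs j)" if "j \<in> {1..m}" for j
  proof -
    have "OP (\<lambda>n \<omega>. qv j n \<omega> + (- dp j / Bv) * (\<Sum>i = 1..m. (dp i / p0 i) * qv i n \<omega>))"
      by (intro OP_add Q that OP_mult[OF OP_const] OP_sum) auto
    thus ?thesis unfolding qs_def by (simp add: mult.commute)
  qed
  have diff: "oP (\<lambda>n \<omega>. qt j n \<omega> - qs j n \<omega>)" if "j \<in> {1..m}" for j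
  proof -
    have "oP (\<lambda>n \<omega>. (-1) * ((s j (\<theta> n \<omega>) - dp j) * Dv n \<omega>) + (- dp j) * (Dv n \<omega> - (\<Sum>i = 1..m. qv i n \<omega> * (dp i / p0 i)) / Bv))"
      by (intro oP_add oP_cmult SD Dexp that)
    thus ?thesis unfolding qt_def qs_def by (simp add: algebra_simps)
  qed
  \<comment> \<open>The difference of two squares, one factor of which is oP(1), plus the effect of
    replacing the estimated denominator by the true one.\<close>
  have "oP (\<lambda>n \<omega>. \<Sum>j = 1..m. (1 / p0 j) * ((qt j n \<omega> - qs j n \<omega>) * (qt j n \<omega> + qs j n \<omega>)) + (1 / cell_prob x j (\<theta> n \<omega>) - 1 / p0 j) * (qt j n \<omega> * qt j n \<omega>))"
    by (intro oP_sum oP_add oP_cmult oP_OP_mult diff OP_add QT QS Inv OP_mult) auto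
  thus ?thesis
  proof (rule oP_mono, intro whp_all eventually_mono[OF eventually_ge_at_top[of 1]] ballI)
    fix n :: nat and \<omega> assume n: "1 \<le> n"
    let ?t = "\<theta> n \<omega>" and ?r = "sqrt (real n)"
    have r: "0 < ?r" "?r * ?r = real n" using n by auto
    have summand: "(real (c n \<omega> j) - real n * cell_prob x j ?t)\<^sup>2 / (real n * cell_prob x j ?t) = qt j n \<omega> * qt j n \<omega> / cell_prob x j ?t"
      if j: "j \<in> {1..m}" for j
    proof -
      have "real (c n \<omega> j) - real n * cell_prob x j ?t = ?r * qt j n \<omega>" by (rule qt_eq[OF n j, symmetric])
      hence "(real (c n \<omega> j) - real n * cell_prob x j ?t)\<^sup>2 = real n * (qt j n \<omega> * qt j n \<omega>)"
        using n by (simp add: power_mult_distrib power2_eq_square)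
      thus ?thesis using n by simp
    qed
    have "pearson_statistic x m n (c n \<omega>) ?t = (\<Sum>j = 1..m. qt j n \<omega> * qt j n \<omega> / cell_prob x j ?t)"
      unfolding pearson_statistic_def by (intro sum.cong refl summand)
    hence "pearson_statistic x m n (c n \<omega>) ?t - (\<Sum>j = 1..m. (qs j n \<omega>)\<^sup>2 / p0 j)
        = (\<Sum>j = 1..m. (1 / p0 j) * ((qt j n \<omega> - qs j n \<omega>) * (qt j n \<omega> + qs j n \<omega>)) + (1 / cell_prob x j ?t - 1 / p0 j) * (qt j n \<omega> * qt j n \<omega>))"
      by (simp only: sum_subtractf[symmetric]) (intro sum.cong refl, simp add: algebra_simps power2_eq_square add_divide_distrib diff_divide_distrib)
    thus "\<bar>pearson_statistic x m n (c n \<omega>) (\<theta> n \<omega>)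
       - (\<Sum>j = 1..m. (qv j n \<omega> - dp j * ((\<Sum>i = 1..m. qv i n \<omega> * (dp i / p0 i)) / Bv))\<^sup>2 / p0 j)\<bar>
      \<le> \<bar>\<Sum>j = 1..m. (1 / p0 j) * ((qt j n \<omega> - qs j n \<omega>) * (qt j n \<omega> + qs j n \<omega>)) + (1 / cell_prob x j (\<theta> n \<omega>) - 1 / p0 j) * (qt j n \<omega> * qt j n \<omega>)\<bar>"
      unfolding qs_def by simp
  qed
qed

text \<open>Estimating the scale removes the direction of the score, and the counts add up to \<open>n\<close>: in an
  orthonormal basis starting with \<open>sqrt p0\<close> and the score direction, only the other coordinates
  remain.\<close>

lemma pearson_expansion:
  assumes e: "orthonormal {1..m} e m" and e0: "\<And>j. j \<in> {1..m} \<Longrightarrow> e 0 j = sqrt (p0 j)"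
    and e1: "\<And>j. j \<in> {1..m} \<Longrightarrow> e 1 j = dp j / sqrt (p0 j) / sqrt Bv"
  shows "oP (\<lambda>n \<omega>. pearson_statistic x m n (c n \<omega>) (\<theta> n \<omega>)
     - (\<Sum>k<m - 2. (\<Sum>j = 1..m. e (k + 2) j / sqrt (p0 j) * qv j n \<omega>)\<^sup>2))"
proof (rule oP_mono[OF pearson_expansion_aux], intro whp_all eventually_mono[OF eventually_ge_at_top[of 1]] ballI)
  fix n :: nat and \<omega> assume n: "1 \<le> n"
  let ?I = "{1..m}"
  define y where "y j = qv j n \<omega> / sqrt (p0 j)" for j
  have sp: "sqrt (p0 j) * sqrt (p0 j) = p0 j" "sqrt (p0 j) \<noteq> 0" if "j \<in> ?I" for j using p0_pos[OF that] by auto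
  have sB: "sqrt Bv * sqrt Bv = Bv" "sqrt Bv \<noteq> 0" using Bv_pos by auto
  define a where "a = dotp ?I (e 1) y"
  have a: "(\<Sum>i = 1..m. qv i n \<omega> * (dp i / p0 i)) = sqrt Bv * a"
    unfolding a_def dotp_def sum_distrib_left y_def
  proof (rule sum.cong[OF refl])
    fix j assume j: "j \<in> ?I"
    have "sqrt Bv * (dp j / sqrt (p0 j) / sqrt Bv * (qv j n \<omega> / sqrt (p0 j))) = qv j n \<omega> * (dp j / (sqrt (p0 j) * sqrt (p0 j)))"
      using sB(2) by (simp add: mult.commute del: real_sqrt_mult_self)
    thus "qv j n \<omega> * (dp j / p0 j) = sqrt Bv * (e 1 j * (qv j n \<omega> / sqrt (p0 j)))"
      unfolding e1[OF j] sp(1)[OF j] by simp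
  qed
  have "(\<Sum>j = 1..m. (qv j n \<omega> - dp j * ((\<Sum>i = 1..m. qv i n \<omega> * (dp i / p0 i)) / Bv))\<^sup>2 / p0 j) = (\<Sum>j = 1..m. (y j - a * e 1 j)\<^sup>2)"
  proof (rule sum.cong[OF refl])
    fix j assume j: "j \<in> ?I"
    have "sqrt Bv * a / Bv = a / sqrt Bv" using sB by (metis mult_divide_mult_cancel_left)
    hence "y j - a * e 1 j = (qv j n \<omega> - dp j * (sqrt Bv * a / Bv)) / sqrt (p0 j)"
      unfolding y_def e1[OF j] by (simp add: diff_divide_distrib mult.commute)
    hence "(y j - a * e 1 j)\<^sup>2 = (qv j n \<omega> - dp j * (sqrt Bv * a / Bv))\<^sup>2 / p0 j"
      using p0_pos[OF j] by (simp add: power_divide)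
    thus "(qv j n \<omega> - dp j * ((\<Sum>i = 1..m. qv i n \<omega> * (dp i / p0 i)) / Bv))\<^sup>2 / p0 j = (y j - a * e 1 j)\<^sup>2"
      unfolding a by simp
  qed
  also have "\<dots> = dotp ?I y y - 2 * a * dotp ?I (e 1) y + a * a * dotp ?I (e 1) (e 1)"
    by (simp add: dotp_def power2_eq_square algebra_simps sum.distrib sum_subtractf sum_distrib_left)
  also have "dotp ?I (e 1) (e 1) = 1" using e m2 by (simp add: orthonormal_def)
  also have "dotp ?I y y - 2 * a * dotp ?I (e 1) y + a * a * 1 = dotp ?I y y - a * a" by (simp add: a_def)
  also have "dotp ?I y y = (\<Sum>k<m. (dotp ?I (e k) y)\<^sup>2)" using orthonormal_Parseval[of ?I e y] e by simp
  also have "\<dots> = (dotp ?I (e 0) y)\<^sup>2 + (dotp ?I (e 1) y)\<^sup>2 + (\<Sum>k<m - 2. (dotp ?I (e (k + 2)) y)\<^sup>2)"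
  proof -
    obtain k where k: "m = Suc (Suc k)" using m2 by (metis less_imp_Suc_add add_2_eq_Suc)
    show ?thesis unfolding k by (simp add: sum.lessThan_Suc_shift del: sum.lessThan_Suc)
  qed
  \<comment> \<open>The coordinate along sqrt p0 is the normalized total count minus n, which is 0:
    one degree of freedom is lost to the total and one to the scale.\<close>
  also have "dotp ?I (e 0) y = 0"
  proof -
    have "dotp ?I (e 0) y = (\<Sum>j = 1..m. qv j n \<omega>)"
      unfolding dotp_def y_def using sp by (intro sum.cong refl) (simp add: e0)
    also have "\<dots> = ((\<Sum>j = 1..m. real (c n \<omega> j)) - real n * (\<Sum>j = 1..m. p0 j)) / sqrt (real n)"
      unfolding qv_def sum_divide_distrib[symmetric] by (simp add: sum_subtractf sum_distrib_left)
    also have "\<dots> = 0" using total[OF n, of \<omega>] cell_prob_sum[OF theta0] by (simp add: p0_def)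
    finally show ?thesis .
  qed
  finally have "(\<Sum>j = 1..m. (qv j n \<omega> - dp j * ((\<Sum>i = 1..m. qv i n \<omega> * (dp i / p0 i)) / Bv))\<^sup>2 / p0 j)
      = (\<Sum>k<m - 2. (dotp ?I (e (k + 2)) y)\<^sup>2)" by (simp add: a_def power2_eq_square)
  also have "\<dots> = (\<Sum>k<m - 2. (\<Sum>j = 1..m. e (k + 2) j / sqrt (p0 j) * qv j n \<omega>)\<^sup>2)"
    by (simp add: dotp_def y_def)
  finally show "\<bar>pearson_statistic x m n (c n \<omega>) (\<theta> n \<omega>) - (\<Sum>k<m - 2. (\<Sum>j = 1..m. e (k + 2) j / sqrt (p0 j) * qv j n \<omega>)\<^sup>2)\<bar>
    \<le> \<bar>pearson_statistic x m n (c n \<omega>) (\<theta> n \<omega>)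
     - (\<Sum>j = 1..m. (qv j n \<omega> - dp j * ((\<Sum>i = 1..m. qv i n \<omega> * (dp i / p0 i)) / Bv))\<^sup>2 / p0 j)\<bar>" by simp
qed

end

declare One_nat_def [simp del]

subsection \<open>The shift caused by the outliers\<close>

lemma outlier_term:
  assumes Q: "real_distribution Q"
  shows "\<bar>(\<integral>s. Phi ((u + b * s) / \<theta>) \<partial>Q) - Phi (u / \<theta>)\<bar> \<le> 1"
proof -
  interpret Q: real_distribution Q by fact
  have i: "integrable Q (\<lambda>s. Phi ((u + b * s) / \<theta>))"
    by (rule Q.integrable_bounded[where B = 1]) (use Phi_bounds in auto)
  have "0 \<le> (\<integral>s. Phi ((u + b * s) / \<theta>) \<partial>Q)" by (intro integral_nonneg_AE AE_I2 Phi_bounds)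
  moreover have "(\<integral>s. Phi ((u + b * s) / \<theta>) \<partial>Q) \<le> 1"
    using integral_mono[OF i, of "\<lambda>_. 1"] Phi_bounds Q.prob_space by simp
  ultimately show ?thesis using Phi_bounds[of "u / \<theta>"] by (simp add: abs_le_iff)
qed

text \<open>Each of the p + 1 terms is a difference of two numbers in [0, 1]. That the bound does
  not depend on the outlier law makes the supremum in the robustness bound finite.\<close>

lemma Delta_S_bound:
  assumes "real_distribution Q"
  shows "\<bar>Delta_S p \<beta> \<theta> Q u\<bar> \<le> real p + 1"
proof -
  have D: "\<bar>Delta_0 p \<beta> \<theta> Q u\<bar> \<le> real p + 1" for u
  proof -
    have "\<bar>Delta_0 p \<beta> \<theta> Q u\<bar> \<le> (\<Sum>j = 0..p. 1)"
      unfolding Delta_0_def by (rule order_trans[OF sum_abs sum_mono]) (rule outlier_term[OF assms])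
    thus ?thesis by simp
  qed
  show ?thesis using D[of u] D[of "- u"] by (simp add: Delta_S_def abs_le_iff)
qed

text \<open>At either end of the line a shifted and averaged \<open>Phi\<close> has the same limit
  as \<open>Phi\<close> itself, so each term cancels. This fixes the value at the infinite boundary
  of the last cell.\<close>

lemma Delta_S_at_top:
  assumes Q: "real_distribution Q" and \<theta>: "0 < \<theta>"
  shows "(Delta_S p \<beta> \<theta> Q \<longlongrightarrow> 0) at_top"
proof -
  interpret Q: real_distribution Q by fact
  have lin: "filterlim (\<lambda>u. (u + c) / \<theta>) at_top at_top" for c
    using \<theta> by real_asymp
  have lin': "filterlim (\<lambda>u. (c - u) / \<theta>) at_bot at_top" for c
    using \<theta> by real_asymp
  have 1: "((\<lambda>u. (\<integral>s. Phi ((u + b * s) / \<theta>) \<partial>Q)) \<longlongrightarrow> (\<integral>s. 1 \<partial>Q)) at_top" for b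
    by (rule integral_dominated_convergence_at_top[where w = "\<lambda>_. 1"])
       (use Phi_bounds in \<open>auto intro!: filterlim_compose[OF Phi_at_top lin]\<close>)
  have 2: "((\<lambda>u. (\<integral>s. Phi ((b * s - u) / \<theta>) \<partial>Q)) \<longlongrightarrow> (\<integral>s. 0 \<partial>Q)) at_top" for b
    by (rule integral_dominated_convergence_at_top[where w = "\<lambda>_. 1"])
       (use Phi_bounds in \<open>auto intro!: filterlim_compose[OF Phi_at_bot lin']\<close>)
  have "((\<lambda>u. Delta_0 p \<beta> \<theta> Q u) \<longlongrightarrow> (\<Sum>j = 0..p. (\<integral>s. 1 \<partial>Q) - 1)) at_top"
    unfolding Delta_0_def
    by (intro tendsto_sum tendsto_diff 1) (use filterlim_compose[OF Phi_at_top lin[of 0]] in simp)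
  moreover have "((\<lambda>u. Delta_0 p \<beta> \<theta> Q (- u)) \<longlongrightarrow> (\<Sum>j = 0..p. (\<integral>s. 0 \<partial>Q) - 0)) at_top"
    unfolding Delta_0_def uminus_add_conv_diff
    by (intro tendsto_sum tendsto_diff 2) (use filterlim_compose[OF Phi_at_bot lin'[of 0]] in simp)
  ultimately have "((\<lambda>u. (Delta_0 p \<beta> \<theta> Q u - Delta_0 p \<beta> \<theta> Q (- u)) / 2) \<longlongrightarrow> (0 - 0) / 2) at_top"
    using Q.prob_space by (intro tendsto_divide tendsto_diff tendsto_const) simp_all
  thus ?thesis by (simp add: Delta_S_def[abs_def])
qed

context scaled_partition
begin

text \<open>The shift telescopes between 0, where the odd function \<open>Delta_S\<close> vanishes,
  and infinity, where its limit is 0. Hence it has no component in the direction belonging to the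
  total count.\<close>

lemma outlier_shift_sum: "real_distribution Q \<Longrightarrow> (\<Sum>j = 1..m. outlier_shift p \<beta> \<theta>\<^sub>0 x Q j) = 0"
  unfolding outlier_shift_def by (subst cell_increment_sum[OF Delta_S_at_top[OF _ theta0]]) (auto simp: Delta_S_def)

lemma outlier_shift_bound:
  assumes Q: "real_distribution Q" and j: "j \<in> {1..m}"
  shows "\<bar>outlier_shift p \<beta> \<theta>\<^sub>0 x Q j\<bar> \<le> 4 * (real p + 1)"
  using Delta_S_bound[OF Q, of p \<beta> \<theta>\<^sub>0 "xr j"] Delta_S_bound[OF Q, of p \<beta> \<theta>\<^sub>0 "xr (j - 1)"]
  unfolding outlier_shift_def cell_increment_eq[OF Delta_S_at_top[OF Q theta0] j] by (auto simp: abs_le_iff)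

lemma alternative_shift_sum:
  assumes H: "real_distribution H" and sym: "\<And>s. cdf H (- s) = 1 - cdf H s"
  shows "(\<Sum>j = 1..m. cell_increment (cdf H) x j - cell_prob x j \<theta>\<^sub>0) = 0"
proof -
  interpret H: real_distribution H by fact
  have "cdf H 0 = 1 / 2" using sym[of 0] by simp
  thus ?thesis using cell_increment_sum[OF H.cdf_lim_at_top_prob] cell_prob_sum[OF theta0] by (simp add: sum_subtractf)
qed

subsection \<open>The noncentrality parameter\<close>

lemma score_direction_eq: "score_direction x m \<theta>\<^sub>0 j = dp j / sqrt (p0 j) / sqrt Bv"
proof -
  have "(\<Sum>j = 1..m. (dp j / sqrt (p0 j))\<^sup>2) = Bv"
    unfolding Bv_def by (intro sum.cong refl) (use p0_pos in \<open>simp add: power_divide less_imp_le\<close>)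
  thus ?thesis by (simp add: score_direction_def Let_def L2_set_def dp_def[symmetric] p0_def[symmetric])
qed

text \<open>These are the relations that allow sqrt p0 and the score direction to start an
  orthonormal basis; their orthogonality is the vanishing of the derivative of the total
  probability.\<close>

lemma dotp_score: "dotp {1..m} (score_direction x m \<theta>\<^sub>0) (score_direction x m \<theta>\<^sub>0) = 1"
  and dotp_sqrt: "dotp {1..m} (\<lambda>j. sqrt (p0 j)) (\<lambda>j. sqrt (p0 j)) = 1"
  and dotp_sqrt_score: "dotp {1..m} (\<lambda>j. sqrt (p0 j)) (score_direction x m \<theta>\<^sub>0) = 0"
proof -
  have sB: "sqrt Bv * sqrt Bv = Bv" "Bv \<noteq> 0" "sqrt Bv \<noteq> 0" using Bv_pos by auto
  have sp: "sqrt (p0 j) * sqrt (p0 j) = p0 j" "sqrt (p0 j) \<noteq> 0" if "j \<in> {1..m}" for j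
    using p0_pos[OF that] by auto
  have "dotp {1..m} (score_direction x m \<theta>\<^sub>0) (score_direction x m \<theta>\<^sub>0) = (\<Sum>j = 1..m. (dp j)\<^sup>2 / p0 j / Bv)"
    unfolding dotp_def score_direction_eq
  proof (rule sum.cong[OF refl])
    fix j assume j: "j \<in> {1..m}"
    have "dp j / sqrt (p0 j) / sqrt Bv * (dp j / sqrt (p0 j) / sqrt Bv) = dp j * dp j / (sqrt (p0 j) * sqrt (p0 j)) / (sqrt Bv * sqrt Bv)"
      by (simp del: real_sqrt_mult_self)
    thus "dp j / sqrt (p0 j) / sqrt Bv * (dp j / sqrt (p0 j) / sqrt Bv) = (dp j)\<^sup>2 / p0 j / Bv"
      unfolding sp(1)[OF j] sB(1) power2_eq_square .
  qed
  also have "\<dots> = Bv / Bv" unfolding sum_divide_distrib[symmetric] Bv_def[symmetric] ..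
  also have "\<dots> = 1" using sB by simp
  finally show "dotp {1..m} (score_direction x m \<theta>\<^sub>0) (score_direction x m \<theta>\<^sub>0) = 1" .
  have "dotp {1..m} (\<lambda>j. sqrt (p0 j)) (\<lambda>j. sqrt (p0 j)) = (\<Sum>j = 1..m. p0 j)"
    unfolding dotp_def by (intro sum.cong refl sp)
  thus "dotp {1..m} (\<lambda>j. sqrt (p0 j)) (\<lambda>j. sqrt (p0 j)) = 1" using cell_prob_sum[OF theta0] by (simp add: p0_def)
  have "dotp {1..m} (\<lambda>j. sqrt (p0 j)) (score_direction x m \<theta>\<^sub>0) = (\<Sum>j = 1..m. dp j / sqrt Bv)"
    unfolding dotp_def score_direction_eq by (intro sum.cong refl) (use sp in simp)
  also have "\<dots> = 0" using deriv_cell_prob_sum[OF theta0] by (simp add: sum_divide_distrib[symmetric] dp_def)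
  finally show "dotp {1..m} (\<lambda>j. sqrt (p0 j)) (score_direction x m \<theta>\<^sub>0) = 0" .
qed

definition proj :: "(nat \<Rightarrow> real) \<Rightarrow> nat \<Rightarrow> real" where
  "proj u i = (\<Sum>j = 1..m. projection_matrix x m \<theta>\<^sub>0 i j * u j)"

lemma proj_eq:
  assumes i: "i \<in> {1..m}"
  shows "proj u i = u i / sqrt (p0 i) - dotp {1..m} (score_direction x m \<theta>\<^sub>0) (\<lambda>j. u j / sqrt (p0 j)) * score_direction x m \<theta>\<^sub>0 i"
proof -
  let ?s = "score_direction x m \<theta>\<^sub>0"
  have "proj u i = (\<Sum>j = 1..m. (if i = j then u j / sqrt (p0 j) else 0) - ?s j * (u j / sqrt (p0 j)) * ?s i)"
    unfolding proj_def projection_matrix_def p0_def[symmetric]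
    by (intro sum.cong refl) (auto simp: diff_divide_distrib algebra_simps)
  also have "\<dots> = (\<Sum>j = 1..m. if i = j then u j / sqrt (p0 j) else 0) - (\<Sum>j = 1..m. ?s j * (u j / sqrt (p0 j)) * ?s i)"
    by (rule sum_subtractf)
  also have "\<dots> = u i / sqrt (p0 i) - dotp {1..m} ?s (\<lambda>j. u j / sqrt (p0 j)) * ?s i"
    using i by (simp add: dotp_def sum_distrib_right)
  finally show ?thesis .
qed

definition frob :: real where
  "frob = L2_set (\<lambda>(i, j). projection_matrix x m \<theta>\<^sub>0 i j) ({1..m} \<times> {1..m})"

text \<open>Cauchy-Schwarz in each row: the Frobenius norm dominates the operator norm.\<close>

lemma L2_proj_le: "L2_set (proj u) {1..m} \<le> frob * L2_set u {1..m}"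
proof -
  let ?A = "projection_matrix x m \<theta>\<^sub>0"
  have "(L2_set (proj u) {1..m})\<^sup>2 = (\<Sum>i = 1..m. (proj u i)\<^sup>2)" by (simp add: L2_set_def sum_nonneg)
  also have "\<dots> \<le> (\<Sum>i = 1..m. (L2_set (?A i) {1..m} * L2_set u {1..m})\<^sup>2)"
  proof (rule sum_mono)
    fix i
    have "\<bar>proj u i\<bar> \<le> (\<Sum>j = 1..m. \<bar>?A i j\<bar> * \<bar>u j\<bar>)"
      unfolding proj_def by (rule order_trans[OF sum_abs]) (simp add: abs_mult)
    also have "\<dots> \<le> L2_set (?A i) {1..m} * L2_set u {1..m}" by (rule L2_set_mult_ineq)
    finally show "(proj u i)\<^sup>2 \<le> (L2_set (?A i) {1..m} * L2_set u {1..m})\<^sup>2"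
      by (metis abs_ge_zero power2_abs power_mono)
  qed
  also have "\<dots> = (\<Sum>i = 1..m. (L2_set (?A i) {1..m})\<^sup>2) * (L2_set u {1..m})\<^sup>2"
    by (simp add: power_mult_distrib sum_distrib_right)
  also have "(\<Sum>i = 1..m. (L2_set (?A i) {1..m})\<^sup>2) = frob\<^sup>2"
    unfolding frob_def L2_set_def by (simp add: sum_nonneg sum.cartesian_product case_prod_unfold)
  finally have "(L2_set (proj u) {1..m})\<^sup>2 \<le> (frob * L2_set u {1..m})\<^sup>2" by (simp add: power_mult_distrib)
  thus ?thesis by (rule power2_le_imp_le) (simp add: frob_def L2_set_nonneg)
qed

lemma L2_proj_diff: "\<bar>L2_set (proj u) {1..m} - L2_set (proj w) {1..m}\<bar> \<le> frob * L2_set (\<lambda>j. u j - w j) {1..m}"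
proof -
  have d: "L2_set (proj u) {1..m} - L2_set (proj w) {1..m} \<le> frob * L2_set (\<lambda>j. u j - w j) {1..m}" for u w
  proof -
    have "proj u i = proj w i + proj (\<lambda>j. u j - w j) i" for i
      unfolding proj_def sum.distrib[symmetric] by (intro sum.cong refl) (simp add: algebra_simps)
    hence "L2_set (proj u) {1..m} = L2_set (\<lambda>i. proj w i + proj (\<lambda>j. u j - w j) i) {1..m}" by (intro L2_set_cong refl)
    also have "\<dots> \<le> L2_set (proj w) {1..m} + L2_set (proj (\<lambda>j. u j - w j)) {1..m}" by (rule L2_set_triangle_ineq)
    also have "\<dots> \<le> L2_set (proj w) {1..m} + frob * L2_set (\<lambda>j. u j - w j) {1..m}" by (simp add: L2_proj_le)
    finally show ?thesis by simp
  qed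
  have "L2_set (\<lambda>j. w j - u j) {1..m} = L2_set (\<lambda>j. u j - w j) {1..m}"
    by (simp add: L2_set_def power2_commute)
  thus ?thesis using d[of u w] d[of w u] by (simp add: abs_le_iff)
qed

text \<open>The third basis vector points along the projected mean, so that the noncentrality sits in the
  first of the remaining coordinates.\<close>

lemma adapted_basis:
  assumes u: "(\<Sum>j = 1..m. u j) = 0"
  obtains e where "orthonormal {1..m} e m" "\<And>j. e 0 j = sqrt (p0 j)" "\<And>j. e 1 j = score_direction x m \<theta>\<^sub>0 j"
    "\<And>k. k < m - 2 \<Longrightarrow> (\<Sum>j = 1..m. e (k + 2) j / sqrt (p0 j) * u j) = (if k = 0 then L2_set (proj u) {1..m} else 0)"
proof -
  let ?I = "{1..m}" and ?s = "score_direction x m \<theta>\<^sub>0" and ?l = "L2_set (proj u) {1..m}"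
  define y where "y j = u j / sqrt (p0 j)" for j
  define a where "a = dotp ?I ?s y"
  have P: "proj u i = y i - a * ?s i" if "i \<in> ?I" for i using proj_eq[OF that, of u] by (simp add: y_def[abs_def] a_def)
  have dP: "dotp ?I w (proj u) = dotp ?I w y - a * dotp ?I w ?s" for w
  proof -
    have "dotp ?I w (proj u) = (\<Sum>i = 1..m. w i * y i - a * (w i * ?s i))"
      unfolding dotp_def by (intro sum.cong refl) (simp add: P algebra_simps)
    thus ?thesis by (simp add: dotp_def sum_subtractf sum_distrib_left)
  qed
  have "dotp ?I (\<lambda>j. sqrt (p0 j)) y = (\<Sum>j = 1..m. u j)"
    unfolding dotp_def y_def by (intro sum.cong refl) (use p0_pos in force)
  hence P0: "dotp ?I (\<lambda>j. sqrt (p0 j)) (proj u) = 0" unfolding dP dotp_sqrt_score using u by simp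
  have P1: "dotp ?I ?s (proj u) = 0" unfolding dP dotp_score by (simp add: a_def)
  have PP: "dotp ?I (proj u) (proj u) = ?l * ?l"
    by (simp add: dotp_def L2_set_def sum_nonneg power2_eq_square)
  \<comment> \<open>The third vector is the normalized projected mean; if that mean is 0 it has no
    direction, and only the first two vectors are prescribed.\<close>
  define d where "d k = (if k = 0 then (\<lambda>j. sqrt (p0 j)) else if k = 1 then ?s else (\<lambda>j. proj u j / ?l))" for k :: nat
  have dl: "dotp ?I w (\<lambda>j. proj u j / ?l) = dotp ?I w (proj u) / ?l" "dotp ?I (\<lambda>j. proj u j / ?l) w = dotp ?I (proj u) w / ?l" for w
    by (simp_all add: dotp_def sum_divide_distrib)
  have sw: "dotp ?I (proj u) w = dotp ?I w (proj u)" "dotp ?I ?s (\<lambda>j. sqrt (p0 j)) = 0" for w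
    by (rule dotp_commute, subst dotp_commute, rule dotp_sqrt_score)
  have orth: "orthonormal ?I d (if ?l = 0 then 2 else 3)"
    unfolding orthonormal_def
  proof (intro allI impI)
    fix k l :: nat assume kl: "k < (if ?l = 0 then 2 else 3)" "l < (if ?l = 0 then 2 else 3)"
    have "k = 0 \<or> k = 1 \<or> (k = 2 \<and> ?l \<noteq> 0)" "l = 0 \<or> l = 1 \<or> (l = 2 \<and> ?l \<noteq> 0)"
      using kl by (auto split: if_splits)
    thus "dotp ?I (d k) (d l) = (if k = l then 1 else 0)"
      unfolding d_def
      by (elim disjE) (simp_all add: dl sw(1)[of "\<lambda>j. sqrt (p0 j)"] sw(1)[of ?s] sw(2) P0 P1 PP dotp_score dotp_sqrt dotp_sqrt_score)
  qed
  have le: "(if ?l = 0 then 2 else 3) \<le> card ?I" using m2 by simp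
  obtain e where e: "orthonormal ?I e m" "\<forall>k<(if ?l = 0 then 2 else 3). e k = d k"
    using orthonormal_complete[OF _ le orth] by auto
  have e01: "e 0 = (\<lambda>j. sqrt (p0 j))" "e 1 = ?s" using e(2) by (auto simp: d_def)
  have "(\<Sum>j = 1..m. e (k + 2) j / sqrt (p0 j) * u j) = (if k = 0 then ?l else 0)" if k: "k < m - 2" for k
  proof -
    have "k + 2 < m" "1 < m" using k by auto
    hence "dotp ?I (e (k + 2)) ?s = 0" using e(1) unfolding orthonormal_def e01(2)[symmetric] by auto
    \<comment> \<open>Orthogonality to the score lets the mean be replaced by its projection, which
      is a multiple of the third basis vector.\<close>
    hence "dotp ?I (e (k + 2)) y = dotp ?I (e (k + 2)) (proj u)" unfolding dP by simp
    also have "\<dots> = (if k = 0 then ?l else 0)"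
    proof (cases "?l = 0")
      case True
      hence "proj u j = 0" if "j \<in> ?I" for j using that by (simp add: L2_set_eq_0_iff)
      thus ?thesis using True by (simp add: dotp_def)
    next
      case False
      hence e2: "e 2 = (\<lambda>j. proj u j / ?l)" using e(2) by (simp add: d_def)
      have "dotp ?I (e (k + 2)) (e 2) = (if k = 0 then 1 else 0)"
        using e(1) \<open>k + 2 < m\<close> unfolding orthonormal_def by auto
      thus ?thesis using False unfolding e2 dl by (auto split: if_splits)
    qed
    finally show ?thesis by (simp add: dotp_def y_def)
  qed
  thus ?thesis using that e(1) e01 by auto
qed

subsection \<open>The asymptotic power\<close>

definition shift :: "nat \<Rightarrow> (nat \<Rightarrow> real) \<Rightarrow> real measure \<Rightarrow> real \<Rightarrow> real \<Rightarrow> real measure \<Rightarrow> nat \<Rightarrow> real" where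
  "shift p \<beta> H \<rho> \<gamma> Q j = \<rho> * (cell_increment (cdf H) x j - cell_prob x j \<theta>\<^sub>0) + \<gamma> * outlier_shift p \<beta> \<theta>\<^sub>0 x Q j"

lemma noncentrality_eq: "noncentrality p \<beta> \<theta>\<^sub>0 x m H \<rho> \<gamma> Q = (L2_set (proj (shift p \<beta> H \<rho> \<gamma> Q)) {1..m})\<^sup>2"
  by (simp add: noncentrality_def proj_def[abs_def] shift_def)

text \<open>The power is Lipschitz in the norm of the projected shift, and that norm is Lipschitz in
  the shift. Formulated for two arbitrary parameter triples, so that it yields both continuity in
  the parameters and robustness.\<close>

lemma asymptotic_power_lipschitz:
  "\<bar>asymptotic_power p \<beta> \<theta>\<^sub>0 x m H \<alpha> \<rho> \<gamma> Q - asymptotic_power p \<beta> \<theta>\<^sub>0 x m H \<alpha> \<rho>' \<gamma>' Q'\<bar>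
    \<le> sqrt (2 / pi) * (frob * L2_set (\<lambda>j. shift p \<beta> H \<rho> \<gamma> Q j - shift p \<beta> H \<rho>' \<gamma>' Q' j) {1..m})"
proof -
  define l l' where "l = L2_set (proj (shift p \<beta> H \<rho> \<gamma> Q)) {1..m}" and "l' = L2_set (proj (shift p \<beta> H \<rho>' \<gamma>' Q')) {1..m}"
  define c where "c = chi_square_quantile (m - 2) (1 - \<alpha>)"
  have "\<bar>cdf (noncentral_chi_square (m - 2) (l\<^sup>2)) c - cdf (noncentral_chi_square (m - 2) (l'\<^sup>2)) c\<bar> \<le> sqrt (2 / pi) * \<bar>l - l'\<bar>"
    by (rule ncc_lipschitz) (use m2 in \<open>auto simp: l_def l'_def L2_set_nonneg\<close>)
  hence "\<bar>asymptotic_power p \<beta> \<theta>\<^sub>0 x m H \<alpha> \<rho> \<gamma> Q - asymptotic_power p \<beta> \<theta>\<^sub>0 x m H \<alpha> \<rho>' \<gamma>' Q'\<bar>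
    \<le> sqrt (2 / pi) * \<bar>L2_set (proj (shift p \<beta> H \<rho> \<gamma> Q)) {1..m} - L2_set (proj (shift p \<beta> H \<rho>' \<gamma>' Q')) {1..m}\<bar>"
    unfolding asymptotic_power_def noncentrality_eq l_def[symmetric] l'_def[symmetric] c_def[symmetric] by linarith
  also have "\<dots> \<le> sqrt (2 / pi) * (frob * L2_set (\<lambda>j. shift p \<beta> H \<rho> \<gamma> Q j - shift p \<beta> H \<rho>' \<gamma>' Q' j) {1..m})"
    by (intro mult_left_mono L2_proj_diff) simp
  finally show ?thesis .
qed

lemma asymptotic_power_tendsto:
  assumes "rho \<longlonglongrightarrow> \<rho>" "gam \<longlonglongrightarrow> \<gamma>"
  shows "(\<lambda>n. asymptotic_power p \<beta> \<theta>\<^sub>0 x m H \<alpha> (rho n) (gam n) Q) \<longlonglongrightarrow> asymptotic_power p \<beta> \<theta>\<^sub>0 x m H \<alpha> \<rho> \<gamma> Q"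
proof -
  have "(\<lambda>n. sqrt (2 / pi) * (frob * L2_set (\<lambda>j. shift p \<beta> H (rho n) (gam n) Q j - shift p \<beta> H \<rho> \<gamma> Q j) {1..m})) \<longlonglongrightarrow>
     sqrt (2 / pi) * (frob * L2_set (\<lambda>j. shift p \<beta> H \<rho> \<gamma> Q j - shift p \<beta> H \<rho> \<gamma> Q j) {1..m})"
    unfolding L2_set_def shift_def by (intro tendsto_intros assms)
  hence "(\<lambda>n. sqrt (2 / pi) * (frob * L2_set (\<lambda>j. shift p \<beta> H (rho n) (gam n) Q j - shift p \<beta> H \<rho> \<gamma> Q j) {1..m})) \<longlonglongrightarrow> 0"
    by (simp add: L2_set_def)
  hence "(\<lambda>n. asymptotic_power p \<beta> \<theta>\<^sub>0 x m H \<alpha> (rho n) (gam n) Q - asymptotic_power p \<beta> \<theta>\<^sub>0 x m H \<alpha> \<rho> \<gamma> Q) \<longlonglongrightarrow> 0"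
    by (rule Lim_null_comparison[rotated]) (intro always_eventually allI, unfold real_norm_def, rule asymptotic_power_lipschitz)
  thus ?thesis by (simp add: LIM_zero_iff)
qed

lemma asymptotic_power_null:
  assumes "0 < \<alpha>" "\<alpha> < 1"
  shows "asymptotic_power p \<beta> \<theta>\<^sub>0 x m H \<alpha> 0 0 Q = \<alpha>"
proof -
  have "noncentrality p \<beta> \<theta>\<^sub>0 x m H 0 0 Q = 0" by (simp add: noncentrality_def L2_set_def)
  thus ?thesis using chi_square_quantile_cdf[of "m - 2" "1 - \<alpha>"] assms m2 by (simp add: asymptotic_power_def)
qed

definition max_shift :: "nat \<Rightarrow> (nat \<Rightarrow> real) \<Rightarrow> ereal" where
  "max_shift p \<beta> = (SUP Q \<in> {Q. real_distribution Q}. ereal (L2_set (outlier_shift p \<beta> \<theta>\<^sub>0 x Q) {1..m}))"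

lemma robustness_bound_eq:
  "robustness_bound p \<beta> \<theta>\<^sub>0 x m \<gamma> = ereal (\<gamma> * sqrt (2 / pi) * frob) * max_shift p \<beta>"
  by (simp add: robustness_bound_def frob_def max_shift_def)

text \<open>The contributions of the alternative are the same in both powers and cancel in the
  difference of the shifts, so the estimate is uniform in \<rho> although \<rho> is
  unbounded.\<close>

lemma robustness:
  assumes \<gamma>: "0 \<le> \<gamma>"
  shows "(SUP (Q, \<rho>) \<in> {Q. real_distribution Q} \<times> {0..}.
      ereal \<bar>asymptotic_power p \<beta> \<theta>\<^sub>0 x m H \<alpha> \<rho> \<gamma> Q - asymptotic_power p \<beta> \<theta>\<^sub>0 x m H \<alpha> \<rho> 0 Q\<bar>)
    \<le> robustness_bound p \<beta> \<theta>\<^sub>0 x m \<gamma>"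
proof (rule SUP_least, clarify)
  fix Q :: "real measure" and \<rho> :: real assume Q: "real_distribution Q"
  have f: "0 \<le> frob" by (simp add: frob_def L2_set_nonneg)
  have "L2_set (\<lambda>j. shift p \<beta> H \<rho> \<gamma> Q j - shift p \<beta> H \<rho> 0 Q j) {1..m} = \<gamma> * L2_set (outlier_shift p \<beta> \<theta>\<^sub>0 x Q) {1..m}"
    using \<gamma> by (simp add: shift_def L2_set_right_distrib)
  with asymptotic_power_lipschitz[of p \<beta> H \<alpha> \<rho> \<gamma> Q \<rho> 0 Q]
  have "\<bar>asymptotic_power p \<beta> \<theta>\<^sub>0 x m H \<alpha> \<rho> \<gamma> Q - asymptotic_power p \<beta> \<theta>\<^sub>0 x m H \<alpha> \<rho> 0 Q\<bar>
    \<le> (\<gamma> * sqrt (2 / pi) * frob) * L2_set (outlier_shift p \<beta> \<theta>\<^sub>0 x Q) {1..m}"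
    by (simp add: mult_ac)
  hence "ereal \<bar>asymptotic_power p \<beta> \<theta>\<^sub>0 x m H \<alpha> \<rho> \<gamma> Q - asymptotic_power p \<beta> \<theta>\<^sub>0 x m H \<alpha> \<rho> 0 Q\<bar>
    \<le> ereal (\<gamma> * sqrt (2 / pi) * frob) * ereal (L2_set (outlier_shift p \<beta> \<theta>\<^sub>0 x Q) {1..m})" by simp
  also have "\<dots> \<le> ereal (\<gamma> * sqrt (2 / pi) * frob) * max_shift p \<beta>"
    unfolding max_shift_def using \<gamma> f Q by (intro ereal_mult_left_mono SUP_upper) auto
  finally show "ereal \<bar>asymptotic_power p \<beta> \<theta>\<^sub>0 x m H \<alpha> \<rho> \<gamma> Q - asymptotic_power p \<beta> \<theta>\<^sub>0 x m H \<alpha> \<rho> 0 Q\<bar>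
    \<le> robustness_bound p \<beta> \<theta>\<^sub>0 x m \<gamma>" by (simp add: robustness_bound_eq)
qed

text \<open>In the extended reals the product tends to 0 only once the supremum is known to be
  finite: the uniform bound on the shifts excludes infinity, and the value at one particular law
  excludes minus infinity.\<close>

lemma robustness_bound_tendsto: "(robustness_bound p \<beta> \<theta>\<^sub>0 x m \<longlongrightarrow> 0) (at_right 0)"
proof -
  have "max_shift p \<beta> \<le> ereal (\<Sum>j = 1..m. 4 * (real p + 1))"
    unfolding max_shift_def
  proof (rule SUP_least)
    fix Q :: "real measure" assume "Q \<in> {Q. real_distribution Q}"
    hence "L2_set (outlier_shift p \<beta> \<theta>\<^sub>0 x Q) {1..m} \<le> (\<Sum>j = 1..m. 4 * (real p + 1))"
      by (intro order_trans[OF L2_set_le_sum_abs] sum_mono outlier_shift_bound) auto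
    thus "ereal (L2_set (outlier_shift p \<beta> \<theta>\<^sub>0 x Q) {1..m}) \<le> ereal (\<Sum>j = 1..m. 4 * (real p + 1))" by simp
  qed
  moreover have "ereal (L2_set (outlier_shift p \<beta> \<theta>\<^sub>0 x std_normal_distribution) {1..m}) \<le> max_shift p \<beta>"
    unfolding max_shift_def by (intro SUP_upper) (simp add: real_dist_normal_dist)
  ultimately obtain r where r: "max_shift p \<beta> = ereal r" by (cases "max_shift p \<beta>") auto
  have "((\<lambda>\<gamma>. \<gamma> * sqrt (2 / pi) * frob * r) \<longlongrightarrow> 0 * sqrt (2 / pi) * frob * r) (at_right 0)"
    by (intro tendsto_intros)
  hence "((\<lambda>\<gamma>. ereal (\<gamma> * sqrt (2 / pi) * frob * r)) \<longlongrightarrow> ereal 0) (at_right 0)" by (intro tendsto_ereal) simp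
  thus ?thesis by (simp add: robustness_bound_eq[abs_def] r zero_ereal_def)
qed

end

subsection \<open>Sums over independent innovations\<close>

context contaminated_ar
begin

lemma observations_measurable:
  "observations p n v z xi \<in> measurable M (\<Pi>\<^sub>M t\<in>{1 - int p..int n}. borel)"
  unfolding observations_def by measurable

lemma eps_compose_indep:
  assumes [measurable]: "h \<in> borel_measurable borel"
  shows "indep_vars (\<lambda>_. borel) (\<lambda>t \<omega>. h (eps t \<omega>)) UNIV"
  by (rule indep_vars_compose2[OF eps_indep]) auto

lemma iid_sum_char:
  fixes h :: "real \<Rightarrow> real"
  assumes [measurable]: "h \<in> borel_measurable borel"
  shows "expectation (\<lambda>\<omega>. iexp (\<Sum>t = 1..int n. h (eps t \<omega>))) = (\<integral>u. iexp (h u) \<partial>distr M borel (eps 1)) ^ n"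
proof -
  have c: "char (distr M borel (\<lambda>\<omega>. h (eps t \<omega>))) 1 = (\<integral>u. iexp (h u) \<partial>distr M borel (eps 1))" for t
  proof -
    have "char (distr M borel (\<lambda>\<omega>. h (eps t \<omega>))) 1 = expectation (\<lambda>\<omega>. iexp (h (eps t \<omega>)))"
      unfolding char_def by (subst integral_distr) auto
    also have "\<dots> = (\<integral>u. iexp (h u) \<partial>distr M borel (eps t))" by (subst integral_distr) auto
    finally show ?thesis unfolding distr_eps[of t 1] .
  qed
  have "expectation (\<lambda>\<omega>. iexp (\<Sum>t = 1..int n. h (eps t \<omega>))) = char (distr M borel (\<lambda>\<omega>. \<Sum>t = 1..int n. h (eps t \<omega>))) 1"
    unfolding char_def by (subst integral_distr) auto
  also have "\<dots> = (\<Prod>t = 1..int n. char (distr M borel (\<lambda>\<omega>. h (eps t \<omega>))) 1)"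
    by (rule char_distr_sum[OF indep_vars_subset[OF eps_compose_indep]]) auto
  also have "\<dots> = (\<integral>u. iexp (h u) \<partial>distr M borel (eps 1)) ^ n" by (simp add: c)
  finally show ?thesis .
qed

lemma iid_sum_square:
  fixes h :: "real \<Rightarrow> real"
  assumes [measurable]: "h \<in> borel_measurable borel" and b: "\<And>u. \<bar>h u\<bar> \<le> 1"
    and mean: "(\<integral>u. h u \<partial>distr M borel (eps 1)) = 0"
  shows "integrable M (\<lambda>\<omega>. (\<Sum>t = 1..int n. h (eps t \<omega>))\<^sup>2)"
    "expectation (\<lambda>\<omega>. (\<Sum>t = 1..int n. h (eps t \<omega>))\<^sup>2) \<le> real n"
proof -
  have i: "integrable M (\<lambda>\<omega>. h (eps t \<omega>))" for t by (rule integrable_bounded[where B = 1]) (use b in auto)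
  have b2: "\<bar>h u * h w\<bar> \<le> 1" for u w using mult_mono[OF b[of u] b[of w]] by (simp add: abs_mult)
  have i2: "integrable M (\<lambda>\<omega>. h (eps s \<omega>) * h (eps t \<omega>))" for s t
    by (rule integrable_bounded[where B = 1]) (use b2 in auto)
  have E0: "expectation (\<lambda>\<omega>. h (eps t \<omega>)) = 0" for t
  proof -
    have "expectation (\<lambda>\<omega>. h (eps t \<omega>)) = (\<integral>u. h u \<partial>distr M borel (eps t))" by (subst integral_distr) auto
    thus ?thesis using mean unfolding distr_eps[of t 1] by simp
  qed
  have E: "expectation (\<lambda>\<omega>. h (eps s \<omega>) * h (eps t \<omega>)) \<le> (if s = t then 1 else 0)" for s t
  proof (cases "s = t")
    case True
    have "expectation (\<lambda>\<omega>. h (eps t \<omega>) * h (eps t \<omega>)) \<le> expectation (\<lambda>\<omega>. 1)"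
      by (rule integral_mono[OF i2]) (use b2 in \<open>auto simp: abs_le_iff\<close>)
    thus ?thesis using True by (simp add: prob_space)
  next
    case False
    thus ?thesis using indep_var_lebesgue_integral[OF indep_var_pair[OF eps_compose_indep False] i i] E0 by simp
  qed
  have S2: "(\<Sum>t = 1..int n. h (eps t \<omega>))\<^sup>2 = (\<Sum>s = 1..int n. \<Sum>t = 1..int n. h (eps s \<omega>) * h (eps t \<omega>))" for \<omega>
    by (simp add: power2_eq_square sum_product)
  show "integrable M (\<lambda>\<omega>. (\<Sum>t = 1..int n. h (eps t \<omega>))\<^sup>2)"
    unfolding S2 by (intro Bochner_Integration.integrable_sum i2)
  have "expectation (\<lambda>\<omega>. (\<Sum>t = 1..int n. h (eps t \<omega>))\<^sup>2) = (\<Sum>s = 1..int n. \<Sum>t = 1..int n. expectation (\<lambda>\<omega>. h (eps s \<omega>) * h (eps t \<omega>)))"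
    unfolding S2 by (simp add: Bochner_Integration.integral_sum i2)
  also have "\<dots> \<le> (\<Sum>s = 1..int n. \<Sum>t = 1..int n. if s = t then 1 else 0)" by (intro sum_mono E)
  also have "\<dots> = real n" by simp
  finally show "expectation (\<lambda>\<omega>. (\<Sum>t = 1..int n. h (eps t \<omega>))\<^sup>2) \<le> real n" .
qed

end

subsection \<open>Residuals and cell counts\<close>

text \<open>An exact identity, without cross terms between the errors: the intercept b 0 combines
  the error of the mean with the estimated coefficients, the outliers are filtered with the true
  coefficients, and the differences of coefficients act on the contaminated regressors.\<close>

lemma (in ar_model) residual_eq:
  assumes t: "t \<in> {1..int n}" and n: "1 \<le> n"
    and y: "\<And>s. s \<in> {1 - int p..int n} \<Longrightarrow> y s = \<mu> + V s \<omega> + z s \<omega> * xi s \<omega>"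
    and rec: "V t \<omega> = (\<Sum>i = 1..p. \<beta> i * V (t - int i) \<omega>) + eps t \<omega>"
    and b0: "b 0 = sqrt (real n) * ((mh - \<mu>) * (1 - (\<Sum>i = 1..p. bh i)))"
    and b: "\<And>i. i \<in> {1..p} \<Longrightarrow> b i = sqrt (real n) * (bh i - \<beta> i)"
  shows "residual p mh bh y t = eps t \<omega> - (outl t \<omega> + pert b 0 t \<omega> / sqrt (real n))"
proof -
  define R where "R s = V s \<omega> + z s \<omega> * xi s \<omega>" for s
  define a where "a = mh - \<mu>"
  have r: "sqrt (real n) \<noteq> 0" using n by simp
  have yR: "y s - mh = R s - a" if "s \<in> {1 - int p..int n}" for s using y[OF that] by (simp add: R_def a_def)
  have split: "(\<Sum>i\<le>p. f i) = f 0 + (\<Sum>i = 1..p. f i)" for f :: "nat \<Rightarrow> real"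
    unfolding atMost_atLeast0 by (subst sum.atLeast_Suc_atMost) (auto simp: One_nat_def)
  have o: "outl t \<omega> = - (z t \<omega> * xi t \<omega>) + (\<Sum>i = 1..p. \<beta> i * (z (t - int i) \<omega> * xi (t - int i) \<omega>))"
    unfolding outl_def split by (simp add: kap_def)
  have "pert b 0 t \<omega> = b 0 + (\<Sum>i = 1..p. sqrt (real n) * (bh i - \<beta> i) * R (t - int i))"
    unfolding pert_def split by (simp add: reg_def b R_def)
  also have "\<dots> = sqrt (real n) * (a * (1 - (\<Sum>i = 1..p. bh i)) + (\<Sum>i = 1..p. (bh i - \<beta> i) * R (t - int i)))"
    unfolding b0 a_def by (simp add: distrib_left sum_distrib_left mult.assoc)
  finally have pe: "pert b 0 t \<omega> / sqrt (real n) = a * (1 - (\<Sum>i = 1..p. bh i)) + (\<Sum>i = 1..p. (bh i - \<beta> i) * R (t - int i))"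
    using r by simp
  have "residual p mh bh y t = (R t - a) - (\<Sum>i = 1..p. bh i * (R (t - int i) - a))"
  proof -
    have "y t - mh = R t - a" "\<And>i. i \<in> {1..p} \<Longrightarrow> y (t - int i) - mh = R (t - int i) - a"
      using t by (auto intro!: yR)
    thus ?thesis by (simp add: residual_def)
  qed
  also have "\<dots> = R t - (\<Sum>i = 1..p. \<beta> i * R (t - int i)) - (a * (1 - (\<Sum>i = 1..p. bh i)) + (\<Sum>i = 1..p. (bh i - \<beta> i) * R (t - int i)))"
  proof -
    have "(\<Sum>i = 1..p. bh i * (R (t - int i) - a)) = (\<Sum>i = 1..p. \<beta> i * R (t - int i) + (bh i - \<beta> i) * R (t - int i) - a * bh i)"
      by (intro sum.cong refl) (simp add: algebra_simps)
    also have "\<dots> = (\<Sum>i = 1..p. \<beta> i * R (t - int i)) + (\<Sum>i = 1..p. (bh i - \<beta> i) * R (t - int i)) - a * (\<Sum>i = 1..p. bh i)"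
      by (simp add: sum.distrib sum_subtractf sum_distrib_left)
    finally show ?thesis by (simp add: right_diff_distrib)
  qed
  also have "R t - (\<Sum>i = 1..p. \<beta> i * R (t - int i)) = eps t \<omega> - outl t \<omega>"
    unfolding o R_def rec by (simp add: distrib_left sum.distrib)
  finally show ?thesis unfolding pe by simp
qed

section \<open>Counting residuals in cells\<close>

context partition
begin

lemma cell_unique:
  obtains i where "i \<in> {1..m}" "\<And>j. j \<in> {1..m} \<Longrightarrow> indicator (sym_cell x j) u = (if j = i then 1 else 0 :: real)"
proof -
  have "\<exists>i\<in>{1..m}. u \<in> sym_cell x i"
  proof (rule ccontr)
    assume "\<not> ?thesis"
    hence "(\<Sum>j = 1..m. indicator (sym_cell x j) u :: real) = 0" by (intro sum.neutral) auto
    thus False using cells_partition[of u] by simp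
  qed
  then obtain i where i: "i \<in> {1..m}" "u \<in> sym_cell x i" by blast
  have "u \<notin> sym_cell x j" if j: "j \<in> {1..m}" "j \<noteq> i" for j
  proof
    assume uj: "u \<in> sym_cell x j"
    have "(\<Sum>k\<in>{i, j}. indicator (sym_cell x k) u) \<le> (\<Sum>k = 1..m. indicator (sym_cell x k) u :: real)"
      by (rule sum_mono2) (use i j in auto)
    thus False using cells_partition[of u] i uj j(2) by simp
  qed
  hence "indicator (sym_cell x j) u = (if j = i then 1 else 0 :: real)" if "j \<in> {1..m}" for j
    using that i by (auto simp: indicator_def)
  thus thesis using that i by blast
qed

lemma cell_count_eq: "real (cell_count x p n mh bh y j) = (\<Sum>t = 1..int n. indicator (sym_cell x j) (residual p mh bh y t))"
proof -
  have "(\<Sum>t = 1..int n. indicator (sym_cell x j) (residual p mh bh y t) :: real)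
    = real (card ({1..int n} \<inter> {t. residual p mh bh y t \<in> sym_cell x j}))"
    by (simp add: indicator_def of_bool_def sum.If_cases)
  moreover have "{t \<in> {1..int n}. residual p mh bh y t \<in> sym_cell x j} = {1..int n} \<inter> {t. residual p mh bh y t \<in> sym_cell x j}"
    by auto
  ultimately show ?thesis unfolding cell_count_def by simp
qed

lemma cell_count_total: "(\<Sum>j = 1..m. real (cell_count x p n mh bh y j)) = real n"
  unfolding cell_count_eq by (subst sum.swap) (simp add: cells_partition)

end

subsection \<open>The statistic along a sequence of local alternatives\<close>

locale estimated_seq = ar_seq M p \<beta> \<nu> \<mu> \<theta>\<^sub>0 H Q eps z xi v rho gam \<rho> \<gamma> LH + scaled_partition m x \<theta>\<^sub>0
  for M :: "nat \<Rightarrow> 'a measure" and p :: nat and \<beta> :: "nat \<Rightarrow> real" and \<nu> \<mu> \<theta>\<^sub>0 :: real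
    and H Q :: "real measure" and eps z xi v :: "nat \<Rightarrow> int \<Rightarrow> 'a \<Rightarrow> real"
    and rho gam :: "nat \<Rightarrow> real" and \<rho> \<gamma> LH :: real and m :: nat and x :: "nat \<Rightarrow> ereal" +
  fixes mu_hat theta_hat :: "nat \<Rightarrow> (int \<Rightarrow> real) \<Rightarrow> real" and beta_hat :: "nat \<Rightarrow> (int \<Rightarrow> real) \<Rightarrow> nat \<Rightarrow> real"
    and Yo :: "nat \<Rightarrow> 'a \<Rightarrow> int \<Rightarrow> real" and Nh :: "nat \<Rightarrow> 'a \<Rightarrow> nat \<Rightarrow> nat"
  assumes Yo: "\<And>n. Yo n = observations p n (v n) (z n) (xi n)"
    and Nh: "\<And>n \<omega>. Nh n \<omega> = cell_count x p n (mu_hat n (Yo n \<omega>)) (beta_hat n (Yo n \<omega>)) (Yo n \<omega>)"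
    and H_symmetric: "\<And>s. cdf H (- s) = 1 - cdf H s"
    and est_measurable:
      "\<And>n. mu_hat n \<in> borel_measurable (\<Pi>\<^sub>M t\<in>{1 - int p..int n}. borel)"
      "\<And>n i. i \<in> {1..p} \<Longrightarrow> (\<lambda>y. beta_hat n y i) \<in> borel_measurable (\<Pi>\<^sub>M t\<in>{1 - int p..int n}. borel)"
      "\<And>n. theta_hat n \<in> borel_measurable (\<Pi>\<^sub>M t\<in>{1 - int p..int n}. borel)"
    and mu_OP: "OP (\<lambda>n \<omega>. sqrt (real n) * (mu_hat n (Yo n \<omega>) - \<mu>))"
    and beta_OP: "\<And>i. i \<in> {1..p} \<Longrightarrow> OP (\<lambda>n \<omega>. sqrt (real n) * (beta_hat n (Yo n \<omega>) i - \<beta> i))"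
    and theta_OP: "OP (\<lambda>n \<omega>. sqrt (real n) * (theta_hat n (Yo n \<omega>) - \<theta>\<^sub>0))"
    and theta_solves: "whp (\<lambda>n \<omega>. solves_scale_equation x m (Nh n \<omega>) (theta_hat n (Yo n \<omega>)))"
begin

definition bb :: "nat \<Rightarrow> 'a \<Rightarrow> nat \<Rightarrow> real" where
  "bb n \<omega> i = (if i = 0 then sqrt (real n) * ((mu_hat n (Yo n \<omega>) - \<mu>) * (1 - (\<Sum>i = 1..p. beta_hat n (Yo n \<omega>) i)))
     else sqrt (real n) * (beta_hat n (Yo n \<omega>) i - \<beta> i))"

definition res :: "nat \<Rightarrow> int \<Rightarrow> 'a \<Rightarrow> real" where
  "res n t \<omega> = residual p (mu_hat n (Yo n \<omega>)) (beta_hat n (Yo n \<omega>)) (Yo n \<omega>) t"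

definition cnt :: "nat \<Rightarrow> nat \<Rightarrow> 'a \<Rightarrow> real" where
  "cnt j n \<omega> = (\<Sum>t = 1..int n. indicator (sym_cell x j) (eps n t \<omega>))"

lemma Nh_eq: "real (Nh n \<omega> j) = (\<Sum>t = 1..int n. indicator (sym_cell x j) (res n t \<omega>))"
  unfolding Nh cell_count_eq res_def ..

lemma bb_OP:
  assumes i: "i \<le> p"
  shows "OP (\<lambda>n \<omega>. bb n \<omega> i)"
proof (cases "i = 0")
  case True
  define d where "d i n \<omega> = sqrt (real n) * (beta_hat n (Yo n \<omega>) i - \<beta> i)" for i n \<omega>
  define e where "e n \<omega> = sqrt (real n) * (mu_hat n (Yo n \<omega>) - \<mu>)" for n \<omega>
  have d: "OP (d i)" if "i \<in> {1..p}" for i using beta_OP[OF that] unfolding d_def .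
  have e: "OP e" using mu_OP unfolding e_def .
  \<comment> \<open>The intercept involves the sum of the estimated coefficients, which differs from
    the true sum by n^(-1/2) times bounded errors and is therefore itself bounded in
    probability.\<close>
  have "OP (\<lambda>n \<omega>. \<Sum>i = 1..p. (1 / sqrt (real n)) * d i n \<omega>)"
    by (rule OP_sum, rule OP_mult[OF OP_convergent[OF inv_sqrt_tendsto] d])
  hence "OP (\<lambda>n \<omega>. e n \<omega> * ((1 - (\<Sum>i = 1..p. \<beta> i)) + (- 1) * (\<Sum>i = 1..p. (1 / sqrt (real n)) * d i n \<omega>)))"
    by (rule OP_mult[OF e OP_add[OF OP_const OP_mult[OF OP_const]]])
  thus ?thesis
  proof (rule OP_mono, intro whp_all eventually_mono[OF eventually_ge_at_top[of 1]] ballI)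
    fix n :: nat and \<omega> assume "1 \<le> n"
    hence "(\<Sum>i = 1..p. (1 / sqrt (real n)) * d i n \<omega>) = (\<Sum>i = 1..p. beta_hat n (Yo n \<omega>) i) - (\<Sum>i = 1..p. \<beta> i)"
      unfolding sum_subtractf[symmetric] by (intro sum.cong refl) (simp add: d_def)
    thus "\<bar>bb n \<omega> i\<bar> \<le> \<bar>e n \<omega> * ((1 - (\<Sum>i = 1..p. \<beta> i)) + (- 1) * (\<Sum>i = 1..p. (1 / sqrt (real n)) * d i n \<omega>))\<bar>"
      using True by (simp add: bb_def e_def mult.assoc)
  qed
next
  case False
  hence "i \<in> {1..p}" using i by auto
  from beta_OP[OF this] show ?thesis using False by (simp add: bb_def)
qed

lemma res_AE:
  assumes n: "1 \<le> n"
  shows "AE \<omega> in M n. \<forall>t\<in>{1..int n}. res n t \<omega> = eps n t \<omega> - (outl n t \<omega> + pert n (bb n \<omega>) 0 t \<omega> / sqrt (real n))"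
proof -
  interpret a: ar_model "M n" p \<beta> \<nu> "Gn n" "gn n" Q "eps n" "z n" "xi n" "v n" \<mu> by (rule model_n[OF n])
  have "AE \<omega> in M n. \<forall>t. v n t \<omega> - \<mu> = a.V t \<omega>" unfolding AE_all_countable by (intro allI a.v_eq_V)
  moreover have "AE \<omega> in M n. \<forall>t. a.V t \<omega> = (\<Sum>i = 1..p. \<beta> i * a.V (t - int i) \<omega>) + eps n t \<omega>"
    unfolding AE_all_countable by (intro allI a.V_recursion)
  ultimately show ?thesis
  proof eventually_elim
    case (elim \<omega>)
    show ?case
    proof
      fix t assume t: "t \<in> {1..int n}"
      show "res n t \<omega> = eps n t \<omega> - (outl n t \<omega> + pert n (bb n \<omega>) 0 t \<omega> / sqrt (real n))"
        unfolding res_def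
      proof (rule a.residual_eq[OF t n])
        fix s assume "s \<in> {1 - int p..int n}"
        thus "Yo n \<omega> s = \<mu> + a.V s \<omega> + z n s \<omega> * xi n s \<omega>"
          using elim(1)[rule_format, of s] by (simp add: Yo observations_def)
      qed (rule elim(2)[rule_format], auto simp: bb_def)
    qed
  qed
qed

definition lev :: "ereal \<Rightarrow> nat \<Rightarrow> 'a \<Rightarrow> real" where
  "lev y n \<omega> = (\<Sum>t = 1..int n. le_ind y (res n t \<omega>) - le_ind y (eps n t \<omega>)) / sqrt (real n)"

text \<open>At an infinite level the indicator of every residual equals that of its innovation, so
  density and outlier term have to be 0 there.\<close>

definition on_finite :: "(real \<Rightarrow> real) \<Rightarrow> ereal \<Rightarrow> real" where
  "on_finite f y = (if \<bar>y\<bar> = \<infinity> then 0 else f (real_of_ereal y))"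

lemma on_finite_simps [simp]: "on_finite f (ereal r) = f r" "on_finite f \<infinity> = 0" "on_finite f (- \<infinity>) = 0"
  by (auto simp: on_finite_def)

lemma level_expansion:
  "oP (\<lambda>n \<omega>. lev y n \<omega> - on_finite f0 y * bb n \<omega> 0 - \<gamma> * on_finite (Delta_0 p \<beta> \<theta>\<^sub>0 Q) y)"
proof (cases y)
  case (real r)
  show ?thesis
  proof (rule oP_mono[OF Dn_estimated[of bb r, OF bb_OP]])
    show "whp (\<lambda>n \<omega>. \<bar>lev y n \<omega> - on_finite f0 y * bb n \<omega> 0 - \<gamma> * on_finite (Delta_0 p \<beta> \<theta>\<^sub>0 Q) y\<bar>
        \<le> \<bar>Dn r n (bb n \<omega>) 0 \<omega> - f0 r * bb n \<omega> 0 - \<gamma> * Delta_0 p \<beta> \<theta>\<^sub>0 Q r\<bar>)"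
    proof (rule whp_AE, rule eventually_mono[OF eventually_ge_at_top[of 1]])
      fix n :: nat assume n: "1 \<le> n"
      interpret a: ar_model "M n" p \<beta> \<nu> "Gn n" "gn n" Q "eps n" "z n" "xi n" "v n" \<mu> by (rule model_n[OF n])
      from res_AE[OF n]
      show "AE \<omega> in M n. \<bar>lev y n \<omega> - on_finite f0 y * bb n \<omega> 0 - \<gamma> * on_finite (Delta_0 p \<beta> \<theta>\<^sub>0 Q) y\<bar>
        \<le> \<bar>Dn r n (bb n \<omega>) 0 \<omega> - f0 r * bb n \<omega> 0 - \<gamma> * Delta_0 p \<beta> \<theta>\<^sub>0 Q r\<bar>"
      proof eventually_elim
        case (elim \<omega>)
        have "lev y n \<omega> = Dn r n (bb n \<omega>) 0 \<omega>"
          unfolding lev_def Dn_def real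
        proof (intro arg_cong2[where f = "(/)"] sum.cong refl)
          fix t assume t: "t \<in> {1..int n}"
          show "le_ind (ereal r) (res n t \<omega>) - le_ind (ereal r) (eps n t \<omega>)
            = jmp r (outl n t \<omega> + pert n (bb n \<omega>) 0 t \<omega> / sqrt (real n)) (eps n t \<omega>)"
            unfolding elim[rule_format, OF t] a.jump_def le_ind_simps by (simp add: diff_le_eq add.assoc)
        qed
        thus ?case by (simp add: real)
      qed
    qed
  qed
qed (simp_all add: lev_def oP_zero)

lemma f0_even: "f0 (- r) = f0 r"
  by (simp add: f0_def normal_density_def)

lemma count_expansion:
  assumes j: "j \<in> {1..m}"
  shows "oP (\<lambda>n \<omega>. (real (Nh n \<omega> j) - cnt j n \<omega>) / sqrt (real n) - \<gamma> * outlier_shift p \<beta> \<theta>\<^sub>0 x Q j)"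
proof -
  define r where "r = xr (j - 1)"
  have r: "x (j - 1) = ereal r" using j by (auto simp: r_def intro!: x_finite)
  let ?D = "on_finite (Delta_0 p \<beta> \<theta>\<^sub>0 Q)"
  let ?e = "\<lambda>y n \<omega>. lev y n \<omega> - on_finite f0 y * bb n \<omega> 0 - \<gamma> * ?D y"
  have even: "on_finite f0 (- y) = on_finite f0 y" for y by (cases y) (simp_all add: f0_even)
  \<comment> \<open>The factor 2 of \<open>cell_increment\<close> cancels the factor 1/2 of
    \<open>Delta_S\<close>, so the four boundary levels of a symmetrized cell reproduce the outlier
    shift exactly.\<close>
  have shift: "outlier_shift p \<beta> \<theta>\<^sub>0 x Q j = (?D (x j) - ?D (x (j - 1))) + (?D (- x (j - 1)) - ?D (- x j))"
  proof (cases "j = m")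
    case True
    thus ?thesis unfolding outlier_shift_def cell_increment_eq[OF Delta_S_at_top[OF Q theta_pos] j] r r_def[symmetric]
      by (simp add: xm Delta_S_def field_simps)
  next
    case False
    hence "x j = ereal (xr j)" using j by (auto intro!: x_finite)
    thus ?thesis unfolding outlier_shift_def cell_increment_eq[OF Delta_S_at_top[OF Q theta_pos] j] r r_def[symmetric]
      using False by (simp add: Delta_S_def field_simps)
  qed
  have "oP (\<lambda>n \<omega>. (?e (x j) n \<omega> - ?e (x (j - 1)) n \<omega>) + (?e (- x (j - 1)) n \<omega> - ?e (- x j) n \<omega>))"
    by (intro oP_add oP_diff level_expansion)
  moreover have "(real (Nh n \<omega> j) - cnt j n \<omega>) / sqrt (real n) - \<gamma> * outlier_shift p \<beta> \<theta>\<^sub>0 x Q j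
      = (?e (x j) n \<omega> - ?e (x (j - 1)) n \<omega>) + (?e (- x (j - 1)) n \<omega> - ?e (- x j) n \<omega>)" for n \<omega>
  proof -
    have "(real (Nh n \<omega> j) - cnt j n \<omega>) / sqrt (real n) = (lev (x j) n \<omega> - lev (x (j - 1)) n \<omega>) + (lev (- x (j - 1)) n \<omega> - lev (- x j) n \<omega>)"
      unfolding lev_def diff_divide_distrib[symmetric] add_divide_distrib[symmetric] Nh_eq cnt_def
        sum_subtractf[symmetric] sum.distrib[symmetric]
      by (intro arg_cong2[where f = "(/)"] sum.cong refl) (simp add: cell_indicator[OF j])
    thus ?thesis unfolding shift even by (simp add: algebra_simps)
  qed
  ultimately show ?thesis by simp
qed

definition hj :: "nat \<Rightarrow> real" where "hj j = cell_increment (cdf H) x j - p0 j"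

definition q0 :: "nat \<Rightarrow> nat \<Rightarrow> 'a \<Rightarrow> real" where "q0 j n \<omega> = (cnt j n \<omega> - real n * p0 j) / sqrt (real n)"

lemma innovation_law:
  assumes n: "1 \<le> n"
  shows "real_distribution (distr (M n) borel (eps n t))" "cdf (distr (M n) borel (eps n t)) = Gn n"
proof -
  interpret a: ar_model "M n" p \<beta> \<nu> "Gn n" "gn n" Q "eps n" "z n" "xi n" "v n" \<mu> by (rule model_n[OF n])
  show "real_distribution (distr (M n) borel (eps n t))" "cdf (distr (M n) borel (eps n t)) = Gn n"
    by (rule a.eps_law, rule a.eps_cdf)
qed

lemma innovation_cell:
  assumes n: "1 \<le> n" and j: "j \<in> {1..m}"
  shows "measure (distr (M n) borel (eps n t)) (sym_cell x j) = p0 j + rn n * hj j"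
proof -
  interpret E: real_distribution "distr (M n) borel (eps n t)" by (rule innovation_law[OF n])
  interpret H: real_distribution H by (rule H)
  have s: "Gn n (- s) = 1 - Gn n s" for s by (simp add: alt_cdf_def H_symmetric Phi_minus algebra_simps)
  have lim: "(Gn n \<longlongrightarrow> 1) at_top" using E.cdf_lim_at_top_prob unfolding innovation_law(2)[OF n] .
  have "measure (distr (M n) borel (eps n t)) (sym_cell x j) = cell_increment (Gn n) x j"
    using measure_cell[OF innovation_law(1)[OF n, of t] _ j] s unfolding innovation_law(2)[OF n] by simp
  also have "\<dots> = p0 j + rn n * hj j"
    unfolding hj_def p0_def cell_prob_def cell_increment_eq[OF lim j] cell_increment_eq[OF H.cdf_lim_at_top_prob j]
      cell_increment_eq[OF Phi_scaled_limit[OF theta_pos] j] alt_cdf_def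
    by (simp add: algebra_simps)
  finally show ?thesis .
qed

text \<open>The counts are first centred at the true cell probabilities, where their normalized
  second moment is at most 1; recentring at the null probabilities adds a convergent deterministic
  term.\<close>

lemma q0_OP:
  assumes j: "j \<in> {1..m}"
  shows "OP (q0 j)"
proof -
  let ?Z = "\<lambda>n \<omega>. (\<Sum>t = 1..int n. indicator (sym_cell x j) (eps n t \<omega>) - (p0 j + rn n * hj j)) / sqrt (real n)"
  have "OP ?Z"
  proof (rule OP_square, rule OP_expectation[where C = 1], rule eventually_mono[OF eventually_ge_at_top[of 1]])
    fix n :: nat assume n: "1 \<le> n"
    interpret a: ar_model "M n" p \<beta> \<nu> "Gn n" "gn n" Q "eps n" "z n" "xi n" "v n" \<mu> by (rule model_n[OF n])
    interpret E: real_distribution "distr (M n) borel (eps n 1)" by (rule innovation_law[OF n])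
    let ?h = "\<lambda>u. indicator (sym_cell x j) u - (p0 j + rn n * hj j) :: real"
    have pr: "0 \<le> p0 j + rn n * hj j" "p0 j + rn n * hj j \<le> 1"
      unfolding innovation_cell[OF n j, of 1, symmetric] by (simp_all add: E.prob_le_1 measure_nonneg)
    have h: "?h \<in> borel_measurable borel" by measurable
    have b: "\<bar>?h u\<bar> \<le> 1" for u using pr by (auto simp: indicator_def)
    have "(\<integral>u. ?h u \<partial>distr (M n) borel (eps n 1)) = measure (distr (M n) borel (eps n 1)) (sym_cell x j) - (p0 j + rn n * hj j)"
    proof -
      have "integrable (distr (M n) borel (eps n 1)) (indicator (sym_cell x j) :: real \<Rightarrow> real)"
        by (rule E.integrable_bounded[where B = 1]) (auto simp: indicator_def)
      thus ?thesis using E.prob_space by (subst Bochner_Integration.integral_diff) auto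
    qed
    hence mean: "(\<integral>u. ?h u \<partial>distr (M n) borel (eps n 1)) = 0" by (simp add: innovation_cell[OF n j])
    note sq = a.iid_sum_square[of ?h n, OF h b mean]
    have "(?Z n \<omega>)\<^sup>2 = (\<Sum>t = 1..int n. ?h (eps n t \<omega>))\<^sup>2 / real n" for \<omega> by (simp add: power_divide)
    thus "integrable (M n) (\<lambda>\<omega>. (?Z n \<omega>)\<^sup>2) \<and> (\<integral>\<omega>. \<bar>(?Z n \<omega>)\<^sup>2\<bar> \<partial>M n) \<le> 1"
      using sq n by (simp add: divide_le_eq)
  qed
  hence "OP (\<lambda>n \<omega>. ?Z n \<omega> + hj j * (sqrt (real n) * rn n))"
    by (intro OP_add OP_mult[OF OP_const] OP_convergent[OF rn_tendsto(1)])
  thus ?thesis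
  proof (rule OP_mono, intro whp_all eventually_mono[OF eventually_ge_at_top[of 1]] ballI)
    fix n :: nat and \<omega> assume n: "1 \<le> n"
    hence "real n / sqrt (real n) = sqrt (real n)" by (simp add: real_div_sqrt)
    moreover have "?Z n \<omega> = (cnt j n \<omega> - real n * p0 j) / sqrt (real n) - real n / sqrt (real n) * (rn n * hj j)"
      by (simp add: cnt_def sum_subtractf diff_divide_distrib add_divide_distrib distrib_left)
    ultimately show "\<bar>q0 j n \<omega>\<bar> \<le> \<bar>?Z n \<omega> + hj j * (sqrt (real n) * rn n)\<bar>" by (simp add: q0_def)
  qed
qed

lemma q0_measurable: "1 \<le> n \<Longrightarrow> q0 j n \<in> borel_measurable (M n)"
proof -
  assume n: "1 \<le> n"
  interpret a: ar_model "M n" p \<beta> \<nu> "Gn n" "gn n" Q "eps n" "z n" "xi n" "v n" \<mu> by (rule model_n[OF n])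
  show ?thesis unfolding q0_def[abs_def] cnt_def by measurable
qed

text \<open>A linear form in the cell counts is a sum over independent innovations, so its
  characteristic function is an n-th power. The condition on \<open>a\<close> removes the centring
  constant and makes the single summand centred under the null probabilities.\<close>

lemma q0_char:
  assumes a0: "(\<Sum>j = 1..m. p0 j * a j) = 0"
  shows "(\<lambda>n. \<integral>\<omega>. iexp (\<Sum>j = 1..m. a j * q0 j n \<omega>) \<partial>M n)
    \<longlonglongrightarrow> exp (\<i> * of_real (\<rho> * (\<Sum>j = 1..m. hj j * a j)) - of_real ((\<Sum>j = 1..m. p0 j * (a j)\<^sup>2) / 2))"
proof -
  have ev: "(\<integral>\<omega>. iexp (\<Sum>j = 1..m. a j * q0 j n \<omega>) \<partial>M n) = (\<Sum>j = 1..m. of_real (p0 j + rn n * hj j) * iexp (a j / sqrt (real n))) ^ n"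
    if n: "1 \<le> n" for n
  proof -
    interpret A: ar_model "M n" p \<beta> \<nu> "Gn n" "gn n" Q "eps n" "z n" "xi n" "v n" \<mu> by (rule model_n[OF n])
    interpret E: real_distribution "distr (M n) borel (eps n 1)" by (rule innovation_law[OF n])
    define h where "h u = (\<Sum>j = 1..m. a j / sqrt (real n) * indicator (sym_cell x j) u)" for u
    have hm: "h \<in> borel_measurable borel" unfolding h_def by measurable
    have "(\<Sum>j = 1..m. a j * q0 j n \<omega>) = (\<Sum>t = 1..int n. h (eps n t \<omega>))" for \<omega>
    proof -
      have "(\<Sum>j = 1..m. a j * q0 j n \<omega>) = (\<Sum>j = 1..m. a j / sqrt (real n) * cnt j n \<omega> - real n / sqrt (real n) * (p0 j * a j))"
        by (intro sum.cong refl) (simp add: q0_def diff_divide_distrib algebra_simps)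
      also have "\<dots> = (\<Sum>j = 1..m. a j / sqrt (real n) * cnt j n \<omega>)"
        unfolding sum_subtractf sum_distrib_left[symmetric] a0 by simp
      also have "\<dots> = (\<Sum>t = 1..int n. h (eps n t \<omega>))"
        unfolding h_def cnt_def sum_distrib_left by (rule sum.swap)
      finally show ?thesis .
    qed
    hence "(\<integral>\<omega>. iexp (\<Sum>j = 1..m. a j * q0 j n \<omega>) \<partial>M n) = (\<integral>u. iexp (h u) \<partial>distr (M n) borel (eps n 1)) ^ n"
      by (simp only: A.iid_sum_char[OF hm])
    also have "(\<integral>u. iexp (h u) \<partial>distr (M n) borel (eps n 1))
      = (\<integral>u. (\<Sum>j = 1..m. of_real (indicator (sym_cell x j) u) * iexp (a j / sqrt (real n))) \<partial>distr (M n) borel (eps n 1))"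
    proof (rule Bochner_Integration.integral_cong[OF refl])
      fix u
      \<comment> \<open>Every point lies in exactly one cell, so the exponential of the sum over
        cells is the sum of the exponentials weighted by the cell indicators.\<close>
      obtain i where i: "i \<in> {1..m}" "\<And>j. j \<in> {1..m} \<Longrightarrow> indicator (sym_cell x j) u = (if j = i then 1 else 0 :: real)"
        by (rule cell_unique[of u]) blast
      have "h u = (\<Sum>j = 1..m. if j = i then a j / sqrt (real n) else 0)"
        unfolding h_def by (intro sum.cong refl) (simp add: i(2))
      hence "h u = a i / sqrt (real n)" using i(1) by simp
      moreover have "(\<Sum>j = 1..m. of_real (indicator (sym_cell x j) u) * iexp (a j / sqrt (real n)))
        = (\<Sum>j = 1..m. if j = i then iexp (a j / sqrt (real n)) else 0)"
        by (intro sum.cong refl) (simp add: i(2))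
      ultimately show "iexp (h u) = (\<Sum>j = 1..m. of_real (indicator (sym_cell x j) u) * iexp (a j / sqrt (real n)))"
        using i(1) by simp
    qed
    also have "\<dots> = (\<Sum>j = 1..m. of_real (p0 j + rn n * hj j) * iexp (a j / sqrt (real n)))"
    proof -
      have i: "integrable (distr (M n) borel (eps n 1)) (\<lambda>u. complex_of_real (indicator (sym_cell x j) u))" for j
        by (rule E.integrable_bounded[where B = 1]) (auto simp: indicator_def)
      show ?thesis
        by (subst Bochner_Integration.integral_sum)
           (auto simp: i innovation_cell[OF n] intro!: sum.cong)
    qed
    finally show ?thesis .
  qed
  have "(\<Sum>j = 1..m. hj j) = 0" using alternative_shift_sum[OF H H_symmetric] by (simp add: hj_def p0_def)
  hence tot: "(\<Sum>j = 1..m. p0 j + rn n * hj j) = 1" for n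
    using cell_prob_sum[OF theta_pos] by (simp add: sum.distrib sum_distrib_left[symmetric] p0_def)
  have "(\<lambda>n. (\<Sum>j = 1..m. of_real (p0 j + rn n * hj j) * iexp (a j / sqrt (real n))) ^ n)
    \<longlonglongrightarrow> exp (\<i> * of_real (\<rho> * (\<Sum>j = 1..m. hj j * a j)) - of_real ((\<Sum>j = 1..m. p0 j * (a j)\<^sup>2) / 2))"
    by (rule local_multinomial_char[OF _ a0 _ _ tot rn_tendsto(1)])
       (auto simp: less_imp_le p0_pos innovation_cell[symmetric, of _ _ 1] measure_nonneg)
  moreover have "\<forall>\<^sub>F n in sequentially. (\<Sum>j = 1..m. of_real (p0 j + rn n * hj j) * iexp (a j / sqrt (real n))) ^ n
      = (\<integral>\<omega>. iexp (\<Sum>j = 1..m. a j * q0 j n \<omega>) \<partial>M n)"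
    by (rule eventually_mono[OF eventually_ge_at_top[of 1]]) (rule ev[symmetric])
  ultimately show ?thesis by (rule Lim_transform_eventually)
qed

definition Tn :: "nat \<Rightarrow> 'a \<Rightarrow> real" where
  "Tn n \<omega> = pearson_statistic x m n (Nh n \<omega>) (theta_hat n (Yo n \<omega>))"

lemma Tn_measurable:
  assumes n: "1 \<le> n"
  shows "Tn n \<in> borel_measurable (M n)"
proof -
  interpret a: ar_model "M n" p \<beta> \<nu> "Gn n" "gn n" Q "eps n" "z n" "xi n" "v n" \<mu> by (rule model_n[OF n])
  have Y: "Yo n \<in> measurable (M n) (\<Pi>\<^sub>M t\<in>{1 - int p..int n}. borel)"
    unfolding Yo by (rule a.observations_measurable)
  have Yt: "(\<lambda>\<omega>. Yo n \<omega> t) \<in> borel_measurable (M n)" if "t \<in> {1 - int p..int n}" for t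
    using measurable_compose[OF Y measurable_component_singleton[OF that]] .
  note mh = measurable_compose[OF Y est_measurable(1)]
  note th [measurable] = measurable_compose[OF Y est_measurable(3)]
  have bh: "(\<lambda>\<omega>. beta_hat n (Yo n \<omega>) i) \<in> borel_measurable (M n)" if "i \<in> {1..p}" for i
    using measurable_compose[OF Y est_measurable(2)[OF that]] .
  have res: "res n t \<in> borel_measurable (M n)" if t: "t \<in> {1..int n}" for t
    unfolding res_def[abs_def] residual_def
    by (intro borel_measurable_diff borel_measurable_sum borel_measurable_times mh bh Yt) (use t in auto)
  have N [measurable]: "(\<lambda>\<omega>. real (Nh n \<omega> j)) \<in> borel_measurable (M n)" for j
    unfolding Nh_eq
    by (intro borel_measurable_sum measurable_compose[OF res borel_measurable_indicator]) (auto intro: cell_borel)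
  show ?thesis unfolding Tn_def[abs_def] pearson_statistic_def by measurable
qed

text \<open>In the adapted basis the statistic is, up to oP(1), the squared norm of m - 2 linear
  forms in the innovation counts. Their joint characteristic function converges to that of a
  Gaussian vector with identity covariance whose mean points along the first coordinate, the vector
  that defines the noncentral law.\<close>

theorem power_tendsto:
  "(\<lambda>n. measure (M n) {\<omega> \<in> space (M n). Tn n \<omega> > chi_square_quantile (m - 2) (1 - \<alpha>)})
    \<longlonglongrightarrow> asymptotic_power p \<beta> \<theta>\<^sub>0 x m H \<alpha> \<rho> \<gamma> Q"
proof -
  let ?u = "shift p \<beta> H \<rho> \<gamma> Q" and ?d = "outlier_shift p \<beta> \<theta>\<^sub>0 x Q" and ?K = "m - 2"
  define l where "l = L2_set (proj ?u) {1..m}"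
  have K: "1 \<le> ?K" using m2 by simp
  have u: "?u j = \<rho> * hj j + \<gamma> * ?d j" for j by (simp add: shift_def hj_def p0_def)
  have "(\<Sum>j = 1..m. ?u j) = 0"
    using alternative_shift_sum[OF H H_symmetric] outlier_shift_sum[OF Q, of p \<beta>]
    by (simp add: u sum.distrib sum_distrib_left[symmetric] hj_def p0_def)
  then obtain e where e: "orthonormal {1..m} e m" "\<And>j. e 0 j = sqrt (p0 j)" "\<And>j. e 1 j = score_direction x m \<theta>\<^sub>0 j"
    "\<And>k. k < ?K \<Longrightarrow> (\<Sum>j = 1..m. e (k + 2) j / sqrt (p0 j) * ?u j) = (if k = 0 then l else 0)"
    unfolding l_def by (rule adapted_basis[of ?u]) blast
  define w where "w k j = e (k + 2) j / sqrt (p0 j)" for k j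
  \<comment> \<open>The outliers appear as a deterministic drift. The drift of the local alternative
    is not written here: it is already contained in the law of the innovation counts.\<close>
  define X where "X n k \<omega> = (\<Sum>j = 1..m. w k j * (q0 j n \<omega> + \<gamma> * ?d j))" for n k \<omega>
  have delta: "oP (\<lambda>n \<omega>. (real (Nh n \<omega> j) - real n * p0 j) / sqrt (real n) - (q0 j n \<omega> + \<gamma> * ?d j))" if "j \<in> {1..m}" for j
    using count_expansion[OF that] by (simp add: q0_def diff_divide_distrib algebra_simps)
  have qd: "OP (\<lambda>n \<omega>. q0 j n \<omega> + \<gamma> * ?d j)" if "j \<in> {1..m}" for j
    by (rule OP_add[OF q0_OP[OF that] OP_const])
  have tight: "OP (\<lambda>n \<omega>. (real (Nh n \<omega> j) - real n * p0 j) / sqrt (real n))" if "j \<in> {1..m}" for j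
    using OP_add[OF oP_imp_OP[OF delta[OF that]] qd[OF that]] by simp
  interpret P: pearson_seq M m x \<theta>\<^sub>0 "\<lambda>n \<omega>. theta_hat n (Yo n \<omega>)" Nh
    by unfold_locales (use theta_solves theta_OP tight in \<open>simp_all add: Nh cell_count_total p0_def\<close>)
  define Y where "Y n k \<omega> = (\<Sum>j = 1..m. w k j * P.qv j n \<omega>)" for n k \<omega>
  have T1: "oP (\<lambda>n \<omega>. Tn n \<omega> - (\<Sum>k<?K. (Y n k \<omega>)\<^sup>2))"
    unfolding Tn_def Y_def w_def
    by (rule P.pearson_expansion[OF e(1)]) (simp_all add: e(2,3) score_direction_eq)
  have YX: "oP (\<lambda>n \<omega>. Y n k \<omega> - X n k \<omega>)" for k
  proof -
    have "oP (\<lambda>n \<omega>. \<Sum>j = 1..m. w k j * (P.qv j n \<omega> - (q0 j n \<omega> + \<gamma> * ?d j)))"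
      by (rule oP_sum, rule oP_cmult) (unfold P.qv_def, rule delta)
    thus ?thesis by (simp only: Y_def X_def right_diff_distrib sum_subtractf)
  qed
  have XO: "OP (\<lambda>n \<omega>. X n k \<omega>)" for k
    unfolding X_def by (rule OP_sum, rule OP_mult[OF OP_const qd])
  have T2: "oP (\<lambda>n \<omega>. \<Sum>k<?K. (Y n k \<omega> - X n k \<omega>) * ((Y n k \<omega> - X n k \<omega>) + 2 * X n k \<omega>))"
    by (rule oP_sum, rule oP_OP_mult[OF YX OP_add[OF oP_imp_OP[OF YX] OP_mult[OF OP_const XO]]])
  have close: "oP (\<lambda>n \<omega>. Tn n \<omega> - (\<Sum>k<?K. (X n k \<omega>)\<^sup>2))"
  proof -
    have "(\<Sum>k<?K. (Y n k \<omega> - X n k \<omega>) * ((Y n k \<omega> - X n k \<omega>) + 2 * X n k \<omega>)) = (\<Sum>k<?K. (Y n k \<omega>)\<^sup>2) - (\<Sum>k<?K. (X n k \<omega>)\<^sup>2)" for n \<omega>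
      unfolding sum_subtractf[symmetric] by (intro sum.cong refl) (simp add: power2_eq_square algebra_simps)
    with oP_add[OF T1 T2] show ?thesis by simp
  qed
  have cf: "(\<lambda>n. \<integral>\<omega>. iexp (\<Sum>k<?K. t k * X n k \<omega>) \<partial>M n) \<longlonglongrightarrow> (\<integral>Z. iexp (\<Sum>k<?K. t k * Z k) \<partial>ncp_space ?K (l\<^sup>2))" for t
  proof -
    \<comment> \<open>Cell weights of the linear form with coefficients t. Orthogonality of the
      basis to sqrt p0 centres them, and its orthonormality makes their null variance the sum of the
      squares of t.\<close>
    define a where "a j = (\<Sum>k<?K. t k * w k j)" for j
    have lin: "(\<Sum>j = 1..m. a j * f j) = (\<Sum>k<?K. t k * (\<Sum>j = 1..m. w k j * f j))" for f
      unfolding a_def sum_distrib_left sum_distrib_right by (subst sum.swap) (simp add: mult.assoc)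
    have on: "dotp {1..m} (e (k + 2)) (e (i + 2)) = (if k = i then 1 else 0)" if "k < ?K" "i < ?K" for k i
      using e(1) that unfolding orthonormal_def by auto
    have on0: "dotp {1..m} (e (k + 2)) (e 0) = 0" if "k < ?K" for k
      using e(1) that unfolding orthonormal_def by auto
    have sp: "sqrt (p0 j) * sqrt (p0 j) = p0 j" "sqrt (p0 j) \<noteq> 0" if "j \<in> {1..m}" for j
      using p0_pos[OF that] by auto
    have w0: "(\<Sum>j = 1..m. w k j * p0 j) = 0" if "k < ?K" for k
    proof -
      have "(\<Sum>j = 1..m. w k j * p0 j) = dotp {1..m} (e (k + 2)) (e 0)"
        unfolding dotp_def e(2) w_def
      proof (intro sum.cong refl)
        fix j assume j: "j \<in> {1..m}"
        have "e (k + 2) j / sqrt (p0 j) * (sqrt (p0 j) * sqrt (p0 j)) = e (k + 2) j * sqrt (p0 j)"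
          using sp(2)[OF j] by (simp del: real_sqrt_mult_self)
        thus "e (k + 2) j / sqrt (p0 j) * p0 j = e (k + 2) j * sqrt (p0 j)" unfolding sp(1)[OF j] .
      qed
      thus ?thesis using on0[OF that] by simp
    qed
    have "(\<Sum>j = 1..m. a j * p0 j) = 0" unfolding lin by (intro sum.neutral) (simp add: w0)
    hence a0: "(\<Sum>j = 1..m. p0 j * a j) = 0" by (simp add: mult.commute)
    have au: "(\<Sum>j = 1..m. a j * ?u j) = t 0 * l"
    proof -
      have "(\<Sum>j = 1..m. a j * ?u j) = (\<Sum>k<?K. if k = 0 then t 0 * l else 0)"
        unfolding lin by (intro sum.cong refl) (use e(4) in \<open>simp add: w_def\<close>)
      thus ?thesis using K by simp
    qed
    have aa: "(\<Sum>j = 1..m. p0 j * (a j)\<^sup>2) = (\<Sum>k<?K. (t k)\<^sup>2)"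
    proof -
      have pa: "p0 j * a j = (\<Sum>i<?K. t i * (e (i + 2) j * sqrt (p0 j)))" if j: "j \<in> {1..m}" for j
      proof -
        have "(sqrt (p0 j) * sqrt (p0 j)) * w i j = e (i + 2) j * sqrt (p0 j)" for i
          using sp(2)[OF j] by (simp add: w_def del: real_sqrt_mult_self)
        hence "p0 j * w i j = e (i + 2) j * sqrt (p0 j)" for i unfolding sp(1)[OF j] .
        thus ?thesis unfolding a_def sum_distrib_left by (simp add: mult.left_commute)
      qed
      have "(\<Sum>j = 1..m. p0 j * (a j)\<^sup>2) = (\<Sum>j = 1..m. a j * (\<Sum>i<?K. t i * (e (i + 2) j * sqrt (p0 j))))"
      proof (intro sum.cong refl)
        fix j assume "j \<in> {1..m}"
        from pa[OF this, symmetric] show "p0 j * (a j)\<^sup>2 = a j * (\<Sum>i<?K. t i * (e (i + 2) j * sqrt (p0 j)))"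
          by (simp only: power2_eq_square mult.left_commute)
      qed
      also have "\<dots> = (\<Sum>k<?K. t k * (\<Sum>j = 1..m. w k j * (\<Sum>i<?K. t i * (e (i + 2) j * sqrt (p0 j)))))" by (rule lin)
      also have "\<dots> = (\<Sum>k<?K. t k * t k)"
      proof (intro sum.cong refl arg_cong2[where f = "(*)"])
        fix k assume k: "k \<in> {..<?K}"
        have "(\<Sum>j = 1..m. w k j * (\<Sum>i<?K. t i * (e (i + 2) j * sqrt (p0 j)))) = (\<Sum>j = 1..m. \<Sum>i<?K. t i * (e (k + 2) j * e (i + 2) j))"
          unfolding sum_distrib_left
        proof (intro sum.cong refl)
          fix j i assume j: "j \<in> {1..m}"
          have "w k j * sqrt (p0 j) = e (k + 2) j" using sp(2)[OF j] by (simp add: w_def)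
          hence "t i * (e (i + 2) j * (w k j * sqrt (p0 j))) = t i * (e (i + 2) j * e (k + 2) j)" by simp
          thus "w k j * (t i * (e (i + 2) j * sqrt (p0 j))) = t i * (e (k + 2) j * e (i + 2) j)" by (simp only: mult_ac)
        qed
        also have "\<dots> = (\<Sum>i<?K. t i * dotp {1..m} (e (k + 2)) (e (i + 2)))"
          unfolding dotp_def sum_distrib_left by (rule sum.swap)
        also have "\<dots> = (\<Sum>i<?K. if k = i then t i else 0)"
          by (intro sum.cong refl) (use on k in auto)
        also have "\<dots> = t k" using k by simp
        finally show "(\<Sum>j = 1..m. w k j * (\<Sum>i<?K. t i * (e (i + 2) j * sqrt (p0 j)))) = t k" .
      qed
      finally show ?thesis by (simp add: power2_eq_square)
    qed
    define s where "s = (\<Sum>j = 1..m. a j * (\<gamma> * ?d j))"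
    have X: "(\<Sum>k<?K. t k * X n k \<omega>) = s + (\<Sum>j = 1..m. a j * q0 j n \<omega>)" for n \<omega>
      unfolding X_def lin[symmetric] by (simp add: s_def sum.distrib distrib_left)
    \<comment> \<open>The drift from the multinomial limit and the explicit outlier drift add up to
      the pairing of \<open>a\<close> with the full shift; in the adapted basis only the first
      coordinate of t sees it.\<close>
    have rs: "\<rho> * (\<Sum>j = 1..m. hj j * a j) + s = t 0 * l"
      unfolding au[symmetric] u s_def sum_distrib_left sum.distrib[symmetric] by (intro sum.cong refl) (simp add: algebra_simps)
    have "(\<lambda>n. iexp s * (\<integral>\<omega>. iexp (\<Sum>j = 1..m. a j * q0 j n \<omega>) \<partial>M n))
      \<longlonglongrightarrow> iexp s * exp (\<i> * of_real (\<rho> * (\<Sum>j = 1..m. hj j * a j)) - of_real ((\<Sum>j = 1..m. p0 j * (a j)\<^sup>2) / 2))"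
      by (intro tendsto_mult_left q0_char a0)
    moreover have "iexp s * (\<integral>\<omega>. iexp (\<Sum>j = 1..m. a j * q0 j n \<omega>) \<partial>M n) = (\<integral>\<omega>. iexp (\<Sum>k<?K. t k * X n k \<omega>) \<partial>M n)" for n
      unfolding X by (simp add: exp_add distrib_left)
    moreover have "iexp s * exp (\<i> * of_real (\<rho> * (\<Sum>j = 1..m. hj j * a j)) - of_real ((\<Sum>j = 1..m. p0 j * (a j)\<^sup>2) / 2))
      = (\<integral>Z. iexp (\<Sum>k<?K. t k * Z k) \<partial>ncp_space ?K (l\<^sup>2))"
    proof -
      have "iexp s * exp (\<i> * of_real (\<rho> * (\<Sum>j = 1..m. hj j * a j)) - of_real ((\<Sum>j = 1..m. p0 j * (a j)\<^sup>2) / 2))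
        = iexp (\<rho> * (\<Sum>j = 1..m. hj j * a j) + s) * exp (of_real (- (\<Sum>k<?K. (t k)\<^sup>2) / 2))"
        unfolding aa exp_add[symmetric] by (intro arg_cong[where f = exp]) (simp add: algebra_simps)
      moreover have "sqrt (l\<^sup>2) = l" by (simp add: l_def L2_set_nonneg)
      ultimately show ?thesis unfolding rs ncp_char[OF K] exp_of_real by (simp only:)
    qed
    ultimately show ?thesis by (simp only:)
  qed
  have "(\<lambda>n. measure (M n) {\<omega> \<in> space (M n). Tn n \<omega> > chi_square_quantile (m - 2) (1 - \<alpha>)})
    \<longlonglongrightarrow> 1 - cdf (noncentral_chi_square ?K (l\<^sup>2)) (chi_square_quantile (m - 2) (1 - \<alpha>))"
  proof (rule square_norm_tail_tendsto[OF _ prob_space_ncp _ cf Tn_measurable close])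
    fix n k :: nat assume n: "1 \<le> n"
    show "X n k \<in> borel_measurable (M n)"
      unfolding X_def[abs_def] by (intro borel_measurable_sum borel_measurable_times borel_measurable_add q0_measurable[OF n] borel_measurable_const)
  next
    show "cdf (noncentral_chi_square ?K (l\<^sup>2)) = cdf (distr (ncp_space ?K (l\<^sup>2)) borel (\<lambda>Z. \<Sum>k<?K. (Z k)\<^sup>2))"
      by (simp add: noncentral_chi_square_alt)
  qed (simp_all add: ncp_component ncc_isCont[OF K])
  thus ?thesis by (simp add: asymptotic_power_def noncentrality_eq l_def)
qed

end

subsection \<open>From sequences of parameters to uniform convergence\<close>

text \<open>Off the subsequence the limit itself is inserted, so that a convergent subsequence of
  parameters becomes a full convergent sequence indexed by the sample size.\<close>

lemma tendsto_fill_subsequence: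
  fixes h :: "nat \<Rightarrow> 'b :: topological_space"
  assumes s: "strict_mono s" and l: "(\<lambda>k. h (s k)) \<longlonglongrightarrow> l"
  shows "(\<lambda>n. if n \<in> range s then h n else l) \<longlonglongrightarrow> l"
proof (rule topological_tendstoI)
  fix S assume S: "open S" "l \<in> S"
  then obtain K where K: "\<And>k. K \<le> k \<Longrightarrow> h (s k) \<in> S"
    using topological_tendstoD[OF l S] by (auto simp: eventually_sequentially)
  have "(if n \<in> range s then h n else l) \<in> S" if n: "s K \<le> n" for n
  proof (cases "n \<in> range s")
    case True
    then obtain k where k: "n = s k" by blast
    hence "K \<le> k" using n s by (simp add: strict_mono_less_eq)
    thus ?thesis using K k True by simp
  qed (use S in simp)
  thus "\<forall>\<^sub>F n in sequentially. (if n \<in> range s then h n else l) \<in> S"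
    unfolding eventually_sequentially by blast
qed

text \<open>If uniformity failed, bad parameters would exist for infinitely many n. By compactness
  of the box they converge along a subsequence, and convergence along the filled sequence
  contradicts their badness.\<close>

lemma uniform_limit_box_if_sequences:
  fixes f :: "nat \<Rightarrow> real \<times> real \<Rightarrow> real"
  assumes seq: "\<And>a b r c. a \<longlonglongrightarrow> r \<Longrightarrow> b \<longlonglongrightarrow> c \<Longrightarrow> (\<forall>n. a n \<in> {0..R}) \<Longrightarrow> (\<forall>n. b n \<in> {0..S})
      \<Longrightarrow> (\<lambda>n. f n (a n, b n) - g (a n, b n)) \<longlonglongrightarrow> 0"
  shows "uniform_limit ({0..R} \<times> {0..S}) f g sequentially"
proof (rule ccontr)
  let ?B = "{0..R} \<times> {0..S}"
  assume "\<not> ?thesis"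
  then obtain e where e: "0 < e" "\<not> (\<exists>N. \<forall>y\<in>?B. \<forall>n\<ge>N. dist (f n y) (g y) < e)"
    unfolding uniform_limit_sequentially_iff by blast
  have far: "\<exists>n\<ge>N. \<exists>y\<in>?B. e \<le> dist (f n y) (g y)" for N using e(2) unfolding not_less[symmetric] by blast
  define A where "A = {n. \<exists>y\<in>?B. e \<le> dist (f n y) (g y)}"
  have inf: "infinite A" unfolding infinite_nat_iff_unbounded_le A_def using far by blast
  have "\<forall>n\<in>A. \<exists>y. y \<in> ?B \<and> e \<le> dist (f n y) (g y)" unfolding A_def by blast
  from bchoice[OF this] obtain y where y: "\<And>n. n \<in> A \<Longrightarrow> y n \<in> ?B" "\<And>n. n \<in> A \<Longrightarrow> e \<le> dist (f n (y n)) (g (y n))"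
    by blast
  have "compact ?B" by (intro compact_Times compact_Icc)
  hence C: "\<forall>u :: nat \<Rightarrow> real \<times> real. (\<forall>k. u k \<in> ?B) \<longrightarrow> (\<exists>l\<in>?B. \<exists>t. strict_mono t \<and> (u \<circ> t) \<longlonglongrightarrow> l)" unfolding compact_def .
  have "\<exists>l\<in>?B. \<exists>t. strict_mono t \<and> ((\<lambda>k. y (enumerate A k)) \<circ> t) \<longlonglongrightarrow> l"
    by (rule C[rule_format]) (rule y(1)[OF enumerate_in_set[OF inf]])
  then obtain l t where l: "l \<in> ?B" "strict_mono t" "((\<lambda>k. y (enumerate A k)) \<circ> t) \<longlonglongrightarrow> l" by (elim bexE exE conjE)
  define s where "s = enumerate A \<circ> t"
  have s: "strict_mono s" unfolding s_def by (intro strict_mono_o strict_mono_enumerate inf l(2))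
  have sA: "s k \<in> A" for k unfolding s_def using enumerate_in_set[OF inf] by simp
  \<comment> \<open>The hypothesis speaks of sequences that stay in the box for every n, which holds
    here because the limit also lies in the box.\<close>
  define h where "h n = (if n \<in> range s then y n else l)" for n
  have h: "h \<longlonglongrightarrow> l" unfolding h_def
    by (rule tendsto_fill_subsequence[OF s]) (use l(3) in \<open>simp add: s_def comp_def\<close>)
  have hs: "h (s k) = y (s k)" for k by (simp add: h_def)
  have hB: "h n \<in> ?B" for n
  proof (cases "n \<in> range s")
    case True
    then obtain k where k: "n = s k" by blast
    show ?thesis unfolding k hs by (rule y(1)[OF sA])
  next
    case False
    thus ?thesis using l(1) by (simp add: h_def)
  qed
  have "(\<lambda>n. f n (fst (h n), snd (h n)) - g (fst (h n), snd (h n))) \<longlonglongrightarrow> 0"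
    by (rule seq[OF tendsto_fst[OF h] tendsto_snd[OF h]]) (use hB in \<open>auto simp: mem_Times_iff\<close>)
  hence "(\<lambda>n. f n (h n) - g (h n)) \<longlonglongrightarrow> 0" by simp
  from tendstoD[OF this e(1)] have "\<forall>\<^sub>F n in sequentially. \<bar>f n (h n) - g (h n)\<bar> < e"
    by (simp add: dist_real_def)
  then obtain N where N: "\<And>n. N \<le> n \<Longrightarrow> \<bar>f n (h n) - g (h n)\<bar> < e" by (auto simp: eventually_sequentially)
  have "N \<le> s N" using s by (rule strict_mono_imp_increasing)
  from N[OF this] y(2)[OF sA, of N] show False unfolding hs by (simp add: dist_real_def)
qed

text \<open>Along one sequence of parameters the probability is dominated by the supremum over the
  box. The exceptional set is the event of a large value itself, so measurability of the variable is
  required.\<close>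

lemma OP_if_uniformly_bounded:
  assumes U: "uniformly_bounded_in_prob M X" and P: "prob_seq (\<lambda>n. M n (a n) (b n))"
    and box: "0 \<le> R" "0 \<le> S" "\<And>n. a n \<in> {0..R}" "\<And>n. b n \<in> {0..S}"
    and X: "\<And>n. 1 \<le> n \<Longrightarrow> X n (a n) (b n) \<in> borel_measurable (M n (a n) (b n))"
  shows "prob_seq.OP (\<lambda>n. M n (a n) (b n)) (\<lambda>n. X n (a n) (b n))"
proof -
  interpret P: prob_seq "\<lambda>n. M n (a n) (b n)" by fact
  let ?F = "\<lambda>K n. SUP (r, c) \<in> {0..R} \<times> {0..S}. ereal (measure (M n r c) {\<omega> \<in> space (M n r c). \<bar>X n r c \<omega>\<bar> > K})"
  have lim: "((\<lambda>K. limsup (?F K)) \<longlongrightarrow> 0) at_top" using U box(1,2) unfolding uniformly_bounded_in_prob_def by blast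
  show ?thesis
    unfolding P.OP_def
  proof (intro allI impI)
    fix d :: real assume "0 < d"
    hence "\<forall>\<^sub>F K in at_top. limsup (?F K) < ereal d" using order_tendstoD(2)[OF lim] by simp
    then obtain K where "limsup (?F K) < ereal d" by (rule eventually_happens'[OF trivial_limit_at_top_linorder, THEN exE])
    hence "\<forall>\<^sub>F n in sequentially. ?F K n < ereal d" by (rule Limsup_lessD)
    with eventually_ge_at_top[of 1] have "\<forall>\<^sub>F n in sequentially. P.mostly n d (\<lambda>\<omega>. \<bar>X n (a n) (b n) \<omega>\<bar> \<le> K)"
    proof eventually_elim
      case (elim n)
      let ?M = "M n (a n) (b n)"
      let ?A = "{\<omega> \<in> space ?M. \<bar>X n (a n) (b n) \<omega>\<bar> > K}"
      have "ereal (measure ?M ?A) \<le> ?F K n"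
        by (rule SUP_upper2[of "(a n, b n)"]) (use box(3,4) in auto)
      from le_less_trans[OF this elim(2)] have "measure ?M ?A < d" by simp
      moreover have "?A \<in> sets ?M" using X[OF elim(1)] by measurable
      ultimately show ?case unfolding P.mostly_def by (intro bexI[of _ ?A]) auto
    qed
    thus "\<exists>K. \<forall>\<^sub>F n in sequentially. P.mostly n d (\<lambda>\<omega>. \<bar>X n (a n) (b n) \<omega>\<bar> \<le> K)" ..
  qed
qed

lemma whp_if_uniformly_prob_to_one:
  assumes U: "uniformly_prob_to_one M E" and P: "prob_seq (\<lambda>n. M n (a n) (b n))"
    and box: "0 \<le> R" "0 \<le> S" "\<And>n. a n \<in> {0..R}" "\<And>n. b n \<in> {0..S}"
  shows "prob_seq.whp (\<lambda>n. M n (a n) (b n)) (\<lambda>n. E n (a n) (b n))"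
proof -
  interpret P: prob_seq "\<lambda>n. M n (a n) (b n)" by fact
  let ?f = "\<lambda>n (r, c). measure (M n r c) {\<omega> \<in> space (M n r c). E n r c \<omega>}"
  have U: "uniform_limit ({0..R} \<times> {0..S}) ?f (\<lambda>_. 1) sequentially"
    using U box(1,2) unfolding uniformly_prob_to_one_def by blast
  show ?thesis
  proof (rule P.whp_prob_to_one, rule tendstoI)
    fix e :: real assume "0 < e"
    from uniform_limitD[OF U this]
    show "\<forall>\<^sub>F n in sequentially. dist (measure (M n (a n) (b n)) {\<omega> \<in> space (M n (a n) (b n)). E n (a n) (b n) \<omega>}) 1 < e"
    proof eventually_elim
      case (elim n)
      have "(a n, b n) \<in> {0..R} \<times> {0..S}" using box(3,4) by simp
      from elim[rule_format, OF this] show ?case by simp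
    qed
  qed
qed

theorem mainTheorem3:
  fixes p m :: nat
    and \<beta> :: "nat \<Rightarrow> real" and \<nu> \<mu> \<theta>\<^sub>0 \<alpha> :: real
    and H Q :: "real measure"
    and x :: "nat \<Rightarrow> ereal"
    and M :: "nat \<Rightarrow> real \<Rightarrow> real \<Rightarrow> 'a measure"
    and eps z xi v :: "nat \<Rightarrow> real \<Rightarrow> real \<Rightarrow> int \<Rightarrow> 'a \<Rightarrow> real"
    and mu_hat theta_hat :: "nat \<Rightarrow> (int \<Rightarrow> real) \<Rightarrow> real"
    and beta_hat :: "nat \<Rightarrow> (int \<Rightarrow> real) \<Rightarrow> nat \<Rightarrow> real"
  defines "Y \<equiv> \<lambda>n \<rho> \<gamma>. observations p n (v n \<rho> \<gamma>) (z n \<rho> \<gamma>) (xi n \<rho> \<gamma>)"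
    and "N_hat \<equiv> \<lambda>n y. cell_count x p n (mu_hat n y) (beta_hat n y) y"
    and "W \<equiv> asymptotic_power p \<beta> \<theta>\<^sub>0 x m H \<alpha>"
  assumes p: "1 \<le> p"
    and roots: "\<And>w :: complex. w ^ p = (\<Sum>i = 1..p. of_real (\<beta> i) * w ^ (p - i)) \<Longrightarrow> cmod w < 1"
    and \<mu>: "\<nu> = (1 - (\<Sum>i = 1..p. \<beta> i)) * \<mu>"
    and \<theta>\<^sub>0: "0 < \<theta>\<^sub>0"
    and Q: "real_distribution Q"
    and H: "real_distribution H"
    and H_moments: "integrable H (\<lambda>s. s\<^sup>2)" "(\<integral>s. s \<partial>H) = 0"
    and H_smooth: "cdf H differentiable_on UNIV" "deriv (cdf H) differentiable_on UNIV"
      "bounded (range (deriv (deriv (cdf H))))"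
    and H_symmetric: "\<And>s. cdf H (- s) = 1 - cdf H s"
    and model: "\<And>n \<rho> \<gamma>. 1 \<le> n \<Longrightarrow> 0 \<le> \<rho> \<Longrightarrow> 0 \<le> \<gamma> \<Longrightarrow>
      contaminated_ar (M n \<rho> \<gamma>) p \<beta> \<nu> (alt_cdf \<theta>\<^sub>0 H n \<rho>) (local_weight n \<gamma>) Q
        (eps n \<rho> \<gamma>) (z n \<rho> \<gamma>) (xi n \<rho> \<gamma>) (v n \<rho> \<gamma>)"
    and estimators_measurable:
      "\<And>n. mu_hat n \<in> borel_measurable (\<Pi>\<^sub>M t\<in>{1 - int p..int n}. borel)"
      "\<And>n i. i \<in> {1..p} \<Longrightarrow>
         (\<lambda>y. beta_hat n y i) \<in> borel_measurable (\<Pi>\<^sub>M t\<in>{1 - int p..int n}. borel)"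
      "\<And>n. theta_hat n \<in> borel_measurable (\<Pi>\<^sub>M t\<in>{1 - int p..int n}. borel)"
    and mu_hat: "uniformly_bounded_in_prob M
      (\<lambda>n \<rho> \<gamma> \<omega>. sqrt (real n) * (mu_hat n (Y n \<rho> \<gamma> \<omega>) - \<mu>))"
    and beta_hat: "uniformly_bounded_in_prob M
      (\<lambda>n \<rho> \<gamma> \<omega>. sqrt (real n) * L2_set (\<lambda>i. beta_hat n (Y n \<rho> \<gamma> \<omega>) i - \<beta> i) {1..p})"
    and partition: "2 < m" "x 0 = 0" "x m = \<infinity>" "strict_mono_on {0..m} x"
    and theta_hat_solution: "uniformly_prob_to_one M
      (\<lambda>n \<rho> \<gamma> \<omega>. solves_scale_equation x m (N_hat n (Y n \<rho> \<gamma> \<omega>)) (theta_hat n (Y n \<rho> \<gamma> \<omega>)))"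
    and theta_hat: "uniformly_bounded_in_prob M
      (\<lambda>n \<rho> \<gamma> \<omega>. sqrt (real n) * (theta_hat n (Y n \<rho> \<gamma> \<omega>) - \<theta>\<^sub>0))"
    and \<alpha>: "0 < \<alpha>" "\<alpha> < 1"
  shows "(\<forall>R\<ge>0. \<forall>\<Gamma>\<ge>0.
            uniform_limit ({0..R} \<times> {0..\<Gamma>})
              (\<lambda>n (\<rho>, \<gamma>). measure (M n \<rho> \<gamma>)
                 {\<omega> \<in> space (M n \<rho> \<gamma>).
                    pearson_statistic x m n (N_hat n (Y n \<rho> \<gamma> \<omega>)) (theta_hat n (Y n \<rho> \<gamma> \<omega>))
                    > chi_square_quantile (m - 2) (1 - \<alpha>)})
              (\<lambda>(\<rho>, \<gamma>). W \<rho> \<gamma> Q) sequentially)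
       \<and> W 0 0 Q = \<alpha>
       \<and> (\<forall>\<gamma>\<ge>0. (SUP (Q', \<rho>) \<in> {Q'. real_distribution Q'} \<times> {0..}.
                       ereal \<bar>W \<rho> \<gamma> Q' - W \<rho> 0 Q'\<bar>)
                   \<le> robustness_bound p \<beta> \<theta>\<^sub>0 x m \<gamma>)
       \<and> (robustness_bound p \<beta> \<theta>\<^sub>0 x m \<longlongrightarrow> 0) (at_right 0)"
proof (intro conjI allI impI)
  interpret H: real_distribution H by (rule H)
  have sp: "scaled_partition m x \<theta>\<^sub>0"
    by unfold_locales (fact partition \<theta>\<^sub>0)+
  \<comment> \<open>The smoothness of \<open>H\<close> enters through this single constant, shared
    by all sample sizes and parameters.\<close>
  obtain LH where LH: "0 \<le> LH" "\<And>a b. \<bar>cdf H a - cdf H b\<bar> \<le> LH * \<bar>a - b\<bar>"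
    by (rule lipschitz_from_second_derivative[of "cdf H"]) (use H_smooth H.cdf_nonneg H.cdf_bounded_prob in auto)
  show "W 0 0 Q = \<alpha>" unfolding W_def by (rule scaled_partition.asymptotic_power_null[OF sp \<alpha>])
  show "(SUP (Q', \<rho>) \<in> {Q'. real_distribution Q'} \<times> {0..}. ereal \<bar>W \<rho> \<gamma> Q' - W \<rho> 0 Q'\<bar>)
      \<le> robustness_bound p \<beta> \<theta>\<^sub>0 x m \<gamma>" if "0 \<le> \<gamma>" for \<gamma>
    unfolding W_def by (rule scaled_partition.robustness[OF sp that])
  show "(robustness_bound p \<beta> \<theta>\<^sub>0 x m \<longlongrightarrow> 0) (at_right 0)" by (rule scaled_partition.robustness_bound_tendsto[OF sp])
  fix R \<Gamma> :: real assume R: "0 \<le> R" and \<Gamma>: "0 \<le> \<Gamma>"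
  show "uniform_limit ({0..R} \<times> {0..\<Gamma>})
      (\<lambda>n (\<rho>, \<gamma>). measure (M n \<rho> \<gamma>) {\<omega> \<in> space (M n \<rho> \<gamma>).
          pearson_statistic x m n (N_hat n (Y n \<rho> \<gamma> \<omega>)) (theta_hat n (Y n \<rho> \<gamma> \<omega>)) > chi_square_quantile (m - 2) (1 - \<alpha>)})
      (\<lambda>(\<rho>, \<gamma>). W \<rho> \<gamma> Q) sequentially"
  proof (rule uniform_limit_box_if_sequences)
    fix a b :: "nat \<Rightarrow> real" and r c :: real
    assume a: "a \<longlonglongrightarrow> r" and b: "b \<longlonglongrightarrow> c" and aR: "\<forall>n. a n \<in> {0..R}" and b\<Gamma>: "\<forall>n. b n \<in> {0..\<Gamma>}"
    define M' eps' z' xi' v' Y' where "M' n = M n (a n) (b n)" and "eps' n = eps n (a n) (b n)" and "z' n = z n (a n) (b n)"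
      and "xi' n = xi n (a n) (b n)" and "v' n = v n (a n) (b n)" and "Y' n = Y n (a n) (b n)" for n
    note defs = M'_def eps'_def z'_def xi'_def v'_def Y'_def
    have nonneg: "0 \<le> a n" "0 \<le> b n" for n using aR b\<Gamma> by auto
    have model': "contaminated_ar (M' n) p \<beta> \<nu> (alt_cdf \<theta>\<^sub>0 H n (a n)) (local_weight n (b n)) Q (eps' n) (z' n) (xi' n) (v' n)"
      if "1 \<le> n" for n
      unfolding defs by (rule model[OF that nonneg])
    have A: "ar_seq M' p \<beta> \<nu> \<mu> \<theta>\<^sub>0 H Q eps' z' xi' v' a b r c LH"
      by (rule ar_seq.intro) (fact model' p roots \<mu> \<theta>\<^sub>0 Q H H_moments(1) LH a b nonneg)+
    interpret S: prob_seq M'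
      by (rule prob_seq.intro) (rule contaminated_ar.axioms(1)[OF model'])
    have P: "prob_seq (\<lambda>n. M n (a n) (b n))" using S.prob_seq_axioms unfolding M'_def[abs_def] .
    have Y'm: "Y' n \<in> measurable (M' n) (\<Pi>\<^sub>M t\<in>{1 - int p..int n}. borel)" if "1 \<le> n" for n
      using contaminated_ar.observations_measurable[OF model'[OF that]] unfolding defs Y_def .
    note m1 = measurable_compose[OF Y'm estimators_measurable(1)]
    note m2 = measurable_compose[OF Y'm estimators_measurable(2)]
    note m3 = measurable_compose[OF Y'm estimators_measurable(3)]
    have OPI: "S.OP (\<lambda>n. X n (a n) (b n))"
      if "uniformly_bounded_in_prob M X" "\<And>n. 1 \<le> n \<Longrightarrow> X n (a n) (b n) \<in> borel_measurable (M' n)" for X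
      unfolding M'_def[abs_def]
      by (rule OP_if_uniformly_bounded[OF that(1) P R \<Gamma> aR[rule_format] b\<Gamma>[rule_format]]) (rule that(2)[unfolded M'_def])
    have mu_OP: "S.OP (\<lambda>n \<omega>. sqrt (real n) * (mu_hat n (Y' n \<omega>) - \<mu>))"
      unfolding Y'_def
      by (rule OPI[OF mu_hat])
         (intro borel_measurable_times borel_measurable_diff borel_measurable_const m1[unfolded Y'_def])
    have theta_OP: "S.OP (\<lambda>n \<omega>. sqrt (real n) * (theta_hat n (Y' n \<omega>) - \<theta>\<^sub>0))"
      unfolding Y'_def
      by (rule OPI[OF theta_hat])
         (intro borel_measurable_times borel_measurable_diff borel_measurable_const m3[unfolded Y'_def])
    have "S.OP (\<lambda>n \<omega>. sqrt (real n) * L2_set (\<lambda>i. beta_hat n (Y' n \<omega>) i - \<beta> i) {1..p})"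
      unfolding Y'_def L2_set_def
      by (rule OPI[OF beta_hat[unfolded L2_set_def]])
         (intro borel_measurable_times borel_measurable_const measurable_compose[OF _ borel_measurable_sqrt]
            borel_measurable_sum borel_measurable_power borel_measurable_diff m2[unfolded Y'_def])
    hence beta_OP: "S.OP (\<lambda>n \<omega>. sqrt (real n) * (beta_hat n (Y' n \<omega>) i - \<beta> i))" if i: "i \<in> {1..p}" for i
    proof (rule S.OP_mono, intro S.whp_all always_eventually allI ballI)
      fix n \<omega>
      have "\<bar>beta_hat n (Y' n \<omega>) i - \<beta> i\<bar> \<le> L2_set (\<lambda>i. beta_hat n (Y' n \<omega>) i - \<beta> i) {1..p}"
        using member_le_L2_set[of "{1..p}" i "\<lambda>i. \<bar>beta_hat n (Y' n \<omega>) i - \<beta> i\<bar>"] i by (simp add: L2_set_def)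
      thus "\<bar>sqrt (real n) * (beta_hat n (Y' n \<omega>) i - \<beta> i)\<bar> \<le> \<bar>sqrt (real n) * L2_set (\<lambda>i. beta_hat n (Y' n \<omega>) i - \<beta> i) {1..p}\<bar>"
        by (simp add: abs_mult L2_set_nonneg mult_left_mono)
    qed
    have solves: "S.whp (\<lambda>n \<omega>. solves_scale_equation x m (N_hat n (Y' n \<omega>)) (theta_hat n (Y' n \<omega>)))"
      unfolding M'_def[abs_def] Y'_def
      by (rule whp_if_uniformly_prob_to_one[OF theta_hat_solution P R \<Gamma> aR[rule_format] b\<Gamma>[rule_format]])
    have E: "estimated_seq M' p \<beta> \<nu> \<mu> \<theta>\<^sub>0 H Q eps' z' xi' v' a b r c LH m x mu_hat theta_hat beta_hat Y' (\<lambda>n \<omega>. N_hat n (Y' n \<omega>))"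
    proof (rule estimated_seq.intro[OF A sp], rule estimated_seq_axioms.intro)
      show "Y' n = observations p n (v' n) (z' n) (xi' n)" for n unfolding defs Y_def ..
      show "N_hat n (Y' n \<omega>) = cell_count x p n (mu_hat n (Y' n \<omega>)) (beta_hat n (Y' n \<omega>)) (Y' n \<omega>)" for n \<omega>
        unfolding N_hat_def ..
    qed (rule H_symmetric, rule estimators_measurable, erule estimators_measurable, rule estimators_measurable,
        rule mu_OP, erule beta_OP, rule theta_OP, rule solves)
    \<comment> \<open>The power is compared with \<open>W\<close> at the same moving parameters, so
      besides the limit of the power the continuity of \<open>W\<close> in \<rho> and \<gamma> is
      used.\<close>
    have "(\<lambda>n. measure (M' n) {\<omega> \<in> space (M' n). pearson_statistic x m n (N_hat n (Y' n \<omega>)) (theta_hat n (Y' n \<omega>)) > chi_square_quantile (m - 2) (1 - \<alpha>)}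
        - W (a n) (b n) Q) \<longlonglongrightarrow> W r c Q - W r c Q"
      unfolding W_def
      by (intro tendsto_diff scaled_partition.asymptotic_power_tendsto[OF sp] a b
          estimated_seq.power_tendsto[OF E, unfolded estimated_seq.Tn_def[OF E]])
    thus "(\<lambda>n. (case (a n, b n) of (\<rho>, \<gamma>) \<Rightarrow> measure (M n \<rho> \<gamma>) {\<omega> \<in> space (M n \<rho> \<gamma>).
          pearson_statistic x m n (N_hat n (Y n \<rho> \<gamma> \<omega>)) (theta_hat n (Y n \<rho> \<gamma> \<omega>)) > chi_square_quantile (m - 2) (1 - \<alpha>)})
        - (case (a n, b n) of (\<rho>, \<gamma>) \<Rightarrow> W \<rho> \<gamma> Q)) \<longlonglongrightarrow> 0"
      unfolding defs prod.case by simp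
  qed
qed

end
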